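(* Let $X_1$ and $X_2$ be two complex Banach spaces, $L_1$ and $L_2$ two complex solvable finite dimensional Lie algebras, and $\rho_i\colon L_i\to L(X_i)$, $i=1,2$, two representations of the Lie algebras. Suppose that $X_1\tilde{\otimes}X_2$ is a tensor product of $X_1$ and $X_2$ relative to $\langle X_1,X_1'\rangle$ and $\langle X_2,X_2'\rangle$, and consider the tensor product representation $\rho\colon L\to L(X_1\tilde{\otimes}X_2)$ of $L=L_1\times L_2$. Then, for $k=0,\ldots,\dim L$, (i) $$\bigcup_{p+q=k}\Sigma_{\delta,p}(\rho_1)\times\Sigma_{\delta,q}(\rho_2)\subseteq\Sigma_{\delta,k}(\rho)\subseteq Sp_{\delta,k}(\rho)\subseteq\bigcup_{p+q=k}Sp_{\delta,p}(\rho_1)\times Sp_{\delta,q}(\rho_2);$$ (ii) $$\bigcup_{p+q=k}\Sigma_{\pi,p}(\rho_1)\times\Sigma_{\pi,q}(\rho_2)\subseteq\Sigma_{\pi,k}(\rho)\subseteq Sp_{\pi,k}(\rho)\subseteq\bigcup_{p+q=k}Sp_{\pi,p}(\rho_1)\times Sp_{\pi,q}(\rho_2).$$ In particular, if $X_1$ and $X_2$ are Hilbert spaces, all the inclusions in (i) and (ii) are equalities.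
   Context: $L(X)$ is the algebra of bounded linear operators on $X$; $X'$ is the dual of $X$. A representation $\rho\colon L\to L(X)$ is a Lie algebra homomorphism, where $L(X)$ has the commutator bracket. A character of a Lie algebra is a linear functional vanishing on its derived algebra. $L_1\times L_2$ is the direct sum Lie algebra, and $(L_1\times L_2)^*$ is identified with $L_1^*\times L_2^*$. In the unions, $0\le p\le\dim L_1$, $0\le q\le\dim L_2$. Tensor product. A tensor product of Banach spaces $X$ and $Y$ relative to the dual pairings $\langle X,X'\rangle$, $\langle Y,Y'\rangle$ is a Banach space $X\tilde\otimes Y$ with continuous bilinear maps $X\times Y\to X\tilde\otimes Y$, $(x,y)\mapsto x\otimes y$, and $L(X)\times L(Y)\to L(X\tilde\otimes Y)$, $(T,S)\mapsto T\otimes S$, such that: (T1) $\|x\otimes y\|=\|x\|\|y\|$; (T2) $(T\otimes S)(x\otimes y)=(Tx)\otimes(Sy)$; (T3) $(T_1\otimes S_1)(T_2\otimes S_2)=(T_1T_2)\otimes(S_1S_2)$, $I\otimes I=I$; (T4) for $x\in X,u\in X',y\in Y,v\in Y'$, with $f_{x,u}\in L(X)$, $f_{x,u}(z)=\langle z,u\rangle x$ and $f_{y,v}\in L(Y)$ defined likewise, $\mathrm{Im}(f_{x,u}\otimes I)\subseteq\{x\otimes y':y'\in Y\}$ and $\mathrm{Im}(I\otimes f_{y,v})\subseteq\{x'\otimes y:x'\in X\}$. The tensor product representation is $\rho(l_1,l_2)=\rho_1(l_1)\otimes I+I\otimes\rho_2(l_2)$. Koszul complex. Let $H$ be a complex finite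 dimensional nilpotent Lie algebra, $d=\dim H$, and $\theta\colon H\to L(X)$ a representation. The complex $(X\otimes\wedge H,d(\theta))$ has spaces $X\otimes\wedge^pH$ ($0$ unless $0\le p\le d$) and maps $d_p(\theta)\colon X\otimes\wedge^pH\to X\otimes\wedge^{p-1}H$, $$d_p(\theta)(x\otimes l_1\wedge\cdots\wedge l_p)=\sum_{i=1}^p(-1)^{i+1}\theta(l_i)x\otimes l_1\wedge\cdots\widehat{l_i}\cdots\wedge l_p+\sum_{i<j}(-1)^{i+j}x\otimes[l_i,l_j]\wedge l_1\wedge\cdots\widehat{l_i}\cdots\widehat{l_j}\cdots\wedge l_p .$$ For a character $f$ of $H$, $\theta-f$, $l\mapsto\theta(l)-f(l)I$, is a representation. Write $H_p(\theta-f)$ for the homology at degree $p$ and $R(\cdot)$ for range. The complex is split at degree $p$ if there are bounded linear $h_p\colon X\otimes\wedge^pH\to X\otimes\wedge^{p+1}H$, $h_{p-1}\colon X\otimes\wedge^{p-1}H\to X\otimes\wedge^{p}H$ with $d_{p+1}h_p+h_{p-1}d_p=I$. Joint spectra of $\theta$ (all consisting of characters $f$ of $H$), for $k=0,\ldots,d$: - $\sigma_{\delta,k}(\theta)$: $H_p(\theta-f)\ne0$ for some $0\le p\le k$. $\sigma_{\pi,k}(\theta)$: $H_p(\theta-f)\neq 0$ for some $d-k\le p\le d$, or $R(d_{d-k}(\theta-f))$ is not closed. - $sp_{\delta,k}(\theta)$ (resp. $sp_{\pi,k}(\theta)$): the Koszul complex of $\theta-f$ is not split at some degree $0\le p\le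 k$ (resp. $d-k\le p\le d$). For $k>d$ each of these means the set with index $d$. Cartan spectra. For a nilpotent subalgebra $H$ of a complex solvable finite dimensional Lie algebra $L$ one has $L=\bigoplus_i L^{\alpha_i}$ for finitely many linear functionals $\alpha_i$ on $H$, with $L^{\alpha}=\{l\in L:\exists q,\ (ad(h)-\alpha(h))^q l=0\ \forall h\in H\}\neq 0$. $H$ is a Cartan subalgebra if $H=L^0$; then $L=H\oplus H_*$ with $H_*$ the direct sum of the $L^{\alpha_i}$, $\alpha_i\ne0$. For a representation $\rho$ of $L$ put $$\Sigma_{\delta,k}(\rho)=\{f\in L^*: f|_H\in\sigma_{\delta,k}(\rho|_H),\ f|_{H_*}=0\},$$ and in the same way define $\Sigma_{\pi,k},Sp_{\delta,k},Sp_{\pi,k}$ from $\sigma_{\pi,k},sp_{\delta,k},sp_{\pi,k}$. These sets do not depend on the choice of the Cartan subalgebra $H$; if $H_i$ is a Cartan subalgebra of $L_i$, then $H_1\times H_2$ is one of $L_1\times L_2$, with $(H_1\times H_2)_*=H_{1*}\oplus H_{2*}$.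
   Formalization: In the Koszul differential the bracket sum has the sign (-1)^{i+j+1} instead of (-1)^{i+j}, since with the commutator bracket TS-ST the displayed sign gives d_1d_2(x⊗l∧l') = -2θ([l,l'])x, which need not vanish. *)

theory Defs
  imports "HOL-Analysis.Analysis"
begin

section \<open>Complex vector spaces and complex Banach spaces\<close>

class complex_vector = ab_group_add +
  fixes scaleC :: "complex \<Rightarrow> 'a \<Rightarrow> 'a" (infixr \<open>*\<^sub>C\<close> 75)
  assumes scaleC_add_right: "a *\<^sub>C (x + y) = a *\<^sub>C x + a *\<^sub>C y"
    and scaleC_add_left: "(a + b) *\<^sub>C x = a *\<^sub>C x + b *\<^sub>C x"
    and scaleC_scaleC: "a *\<^sub>C b *\<^sub>C x = (a * b) *\<^sub>C x"
    and scaleC_one: "1 *\<^sub>C x = x"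

global_interpretation complex_vector:
  vector_space "scaleC :: complex \<Rightarrow> 'a \<Rightarrow> 'a::complex_vector"
  by unfold_locales (simp_all add: scaleC_add_right scaleC_add_left scaleC_scaleC scaleC_one)

abbreviation cspan :: "'a::complex_vector set \<Rightarrow> 'a set"
  where "cspan \<equiv> complex_vector.span"

abbreviation cdim :: "'a::complex_vector set \<Rightarrow> nat"
  where "cdim \<equiv> complex_vector.dim"

abbreviation clinear :: "('a::complex_vector \<Rightarrow> 'b::complex_vector) \<Rightarrow> bool"
  where "clinear \<equiv> Vector_Spaces.linear scaleC scaleC"

class complex_normed_vector = complex_vector + real_normed_vector +
  assumes scaleR_scaleC: "r *\<^sub>R x = complex_of_real r *\<^sub>C x"
    and norm_scaleC: "norm (a *\<^sub>C x) = cmod a * norm x"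

class complex_banach = complex_normed_vector + banach

lemma bounded_linear_scaleC: "bounded_linear (\<lambda>x::'a::complex_normed_vector. a *\<^sub>C x)"
  by (rule bounded_linear_intro[where K = "cmod a"])
     (simp_all add: scaleC_add_right scaleR_scaleC scaleC_scaleC norm_scaleC mult.commute)

lemma bounded_linear_scaleC_left: "bounded_linear (\<lambda>a. a *\<^sub>C (x::'a::complex_normed_vector))"
  by (rule bounded_linear_intro[where K = "norm x"])
     (simp_all add: scaleC_add_left scaleR_scaleC scaleC_scaleC norm_scaleC scaleR_conv_of_real)

instantiation complex :: complex_banach
begin

definition scaleC_complex :: "complex \<Rightarrow> complex \<Rightarrow> complex"
  where "scaleC_complex a x = a * x"

instance
  by intro_classes (simp_all add: scaleC_complex_def algebra_simps scaleR_conv_of_real norm_mult)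

end

instantiation prod :: (complex_vector, complex_vector) complex_vector
begin

definition scaleC_prod :: "complex \<Rightarrow> 'a \<times> 'b \<Rightarrow> 'a \<times> 'b"
  where "scaleC_prod a x = (a *\<^sub>C fst x, a *\<^sub>C snd x)"

instance
  by intro_classes
     (simp_all add: scaleC_prod_def scaleC_add_right scaleC_add_left scaleC_scaleC scaleC_one)

end

instantiation blinfun :: (real_normed_vector, complex_normed_vector) complex_vector
begin

lift_definition scaleC_blinfun ::
  "complex \<Rightarrow> ('a \<Rightarrow>\<^sub>L 'b) \<Rightarrow> ('a \<Rightarrow>\<^sub>L 'b)" is "\<lambda>a f x. a *\<^sub>C f x"
  by (rule bounded_linear_compose[OF bounded_linear_scaleC])

instance
  by intro_classes
     (transfer, simp add: scaleC_add_right scaleC_add_left scaleC_scaleC scaleC_one)+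

end

text \<open>
  The type \<open>'a \<Rightarrow>\<^sub>L 'b\<close> consists of the bounded \<^emph>\<open>real\<close>-linear maps. The bounded complex-linear
  maps are the following subset; thus \<open>L(X)\<close> is \<open>cblinfuns :: ('x \<Rightarrow>\<^sub>L 'x) set\<close> and \<open>X'\<close> is
  \<open>cblinfuns :: ('x \<Rightarrow>\<^sub>L complex) set\<close>.
\<close>

definition cblinfuns :: "('a::complex_normed_vector \<Rightarrow>\<^sub>L 'b::complex_normed_vector) set"
  where "cblinfuns = {T. \<forall>a x. blinfun_apply T (a *\<^sub>C x) = a *\<^sub>C blinfun_apply T x}"

text \<open>The rank one operator \<open>z \<mapsto> \<langle>z,u\<rangle> x\<close>.\<close>

lift_definition rank_one ::
  "'a::complex_normed_vector \<Rightarrow> ('a \<Rightarrow>\<^sub>L complex) \<Rightarrow> ('a \<Rightarrow>\<^sub>L 'a)" is "\<lambda>x u z. u z *\<^sub>C x"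
  by (rule bounded_linear_compose[OF bounded_linear_scaleC_left])

text \<open>
  A complex Banach space is a Hilbert space when its norm comes from an inner product. Definiteness
  is contained in the last clause.
\<close>

definition hilbert_space :: "'a::complex_banach itself \<Rightarrow> bool"
  where "hilbert_space _ \<longleftrightarrow> (\<exists>ip :: 'a \<Rightarrow> 'a \<Rightarrow> complex.
    (\<forall>x y z. ip (x + y) z = ip x z + ip y z) \<and>
    (\<forall>a x y. ip (a *\<^sub>C x) y = a * ip x y) \<and>
    (\<forall>x y. ip y x = cnj (ip x y)) \<and>
    (\<forall>x. ip x x = complex_of_real ((norm x)\<^sup>2)))"


section \<open>Tensor products of Banach spaces relative to the dual pairings\<close>

locale banach_tensor_product =
  fixes tens :: "'x::complex_banach \<Rightarrow> 'y::complex_banach \<Rightarrow> 't::complex_banach"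
      (infixl \<open>\<otimes>\<^sub>v\<close> 70)
    and optens :: "('x \<Rightarrow>\<^sub>L 'x) \<Rightarrow> ('y \<Rightarrow>\<^sub>L 'y) \<Rightarrow> ('t \<Rightarrow>\<^sub>L 't)"  (infixl \<open>\<otimes>\<^sub>o\<close> 70)
  assumes tens_bounded_bilinear: "bounded_bilinear (\<otimes>\<^sub>v)"
    and tens_scaleC_left: "\<And>a x y. (a *\<^sub>C x) \<otimes>\<^sub>v y = a *\<^sub>C (x \<otimes>\<^sub>v y)"
    and tens_scaleC_right: "\<And>a x y. x \<otimes>\<^sub>v (a *\<^sub>C y) = a *\<^sub>C (x \<otimes>\<^sub>v y)"
    and optens_closed: "\<And>T S. T \<in> cblinfuns \<Longrightarrow> S \<in> cblinfuns \<Longrightarrow> T \<otimes>\<^sub>o S \<in> cblinfuns"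
    and optens_add_left: "\<And>T T' S. T \<in> cblinfuns \<Longrightarrow> T' \<in> cblinfuns \<Longrightarrow> S \<in> cblinfuns \<Longrightarrow>
      (T + T') \<otimes>\<^sub>o S = T \<otimes>\<^sub>o S + T' \<otimes>\<^sub>o S"
    and optens_add_right: "\<And>T S S'. T \<in> cblinfuns \<Longrightarrow> S \<in> cblinfuns \<Longrightarrow> S' \<in> cblinfuns \<Longrightarrow>
      T \<otimes>\<^sub>o (S + S') = T \<otimes>\<^sub>o S + T \<otimes>\<^sub>o S'"
    and optens_scaleC_left: "\<And>a T S. T \<in> cblinfuns \<Longrightarrow> S \<in> cblinfuns \<Longrightarrow>
      (a *\<^sub>C T) \<otimes>\<^sub>o S = a *\<^sub>C (T \<otimes>\<^sub>o S)"
    and optens_scaleC_right: "\<And>a T S. T \<in> cblinfuns \<Longrightarrow> S \<in> cblinfuns \<Longrightarrow>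
      T \<otimes>\<^sub>o (a *\<^sub>C S) = a *\<^sub>C (T \<otimes>\<^sub>o S)"
    and optens_continuous: "continuous_on (cblinfuns \<times> cblinfuns) (\<lambda>(T, S). T \<otimes>\<^sub>o S)"
    and T1: "\<And>x y. norm (x \<otimes>\<^sub>v y) = norm x * norm y"
    and T2: "\<And>T S x y. T \<in> cblinfuns \<Longrightarrow> S \<in> cblinfuns \<Longrightarrow>
      blinfun_apply (T \<otimes>\<^sub>o S) (x \<otimes>\<^sub>v y) = blinfun_apply T x \<otimes>\<^sub>v blinfun_apply S y"
    and T3: "\<And>T1 T2 S1 S2. T1 \<in> cblinfuns \<Longrightarrow> T2 \<in> cblinfuns \<Longrightarrow> S1 \<in> cblinfuns \<Longrightarrow> S2 \<in> cblinfuns \<Longrightarrow>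
      (T1 \<otimes>\<^sub>o S1) o\<^sub>L (T2 \<otimes>\<^sub>o S2) = (T1 o\<^sub>L T2) \<otimes>\<^sub>o (S1 o\<^sub>L S2)"
    and T3_id: "id_blinfun \<otimes>\<^sub>o id_blinfun = id_blinfun"
    and T4_left: "\<And>x u. u \<in> cblinfuns \<Longrightarrow>
      range (blinfun_apply (rank_one x u \<otimes>\<^sub>o id_blinfun)) \<subseteq> {x \<otimes>\<^sub>v y' |y'. True}"
    and T4_right: "\<And>y v. v \<in> cblinfuns \<Longrightarrow>
      range (blinfun_apply (id_blinfun \<otimes>\<^sub>o rank_one y v)) \<subseteq> {x' \<otimes>\<^sub>v y |x'. True}"


section \<open>Complex Lie algebras\<close>

class complex_lie_algebra = complex_vector +
  fixes lie :: "'a \<Rightarrow> 'a \<Rightarrow> 'a"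
  assumes lie_add_left: "lie (x + y) z = lie x z + lie y z"
    and lie_add_right: "lie x (y + z) = lie x y + lie x z"
    and lie_scaleC_left: "lie (a *\<^sub>C x) y = a *\<^sub>C lie x y"
    and lie_scaleC_right: "lie x (a *\<^sub>C y) = a *\<^sub>C lie x y"
    and lie_self: "lie x x = 0"
    and jacobi: "lie x (lie y z) + lie y (lie z x) + lie z (lie x y) = 0"

instantiation prod :: (complex_lie_algebra, complex_lie_algebra) complex_lie_algebra
begin

definition lie_prod :: "'a \<times> 'b \<Rightarrow> 'a \<times> 'b \<Rightarrow> 'a \<times> 'b"
  where "lie_prod x y = (lie (fst x) (fst y), lie (snd x) (snd y))"

instance
  by intro_classes
     (simp_all add: lie_prod_def scaleC_prod_def lie_add_left lie_add_right lie_scaleC_left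
        lie_scaleC_right lie_self jacobi prod_eq_iff)

end

definition finite_dimensional :: "'l::complex_vector set \<Rightarrow> bool"
  where "finite_dimensional V \<longleftrightarrow> (\<exists>B. finite B \<and> cspan B = V)"

definition lie_subalgebra :: "'l::complex_lie_algebra set \<Rightarrow> bool"
  where "lie_subalgebra H \<longleftrightarrow> complex_vector.subspace H \<and> (\<forall>x\<in>H. \<forall>y\<in>H. lie x y \<in> H)"

definition lie_commutator :: "'l::complex_lie_algebra set \<Rightarrow> 'l set \<Rightarrow> 'l set"
  where "lie_commutator A B = cspan {lie x y |x y. x \<in> A \<and> y \<in> B}"

definition lie_solvable :: "'l::complex_lie_algebra set \<Rightarrow> bool"
  where "lie_solvable H \<longleftrightarrow> (\<exists>n. ((\<lambda>A. lie_commutator A A) ^^ n) H = {0})"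

definition lie_nilpotent :: "'l::complex_lie_algebra set \<Rightarrow> bool"
  where "lie_nilpotent H \<longleftrightarrow> (\<exists>n. (lie_commutator H ^^ n) H = {0})"

text \<open>
  The dual of a subspace \<open>H\<close>, and the characters of a subalgebra \<open>H\<close>. Functionals on \<open>H\<close> are
  extensional functions, so that \<open>f|\<^sub>H\<close> is \<open>restrict f H\<close> and \<open>L\<^sup>*\<close> is \<open>dual_on UNIV\<close>.
\<close>

definition dual_on :: "'l::complex_vector set \<Rightarrow> ('l \<Rightarrow> complex) set"
  where "dual_on H = {f \<in> extensional H.
    (\<forall>x\<in>H. \<forall>y\<in>H. f (x + y) = f x + f y) \<and> (\<forall>a. \<forall>x\<in>H. f (a *\<^sub>C x) = a * f x)}"

definition lie_characters :: "'l::complex_lie_algebra set \<Rightarrow> ('l \<Rightarrow> complex) set"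
  where "lie_characters H = {f \<in> dual_on H. \<forall>l\<in>lie_commutator H H. f l = 0}"

definition lie_representation ::
    "('l::complex_lie_algebra \<Rightarrow> ('x::complex_banach \<Rightarrow>\<^sub>L 'x)) \<Rightarrow> bool"
  where "lie_representation \<rho> \<longleftrightarrow> clinear \<rho> \<and> range \<rho> \<subseteq> cblinfuns \<and>
    (\<forall>x y. \<rho> (lie x y) = (\<rho> x o\<^sub>L \<rho> y) - (\<rho> y o\<^sub>L \<rho> x))"

definition tensor_representation ::
    "(('x::complex_banach \<Rightarrow>\<^sub>L 'x) \<Rightarrow> ('y::complex_banach \<Rightarrow>\<^sub>L 'y) \<Rightarrow> ('t::complex_banach \<Rightarrow>\<^sub>L 't))
      \<Rightarrow> ('l1 \<Rightarrow> ('x \<Rightarrow>\<^sub>L 'x)) \<Rightarrow> ('l2 \<Rightarrow> ('y \<Rightarrow>\<^sub>L 'y)) \<Rightarrow> 'l1 \<times> 'l2 \<Rightarrow> ('t \<Rightarrow>\<^sub>L 't)"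
  where "tensor_representation optens \<rho>1 \<rho>2 =
    (\<lambda>(l1, l2). optens (\<rho>1 l1) id_blinfun + optens id_blinfun (\<rho>2 l2))"


section \<open>The Koszul complex\<close>

text \<open>
  Fix an ordered basis \<open>e\<^sub>0, \<dots>, e\<^bsub>d-1\<^esub>\<close> of \<open>H\<close>. Then \<open>X \<otimes> \<And>\<^sup>p H\<close> is the direct sum of copies of \<open>X\<close>
  indexed by the \<open>p\<close>-element sets \<open>S = {s\<^sub>1 < \<dots> < s\<^sub>p} \<subseteq> {0, \<dots>, d - 1}\<close>, where \<open>S\<close> stands for
  \<open>e\<^sub>S = e\<^bsub>s\<^sub>1\<^esub> \<and> \<dots> \<and> e\<^bsub>s\<^sub>p\<^esub>\<close>. A chain is a family \<open>c\<close> of coefficients, representing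
  \<open>\<Sum>\<^sub>S c S \<otimes> e\<^sub>S\<close>. The degree is an integer, so that degrees outside \<open>0, \<dots>, d\<close> give the zero space.
  The spectra defined below do not depend on the basis.
\<close>

definition ordered_basis :: "'l::complex_vector set \<Rightarrow> 'l list"
  where "ordered_basis H =
    (SOME bs. distinct bs \<and> complex_vector.independent (set bs) \<and> cspan (set bs) = H)"

definition koszul_chains :: "'l list \<Rightarrow> int \<Rightarrow> (nat set \<Rightarrow> 'x::complex_banach) set"
  where "koszul_chains bs p = {c. \<forall>S. c S \<noteq> 0 \<longrightarrow> S \<subseteq> {..<length bs} \<and> int (card S) = p}"

definition chain_norm :: "'l list \<Rightarrow> (nat set \<Rightarrow> 'x::complex_banach) \<Rightarrow> real"
  where "chain_norm bs c = (\<Sum>S\<in>Pow {..<length bs}. norm (c S))"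

text \<open>
  The elementary tensor \<open>x \<otimes> l\<^sub>1 \<and> \<dots> \<and> l\<^sub>p\<close> for arbitrary \<open>l\<^sub>j\<close> in \<open>H\<close>: its coefficient at \<open>S\<close> is \<open>x\<close>
  times the minor, with rows \<open>S\<close>, of the matrix of coordinates of the \<open>l\<^sub>j\<close>.
\<close>

definition elem_tensor ::
    "'l::complex_vector list \<Rightarrow> 'x::complex_banach \<Rightarrow> 'l list \<Rightarrow> nat set \<Rightarrow> 'x"
  where "elem_tensor bs x ls = (\<lambda>S.
    if S \<subseteq> {..<length bs} \<and> card S = length ls
    then (\<Sum>\<pi> | \<pi> permutes {..<length ls}. of_int (sign \<pi>) *
           (\<Prod>j<length ls. complex_vector.representation (set bs) (ls ! j) (nths bs S ! \<pi> j))) *\<^sub>C x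
    else 0)"

text \<open>
  The differential on \<open>x \<otimes> l\<^sub>1 \<and> \<dots> \<and> l\<^sub>p\<close>, with the \<open>l\<^sub>i\<close> numbered from \<open>0\<close> in the code and
  from \<open>1\<close> in this comment; the exponents \<open>i\<close> and \<open>i + j + 1\<close> in the code are those of the signs
  \<open>(-1)\<^bsup>i+1\<^esup>\<close> and \<open>(-1)\<^bsup>i+j+1\<^esup>\<close> for the numbering from \<open>1\<close>, diminished by two.
  Concerning signs: with \<open>(-1)\<^bsup>i+1\<^esup>\<close> in the first sum, the composition of two differentials
  maps \<open>x \<otimes> l \<and> l'\<close> to \<open>-(\<theta>(l)\<theta>(l') - \<theta>(l')\<theta>(l))x\<close> plus the contribution of \<open>x \<otimes> [l,l']\<close>. For
  \<open>\<theta>\<close> a homomorphism for the bracket \<open>TS - ST\<close> on \<open>L(X)\<close> this vanishes only if \<open>x \<otimes> [l,l']\<close> has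
  the sign \<open>+\<close>, that is, if the second sum has the sign \<open>(-1)\<^bsup>i+j+1\<^esup>\<close>. The sign \<open>(-1)\<^bsup>i+j\<^esup>\<close> sometimes
  found in the literature belongs to the opposite bracket \<open>ST - TS\<close> on \<open>L(X)\<close>.
\<close>

definition koszul_elem ::
    "'l::complex_lie_algebra list \<Rightarrow> ('l \<Rightarrow> ('x::complex_banach \<Rightarrow>\<^sub>L 'x)) \<Rightarrow> 'x \<Rightarrow> 'l list
      \<Rightarrow> nat set \<Rightarrow> 'x"
  where "koszul_elem bs \<theta> x ls = (\<lambda>R.
    (\<Sum>i<length ls. (-1) ^ i *\<^sub>C
       elem_tensor bs (blinfun_apply (\<theta> (ls ! i)) x) (nths ls (- {i})) R) +
    (\<Sum>j<length ls. \<Sum>i<j. (-1) ^ (i + j + 1) *\<^sub>C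
       elem_tensor bs x (lie (ls ! i) (ls ! j) # nths ls (- {i, j})) R))"

text \<open>
  The differential of the whole complex at once: on \<open>koszul_chains bs p\<close> it is \<open>d\<^sub>p\<close>. Note that
  \<open>nths bs S\<close> is the list \<open>e\<^bsub>s\<^sub>1\<^esub>, \<dots>, e\<^bsub>s\<^sub>p\<^esub>\<close>.
\<close>

definition koszul_d ::
    "'l::complex_lie_algebra list \<Rightarrow> ('l \<Rightarrow> ('x::complex_banach \<Rightarrow>\<^sub>L 'x)) \<Rightarrow>
      (nat set \<Rightarrow> 'x) \<Rightarrow> nat set \<Rightarrow> 'x"
  where "koszul_d bs \<theta> c = (\<lambda>R. \<Sum>S\<in>Pow {..<length bs}. koszul_elem bs \<theta> (c S) (nths bs S) R)"

definition koszul_cycles where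
  "koszul_cycles bs \<theta> p = {c \<in> koszul_chains bs p. koszul_d bs \<theta> c = (\<lambda>_. 0)}"

definition koszul_boundaries where
  "koszul_boundaries bs \<theta> p = koszul_d bs \<theta> ` koszul_chains bs (p + 1)"

definition koszul_homology where
  "koszul_homology bs \<theta> p = koszul_cycles bs \<theta> p //
     {(a, b). a \<in> koszul_cycles bs \<theta> p \<and> b \<in> koszul_cycles bs \<theta> p \<and>
              (\<lambda>S. a S - b S) \<in> koszul_boundaries bs \<theta> p}"

definition koszul_homology_zero where
  "koszul_homology_zero bs \<theta> p \<longleftrightarrow> koszul_homology bs \<theta> p = {koszul_boundaries bs \<theta> p}"

definition chain_bounded_linear ::
    "'l list \<Rightarrow> int \<Rightarrow> int \<Rightarrow> ((nat set \<Rightarrow> 'x::complex_banach) \<Rightarrow> (nat set \<Rightarrow> 'x)) \<Rightarrow> bool"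
  where "chain_bounded_linear bs p q h \<longleftrightarrow>
    h ` koszul_chains bs p \<subseteq> koszul_chains bs q \<and>
    (\<forall>a\<in>koszul_chains bs p. \<forall>b\<in>koszul_chains bs p. h (\<lambda>S. a S + b S) = (\<lambda>S. h a S + h b S)) \<and>
    (\<forall>t. \<forall>a\<in>koszul_chains bs p. h (\<lambda>S. t *\<^sub>C a S) = (\<lambda>S. t *\<^sub>C h a S)) \<and>
    (\<exists>K. \<forall>a\<in>koszul_chains bs p. chain_norm bs (h a) \<le> K * chain_norm bs a)"

definition koszul_split where
  "koszul_split bs \<theta> p \<longleftrightarrow> (\<exists>h h'.
     chain_bounded_linear bs p (p + 1) h \<and> chain_bounded_linear bs (p - 1) p h' \<and>
     (\<forall>c\<in>koszul_chains bs p. (\<lambda>S. koszul_d bs \<theta> (h c) S + h' (koszul_d bs \<theta> c) S) = c))"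


section \<open>Joint spectra\<close>

definition shifted :: "('l \<Rightarrow> ('x::complex_banach \<Rightarrow>\<^sub>L 'x)) \<Rightarrow> ('l \<Rightarrow> complex) \<Rightarrow> 'l \<Rightarrow> ('x \<Rightarrow>\<^sub>L 'x)"
  where "shifted \<theta> f = (\<lambda>l. \<theta> l - f l *\<^sub>C id_blinfun)"

text \<open>
  In the following definitions \<open>\<theta>\<close> is only used on \<open>H\<close>, so they may be applied to a representation
  \<open>\<rho>\<close> of an algebra containing \<open>H\<close> and then give the spectra of \<open>\<rho>|\<^sub>H\<close>. The range of \<open>d\<^bsub>d-k\<^esub>\<close> is
  \<open>koszul_boundaries\<close> in degree \<open>d - k - 1\<close>; \<open>closed\<close> refers to the product topology of
  \<open>nat set \<Rightarrow> 'x\<close>, which on chains is the topology given by \<open>chain_norm\<close>.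
\<close>

definition sigma_delta ::
    "nat \<Rightarrow> 'l::complex_lie_algebra set \<Rightarrow> ('l \<Rightarrow> ('x::complex_banach \<Rightarrow>\<^sub>L 'x)) \<Rightarrow> ('l \<Rightarrow> complex) set"
  where "sigma_delta k H \<theta> = {f \<in> lie_characters H.
    \<exists>p\<in>{0..int (min k (cdim H))}. \<not> koszul_homology_zero (ordered_basis H) (shifted \<theta> f) p}"

definition sigma_pi ::
    "nat \<Rightarrow> 'l::complex_lie_algebra set \<Rightarrow> ('l \<Rightarrow> ('x::complex_banach \<Rightarrow>\<^sub>L 'x)) \<Rightarrow> ('l \<Rightarrow> complex) set"
  where "sigma_pi k H \<theta> = {f \<in> lie_characters H.
    (\<exists>p\<in>{int (cdim H) - int (min k (cdim H))..int (cdim H)}.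
       \<not> koszul_homology_zero (ordered_basis H) (shifted \<theta> f) p) \<or>
    \<not> closed (koszul_boundaries (ordered_basis H) (shifted \<theta> f)
                (int (cdim H) - int (min k (cdim H)) - 1))}"

definition sp_delta ::
    "nat \<Rightarrow> 'l::complex_lie_algebra set \<Rightarrow> ('l \<Rightarrow> ('x::complex_banach \<Rightarrow>\<^sub>L 'x)) \<Rightarrow> ('l \<Rightarrow> complex) set"
  where "sp_delta k H \<theta> = {f \<in> lie_characters H.
    \<exists>p\<in>{0..int (min k (cdim H))}. \<not> koszul_split (ordered_basis H) (shifted \<theta> f) p}"

definition sp_pi ::
    "nat \<Rightarrow> 'l::complex_lie_algebra set \<Rightarrow> ('l \<Rightarrow> ('x::complex_banach \<Rightarrow>\<^sub>L 'x)) \<Rightarrow> ('l \<Rightarrow> complex) set"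
  where "sp_pi k H \<theta> = {f \<in> lie_characters H.
    \<exists>p\<in>{int (cdim H) - int (min k (cdim H))..int (cdim H)}.
      \<not> koszul_split (ordered_basis H) (shifted \<theta> f) p}"


section \<open>Cartan subalgebras and Cartan spectra\<close>

definition root_space :: "'l::complex_lie_algebra set \<Rightarrow> ('l \<Rightarrow> complex) \<Rightarrow> 'l set"
  where "root_space H \<alpha> = {l. \<exists>q. \<forall>h\<in>H. ((\<lambda>v. lie h v - \<alpha> h *\<^sub>C v) ^^ q) l = 0}"

definition cartan_subalgebra :: "'l::complex_lie_algebra set \<Rightarrow> bool"
  where "cartan_subalgebra H \<longleftrightarrow>
    lie_subalgebra H \<and> lie_nilpotent H \<and> H = root_space H (\<lambda>_. 0)"

text \<open>
  \<open>H\<^sub>*\<close>. All functionals \<open>\<alpha> \<noteq> 0\<close> on \<open>H\<close> may be used here, since \<open>root_space H \<alpha>\<close> is zero unless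
  \<open>\<alpha>\<close> is one of the finitely many weights of \<open>L\<close>.
\<close>

definition cartan_complement :: "'l::complex_lie_algebra set \<Rightarrow> 'l set"
  where "cartan_complement H = cspan (\<Union>\<alpha>\<in>{\<alpha> \<in> dual_on H. \<exists>h\<in>H. \<alpha> h \<noteq> 0}. root_space H \<alpha>)"

text \<open>
  The spectrum of a representation of \<open>L\<close> obtained from a joint spectrum \<open>\<sigma> H\<close> of its restriction to
  a Cartan subalgebra \<open>H\<close>. For the joint spectra considered here the set does not depend on the
  Cartan subalgebra, which is therefore bound existentially.
\<close>

definition cartan_spectrum ::
    "('l::complex_lie_algebra set \<Rightarrow> ('l \<Rightarrow> complex) set) \<Rightarrow> ('l \<Rightarrow> complex) set"
  where "cartan_spectrum \<sigma> = {f \<in> dual_on UNIV.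
    \<exists>H. cartan_subalgebra H \<and> restrict f H \<in> \<sigma> H \<and> (\<forall>l\<in>cartan_complement H. f l = 0)}"

definition Sigma_delta ::
    "('l::complex_lie_algebra \<Rightarrow> ('x::complex_banach \<Rightarrow>\<^sub>L 'x)) \<Rightarrow> nat \<Rightarrow> ('l \<Rightarrow> complex) set"
  where "Sigma_delta \<rho> k = cartan_spectrum (\<lambda>H. sigma_delta k H \<rho>)"

definition Sigma_pi ::
    "('l::complex_lie_algebra \<Rightarrow> ('x::complex_banach \<Rightarrow>\<^sub>L 'x)) \<Rightarrow> nat \<Rightarrow> ('l \<Rightarrow> complex) set"
  where "Sigma_pi \<rho> k = cartan_spectrum (\<lambda>H. sigma_pi k H \<rho>)"

definition Sp_delta ::
    "('l::complex_lie_algebra \<Rightarrow> ('x::complex_banach \<Rightarrow>\<^sub>L 'x)) \<Rightarrow> nat \<Rightarrow> ('l \<Rightarrow> complex) set"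
  where "Sp_delta \<rho> k = cartan_spectrum (\<lambda>H. sp_delta k H \<rho>)"

definition Sp_pi ::
    "('l::complex_lie_algebra \<Rightarrow> ('x::complex_banach \<Rightarrow>\<^sub>L 'x)) \<Rightarrow> nat \<Rightarrow> ('l \<Rightarrow> complex) set"
  where "Sp_pi \<rho> k = cartan_spectrum (\<lambda>H. sp_pi k H \<rho>)"

text \<open>The product of two sets of functionals, under the identification of
  \<open>L\<^sub>1\<^sup>* \<times> L\<^sub>2\<^sup>*\<close> with \<open>(L\<^sub>1 \<times> L\<^sub>2)\<^sup>*\<close>.\<close>

definition dual_times ::
    "('l1 \<Rightarrow> complex) set \<Rightarrow> ('l2 \<Rightarrow> complex) set \<Rightarrow> ('l1 \<times> 'l2 \<Rightarrow> complex) set"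
  where "dual_times F G = (\<lambda>(f, g) (l1, l2). f l1 + g l2) ` (F \<times> G)"

definition product_union ::
    "(nat \<Rightarrow> ('l1::complex_vector \<Rightarrow> complex) set) \<Rightarrow> (nat \<Rightarrow> ('l2::complex_vector \<Rightarrow> complex) set) \<Rightarrow>
      nat \<Rightarrow> ('l1 \<times> 'l2 \<Rightarrow> complex) set"
  where "product_union F G k =
    (\<Union>(p, q)\<in>{(p, q). p \<le> cdim (UNIV :: 'l1 set) \<and> q \<le> cdim (UNIV :: 'l2 set) \<and> p + q = k}.
       dual_times (F p) (G q))"

end

theory Submission
  imports Defs "HOL-Library.Function_Algebras" "Jordan_Normal_Form.Determinant"
begin

text \<open>
  Call it a defect of a complex in degree \<open>p\<close> if there are approximate cycles \<open>z\<close> together with functionals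
  \<open>U\<close> that almost annihilate the boundaries, while \<open>U z\<close> stays away from \<open>0\<close>. Missing exactness is a defect,
  and so is a range of the differential that is not closed, as long as the next range is closed. If two complexes have
  defects in degrees \<open>i\<close> and \<open>j\<close>, then \<open>z \<otimes> z'\<close> and the functional \<open>U \<otimes> U'\<close>, which (T4) provides, show that
  the tensor product complex is not both exact and of closed range in degree \<open>i + j\<close>. This yields the
  first inclusions. For the last ones, partial homotopies of the two complexes are combined into a homotopy of
  the tensor product complex. Both apply to the spectra, since the Koszul complex of \<open>H\<^sub>1 \<times> H\<^sub>2\<close> is the tensor
  product of the two Koszul complexes and every Cartan subalgebra of \<open>L\<^sub>1 \<times> L\<^sub>2\<close> is a product of Cartan
  subalgebras. In a Hilbert space closed ranges are complemented, so exactness with closed range gives a splitting.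
\<close>

text \<open>A nonzero homology class need not be seen by a functional that annihilates the
  boundaries, because the boundaries may be dense in the cycles; and a range that is not closed
  supplies no exact cycle at all. This is why a defect consists of approximate data for every e > 0,
  with bounds that are uniform in e: they survive the tensor product, where they contradict the
  constants that the open mapping theorem gives for an exact complex with closed range. The spectra
  are therefore expressed by one property, \<open>koszul_strict\<close>, exactness together with a
  closed outgoing range. In low degrees exactness alone forces the ranges to be closed; in high
  degrees one closed range propagates upwards. The differential \<open>koszul_d\<close> depends on
  the arbitrary choice \<open>ordered_basis\<close>, whereas the product calls for the concatenated
  basis; creation and annihilation operators give a form of the differential in which its square,
  the change of basis and the splitting into two factors follow from commutation rules. Chain spaces
  are subsets of a function type, hence the theorems of Hahn-Banach and of the open mapping are
  proved for seminorms on a vector space.\<close>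

instantiation "fun" :: (type, complex_vector) complex_vector
begin
definition scaleC_fun :: "complex \<Rightarrow> ('a \<Rightarrow> 'b) \<Rightarrow> 'a \<Rightarrow> 'b"
  where "scaleC_fun a f = (\<lambda>x. a *\<^sub>C f x)"
instance
  by intro_classes (simp_all add: scaleC_fun_def fun_eq_iff scaleC_add_right scaleC_add_left scaleC_scaleC scaleC_one)
end

lemma scaleC_fun_apply: "(a *\<^sub>C f) x = a *\<^sub>C f x"
  by (simp add: scaleC_fun_def)

lemma sum_fun_apply: "(\<Sum>i\<in>I. f i) x = (\<Sum>i\<in>I. f i x)"
  by (induction I rule: infinite_finite_induct) auto

text \<open>Chains are functions, but most arguments treat them as abstract vectors; the pointwise
  rules are collected here so that they are applied only on demand.\<close>

lemmas fun_ops = plus_fun_apply zero_fun_apply scaleC_fun_apply minus_apply uminus_apply sum_fun_apply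

declare plus_fun_apply [simp del] minus_apply [simp del] uminus_apply [simp del] zero_fun_apply [simp del] scaleC_one [simp]

lemma scaleC_zero_left [simp]: "0 *\<^sub>C x = 0" by (rule complex_vector.scale_zero_left)
lemma scaleC_zero_right [simp]: "a *\<^sub>C 0 = 0" by (rule complex_vector.scale_zero_right)
lemma scaleC_minus_left [simp]: "(- a) *\<^sub>C x = - (a *\<^sub>C x)" by (rule complex_vector.scale_minus_left)
lemma scaleC_minus_right [simp]: "a *\<^sub>C (- x) = - (a *\<^sub>C x)" by (rule complex_vector.scale_minus_right)
lemma scaleC_diff_right: "a *\<^sub>C (x - y) = a *\<^sub>C x - a *\<^sub>C y" by (rule complex_vector.scale_right_diff_distrib)
lemma scaleC_sum_right: "a *\<^sub>C (\<Sum>i\<in>I. f i) = (\<Sum>i\<in>I. a *\<^sub>C f i)" by (rule complex_vector.scale_sum_right)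
lemma scaleC_sum_left: "(\<Sum>i\<in>I. f i) *\<^sub>C x = (\<Sum>i\<in>I. f i *\<^sub>C x)" by (rule complex_vector.scale_sum_left)

section \<open>Seminorms, functionals and complete subspaces\<close>

definition real_sublinear :: "('v::complex_vector \<Rightarrow> real) \<Rightarrow> bool"
  where "real_sublinear p \<longleftrightarrow> (\<forall>x y. p (x + y) \<le> p x + p y) \<and>
    (\<forall>r x. 0 \<le> r \<longrightarrow> p (complex_of_real r *\<^sub>C x) = r * p x)"

definition cseminorm :: "('v::complex_vector \<Rightarrow> real) \<Rightarrow> bool"
  where "cseminorm q \<longleftrightarrow> (\<forall>x y. q (x + y) \<le> q x + q y) \<and> (\<forall>a x. q (a *\<^sub>C x) = cmod a * q x)"

lemma cseminormD:
  assumes "cseminorm q"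
  shows "q (x + y) \<le> q x + q y" "q (a *\<^sub>C x) = cmod a * q x" "q 0 = 0" "q (- x) = q x"
    "q (x - y) \<le> q x + q y" "0 \<le> q x"
proof -
  show *: "q (x + y) \<le> q x + q y" "q (a *\<^sub>C x) = cmod a * q x" for x y a
    using assms by (auto simp: cseminorm_def)
  show 0: "q 0 = 0" using *(2)[of 0 0] by simp
  show m: "q (- x) = q x" for x using *(2)[of "-1" x] by simp
  show "q (x - y) \<le> q x + q y" using *(1)[of x "- y"] m by simp
  show "0 \<le> q x" using *(1)[of x "- x"] m[of x] 0 by simp
qed

lemma real_sublinearD:
  assumes "real_sublinear p"
  shows "p (x + y) \<le> p x + p y" "0 \<le> r \<Longrightarrow> p (complex_of_real r *\<^sub>C x) = r * p x"
    "p 0 = 0" "- p (- x) \<le> p x"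
proof -
  show *: "p (x + y) \<le> p x + p y" "0 \<le> r \<Longrightarrow> p (complex_of_real r *\<^sub>C x) = r * p x" for x y r
    using assms by (auto simp: real_sublinear_def)
  show 0: "p 0 = 0" using *(2)[of 0 0] by simp
  show "- p (- x) \<le> p x" using *(1)[of x "- x"] 0 by simp
qed

text \<open>The witness is the infimum over t \<ge> 0 of p(x + ty) - t p(y), which is finite because
  - p(- x) is a lower bound. The value t = 0 gives the first estimate and t = 1 the second. For a
  functional that admits nothing smaller, the second estimate becomes superadditivity.\<close>

lemma real_sublinear_tilt:
  assumes p: "real_sublinear p"
  shows "\<exists>p'. real_sublinear p' \<and> (\<forall>x. p' x \<le> p x) \<and> (\<forall>x. p' x \<le> p (x + y) - p y)"
proof -
  note pD = real_sublinearD[OF p]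
  define F where "F x = (\<lambda>t. p (x + complex_of_real t *\<^sub>C y) - t * p y)" for x
  define p' where "p' x = Inf (F x ` {0..})" for x
  have low: "- p (- x) \<le> F x t" if "0 \<le> t" for x t
    using pD(1)[of "x + complex_of_real t *\<^sub>C y" "- x"] pD(2)[OF that, of y] by (simp add: F_def)
  have bdd: "bdd_below (F x ` {0..})" for x
    using low[of _ x] by (intro bdd_belowI[of _ "- p (- x)"]) auto
  have le: "p' x \<le> F x t" if "0 \<le> t" for x t
    unfolding p'_def using that by (intro cInf_lower bdd) auto
  have ge: "c \<le> p' x" if "\<And>t. 0 \<le> t \<Longrightarrow> c \<le> F x t" for x c
    unfolding p'_def using that by (intro cInf_greatest) auto
  have add: "p' (x + z) \<le> p' x + p' z" for x z
  proof -
    have "p' (x + z) - F x t \<le> p' z" if t: "0 \<le> t" for t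
    proof (rule ge)
      fix s :: real assume s: "0 \<le> s"
      have "p' (x + z) \<le> F (x + z) (t + s)" by (rule le) (use s t in auto)
      also have "\<dots> \<le> F x t + F z s"
        using pD(1)[of "x + complex_of_real t *\<^sub>C y" "z + complex_of_real s *\<^sub>C y"]
        by (simp add: F_def algebra_simps scaleC_add_left)
      finally show "p' (x + z) - F x t \<le> F z s" by simp
    qed
    then have "p' (x + z) - p' z \<le> p' x" by (intro ge) (simp add: algebra_simps)
    then show ?thesis by simp
  qed
  have hom: "r * p' x \<le> p' (complex_of_real r *\<^sub>C x)" if r: "0 < r" for r x
  proof (rule ge)
    fix t :: real assume t: "0 \<le> t"
    have "p' x \<le> F x (t / r)" by (rule le) (use r t in auto)
    then have "r * p' x \<le> r * F x (t / r)" using r by simp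
    also have "\<dots> = F (complex_of_real r *\<^sub>C x) t"
      using pD(2)[of r "x + complex_of_real (t/r) *\<^sub>C y"] r
      by (simp add: F_def algebra_simps scaleC_add_right scaleC_scaleC)
    finally show "r * p' x \<le> F (complex_of_real r *\<^sub>C x) t" .
  qed
  have hom': "p' (complex_of_real r *\<^sub>C x) = r * p' x" if "0 \<le> r" for r x
  proof (cases "r = 0")
    case True
    have "p' 0 \<le> 0" using le[of 0 0] by (simp add: F_def pD)
    moreover have "0 \<le> p' 0" by (rule ge) (simp add: F_def pD)
    ultimately show ?thesis using True by simp
  next
    case False
    with that have r: "0 < r" by simp
    have "inverse r * p' (complex_of_real r *\<^sub>C x) \<le> p' x"
      using hom[of "inverse r" "complex_of_real r *\<^sub>C x"] r
      by (simp add: scaleC_scaleC flip: of_real_mult)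
    then have "r * (inverse r * p' (complex_of_real r *\<^sub>C x)) \<le> r * p' x"
      using r by (intro mult_left_mono) auto
    moreover have "r * (inverse r * c) = c" for c using r by simp
    ultimately have "p' (complex_of_real r *\<^sub>C x) \<le> r * p' x" by metis
    with hom[OF r, of x] show ?thesis by simp
  qed
  have "p' x \<le> p x" for x using le[of 0 x] by (simp add: F_def)
  moreover have "p' x \<le> p (x + y) - p y" for x using le[of 1 x] by (simp add: F_def)
  ultimately show ?thesis using add hom' by (auto simp: real_sublinear_def intro!: exI[of _ p'])
qed

text \<open>A minimal sublinear functional is linear, because it is not changed by tilting.\<close>

lemma exists_real_linear_below:
  assumes q: "real_sublinear (q :: 'v::complex_vector \<Rightarrow> real)"
  shows "\<exists>p. (\<forall>x y. p (x + y) = p x + p y) \<and> (\<forall>r x. p (complex_of_real r *\<^sub>C x) = r * p x) \<and> (\<forall>x. p x \<le> q x)"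
proof -
  define A where "A = {p. real_sublinear p \<and> (\<forall>x. p x \<le> q x)}"
  \<comment> \<open>The order is reversed: an element that is maximal for \<open>P\<close> is a
    minimal functional, and upper bounds of chains are pointwise infima.\<close>
  define P where "P = (\<lambda>(p :: 'v \<Rightarrow> real) p'. \<forall>x. p' x \<le> p x)"
  have po: "partial_order_on A (relation_of P A)"
    by (rule partial_order_on_relation_ofI) (auto simp: P_def fun_eq_iff intro: order_trans order_antisym)
  have "\<exists>m\<in>A. \<forall>a\<in>A. P m a \<longrightarrow> a = m"
  proof (rule predicate_Zorn[OF po])
    fix C assume C: "C \<in> Chains (relation_of P A)"
    show "\<exists>u\<in>A. \<forall>a\<in>C. P a u"
    proof (cases "C = {}")
      case True then show ?thesis using q by (auto simp: A_def)
    next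
      case False
      have CA: "C \<subseteq> A" using C by (auto simp: Chains_def relation_of_def)
      have tot: "P a b \<or> P b a" if "a \<in> C" "b \<in> C" for a b
        using C that by (auto simp: Chains_def relation_of_def)
      have low: "- q (- x) \<le> p x" if "p \<in> C" for p x
      proof -
        have "real_sublinear p" "p (- x) \<le> q (- x)" using CA that by (auto simp: A_def)
        then show ?thesis using real_sublinearD(4)[of p x] by simp
      qed
      \<comment> \<open>All members of the chain lie above - q(- x), so the infimum is finite.
        Subadditivity uses totality of the chain: of two members, the smaller one serves at both
        points.\<close>
      define u where "u x = Inf ((\<lambda>p. p x) ` C)" for x
      have le: "u x \<le> p x" if "p \<in> C" for p x
        unfolding u_def using that low by (intro cInf_lower bdd_belowI[of _ "- q (- x)"]) auto
      have ge: "c \<le> u x" if "\<And>p. p \<in> C \<Longrightarrow> c \<le> p x" for c x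
        unfolding u_def using that False by (intro cInf_greatest) auto
      have sub: "real_sublinear p" if "p \<in> C" for p using that CA by (auto simp: A_def)
      have add: "u (x + y) \<le> u x + u y" for x y
      proof -
        have "u (x + y) - p1 x \<le> u y" if p1: "p1 \<in> C" for p1
        proof (rule ge)
          fix p2 assume p2: "p2 \<in> C"
          obtain p where "p \<in> C" "p x \<le> p1 x" "p y \<le> p2 y"
            using tot[OF p1 p2] p1 p2 by (auto simp: P_def)
          then show "u (x + y) - p1 x \<le> p2 y"
            using le[of p "x + y"] real_sublinearD(1)[OF sub, of p x y] by linarith
        qed
        then have "u (x + y) - u y \<le> u x" by (intro ge) (simp add: algebra_simps)
        then show ?thesis by simp
      qed
      have hom: "r * u x \<le> u (complex_of_real r *\<^sub>C x)" if "0 \<le> r" for r x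
        using that le[of _ x] by (intro ge) (simp add: real_sublinearD(2)[OF sub] mult_left_mono)
      have hom': "u (complex_of_real r *\<^sub>C x) = r * u x" if "0 \<le> r" for r x
      proof (cases "r = 0")
        case True
        obtain p where "p \<in> C" using False by auto
        have "u 0 \<le> 0" using le[OF \<open>p \<in> C\<close>, of 0] real_sublinearD(3)[OF sub[OF \<open>p \<in> C\<close>]] by simp
        moreover have "0 \<le> u 0" by (rule ge) (simp add: real_sublinearD(3)[OF sub])
        ultimately show ?thesis using True by simp
      next
        case False
        with that have r: "0 < r" by simp
        have "inverse r * u (complex_of_real r *\<^sub>C x) \<le> u x"
          using hom[of "inverse r" "complex_of_real r *\<^sub>C x"] r
          by (simp add: scaleC_scaleC flip: of_real_mult)
        then have "r * (inverse r * u (complex_of_real r *\<^sub>C x)) \<le> r * u x"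
          using r by (intro mult_left_mono) auto
        moreover have "r * (inverse r * c) = c" for c using r by simp
        ultimately have "u (complex_of_real r *\<^sub>C x) \<le> r * u x" by metis
        with hom[OF that, of x] show ?thesis by simp
      qed
      have "u x \<le> q x" for x
      proof -
        obtain p where "p \<in> C" using False by auto
        then have "p x \<le> q x" using CA by (auto simp: A_def)
        then show ?thesis using le[OF \<open>p \<in> C\<close>, of x] by simp
      qed
      then have "u \<in> A" using add hom' by (auto simp: A_def real_sublinear_def)
      then show ?thesis using le by (auto simp: P_def)
    qed
  qed
  then obtain p where pA: "p \<in> A" and min: "\<And>a. a \<in> A \<Longrightarrow> P p a \<Longrightarrow> a = p" by blast
  have p: "real_sublinear p" and pq: "\<And>x. p x \<le> q x" using pA by (auto simp: A_def)
  have add: "p (x + y) = p x + p y" for x y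
  proof -
    obtain p' where p': "real_sublinear p'" "\<And>x. p' x \<le> p x" "\<And>x. p' x \<le> p (x + y) - p y"
      using real_sublinear_tilt[OF p, of y] by blast
    have "p' = p" by (rule min) (use p' pq in \<open>auto simp: A_def P_def intro: order_trans\<close>)
    then show ?thesis using p'(3)[of x] real_sublinearD(1)[OF p, of x y] by simp
  qed
  have neg: "p (- x) = - p x" for x
    using add[of x "- x"] real_sublinearD(3)[OF p] by simp
  have "p (complex_of_real r *\<^sub>C x) = r * p x" for r x
  proof (cases "0 \<le> r")
    case True then show ?thesis by (rule real_sublinearD(2)[OF p])
  next
    case False
    then show ?thesis using real_sublinearD(2)[OF p, of "- r" x] neg[of "complex_of_real r *\<^sub>C x"] by simp
  qed
  then show ?thesis using add pq by blast
qed

text \<open>The functional is large at \<open>x0\<close> because \<open>q\<close> is tilted in the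
  direction \<open>x0\<close> before a linear functional is placed below it: q'(- x0) \<le> - q(x0),
  so every linear p \<le> q' satisfies p(x0) \<ge> q(x0). The complex functional has real part p and
  imaginary part - p(ix); rotating x until the value is real and positive bounds its
  modulus.\<close>

theorem hahn_banach_seminorm:
  assumes q: "cseminorm (q :: 'v::complex_vector \<Rightarrow> real)"
  shows "\<exists>U. (\<forall>x y. U (x + y) = U x + U y) \<and> (\<forall>a x. U (a *\<^sub>C x) = a * U x) \<and>
    (\<forall>x. cmod (U x) \<le> q x) \<and> q x0 \<le> cmod (U x0)"
proof -
  note qD = cseminormD[OF q]
  have "real_sublinear q" by (auto simp: real_sublinear_def qD)
  from real_sublinear_tilt[OF this, of x0] obtain q' where
    q': "real_sublinear q'" "\<And>x. q' x \<le> q x" "\<And>x. q' x \<le> q (x + x0) - q x0" by blast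
  obtain p where add: "\<And>x y. p (x + y) = p x + p y"
    and hom: "\<And>r x. p (complex_of_real r *\<^sub>C x) = r * p x" and le: "\<And>x. p x \<le> q' x"
    using exists_real_linear_below[OF q'(1)] by blast
  have neg: "p (- x) = - p x" for x using hom[of "-1" x] by simp
  have px0: "q x0 \<le> p x0" using le[of "- x0"] q'(3)[of "- x0"] neg[of x0] by (simp add: qD)
  define U where "U x = Complex (p x) (- p (\<i> *\<^sub>C x))" for x
  have Uadd: "U (x + y) = U x + U y" for x y
    by (simp add: U_def add scaleC_add_right complex_eq_iff)
  have Uhom: "U (a *\<^sub>C x) = a * U x" for a x
  proof -
    have "a *\<^sub>C x = complex_of_real (Re a) *\<^sub>C x + complex_of_real (Im a) *\<^sub>C \<i> *\<^sub>C x"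
      by (subst complex_eq[of a]) (simp add: scaleC_add_left scaleC_scaleC mult.commute)
    moreover have "\<i> *\<^sub>C a *\<^sub>C x = complex_of_real (Re a) *\<^sub>C \<i> *\<^sub>C x + complex_of_real (- Im a) *\<^sub>C x"
    proof -
      have "\<i> * a = complex_of_real (Re a) * \<i> + complex_of_real (- Im a)" by (simp add: complex_eq_iff)
      then show ?thesis by (simp add: scaleC_scaleC scaleC_add_left del: of_real_minus)
    qed
    ultimately have "p (a *\<^sub>C x) = Re a * p x + Im a * p (\<i> *\<^sub>C x)"
      "p (\<i> *\<^sub>C a *\<^sub>C x) = Re a * p (\<i> *\<^sub>C x) - Im a * p x" by (simp_all only: add hom)
    then show ?thesis by (simp add: U_def complex_eq_iff)
  qed
  have "cmod (U x) \<le> q x" for x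
  proof (cases "U x = 0")
    case True then show ?thesis by (simp add: qD)
  next
    case False
    define a where "a = cnj (U x) / complex_of_real (cmod (U x))"
    have a: "cmod a = 1" "a * U x = complex_of_real (cmod (U x))"
      using False by (simp_all add: a_def norm_divide mult.commute complex_norm_square[symmetric] power2_eq_square)
    have "cmod (U x) = Re (U (a *\<^sub>C x))" by (simp add: Uhom a)
    also have "\<dots> \<le> q (a *\<^sub>C x)" using le[of "a *\<^sub>C x"] q'(2)[of "a *\<^sub>C x"] by (simp add: U_def)
    also have "\<dots> = q x" by (simp add: qD a)
    finally show ?thesis .
  qed
  moreover have "q x0 \<le> cmod (U x0)" using px0 abs_Re_le_cmod[of "U x0"] by (simp add: U_def)
  ultimately show ?thesis using Uadd Uhom by blast
qed

lemma clinearI: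
  assumes "\<And>x y. T (x + y) = T x + T y" "\<And>a x. T (a *\<^sub>C x) = a *\<^sub>C T x"
  shows "clinear T"
  by (rule Vector_Spaces.linear.intro[OF complex_vector.vector_space_axioms complex_vector.vector_space_axioms module_hom.intro])
     (use assms in \<open>auto intro!: complex_vector.module_axioms module_hom_axioms.intro\<close>)

lemma clinearD:
  assumes "clinear T"
  shows "T (x + y) = T x + T y" "T (a *\<^sub>C x) = a *\<^sub>C T x" "T 0 = 0" "T (- x) = - T x" "T (x - y) = T x - T y"
    "T (\<Sum>i\<in>I. f i) = (\<Sum>i\<in>I. T (f i))"
proof -
  interpret Vector_Spaces.linear scaleC scaleC T by fact
  show "T (x + y) = T x + T y" "T (a *\<^sub>C x) = a *\<^sub>C T x" "T 0 = 0" "T (- x) = - T x" "T (x - y) = T x - T y"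
    "T (\<Sum>i\<in>I. f i) = (\<Sum>i\<in>I. T (f i))"
    by (fact add scale zero neg diff sum)+
qed

lemma csubspaceD:
  assumes "complex_vector.subspace A"
  shows "0 \<in> A" "x \<in> A \<Longrightarrow> y \<in> A \<Longrightarrow> x + y \<in> A" "x \<in> A \<Longrightarrow> a *\<^sub>C x \<in> A"
    "x \<in> A \<Longrightarrow> y \<in> A \<Longrightarrow> x - y \<in> A" "x \<in> A \<Longrightarrow> - x \<in> A"
  using assms by (auto intro: complex_vector.subspace_0 complex_vector.subspace_add
      complex_vector.subspace_scale complex_vector.subspace_diff complex_vector.subspace_neg)

section \<open>Completeness and the open mapping theorem\<close>

definition seminorm_complete :: "('v::complex_vector \<Rightarrow> real) \<Rightarrow> 'v set \<Rightarrow> bool"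
  where "seminorm_complete N A \<longleftrightarrow> (\<forall>x::nat \<Rightarrow> 'v. (\<forall>n. x n \<in> A) \<and>
      (\<forall>e>0. \<exists>k. \<forall>m\<ge>k. \<forall>n\<ge>k. N (x m - x n) < e) \<longrightarrow> (\<exists>l\<in>A. (\<lambda>n. N (x n - l)) \<longlonglongrightarrow> 0))"

text \<open>The remainders are halved in each step, so the corrections form a geometric series,
  which explains the factor 2. \<open>Z\<close> is any set that is stable under subtracting values
  of \<open>T\<close>: it will be the image of \<open>T\<close>, a space of cycles, or the closure
  of a range.\<close>

lemma successive_approximation:
  assumes N: "cseminorm N" and M: "cseminorm M" and A: "complex_vector.subspace A"
    and compl: "seminorm_complete N A" and T: "clinear T"
    and bd: "\<And>x. x \<in> A \<Longrightarrow> M (T x) \<le> C * N x" and K: "0 \<le> K"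
    and Z: "\<And>z x. z \<in> Z \<Longrightarrow> x \<in> A \<Longrightarrow> z - T x \<in> Z"
    and approx: "\<And>z. z \<in> Z \<Longrightarrow> \<exists>x\<in>A. N x \<le> K * M z \<and> M (z - T x) \<le> M z / 2"
    and z: "z \<in> Z"
  shows "\<exists>x\<in>A. N x \<le> 2 * K * M z \<and> M (z - T x) = 0"
proof -
  note ND = cseminormD[OF N] and MD = cseminormD[OF M] and TD = clinearD[OF T] and AD = csubspaceD[OF A]
  obtain \<phi> where \<phi>: "\<And>z. z \<in> Z \<Longrightarrow> \<phi> z \<in> A" "\<And>z. z \<in> Z \<Longrightarrow> N (\<phi> z) \<le> K * M z"
    "\<And>z. z \<in> Z \<Longrightarrow> M (z - T (\<phi> z)) \<le> M z / 2"
    using approx by metis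
  define r where "r = rec_nat z (\<lambda>_ w. w - T (\<phi> w))"
  have r0: "r 0 = z" and rS: "\<And>n. r (Suc n) = r n - T (\<phi> (r n))" by (simp_all add: r_def)
  have rZ: "r n \<in> Z" for n by (induction n) (auto simp: r0 rS z Z \<phi>)
  have rM: "M (r n) \<le> M z / 2 ^ n" for n
  proof (induction n)
    case (Suc n)
    have "M (r (Suc n)) \<le> M (r n) / 2" using \<phi>(3)[OF rZ, of n] by (simp add: rS)
    also have "\<dots> \<le> (M z / 2 ^ n) / 2" using Suc by simp
    finally show ?case by simp
  qed (simp add: r0)
  define x where "x n = (\<Sum>k<n. \<phi> (r k))" for n
  have xS: "x (Suc n) = x n + \<phi> (r n)" for n by (simp add: x_def)
  have xA: "x n \<in> A" for n by (induction n) (auto simp: xS x_def AD \<phi> rZ)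
  have unjoin: "r n = z - T (x n)" for n
    by (induction n) (auto simp: r0 rS xS TD, simp add: x_def TD)
  \<comment> \<open>The bound is a difference of tails of the geometric series, so that the
    induction telescopes.\<close>
  have step: "N (x (n + k) - x n) \<le> 2 * K * M z * (1 / 2 ^ n - 1 / 2 ^ (n + k))" for n k
  proof (induction k)
    case (Suc k)
    have "N (x (n + Suc k) - x n) \<le> N (x (n + k) - x n) + N (\<phi> (r (n + k)))"
      using ND(1)[of "x (n + k) - x n" "\<phi> (r (n + k))"] by (simp add: xS algebra_simps)
    also have "N (\<phi> (r (n + k))) \<le> K * (M z / 2 ^ (n + k))"
      using \<phi>(2)[OF rZ, of "n + k"] mult_left_mono[OF rM K, of "n + k"] by simp
    finally have "N (x (n + Suc k) - x n) \<le> 2 * K * M z * (1 / 2 ^ n - 1 / 2 ^ (n + k)) + K * (M z / 2 ^ (n + k))"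
      using Suc by simp
    also have "\<dots> = 2 * K * M z * (1 / 2 ^ n - 1 / 2 ^ (n + Suc k))" by (simp add: right_diff_distrib)
    finally show ?case .
  qed (simp add: ND)
  have bound: "N (x (n + k) - x n) \<le> 2 * K * M z / 2 ^ n" for n k
  proof -
    have "0 \<le> 2 * K * M z" using K MD by simp
    then have "2 * K * M z * (1 / 2 ^ n - 1 / 2 ^ (n + k)) \<le> 2 * K * M z * (1 / 2 ^ n)"
      by (intro mult_left_mono) auto
    then show ?thesis using step[of n k] by simp
  qed
  have half: "(\<lambda>n. c / 2 ^ n) \<longlonglongrightarrow> 0" for c :: real
    using tendsto_mult[OF tendsto_const[of c] LIMSEQ_power_zero[of "1/2::real"]]
    by (simp add: power_divide)
  have "\<exists>l\<in>A. (\<lambda>n. N (x n - l)) \<longlonglongrightarrow> 0"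
  proof (rule compl[unfolded seminorm_complete_def, rule_format], intro conjI allI impI xA)
    fix e :: real assume "0 < e"
    then have "eventually (\<lambda>n. 2 * K * M z / 2 ^ n < e / 2) sequentially"
      by (intro order_tendstoD(2)[OF half]) auto
    then obtain k where k: "2 * K * M z / 2 ^ k < e / 2" by (auto simp: eventually_sequentially)
    show "\<exists>k. \<forall>m\<ge>k. \<forall>n\<ge>k. N (x m - x n) < e"
    proof (intro exI[of _ k] allI impI)
      fix m n assume "k \<le> m" "k \<le> n"
      then obtain i j where ij: "m = k + i" "n = k + j" by (auto simp: le_iff_add)
      have "N (x m - x n) \<le> N (x m - x k) + N (x n - x k)"
        using ND(5)[of "x m - x k" "x n - x k"] by simp
      then show "N (x m - x n) < e" using bound[of k i] bound[of k j] k ij by simp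
    qed
  qed
  then obtain l where l: "l \<in> A" "(\<lambda>n. N (x n - l)) \<longlonglongrightarrow> 0" by blast
  have "N l \<le> 2 * K * M z"
  proof (rule LIMSEQ_le_const[OF tendsto_add[OF tendsto_const[of "2 * K * M z"] l(2), simplified]], intro exI allI impI)
    fix n :: nat
    have "N l \<le> N (x n) + N (x n - l)" using ND(5)[of "x n" "x n - l"] by simp
    moreover have "N (x n) \<le> 2 * K * M z" using bound[of 0 n] by (simp add: x_def)
    ultimately show "N l \<le> 2 * K * M z + N (x n - l)" by simp
  qed
  moreover have "M (z - T l) \<le> 0"
  proof -
    have "(\<lambda>n. M z / 2 ^ n + C * N (x n - l)) \<longlonglongrightarrow> 0 + C * 0"
      by (intro tendsto_intros half l)
    moreover have "M (z - T l) \<le> M z / 2 ^ n + C * N (x n - l)" for n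
    proof -
      have "M (z - T l) \<le> M (r n) + M (T (x n - l))"
        using MD(1)[of "r n" "T (x n - l)"] by (simp add: unjoin TD)
      then show ?thesis using rM[of n] bd[OF AD(4)[OF xA l(1)], of n] by simp
    qed
    ultimately show ?thesis by (intro LIMSEQ_le_const) auto
  qed
  ultimately show ?thesis using l(1) MD(6)[of "z - T l"] by (intro bexI[of _ l]) auto
qed

text \<open>With the metric given by \<open>M\<close>, the set \<open>B\<close> is a complete metric
  space covered by the closures of the images of balls. By Baire one of them contains a ball;
  subtracting approximate preimages of two of its points gives approximate preimages of small
  vectors, and successive approximation makes them exact.\<close>

theorem open_mapping_seminorm:
  assumes N: "cseminorm N" and M: "cseminorm M"
    and A: "complex_vector.subspace A" and compl: "seminorm_complete N A"
    and B: "complex_vector.subspace B" and complB: "seminorm_complete M B"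
    and definite: "\<And>z. z \<in> B \<Longrightarrow> M z = 0 \<Longrightarrow> z = 0"
    and T: "clinear T" and TA: "T ` A = B" and bd: "\<And>x. x \<in> A \<Longrightarrow> M (T x) \<le> C * N x"
  shows "\<exists>K\<ge>0. \<forall>z\<in>B. \<exists>x\<in>A. T x = z \<and> N x \<le> K * M z"
proof -
  note ND = cseminormD[OF N] and MD = cseminormD[OF M] and TD = clinearD[OF T]
    and AD = csubspaceD[OF A] and BD = csubspaceD[OF B]
  interpret Metric_space B "\<lambda>x y. M (x - y)"
  proof
    show "M (x - y) = M (y - x)" for x y using MD(4)[of "x - y"] by simp
    show "(M (x - y) = 0) = (x = y)" if "x \<in> B" "y \<in> B" for x y
      using definite[of "x - y"] that BD MD by auto
    show "M (x - z) \<le> M (x - y) + M (y - z)" for x y z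
      using MD(1)[of "x - y" "y - z"] by simp
  qed (simp add: MD)
  have mcomplete
    unfolding mcomplete_def
  proof (intro allI impI)
    fix \<sigma> assume c: "MCauchy \<sigma>"
    then have "\<exists>l\<in>B. (\<lambda>n. M (\<sigma> n - l)) \<longlonglongrightarrow> 0"
      by (intro complB[unfolded seminorm_complete_def, rule_format]) (auto simp: MCauchy_def)
    then obtain l where "l \<in> B" "(\<lambda>n. M (\<sigma> n - l)) \<longlonglongrightarrow> 0" by blast
    then show "\<exists>x. limitin mtopology \<sigma> x sequentially"
      using c by (intro exI[of _ l]) (auto simp: limitin_metric_dist_null MCauchy_def image_subset_iff)
  qed
  define F where "F n = mtopology closure_of (T ` {x\<in>A. N x \<le> real n})" for n
  have "\<exists>n. mtopology interior_of F n \<noteq> {}"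
  proof (rule ccontr)
    assume "\<not> ?thesis"
    then have "mtopology interior_of \<Union>(range F) = {}"
      by (intro metric_Baire_category_alt \<open>mcomplete\<close>) (auto simp: F_def)
    moreover have "B \<subseteq> \<Union>(range F)"
    proof
      fix z assume "z \<in> B"
      then obtain x where x: "x \<in> A" "T x = z" using TA by auto
      obtain n where "N x \<le> real n" using real_arch_simple by blast
      then have "z \<in> T ` {x\<in>A. N x \<le> real n}" using x by auto
      moreover have "T ` {x\<in>A. N x \<le> real n} \<subseteq> F n"
        unfolding F_def using TA by (intro closure_of_subset) auto
      ultimately show "z \<in> \<Union>(range F)" by auto
    qed
    ultimately show False
      using interior_of_mono[of B "\<Union>(range F)" mtopology] BD(1) interior_of_topspace[of mtopology] by auto
  qed
  then obtain n z0 where "z0 \<in> mtopology interior_of F n" by blast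
  then obtain r where r: "0 < r" "mball z0 r \<subseteq> F n" and z0: "z0 \<in> B"
    using openin_interior_of[of mtopology "F n"] interior_of_subset[of mtopology "F n"]
    unfolding openin_mtopology by blast
  have approxF: "\<exists>x\<in>A. N x \<le> real n \<and> M (z - T x) < e" if "z \<in> B" "M (z - z0) < r" "0 < e" for z e
  proof -
    have "z \<in> F n" using r(2) that z0 MD(4)[of "z - z0"] by (auto simp: mball_def)
    then show ?thesis using that(3) by (fastforce simp: F_def metric_closure_of)
  qed
  \<comment> \<open>A vector z is scaled to w of length r/2, so that z0 and z0 + w both lie in the
    ball. Each is approximated up to r/8 by the image of a vector of norm at most n; the difference
    has norm at most 2n and error at most r/4. Scaling back by 2 M(z) / r turns these bounds into 4n
    M(z) / r and M(z) / 2.\<close>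
  define K where "K = 4 * real n / r"
  have K: "0 \<le> K" using r by (simp add: K_def)
  have "\<exists>x\<in>A. N x \<le> K * M z \<and> M (z - T x) \<le> M z / 2" if z: "z \<in> B" for z
  proof (cases "M z = 0")
    case True then show ?thesis using AD by (intro bexI[of _ 0]) (auto simp: TD ND)
  next
    case False
    with MD(6)[of z] have Mz: "0 < M z" by linarith
    define s where "s = r / (2 * M z)"
    have s: "0 < s" using r Mz by (simp add: s_def)
    define w where "w = complex_of_real s *\<^sub>C z"
    have "M w = s * M z" unfolding w_def using s by (simp only: MD) simp
    then have Mw: "M w = r / 2" using Mz by (simp add: s_def)
    have wB: "w \<in> B" unfolding w_def using z BD by blast
    obtain x1 where x1: "x1 \<in> A" "N x1 \<le> real n" "M (z0 + w - T x1) < r / 8"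
      using approxF[of "z0 + w" "r/8"] r z0 wB BD Mw by auto
    obtain x2 where x2: "x2 \<in> A" "N x2 \<le> real n" "M (z0 - T x2) < r / 8"
      using approxF[of z0 "r/8"] r z0 MD by auto
    define x where "x = complex_of_real (1 / s) *\<^sub>C (x1 - x2)"
    have "N x \<le> (1 / s) * (2 * real n)"
    proof -
      have "N (x1 - x2) \<le> 2 * real n" using ND(5)[of x1 x2] x1 x2 by linarith
      then show ?thesis using s by (simp add: x_def ND norm_divide divide_right_mono)
    qed
    also have "\<dots> = K * M z" using s Mz r by (simp add: K_def s_def field_simps)
    finally have Nx: "N x \<le> K * M z" .
    have "z - T x = complex_of_real (1 / s) *\<^sub>C (w - T (x1 - x2))"
      using s by (simp add: w_def x_def TD scaleC_diff_right scaleC_scaleC)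
    then have "M (z - T x) = (1 / s) * M (w - T (x1 - x2))" using s by (simp only: MD) (simp add: norm_divide)
    also have "M (w - T (x1 - x2)) \<le> r / 4"
      using MD(5)[of "z0 + w - T x1" "z0 - T x2"] x1 x2 by (simp add: TD algebra_simps)
    also have "(1 / s) * (r / 4) = M z / 2" using r Mz by (simp add: s_def)
    finally have "M (z - T x) \<le> M z / 2" using s by (simp add: mult_left_mono divide_right_mono)
    moreover have "x \<in> A" unfolding x_def using x1 x2 AD by blast
    ultimately show ?thesis using Nx by blast
  qed
  then have "\<exists>x\<in>A. N x \<le> 2 * K * M z \<and> M (z - T x) = 0" if "z \<in> B" for z
    using that TA BD by (intro successive_approximation[OF N M A compl T bd K, of B]) auto
  then show ?thesis using K definite TA BD
    by (intro exI[of _ "2 * K"]) (auto, metis eq_iff_diff_eq_0 image_eqI)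
qed

section \<open>Functionals that detect failures of exactness and of closedness\<close>

lemma cseminorm_scale: "cseminorm N \<Longrightarrow> 0 \<le> r \<Longrightarrow> cseminorm (\<lambda>x. r * N x)"
  unfolding cseminorm_def by (metis distrib_left mult.left_commute mult_left_mono)

text \<open>The infimum of N(x) + M(w - Tx) over x in \<open>A\<close> is the largest seminorm that
  lies below \<open>M\<close> and, after composition with \<open>T\<close>, below \<open>N\<close>.
  A functional dominated by it is bounded by \<open>M\<close>, and it almost annihilates the range
  of \<open>T\<close> when \<open>N\<close> carries a small factor.\<close>

lemma inf_convolution:
  assumes N: "cseminorm N" and M: "cseminorm M" and A: "complex_vector.subspace A" and T: "clinear T"
  obtains q where "cseminorm q" "\<And>w. q w \<le> M w" "\<And>x. x \<in> A \<Longrightarrow> q (T x) \<le> N x"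
    "\<And>w c. q w < c \<Longrightarrow> \<exists>x\<in>A. N x + M (w - T x) < c"
proof
  define q where "q = (\<lambda>w. Inf ((\<lambda>x. N x + M (w - T x)) ` A))"
  note ND = cseminormD[OF N] and MD = cseminormD[OF M] and TD = clinearD[OF T] and AD = csubspaceD[OF A]
  have le: "q w \<le> N x + M (w - T x)" if "x \<in> A" for x w
    unfolding q_def using that by (intro cInf_lower bdd_belowI[of _ 0]) (auto simp: ND MD)
  have ge: "c \<le> q w" if "\<And>x. x \<in> A \<Longrightarrow> c \<le> N x + M (w - T x)" for c w
    unfolding q_def using that AD(1) by (intro cInf_greatest) auto
  show "q w \<le> M w" for w using le[OF AD(1), of w] by (simp add: ND TD)
  show "x \<in> A \<Longrightarrow> q (T x) \<le> N x" for x using le[of x "T x"] by (simp add: MD)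
  show "q w < c \<Longrightarrow> \<exists>x\<in>A. N x + M (w - T x) < c" for w c using ge[of c w] by force
  have add: "q (w + w') \<le> q w + q w'" for w w'
  proof -
    have "q (w + w') - (N x + M (w - T x)) \<le> q w'" if x: "x \<in> A" for x
    proof (rule ge)
      fix y assume y: "y \<in> A"
      have "q (w + w') \<le> N (x + y) + M (w + w' - T (x + y))" by (rule le) (use x y AD in auto)
      also have "w + w' - T (x + y) = (w - T x) + (w' - T y)" by (simp add: TD)
      finally show "q (w + w') - (N x + M (w - T x)) \<le> N y + M (w' - T y)"
        using ND(1)[of x y] MD(1)[of "w - T x" "w' - T y"] by linarith
    qed
    then have "q (w + w') - q w' \<le> q w" by (intro ge) (simp add: algebra_simps)
    then show ?thesis by simp
  qed
  have hom: "q (a *\<^sub>C w) \<le> cmod a * q w" if "a \<noteq> 0" for a w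
  proof -
    have "q (a *\<^sub>C w) / cmod a \<le> q w"
    proof (rule ge)
      fix x assume x: "x \<in> A"
      have "q (a *\<^sub>C w) \<le> N (a *\<^sub>C x) + M (a *\<^sub>C w - T (a *\<^sub>C x))" by (rule le) (use x AD in auto)
      also have "\<dots> = cmod a * (N x + M (w - T x))"
        by (simp add: TD ND MD distrib_left flip: scaleC_diff_right)
      finally show "q (a *\<^sub>C w) / cmod a \<le> N x + M (w - T x)" using that by (simp add: field_simps)
    qed
    then show ?thesis using that by (simp add: field_simps)
  qed
  have "q (a *\<^sub>C w) = cmod a * q w" for a w
  proof (cases "a = 0")
    case True
    have "q 0 \<le> 0" using le[OF AD(1), of 0] by (simp add: ND MD TD)
    moreover have "0 \<le> q 0" by (rule ge) (simp add: ND MD)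
    ultimately show ?thesis using True by simp
  next
    case False
    have "q (inverse a *\<^sub>C a *\<^sub>C w) \<le> cmod (inverse a) * q (a *\<^sub>C w)" using False by (intro hom) auto
    then have "q w \<le> q (a *\<^sub>C w) / cmod a" using False by (simp add: scaleC_scaleC norm_inverse divide_inverse mult.commute)
    then have "cmod a * q w \<le> q (a *\<^sub>C w)" using False by (simp add: le_divide_eq mult.commute)
    with hom[OF False, of w] show ?thesis by simp
  qed
  then show "cseminorm q" using add by (auto simp: cseminorm_def)
qed

text \<open>Both lemmas below produce a vector and a functional that witness the same kind of failure of
  exactness.\<close>

lemma functional_of_not_surjective:
  assumes N: "cseminorm N" and M: "cseminorm M"
    and A: "complex_vector.subspace A" and compl: "seminorm_complete N A"
    and Z: "complex_vector.subspace Z" and definite: "\<And>z. z \<in> Z \<Longrightarrow> M z = 0 \<Longrightarrow> z = 0"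
    and T: "clinear T" and TA: "T ` A \<subseteq> Z" and bd: "\<And>x. x \<in> A \<Longrightarrow> M (T x) \<le> C * N x"
    and ns: "z0 \<in> Z" "z0 \<notin> T ` A" and e: "0 < e"
  shows "\<exists>z\<in>Z. \<exists>U. M z \<le> 1 \<and> (\<forall>x y. U (x + y) = U x + U y) \<and> (\<forall>a x. U (a *\<^sub>C x) = a * U x) \<and>
    (\<forall>w. cmod (U w) \<le> M w) \<and> (\<forall>x\<in>A. cmod (U (T x)) \<le> e * N x) \<and> 1 / 2 \<le> cmod (U z)"
proof -
  note ND = cseminormD[OF N] and MD = cseminormD[OF M] and TD = clinearD[OF T]
    and AD = csubspaceD[OF A] and ZD = csubspaceD[OF Z]
  obtain q where q: "cseminorm q" "\<And>w. q w \<le> M w" "\<And>x. x \<in> A \<Longrightarrow> q (T x) \<le> e * N x"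
    "\<And>w c. q w < c \<Longrightarrow> \<exists>x\<in>A. e * N x + M (w - T x) < c"
    using inf_convolution[OF cseminorm_scale[OF N less_imp_le[OF e]] M A T] by blast
  note qD = cseminormD[OF q(1)]
  \<comment> \<open>If \<open>q\<close> were less than 1/2 on all unit vectors of \<open>Z\<close>,
    every z in \<open>Z\<close> could be approximated up to M(z)/2 by the image of a vector of norm
    at most M(z)/e, and successive approximation would put \<open>z0\<close> into the range.\<close>
  have "\<exists>z\<in>Z. M z = 1 \<and> 1 / 2 \<le> q z"
  proof (rule ccontr)
    assume "\<not> ?thesis"
    then have neg: "q z < 1 / 2" if "z \<in> Z" "M z = 1" for z using that by force
    have "\<exists>x\<in>A. N x \<le> 1 / e * M z \<and> M (z - T x) \<le> M z / 2" if z: "z \<in> Z" for z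
    proof (cases "M z = 0")
      case True then show ?thesis using AD by (intro bexI[of _ 0]) (auto simp: TD ND)
    next
      case False
      with MD(6)[of z] have Mz: "0 < M z" by linarith
      have "q (complex_of_real (1 / M z) *\<^sub>C z) < 1 / 2"
        using Mz z ZD by (intro neg) (auto simp: MD norm_divide)
      then have "q z < M z / 2" using Mz by (simp add: qD field_simps norm_divide)
      then obtain x where x: "x \<in> A" "e * N x + M (z - T x) < M z / 2" using q(4)[of z] by blast
      have "e * N x \<le> M z" using x(2) MD(6)[of "z - T x"] Mz by linarith
      then have "N x \<le> 1 / e * M z" using e by (simp add: field_simps)
      moreover have "0 \<le> e * N x" using e ND by simp
      ultimately show ?thesis using x by (intro bexI[of _ x]) auto
    qed
    then have "\<exists>x\<in>A. N x \<le> 2 * (1 / e) * M z0 \<and> M (z0 - T x) = 0"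
      using e TA ZD ns by (intro successive_approximation[OF N M A compl T bd _, of _ Z]) auto
    then obtain x where x: "x \<in> A" "M (z0 - T x) = 0" by blast
    then have "z0 - T x = 0" using TA ns by (intro definite ZD(4)) auto
    then show False using x ns by auto
  qed
  then obtain z where z: "z \<in> Z" "M z = 1" "1 / 2 \<le> q z" by blast
  obtain U where U: "\<And>x y. U (x + y) = U x + U y" "\<And>a x. U (a *\<^sub>C x) = a * U x"
    "\<And>x. cmod (U x) \<le> q x" "q z \<le> cmod (U z)"
    using hahn_banach_seminorm[OF q(1), of z] by blast
  have "cmod (U w) \<le> M w" for w using U(3)[of w] q(2)[of w] by simp
  moreover have "cmod (U (T x)) \<le> e * N x" if "x \<in> A" for x using U(3)[of "T x"] q(3)[OF that] by simp
  moreover have "1 / 2 \<le> cmod (U z)" using U(4) z by simp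
  ultimately show ?thesis using z U(1,2) by (intro bexI[of _ z] exI[of _ U]) auto
qed

lemma functional_of_not_bounded_below:
  assumes M: "cseminorm M" and N: "cseminorm N"
    and C: "complex_vector.subspace C" and B: "complex_vector.subspace B" "B \<subseteq> C"
    and T: "clinear T" and T0: "\<And>b. b \<in> B \<Longrightarrow> T b = 0"
    and nb: "\<And>K. 0 \<le> K \<Longrightarrow> \<exists>x\<in>C. \<exists>c. K * N (T x) < c \<and> (\<forall>b\<in>B. c \<le> M (x - b))" and e: "0 < e"
  shows "\<exists>z\<in>C. \<exists>U. M z \<le> 2 \<and> N (T z) \<le> e \<and> (\<forall>x y. U (x + y) = U x + U y) \<and> (\<forall>a x. U (a *\<^sub>C x) = a * U x) \<and>
    (\<forall>w. cmod (U w) \<le> M w) \<and> (\<forall>b\<in>B. U b = 0) \<and> 1 / 2 \<le> cmod (U z)"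
proof -
  note ND = cseminormD[OF N] and MD = cseminormD[OF M] and TD = clinearD[OF T]
    and CD = csubspaceD[OF C]
  have zero: "cseminorm (\<lambda>_. 0)" by (simp add: cseminorm_def)
  have lin: "clinear (\<lambda>x. x)" by (rule clinearI) auto
  \<comment> \<open>With the zero seminorm on \<open>B\<close> and the identity as the operator, the
    infimal convolution is the distance from \<open>B\<close>.\<close>
  obtain q where q: "cseminorm q" "\<And>w. q w \<le> M w" "\<And>x. x \<in> B \<Longrightarrow> q x \<le> 0"
    "\<And>w c. q w < c \<Longrightarrow> \<exists>x\<in>B. 0 + M (w - x) < c"
    using inf_convolution[OF zero M B(1) lin] by blast
  \<comment> \<open>The distance of \<open>x\<close> from \<open>B\<close> exceeds 2/e times
    \<open>N (T x)\<close>, so that dividing by the distance makes the image small. Subtracting some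
    \<open>b\<close> within twice the distance keeps the norm of the quotient below 2.\<close>
  obtain x c where x: "x \<in> C" "2 / e * N (T x) < c" "\<And>b. b \<in> B \<Longrightarrow> c \<le> M (x - b)"
    using nb[of "2 / e"] e by auto
  have qx: "c \<le> q x" using q(4)[of x c] x(3) by force
  have "0 \<le> 2 / e * N (T x)" using e ND by simp
  then have qpos: "0 < q x" using qx x(2) by linarith
  obtain b where b: "b \<in> B" "M (x - b) < 2 * q x" using q(4)[of x "2 * q x"] qpos by auto
  obtain U where U: "\<And>x y. U (x + y) = U x + U y" "\<And>a x. U (a *\<^sub>C x) = a * U x"
    "\<And>x. cmod (U x) \<le> q x" "q x \<le> cmod (U x)"
    using hahn_banach_seminorm[OF q(1), of x] by blast
  have UB: "U b' = 0" if "b' \<in> B" for b' using order_trans[OF U(3) q(3)[OF that]] by simp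
  define z where "z = complex_of_real (1 / q x) *\<^sub>C (x - b)"
  have "z \<in> C" unfolding z_def using x(1) b(1) B(2) CD by blast
  moreover have "M z \<le> 2"
  proof -
    have "M z = (1 / q x) * M (x - b)" unfolding z_def using qpos by (simp only: MD) (simp add: norm_divide)
    also have "\<dots> \<le> 2" using b(2) qpos by (simp add: field_simps)
    finally show ?thesis .
  qed
  moreover have "N (T z) \<le> e"
  proof -
    have "N (T z) = (1 / q x) * N (T x)" unfolding z_def using qpos T0[OF b(1)]
      by (simp only: TD ND) (simp add: norm_divide)
    moreover have "2 / e * N (T x) < q x" using x(2) qx by simp
    then have "2 * N (T x) < e * q x" using e by (simp add: field_simps)
    then have "N (T x) \<le> e * q x" using ND(6)[of "T x"] by linarith
    ultimately have "q x * N (T z) \<le> q x * e" using qpos by (simp add: mult.commute)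
    then show ?thesis using qpos by simp
  qed
  moreover have "cmod (U w) \<le> M w" for w using U(3)[of w] q(2)[of w] by simp
  moreover have "1 / 2 \<le> cmod (U z)"
  proof -
    have "U x = U (x - b)" using U(1)[of "x - b" b] UB[OF b(1)] by simp
    then have "U z = complex_of_real (1 / q x) * U x" by (simp add: z_def U(2))
    then have "cmod (U z) = cmod (U x) / q x" using qpos by (simp add: norm_mult norm_divide)
    moreover have "1 \<le> cmod (U x) / q x" using U(4) qpos by (simp add: le_divide_eq)
    ultimately show ?thesis by linarith
  qed
  ultimately show ?thesis using U(1,2) UB by (intro bexI[of _ z] exI[of _ U]) auto
qed

section \<open>Creation and annihilation operators\<close>

text \<open>The sign that arises when the i-th basis vector is moved to its place in the ordered
  wedge over S. Only smaller elements count, so S and S with i added or removed give the same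
  sign.\<close>

definition ksgn :: "nat \<Rightarrow> nat set \<Rightarrow> complex"
  where "ksgn i S = (-1) ^ card {s\<in>S. s < i}"

text \<open>Exterior multiplication by the i-th basis vector from the left; \<open>ann\<close> is
  the contraction with the i-th vector of the dual basis.\<close>

definition cre :: "nat \<Rightarrow> (nat set \<Rightarrow> 'x::complex_vector) \<Rightarrow> nat set \<Rightarrow> 'x"
  where "cre i c = (\<lambda>S. if i \<in> S then ksgn i S *\<^sub>C c (S - {i}) else 0)"

definition ann :: "nat \<Rightarrow> (nat set \<Rightarrow> 'x::complex_vector) \<Rightarrow> nat set \<Rightarrow> 'x"
  where "ann i c = (\<lambda>S. if i \<in> S then 0 else ksgn i S *\<^sub>C c (insert i S))"

definition single :: "'j \<Rightarrow> 'x::complex_vector \<Rightarrow> 'j \<Rightarrow> 'x"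
  where "single S x = (\<lambda>R. if R = S then x else 0)"

lemma ksgn_remove: "j \<in> S \<Longrightarrow> ksgn i (S - {j}) = (if j < i then - ksgn i S else ksgn i S)"
proof -
  assume j: "j \<in> S"
  show ?thesis
  proof (cases "j < i")
    case True
    have "{s\<in>S. s < i} = insert j {s\<in>S - {j}. s < i}" using True j by auto
    moreover have "finite {s\<in>S - {j}. s < i}" by (rule finite_subset[of _ "{..<i}"]) auto
    ultimately show ?thesis using True by (simp add: ksgn_def)
  next
    case False
    then have "{s\<in>S. s < i} = {s\<in>S - {j}. s < i}" by auto
    then show ?thesis using False by (simp add: ksgn_def)
  qed
qed

lemma ksgn_insert: "j \<notin> S \<Longrightarrow> ksgn i (insert j S) = (if j < i then - ksgn i S else ksgn i S)"
  using ksgn_remove[of j "insert j S" i] by (auto split: if_splits)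

lemma ksgn_square [simp]: "ksgn i S * ksgn i S = 1"
  by (simp add: ksgn_def flip: power_add)

lemma cre_lin: "clinear (cre i)"
  by (rule clinearI) (auto simp: cre_def fun_eq_iff fun_ops scaleC_add_right scaleC_scaleC mult.commute)

lemma ann_lin: "clinear (ann i)"
  by (rule clinearI) (auto simp: ann_def fun_eq_iff fun_ops scaleC_add_right scaleC_scaleC mult.commute)

lemma cre_cre: "cre i (cre j c) = - cre j (cre i c)"
proof (cases "i = j")
  case True then show ?thesis by (auto simp: cre_def fun_eq_iff fun_ops)
next
  case False
  have "S - {i} - {j} = S - {j} - {i}" for S by auto
  then show ?thesis using False
    by (auto simp: cre_def fun_eq_iff fun_ops ksgn_remove scaleC_scaleC mult.commute)
qed

text \<open>Together with \<open>cre_cre\<close> these are the canonical anticommutation relations,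
  on which the computations with the Koszul differential rest.\<close>

lemma ann_cre: "ann i (cre j c) = (if i = j then c else 0) - cre j (ann i c)"
proof (cases "i = j")
  case True
  then show ?thesis
    by (auto simp: cre_def ann_def fun_eq_iff fun_ops ksgn_remove ksgn_insert scaleC_scaleC insert_absorb)
next
  case False
  have "insert i S - {j} = insert i (S - {j})" for S using False by auto
  then show ?thesis using False
    by (auto simp: cre_def ann_def fun_eq_iff fun_ops ksgn_remove ksgn_insert scaleC_scaleC mult.commute)
qed

section \<open>Wedge products of arbitrary vectors and their coordinates\<close>

definition coord :: "'l::complex_vector list \<Rightarrow> 'l \<Rightarrow> nat \<Rightarrow> complex"
  where "coord bs l i = complex_vector.representation (set bs) l (bs ! i)"

definition crel :: "'l::complex_vector list \<Rightarrow> 'l \<Rightarrow> (nat set \<Rightarrow> 'x::complex_vector) \<Rightarrow> nat set \<Rightarrow> 'x"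
  where "crel bs l c = (\<Sum>i<length bs. coord bs l i *\<^sub>C cre i c)"

text \<open>The tensor of x with the wedge of \<open>ls\<close>, produced by exterior
  multiplications from the vacuum \<open>single {} x\<close>. Unlike the minors of
  \<open>elem_tensor\<close>, this form is recursive in the list.\<close>

definition kword :: "'l::complex_vector list \<Rightarrow> 'l list \<Rightarrow> 'x::complex_vector \<Rightarrow> nat set \<Rightarrow> 'x"
  where "kword bs ls x = foldr (crel bs) ls (single {} x)"

lemma kword_simps [simp]: "kword bs [] x = single {} x" "kword bs (l # ls) x = crel bs l (kword bs ls x)"
  by (simp_all add: kword_def)

lemma crel_lin: "clinear (crel bs l)"
  by (rule clinearI)
    (simp_all add: crel_def clinearD[OF cre_lin] scaleC_add_right sum.distrib scaleC_sum_right scaleC_scaleC mult.commute)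

lemma single_lin: "clinear (single S)"
  by (rule clinearI) (auto simp: single_def fun_eq_iff fun_ops)

lemma kword_lin: "clinear (kword bs ls)"
proof (induction ls)
  case Nil
  have "kword bs [] = (single {} :: 'b \<Rightarrow> _)" by (rule ext) simp
  then show ?case by (simp add: single_lin)
next
  case (Cons l ls)
  show ?case by (rule clinearI) (simp_all add: clinearD[OF Cons] clinearD[OF crel_lin])
qed

lemma crel_anticommute: "crel bs l (crel bs m c) = - crel bs m (crel bs l c)"
proof -
  have *: "crel bs l (crel bs m c) = (\<Sum>i<length bs. \<Sum>j<length bs. (coord bs l i * coord bs m j) *\<^sub>C cre i (cre j c))" for l m
    by (simp add: crel_def clinearD[OF cre_lin] scaleC_sum_right scaleC_scaleC)
  show ?thesis
    unfolding * by (subst sum.swap, subst cre_cre) (simp add: sum_negf mult.commute)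
qed

lemma eq_uminus_zero: "(x::'a::complex_vector) = - x \<Longrightarrow> x = 0"
proof -
  assume "x = - x"
  then have "x + x = 0" by (metis add.right_inverse)
  then have "2 *\<^sub>C x = 0" using scaleC_add_left[of 1 1 x] by simp
  then show "x = 0" using complex_vector.scale_eq_0_iff by fastforce
qed

lemma scaleC_2: "2 *\<^sub>C x = x + x"
  using scaleC_add_left[of 1 1 x] by simp

text \<open>The coefficients of \<open>elem_tensor\<close> are minors; expanding them along the first vector shows that
  they are obtained by letting the creation operators act.\<close>

definition idx :: "nat \<Rightarrow> nat set \<Rightarrow> nat list"
  where "idx n S = filter (\<lambda>i. i \<in> S) [0..<n]"

lemma idx_props: "sorted_wrt (<) (idx n S)" "distinct (idx n S)" "S \<subseteq> {..<n} \<Longrightarrow> set (idx n S) = S"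
  "S \<subseteq> {..<n} \<Longrightarrow> length (idx n S) = card S"
proof -
  show 1: "sorted_wrt (<) (idx n S)" by (simp add: idx_def sorted_wrt_filter)
  show 2: "distinct (idx n S)" by (simp add: idx_def)
  show 3: "S \<subseteq> {..<n} \<Longrightarrow> set (idx n S) = S" by (auto simp: idx_def)
  show "S \<subseteq> {..<n} \<Longrightarrow> length (idx n S) = card S" using 2 3 distinct_card by metis
qed

lemma nths_idx: "nths bs S = map ((!) bs) (idx (length bs) S)"
proof (induction bs rule: rev_induct)
  case (snoc b bs)
  have "map ((!) (bs @ [b])) (idx (length bs) S) = map ((!) bs) (idx (length bs) S)"
    by (auto simp: idx_def nth_append)
  then show ?case using snoc by (auto simp: nths_append idx_def)
qed (simp add: idx_def)

lemma idx_unique: "sorted_wrt (<) xs \<Longrightarrow> set xs = S \<Longrightarrow> S \<subseteq> {..<n} \<Longrightarrow> idx n S = xs"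
  using idx_props[where n=n and S=S] by (intro strict_sorted_equal) auto

text \<open>Exactly k elements of S lie below its k-th one, counted from 0. This identifies
  \<open>ksgn\<close> with the sign of a cofactor.\<close>

lemma idx_remove:
  assumes S: "S \<subseteq> {..<n}" and k: "k < card S"
  shows "idx n (S - {idx n S ! k}) = take k (idx n S) @ drop (Suc k) (idx n S)"
    "ksgn (idx n S ! k) S = (-1) ^ k"
proof -
  define xs where "xs = idx n S"
  note xs = idx_props[where n=n and S=S, folded xs_def]
  have kl: "k < length xs" using k xs(4)[OF S] by simp
  have split: "xs = take k xs @ xs ! k # drop (Suc k) xs" using id_take_nth_drop[OF kl] .
  have sw: "sorted_wrt (<) (take k xs @ xs ! k # drop (Suc k) xs)" using xs(1) by (simp only: split[symmetric])
  have "distinct (take k xs @ xs ! k # drop (Suc k) xs)" using xs(2) by (simp only: split[symmetric])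
  moreover have "set (a @ y # b) - {y} = set (a @ b)" if "distinct (a @ y # b)" for a b :: "nat list" and y
    using that by auto
  ultimately have "set (take k xs @ xs ! k # drop (Suc k) xs) - {xs ! k} = set (take k xs @ drop (Suc k) xs)" by blast
  then have d: "set xs - {xs ! k} = set (take k xs @ drop (Suc k) xs)" by (simp only: split[symmetric])
  show "idx n (S - {idx n S ! k}) = take k (idx n S) @ drop (Suc k) (idx n S)"
    unfolding xs_def[symmetric]
  proof (rule idx_unique)
    show "sorted_wrt (<) (take k xs @ drop (Suc k) xs)" using sw by (simp only: sorted_wrt_append) simp
    show "set (take k xs @ drop (Suc k) xs) = S - {xs ! k}" using d xs(3)[OF S] by simp
  qed (use S in auto)
  have "set xs = set (take k xs @ xs ! k # drop (Suc k) xs)" by (simp only: split[symmetric])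
  moreover have "{s \<in> set (a @ y # b). s < y} = set a" if "sorted_wrt (<) (a @ y # b)" for a b :: "nat list" and y
    using that by (auto simp: sorted_wrt_append)
  ultimately have "{s\<in>S. s < xs ! k} = set (take k xs)" using sw xs(3)[OF S] by simp
  then show "ksgn (idx n S ! k) S = (-1) ^ k"
    unfolding ksgn_def xs_def[symmetric] using xs(2) kl by (simp add: distinct_card)
qed

lemma elem_tensor_kword:
  fixes x :: "'x::complex_banach"
  shows "elem_tensor bs x ls = kword bs ls x"
proof (induction ls)
  case Nil
  have "S = {}" if "S \<subseteq> {..<length bs}" "card S = 0" for S
    using that finite_subset[of S "{..<length bs}"] by auto
  moreover have "{\<pi>::nat \<Rightarrow> nat. \<forall>i. \<pi> i = i} = {id}" by (auto simp: fun_eq_iff fun_ops)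
  ultimately show ?case by (auto simp: elem_tensor_def fun_eq_iff fun_ops single_def)
next
  case (Cons l ls)
  define n where "n = length bs"
  define M where "M ls S = Matrix.mat (length ls) (length ls) (\<lambda>(j, k). coord bs (ls ! j) (idx n S ! k))" for ls S
  have elem: "elem_tensor bs x ls S = (if S \<subseteq> {..<n} \<and> card S = length ls then det (M ls S) *\<^sub>C x else 0)" for ls S
  proof -
    have "det (M ls S) = (\<Sum>\<pi> | \<pi> permutes {..<length ls}. of_int (sign \<pi>) *
           (\<Prod>j<length ls. complex_vector.representation (set bs) (ls ! j) (nths bs S ! \<pi> j)))"
      if "S \<subseteq> {..<n}" "card S = length ls"
    proof -
      have "det (M ls S) = (\<Sum>\<pi> | \<pi> permutes {..<length ls}. of_int (sign \<pi>) * (\<Prod>j<length ls. M ls S $$ (j, \<pi> j)))"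
        by (simp add: det_def M_def atLeast0LessThan)
      moreover have "M ls S $$ (j, \<pi> j) = complex_vector.representation (set bs) (ls ! j) (nths bs S ! \<pi> j)"
        if "\<pi> permutes {..<length ls}" "j < length ls" for \<pi> j
      proof -
        have "\<pi> j < length ls" using that permutes_in_image[OF that(1), of j] by simp
        then show ?thesis using \<open>card S = length ls\<close> \<open>S \<subseteq> {..<n}\<close> that idx_props(4)[where n=n and S=S]
          by (simp add: M_def coord_def nths_idx n_def)
      qed
      ultimately show ?thesis by simp
    qed
    then show ?thesis by (simp add: elem_tensor_def n_def)
  qed
  show ?case
  proof
    fix S
    have crelS: "crel bs l c S = (\<Sum>i<n. coord bs l i *\<^sub>C cre i c S)" for c :: "nat set \<Rightarrow> 'x"
      by (simp add: crel_def fun_ops n_def)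
    show "elem_tensor bs x (l # ls) S = kword bs (l # ls) x S"
    proof (cases "S \<subseteq> {..<n}")
      case False
      then have "cre i (elem_tensor bs x ls) S = 0" if "i < n" for i
        using that by (auto simp: cre_def elem)
      then have "kword bs (l # ls) x S = 0" by (simp add: crelS Cons[symmetric])
      then show ?thesis using False by (simp add: elem)
    next
      case S: True
      have fin: "finite S" using S finite_subset by blast
      have "kword bs (l # ls) x S = (\<Sum>i\<in>S. (coord bs l i * ksgn i S) *\<^sub>C elem_tensor bs x ls (S - {i}))"
        unfolding kword_simps crelS Cons[symmetric] using S
        by (intro sum.mono_neutral_cong_right) (auto simp: cre_def scaleC_scaleC)
      also have "\<dots> = (\<Sum>k<card S. (coord bs l (idx n S ! k) * (-1) ^ k) *\<^sub>C elem_tensor bs x ls (S - {idx n S ! k}))"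
      proof -
        have "bij_betw ((!) (idx n S)) {..<card S} S"
          using idx_props[where n=n and S=S] S by (intro bij_betw_nth) auto
        note sum.reindex_bij_betw[OF this, of "\<lambda>i. (coord bs l i * ksgn i S) *\<^sub>C elem_tensor bs x ls (S - {i})", symmetric]
        then show ?thesis using idx_remove(2)[OF S] by simp
      qed
      also have "\<dots> = elem_tensor bs x (l # ls) S"
      proof (cases "card S = Suc (length ls)")
        case False
        then have "elem_tensor bs x ls (S - {idx n S ! k}) = 0" if "k < card S" for k
          using that idx_props[where n=n and S=S] S fin by (auto simp: elem) (metis card_Suc_Diff1 nth_mem)
        then show ?thesis using False by (simp add: elem)
      next
        case True
        have idxS: "length (idx n S) = Suc (length ls)" "\<And>k. k \<le> length ls \<Longrightarrow> idx n S ! k \<in> S"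
          using idx_props[where n=n and S=S] S True nth_mem[of _ "idx n S"] by auto
        \<comment> \<open>Deleting the first row and column k leaves the matrix of the remaining
          vectors over S without its k-th element, so the Laplace expansion matches the sum of the
          creation operators term by term.\<close>
        have del: "mat_delete (M (l # ls) S) 0 k = M ls (S - {idx n S ! k})" if "k < Suc (length ls)" for k
          using that idx_remove(1)[OF S, of k] True idxS
          by (intro eq_matI) (auto simp: M_def mat_delete_def nth_append)
        have "det (M (l # ls) S) = (\<Sum>k<Suc (length ls). M (l # ls) S $$ (0, k) * cofactor (M (l # ls) S) 0 k)"
          by (rule laplace_expansion_row) (auto simp: M_def)
        also have "\<dots> = (\<Sum>k<Suc (length ls). coord bs l (idx n S ! k) * (-1) ^ k * det (M ls (S - {idx n S ! k})))"
          by (intro sum.cong refl) (auto simp: cofactor_def del, simp add: M_def)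
        finally have "det (M (l # ls) S) *\<^sub>C x = (\<Sum>k<card S. (coord bs l (idx n S ! k) * (-1) ^ k) *\<^sub>C det (M ls (S - {idx n S ! k})) *\<^sub>C x)"
          by (simp add: True scaleC_sum_left scaleC_scaleC del: sum.lessThan_Suc)
        also have "\<dots> = (\<Sum>k<card S. (coord bs l (idx n S ! k) * (-1) ^ k) *\<^sub>C elem_tensor bs x ls (S - {idx n S ! k}))"
          using S True idxS fin by (intro sum.cong refl) (auto simp: elem)
        finally show ?thesis using S True by (simp add: elem)
      qed
      finally show ?thesis by simp
    qed
  qed
qed

text \<open>Every vector that is multiplied on precedes all those already present, so all signs are
  1.\<close>

lemma foldr_cre_sorted: "sorted_wrt (<) xs \<Longrightarrow> foldr cre xs (single {} x) = single (set xs) x"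
proof (induction xs)
  case (Cons i xs)
  have "{s \<in> insert i (set xs). s < i} = {}" using Cons by force
  then have "ksgn i (insert i (set xs)) = 1" unfolding ksgn_def by (simp only: card.empty power_0)
  moreover have "insert i (set xs) - {i} = set xs" using Cons by force
  moreover have "S = insert i (set xs)" if "i \<in> S" "S - {i} = set xs" for S using that by auto
  ultimately show ?case using Cons by (auto simp: cre_def single_def fun_eq_iff fun_ops)
qed simp

text \<open>In a product of anticommuting operators, the first one can be moved to its place in the
  increasing order.\<close>

lemma anticommuting_insort:
  fixes g :: "nat \<Rightarrow> 'v::complex_vector \<Rightarrow> 'v"
  assumes lin: "\<And>i. clinear (g i)" and anti: "\<And>i j w. g i (g j w) = - g j (g i w)"
    and "sorted_wrt (<) xs"
  shows "g i (foldr g xs v) = (if i \<in> set xs then 0 else ksgn i (set xs) *\<^sub>C foldr g (insort i xs) v)"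
  using assms(3)
proof (induction xs)
  case Nil then show ?case by (simp add: ksgn_def)
next
  case (Cons y ys)
  have gg: "g i (g i w) = 0" for i w by (rule eq_uminus_zero) (rule anti)
  have y: "y \<notin> set ys" "\<forall>z\<in>set ys. y < z" using Cons by auto
  consider "i < y" | "i = y" | "y < i" by linarith
  then show ?case
  proof cases
    case 1
    then have "{s \<in> insert y (set ys). s < i} = {}" using y by force
    then have "ksgn i (insert y (set ys)) = 1" unfolding ksgn_def by (simp only: card.empty power_0)
    then show ?thesis using 1 y by auto
  next
    case 2 then show ?thesis using gg by simp
  next
    case 3
    have "g i (foldr g (y # ys) v) = - g y (g i (foldr g ys v))" by (simp add: anti[of i y])
    also have "\<dots> = (if i \<in> set ys then 0 else - (ksgn i (set ys) *\<^sub>C g y (foldr g (insort i ys) v)))"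
      using Cons by (simp add: clinearD[OF lin])
    finally show ?thesis using 3 y by (auto simp: ksgn_insert)
  qed
qed

section \<open>The Koszul differential\<close>

definition app :: "('x::complex_banach \<Rightarrow>\<^sub>L 'y::complex_banach) \<Rightarrow> ('j \<Rightarrow> 'x) \<Rightarrow> 'j \<Rightarrow> 'y"
  where "app T c = (\<lambda>S. blinfun_apply T (c S))"

lemma cblinfunsD: "T \<in> cblinfuns \<Longrightarrow> blinfun_apply T (a *\<^sub>C x) = a *\<^sub>C blinfun_apply T x"
  by (simp add: cblinfuns_def)

lemma app_lin: "T \<in> cblinfuns \<Longrightarrow> clinear (app T)"
  by (rule clinearI) (auto simp: app_def fun_eq_iff fun_ops blinfun.add_right cblinfunsD)

lemma app_cre: "T \<in> cblinfuns \<Longrightarrow> app T (cre i c) = cre i (app T c)"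
  by (auto simp: app_def cre_def fun_eq_iff fun_ops cblinfunsD blinfun.zero_right)

lemma app_crel: "T \<in> cblinfuns \<Longrightarrow> app T (crel bs l c) = crel bs l (app T c)"
  by (simp add: crel_def clinearD[OF app_lin] app_cre)

lemma app_single: "app T (single S x) = single S (blinfun_apply T x)"
  by (auto simp: app_def single_def fun_eq_iff fun_ops blinfun.zero_right)

text \<open>The Koszul differential in operator form. The factor 1/2 compensates for summing over
  ordered pairs: exchanging i and j changes the sign of the bracket and that of the two
  contractions. Contracting with i before j gives the bracket of the first two vectors the sign + of
  \<open>koszul_elem\<close>.\<close>

definition kd :: "'l::complex_lie_algebra list \<Rightarrow> ('l \<Rightarrow> ('x::complex_banach \<Rightarrow>\<^sub>L 'x)) \<Rightarrow>
    (nat set \<Rightarrow> 'x) \<Rightarrow> nat set \<Rightarrow> 'x"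
  where "kd bs \<theta> c = (\<Sum>i<length bs. app (\<theta> (bs ! i)) (ann i c)) +
    (1 / 2) *\<^sub>C (\<Sum>i<length bs. \<Sum>j<length bs. crel bs (lie (bs ! i) (bs ! j)) (ann j (ann i c)))"

text \<open>The Lie derivative along l: the representation acts on the coefficients, and the adjoint
  action is extended to the exterior algebra as a derivation.\<close>

definition klie :: "'l::complex_lie_algebra list \<Rightarrow> ('l \<Rightarrow> ('x::complex_banach \<Rightarrow>\<^sub>L 'x)) \<Rightarrow> 'l \<Rightarrow>
    (nat set \<Rightarrow> 'x) \<Rightarrow> nat set \<Rightarrow> 'x"
  where "klie bs \<theta> l c = app (\<theta> l) c + (\<Sum>j<length bs. crel bs (lie l (bs ! j)) (ann j c))"

lemma lie_zero [simp]: "lie 0 y = 0" "lie x 0 = 0"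
  using lie_scaleC_left[of 0 0 y] lie_scaleC_right[of x 0 0] by simp_all

lemma lie_sum_left: "lie (\<Sum>i\<in>I. f i) y = (\<Sum>i\<in>I. lie (f i) y)"
  by (induction I rule: infinite_finite_induct) (auto simp: lie_add_left)

lemma lie_antisym: "lie x y = - lie y (x::'l::complex_lie_algebra)"
proof -
  have "lie (x + y) (x + y) = lie x x + lie y x + (lie x y + lie y y)" by (simp only: lie_add_left lie_add_right)
  then show ?thesis by (simp add: lie_self eq_neg_iff_add_eq_0 add.commute)
qed

text \<open>The law of a representation is demanded on \<open>H\<close>, linearity on the whole
  type. This fits \<rho> - f for a representation \<rho> and a functional f of the whole algebra: f
  vanishes on the brackets of elements of \<open>H\<close>, which makes \<rho> - f multiplicative
  there.\<close>

locale koszul_setting =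
  fixes bs :: "'l::complex_lie_algebra list" and H :: "'l set"
    and \<theta> :: "'l \<Rightarrow> ('x::complex_banach \<Rightarrow>\<^sub>L 'x)"
  assumes dist: "distinct bs" and indep: "complex_vector.independent (set bs)" and span: "cspan (set bs) = H"
    and lie_closed: "\<And>x y. x \<in> H \<Longrightarrow> y \<in> H \<Longrightarrow> lie x y \<in> H"
    and rep_lin: "clinear \<theta>" and rep_cblin: "\<And>l. \<theta> l \<in> cblinfuns"
    and rep_lie: "\<And>x y. x \<in> H \<Longrightarrow> y \<in> H \<Longrightarrow> \<theta> (lie x y) = (\<theta> x o\<^sub>L \<theta> y) - (\<theta> y o\<^sub>L \<theta> x)"
begin

abbreviation "n \<equiv> length bs"

lemma bsH: "i < n \<Longrightarrow> bs ! i \<in> H"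
  using span complex_vector.span_base nth_mem by blast

lemma H_sub: "complex_vector.subspace H"
  using span complex_vector.subspace_span by blast

lemma coord_lin: "l \<in> H \<Longrightarrow> m \<in> H \<Longrightarrow> coord bs (l + m) i = coord bs l i + coord bs m i"
  "l \<in> H \<Longrightarrow> coord bs (a *\<^sub>C l) i = a * coord bs l i"
  using span by (simp_all add: coord_def complex_vector.representation_add[OF indep] complex_vector.representation_scale[OF indep])

lemma coord_expand: "l \<in> H \<Longrightarrow> l = (\<Sum>i<n. coord bs l i *\<^sub>C bs ! i)"
proof -
  assume l: "l \<in> H"
  have "(\<Sum>i<n. coord bs l i *\<^sub>C bs ! i) = (\<Sum>b\<in>set bs. complex_vector.representation (set bs) l b *\<^sub>C b)"
    unfolding coord_def by (rule sum.reindex_bij_betw) (rule bij_betw_nth[OF dist], auto)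
  also have "\<dots> = l"
    using l span by (intro complex_vector.sum_representation_eq[OF indep]) auto
  finally show ?thesis by simp
qed

lemma coord_basis: "i < n \<Longrightarrow> j < n \<Longrightarrow> coord bs (bs ! i) j = (if i = j then 1 else 0)"
  using dist by (simp add: coord_def complex_vector.representation_basis[OF indep] nth_eq_iff_index_eq)

lemma crel_basis: "i < n \<Longrightarrow> crel bs (bs ! i) c = cre i c"
  by (simp add: crel_def coord_basis if_distrib[of "\<lambda>a. a *\<^sub>C _"] sum.delta cong: if_cong)

lemma crel_add: "l \<in> H \<Longrightarrow> m \<in> H \<Longrightarrow> crel bs (l + m) c = crel bs l c + crel bs m c"
  by (simp add: crel_def coord_lin scaleC_add_left sum.distrib)

lemma crel_scaleC: "l \<in> H \<Longrightarrow> crel bs (a *\<^sub>C l) c = a *\<^sub>C crel bs l c"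
  by (simp add: crel_def coord_lin scaleC_scaleC scaleC_sum_right)

lemma crel_neg: "l \<in> H \<Longrightarrow> crel bs (- l) c = - crel bs l c"
  using crel_scaleC[of l "-1" c] by simp

lemma crel_zero: "crel bs 0 c = 0"
  using crel_scaleC[of 0 0 c] csubspaceD(1)[OF H_sub] by simp

lemma crel_sum: "finite I \<Longrightarrow> (\<And>i. i \<in> I \<Longrightarrow> m i \<in> H) \<Longrightarrow>
    crel bs (\<Sum>i\<in>I. a i *\<^sub>C m i) c = (\<Sum>i\<in>I. a i *\<^sub>C crel bs (m i) c)"
proof (induction I rule: finite_induct)
  case (insert i I)
  have "(\<Sum>i\<in>I. a i *\<^sub>C m i) \<in> H"
    using insert csubspaceD(3)[OF H_sub] by (intro complex_vector.subspace_sum[OF H_sub]) auto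
  then show ?case using insert csubspaceD(3)[OF H_sub] by (simp add: crel_add crel_scaleC)
qed (simp add: crel_zero)

lemma ann_crel: "i < n \<Longrightarrow> ann i (crel bs l c) = coord bs l i *\<^sub>C c - crel bs l (ann i c)"
  by (simp add: crel_def clinearD[OF ann_lin] ann_cre scaleC_diff_right sum_subtractf sum.delta
      if_distrib[of "\<lambda>c. _ *\<^sub>C c"] cong: if_cong)

lemma kd_lin: "clinear (kd bs \<theta>)"
  by (rule clinearI)
    (simp_all add: kd_def clinearD[OF app_lin[OF rep_cblin]] clinearD[OF crel_lin] clinearD[OF ann_lin]
      sum.distrib scaleC_add_right scaleC_sum_right scaleC_scaleC)

lemma klie_lin: "clinear (klie bs \<theta> l)"
  by (rule clinearI)
    (simp_all add: klie_def clinearD[OF app_lin[OF rep_cblin]] clinearD[OF crel_lin] clinearD[OF ann_lin]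
      sum.distrib scaleC_add_right scaleC_sum_right)

lemma rep_sum: "\<theta> (\<Sum>i\<in>I. f i) = (\<Sum>i\<in>I. \<theta> (f i))" "\<theta> (a *\<^sub>C l) = a *\<^sub>C \<theta> l"
  by (rule clinearD[OF rep_lin])+

lemma lie_expand: "l \<in> H \<Longrightarrow> lie l m = (\<Sum>i<n. coord bs l i *\<^sub>C lie (bs ! i) m)"
  by (subst coord_expand[of l]) (simp_all add: lie_sum_left lie_scaleC_left)

lemma rep_expand: "l \<in> H \<Longrightarrow> app (\<theta> l) c = (\<Sum>i<n. coord bs l i *\<^sub>C app (\<theta> (bs ! i)) c)"
  by (subst coord_expand[of l])
    (simp_all add: rep_sum app_def fun_eq_iff fun_ops fun_ops blinfun.sum_left scaleC_blinfun.rep_eq)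

text \<open>Cartan's formula: the anticommutator of the differential with exterior multiplication by
  l is the Lie derivative along l. Each contraction that meets l yields a coordinate of l; the
  coordinates add up to the representation in the first sum and to the adjoint action in the
  second.\<close>

lemma kd_crel:
  assumes l: "l \<in> H"
  shows "kd bs \<theta> (crel bs l c) = klie bs \<theta> l c - crel bs l (kd bs \<theta> c)"
proof -
  let ?e = "crel bs" and ?l = "coord bs l" and ?b = "\<lambda>i j. lie (bs ! i) (bs ! j)"
  have bH: "?b i j \<in> H" if "i < n" "j < n" for i j using that bsH lie_closed by blast
  have 1: "(\<Sum>i<n. app (\<theta> (bs ! i)) (ann i (?e l c))) = app (\<theta> l) c - ?e l (\<Sum>i<n. app (\<theta> (bs ! i)) (ann i c))"
    using l by (simp add: ann_crel clinearD[OF app_lin[OF rep_cblin]] app_crel[OF rep_cblin] sum_subtractf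
        clinearD[OF crel_lin] rep_expand)
  have A: "(\<Sum>j<n. ?e (lie l (bs ! j)) (ann j c)) = (\<Sum>i<n. \<Sum>j<n. ?l i *\<^sub>C ?e (?b i j) (ann j c))"
  proof -
    have "?e (lie l (bs ! j)) (ann j c) = (\<Sum>i<n. ?l i *\<^sub>C ?e (?b i j) (ann j c))" if "j < n" for j
      unfolding lie_expand[OF l, of "bs ! j"] using that bH by (intro crel_sum) auto
    then show ?thesis by (subst sum.swap) simp
  qed
  \<comment> \<open>Antisymmetry of the bracket makes the two coordinate terms of the double sum
    opposite, so that their difference is twice the adjoint action; this cancels the factor 1/2 of
    \<open>kd\<close>.\<close>
  have B: "(\<Sum>i<n. \<Sum>j<n. ?l j *\<^sub>C ?e (?b i j) (ann i c)) = - (\<Sum>i<n. \<Sum>j<n. ?l i *\<^sub>C ?e (?b i j) (ann j c))"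
  proof -
    have "?e (?b i j) (ann i c) = - ?e (?b j i) (ann i c)" if "i < n" "j < n" for i j
      by (subst lie_antisym) (simp add: crel_neg bH that)
    then show ?thesis by (subst sum.swap) (simp add: sum_negf)
  qed
  have "(\<Sum>i<n. \<Sum>j<n. ?e (?b i j) (ann j (ann i (?e l c)))) =
    (\<Sum>i<n. \<Sum>j<n. ?l i *\<^sub>C ?e (?b i j) (ann j c)) - (\<Sum>i<n. \<Sum>j<n. ?l j *\<^sub>C ?e (?b i j) (ann i c))
     - ?e l (\<Sum>i<n. \<Sum>j<n. ?e (?b i j) (ann j (ann i c)))"
  proof -
    have "?e (?b i j) (ann j (ann i (?e l c))) = ?l i *\<^sub>C ?e (?b i j) (ann j c) - ?l j *\<^sub>C ?e (?b i j) (ann i c)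
       - ?e l (?e (?b i j) (ann j (ann i c)))" if "i < n" "j < n" for i j
      using that by (simp add: ann_crel clinearD[OF ann_lin] clinearD[OF crel_lin] crel_anticommute[of bs "?b i j" l])
    then show ?thesis by (simp add: sum_subtractf clinearD[OF crel_lin])
  qed
  then have 2: "(\<Sum>i<n. \<Sum>j<n. ?e (?b i j) (ann j (ann i (?e l c)))) =
    2 *\<^sub>C (\<Sum>j<n. ?e (lie l (bs ! j)) (ann j c)) - ?e l (\<Sum>i<n. \<Sum>j<n. ?e (?b i j) (ann j (ann i c)))"
    unfolding B A[symmetric] by (simp add: scaleC_2)
  show ?thesis
    unfolding kd_def klie_def 1 2
    by (simp add: scaleC_diff_right scaleC_scaleC clinearD[OF crel_lin])
qed

text \<open>The derivation rule. The extra term appears because the contractions in the adjoint part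
  return the coordinates of m.\<close>

lemma klie_crel:
  assumes l: "l \<in> H" and m: "m \<in> H"
  shows "klie bs \<theta> l (crel bs m c) = crel bs m (klie bs \<theta> l c) + crel bs (lie l m) c"
proof -
  have "crel bs (lie l m) c = (\<Sum>j<n. coord bs m j *\<^sub>C crel bs (lie l (bs ! j)) c)"
  proof -
    have "lie l m = (\<Sum>j<n. coord bs m j *\<^sub>C lie l (bs ! j))"
      using lie_expand[OF m, of l] by (subst lie_antisym, subst (2) lie_antisym) (simp add: sum_negf)
    then show ?thesis using l bsH lie_closed by (simp only:) (intro crel_sum, auto)
  qed
  then show ?thesis
    by (simp add: klie_def app_crel[OF rep_cblin] clinearD[OF crel_lin] ann_crel sum_subtractf
        crel_anticommute[of bs "lie l _" m] sum_negf sum.distrib)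
qed

lemma kd_vac: "kd bs \<theta> (single {} x) = 0" and klie_vac: "klie bs \<theta> l (single {} x) = single {} (blinfun_apply (\<theta> l) x)"
proof -
  have "ann i (single {} x) = 0" for i by (auto simp: ann_def single_def fun_eq_iff fun_ops)
  then show "kd bs \<theta> (single {} x) = 0" "klie bs \<theta> l (single {} x) = single {} (blinfun_apply (\<theta> l) x)"
    by (simp_all add: kd_def klie_def clinearD[OF app_lin[OF rep_cblin]] clinearD[OF crel_lin] clinearD[OF ann_lin] app_single)
qed

lemma kword_basis: "S \<subseteq> {..<n} \<Longrightarrow> kword bs (nths bs S) x = single S x"
proof -
  assume S: "S \<subseteq> {..<n}"
  have "kword bs (map ((!) bs) xs) x = foldr cre xs (single {} x)" if "set xs \<subseteq> {..<n}" for xs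
    using that by (induction xs) (auto simp: crel_basis)
  then show ?thesis
    using idx_props[where n=n and S=S] S by (simp add: nths_idx foldr_cre_sorted)
qed

definition supported :: "(nat set \<Rightarrow> 'x) \<Rightarrow> bool"
  where "supported c \<longleftrightarrow> (\<forall>S. c S \<noteq> 0 \<longrightarrow> S \<subseteq> {..<n})"

lemma supported_add: "supported a \<Longrightarrow> supported b \<Longrightarrow> supported (a + b)"
  unfolding supported_def plus_fun_apply by (metis add_0)

lemma supported_single: "S \<subseteq> {..<n} \<Longrightarrow> supported (single S x)"
  by (auto simp: supported_def single_def split: if_splits)

lemma supported_crel: "supported c \<Longrightarrow> supported (crel bs k c)"
  unfolding supported_def
proof (intro allI impI)
  fix S assume c: "\<forall>S. c S \<noteq> 0 \<longrightarrow> S \<subseteq> {..<n}" and "crel bs k c S \<noteq> 0"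
  then obtain i where "i < n" "coord bs k i *\<^sub>C cre i c S \<noteq> 0"
    unfolding crel_def fun_ops by (meson lessThan_iff sum.not_neutral_contains_not_neutral)
  then have "i \<in> S" "c (S - {i}) \<noteq> 0" by (auto simp: cre_def split: if_splits)
  then show "S \<subseteq> {..<n}" using c \<open>i < n\<close> by blast
qed

lemma supported_expand: "supported c \<Longrightarrow> c = (\<Sum>S\<in>Pow {..<n}. single S (c S))"
  by (auto simp: fun_eq_iff fun_ops fun_ops single_def supported_def if_distrib sum.delta)

text \<open>Every chain supported on subsets of the basis is a sum of words applied to the vacuum.
  Linear identities may thus be checked on the vacuum and carried through one exterior
  multiplication, which is the method of the following proofs about the differential.\<close>

lemma chain_induct [consumes 1, case_names add vac crel]:
  assumes c: "supported c"
    and add: "\<And>a b. P a \<Longrightarrow> P b \<Longrightarrow> P (a + b)" and vac: "\<And>x. P (single {} x)"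
    and crel: "\<And>l c. l \<in> H \<Longrightarrow> P c \<Longrightarrow> P (crel bs l c)"
  shows "P c"
proof -
  have "P (0 :: nat set \<Rightarrow> 'x)" using vac[of 0] clinearD(3)[OF single_lin] by metis
  then have sum: "P (\<Sum>i\<in>I. f i)" if "\<And>i. i \<in> I \<Longrightarrow> P (f i)" for I and f :: "nat set \<Rightarrow> nat set \<Rightarrow> 'x"
    using that by (induction I rule: infinite_finite_induct) (auto simp: add)
  have word: "P (kword bs ls x)" if "set ls \<subseteq> H" for ls x
    using that by (induction ls) (auto simp: vac crel)
  have "set (nths bs S) \<subseteq> H" for S using set_nths_subset[of bs S] complex_vector.span_superset[of "set bs"] span by auto
  then have "P (\<Sum>S\<in>Pow {..<n}. single S (c S))"
    by (intro sum) (auto simp: kword_basis[symmetric] intro!: word)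
  then show ?thesis using supported_expand[OF c] by simp
qed

text \<open>On the vacuum this is the law of the representation; an exterior multiplication by k
  adds a bracket term that is settled by the Jacobi identity.\<close>

lemma klie_klie:
  assumes "supported c" "l \<in> H" "m \<in> H"
  shows "klie bs \<theta> l (klie bs \<theta> m c) - klie bs \<theta> m (klie bs \<theta> l c) = klie bs \<theta> (lie l m) c"
  using assms(1)
proof (induction c rule: chain_induct)
  case (add a b)
  then show ?case by (simp add: clinearD[OF klie_lin] algebra_simps)
next
  case (vac x)
  then show ?case using rep_lie[OF assms(2,3)]
    by (simp add: klie_vac blinfun.diff_left flip: clinearD(5)[OF single_lin])
next
  case (crel k c)
  note lm = assms(2,3)
  have "lie (lie l m) k = lie l (lie m k) - lie m (lie l k)"
    using jacobi[of l m k] lie_antisym[of "lie l m" k] lie_antisym[of k l]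
      clinearD(4)[OF clinearI, of "lie m" "lie l k"]
    by (simp add: lie_add_right lie_scaleC_right algebra_simps)
  then have "crel bs (lie (lie l m) k) c = crel bs (lie l (lie m k)) c - crel bs (lie m (lie l k)) c"
    using crel_add[of "lie l (lie m k)" "- lie m (lie l k)" c] crel_neg[of "lie m (lie l k)" c] lm crel
      lie_closed csubspaceD(5)[OF H_sub] by simp
  then show ?case using crel lm lie_closed
    by (simp add: klie_crel clinearD[OF klie_lin] algebra_simps clinearD[OF crel_lin] flip: crel.IH)
qed

lemma kd_klie:
  assumes "supported c" "l \<in> H"
  shows "kd bs \<theta> (klie bs \<theta> l c) = klie bs \<theta> l (kd bs \<theta> c)"
  using assms(1)
proof -
  \<comment> \<open>The support is carried along in the claim because \<open>klie_klie\<close> is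
    applied to the chain of the induction hypothesis.\<close>
  have "supported c \<and> kd bs \<theta> (klie bs \<theta> l c) = klie bs \<theta> l (kd bs \<theta> c)"
    using assms(1)
  proof (induction c rule: chain_induct)
    case (add a b)
    then show ?case by (simp add: clinearD[OF klie_lin] clinearD[OF kd_lin] supported_add)
  next
    case (vac x)
    then show ?case by (simp add: klie_vac kd_vac clinearD[OF klie_lin] supported_single)
  next
    case (crel k c)
    show ?case using crel assms(2) lie_closed klie_klie[of c k l] supported_crel[of c k]
      by (simp add: klie_crel kd_crel clinearD[OF klie_lin] clinearD[OF kd_lin] clinearD[OF crel_lin] algebra_simps)
        (simp add: klie_klie[symmetric])
  qed
  then show ?thesis by blast
qed

text \<open>By Cartan's formula, d d (l \<and> c) equals d(L c) - d(l \<and> d c), where L is the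
  Lie derivative along l. The second term is L(d c) - l \<and> d d c, and L commutes with d, so
  everything reduces to d d c.\<close>

lemma kd_kd:
  assumes "supported c"
  shows "kd bs \<theta> (kd bs \<theta> c) = 0"
proof -
  have "supported c \<and> kd bs \<theta> (kd bs \<theta> c) = 0"
    using assms
  proof (induction c rule: chain_induct)
    case (add a b)
    then show ?case by (simp add: clinearD[OF kd_lin] supported_add)
  next
    case (vac x)
    then show ?case by (simp add: kd_vac clinearD[OF kd_lin] supported_single)
  next
    case (crel k c)
    show ?case using crel supported_crel[of c k]
      by (simp add: kd_crel clinearD[OF kd_lin] clinearD[OF crel_lin] kd_klie)
  qed
  then show ?thesis by blast
qed

text \<open>The left hand side is the part of the differential of \<open>x \<otimes> l \<and> ls\<close> that involves \<open>l\<close>.\<close>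

lemma klie_kword:
  assumes "l \<in> H" "set ls \<subseteq> H"
  shows "kword bs ls (blinfun_apply (\<theta> l) x) +
    (\<Sum>j<length ls. (-1) ^ j *\<^sub>C kword bs (lie l (ls ! j) # nths ls (- {j})) x) = klie bs \<theta> l (kword bs ls x)"
  using assms(2)
proof (induction ls)
  case Nil
  then show ?case by (simp add: klie_vac)
next
  case (Cons m ls)
  have m: "m \<in> H" "set ls \<subseteq> H" using Cons by auto
  have "nths (m # ls) (- {0}) = ls"
    by (simp add: nths_Cons) (rule nths_all, simp)
  moreover have "nths (m # ls) (- {Suc j}) = m # nths ls (- {j})" for j
    by (simp add: nths_Cons Compl_eq)
  ultimately have "(\<Sum>j<length (m # ls). (-1) ^ j *\<^sub>C kword bs (lie l ((m # ls) ! j) # nths (m # ls) (- {j})) x) =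
    crel bs (lie l m) (kword bs ls x) +
    crel bs m (\<Sum>j<length ls. (-1) ^ j *\<^sub>C kword bs (lie l (ls ! j) # nths ls (- {j})) x)"
    by (simp add: sum.lessThan_Suc_shift clinearD[OF crel_lin] crel_anticommute[of bs "lie l _" m] del: sum.lessThan_Suc)
  then show ?case
    using Cons.IH[OF m(2)] klie_crel[OF assms(1) m(1), of "kword bs ls x"]
    by (simp add: algebra_simps flip: clinearD(1)[OF crel_lin])
qed

lemma koszul_elem_kword: "koszul_elem bs \<theta> x ls =
    (\<Sum>i<length ls. (-1) ^ i *\<^sub>C kword bs (nths ls (- {i})) (blinfun_apply (\<theta> (ls ! i)) x)) +
    (\<Sum>j<length ls. \<Sum>i<j. (-1) ^ (i + j + 1) *\<^sub>C kword bs (lie (ls ! i) (ls ! j) # nths ls (- {i, j})) x)"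
  by (simp add: koszul_elem_def elem_tensor_kword fun_eq_iff fun_ops)

text \<open>Both sides satisfy the same recursion in the first vector l: the terms involving l form
  the Lie derivative of the tail by \<open>klie_kword\<close>, the others are minus l times the
  differential of the tail, and this is Cartan's formula.\<close>

lemma koszul_elem_kd:
  assumes "set ls \<subseteq> H"
  shows "koszul_elem bs \<theta> x ls = kd bs \<theta> (kword bs ls x)"
  using assms
proof (induction ls)
  case Nil
  then show ?case by (simp add: koszul_elem_kword kd_vac)
next
  case (Cons l ls)
  have l: "l \<in> H" "set ls \<subseteq> H" using Cons by auto
  have n0: "nths (l # ls) (- {0}) = ls"
    by (simp add: nths_Cons) (rule nths_all, simp)
  have n1: "nths (l # ls) (- {Suc i}) = l # nths ls (- {i})" for i
    by (simp add: nths_Cons Compl_eq)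
  have n2: "nths (l # ls) (- {0, Suc i}) = nths ls (- {i})" for i
    by (simp add: nths_Cons Compl_eq)
  have n3: "nths (l # ls) (- {Suc i, Suc j}) = l # nths ls (- {i, j})" for i j
    by (simp add: nths_Cons Compl_eq)
  have 1: "(\<Sum>i<length (l # ls). (-1) ^ i *\<^sub>C kword bs (nths (l # ls) (- {i})) (blinfun_apply (\<theta> ((l # ls) ! i)) x)) =
    kword bs ls (blinfun_apply (\<theta> l) x) -
    crel bs l (\<Sum>i<length ls. (-1) ^ i *\<^sub>C kword bs (nths ls (- {i})) (blinfun_apply (\<theta> (ls ! i)) x))"
    by (simp add: sum.lessThan_Suc_shift n0 n1 clinearD[OF crel_lin] sum_negf del: sum.lessThan_Suc)
  have 2: "(\<Sum>j<length (l # ls). \<Sum>i<j. (-1) ^ (i + j + 1) *\<^sub>C kword bs (lie ((l # ls) ! i) ((l # ls) ! j) # nths (l # ls) (- {i, j})) x) =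
    (\<Sum>j<length ls. (-1) ^ j *\<^sub>C kword bs (lie l (ls ! j) # nths ls (- {j})) x) -
    crel bs l (\<Sum>j<length ls. \<Sum>i<j. (-1) ^ (i + j + 1) *\<^sub>C kword bs (lie (ls ! i) (ls ! j) # nths ls (- {i, j})) x)"
    by (simp add: sum.lessThan_Suc_shift n2 n3 clinearD[OF crel_lin] sum_negf sum.distrib sum_subtractf
        crel_anticommute[of bs "lie _ _" l] del: sum.lessThan_Suc)
  have "koszul_elem bs \<theta> x (l # ls) = klie bs \<theta> l (kword bs ls x) - crel bs l (koszul_elem bs \<theta> x ls)"
    unfolding koszul_elem_kword[of x "l # ls"] 1 2
    unfolding koszul_elem_kword[of x ls] clinearD(1)[OF crel_lin] klie_kword[OF l, symmetric] by simp
  then show ?case using Cons.IH[OF l(2)] kd_crel[OF l(1)] by simp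
qed

lemma koszul_d_kd: "supported c \<Longrightarrow> koszul_d bs \<theta> c = kd bs \<theta> c"
proof -
  assume c: "supported c"
  have "set (nths bs S) \<subseteq> H" for S using set_nths_subset[of bs S] complex_vector.span_superset[of "set bs"] span by auto
  then have "koszul_d bs \<theta> c = (\<Sum>S\<in>Pow {..<n}. kd bs \<theta> (kword bs (nths bs S) (c S)))"
    by (simp add: koszul_d_def koszul_elem_kd fun_eq_iff fun_ops)
  also have "\<dots> = kd bs \<theta> (\<Sum>S\<in>Pow {..<n}. single S (c S))"
    by (simp add: clinearD[OF kd_lin] kword_basis)
  finally show ?thesis using supported_expand[OF c] by simp
qed

end

section \<open>Change of basis\<close>

text \<open>The isomorphism between two coordinate models of the same space: each basis wedge of
  \<open>bs\<close> is rewritten as the wedge of the same vectors in the coordinates of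
  \<open>bs'\<close>.\<close>

definition kchange :: "'l::complex_vector list \<Rightarrow> 'l list \<Rightarrow> (nat set \<Rightarrow> 'x::complex_banach) \<Rightarrow> nat set \<Rightarrow> 'x"
  where "kchange bs bs' c = (\<Sum>S\<in>Pow {..<length bs}. kword bs' (nths bs S) (c S))"

locale koszul_change = koszul_setting bs H \<theta> + other: koszul_setting bs' H \<theta>
  for bs bs' :: "'l::complex_lie_algebra list" and H and \<theta> :: "'l \<Rightarrow> ('x::complex_banach \<Rightarrow>\<^sub>L 'x)"
begin

lemma kchange_lin: "clinear (kchange bs bs' :: (nat set \<Rightarrow> 'x) \<Rightarrow> _)"
  by (rule clinearI) (simp_all add: kchange_def fun_ops clinearD[OF kword_lin] sum.distrib scaleC_sum_right)

text \<open>Multiplying a word by its i-th vector sorts that vector into its place with the sign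
  \<open>ksgn\<close> and annihilates words that contain it already. This is the action of
  \<open>cre\<close> on index sets, after the reindexing that inserts i into S.\<close>

lemma kchange_cre: "i < n \<Longrightarrow> kchange bs bs' (cre i c) = crel bs' (bs ! i) (kchange bs bs' (c :: nat set \<Rightarrow> 'x))"
proof -
  assume i: "i < n"
  define g where "g = (\<lambda>j. crel bs' (bs ! j) :: (nat set \<Rightarrow> 'x) \<Rightarrow> _)"
  define W where "W S x = foldr g (idx n S) (single {} (x :: 'x))" for S x
  have word: "kword bs' (nths bs S) x = W S x" for S and x :: 'x
    by (simp add: kword_def nths_idx W_def g_def foldr_map comp_def)
  have Wlin: "clinear (W S)" for S
  proof -
    have "W S = kword bs' (nths bs S)" by (rule ext) (simp add: word)
    then show ?thesis by (simp add: kword_lin)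
  qed
  have ins: "g i (W S x) = (if i \<in> S then 0 else ksgn i S *\<^sub>C W (insert i S) x)" if S: "S \<subseteq> {..<n}" for S x
  proof -
    note iS = idx_props[where n=n and S=S]
    have "insort i (idx n S) = idx n (insert i S)" if "i \<notin> S"
    proof (rule idx_unique[symmetric])
      show "sorted_wrt (<) (insort i (idx n S))"
        using iS that S by (simp add: strict_sorted_iff distinct_insort sorted_insort)
    qed (use iS S i in \<open>auto simp: set_insort_key\<close>)
    moreover have "clinear (g j)" and "g j (g k w) = - g k (g j w)" for j k w
      unfolding g_def by (rule crel_lin, rule crel_anticommute)
    note anticommuting_insort[of g "idx n S" i "single {} x", OF this iS(1)]
    ultimately show ?thesis unfolding W_def using iS(3)[OF S] by simp
  qed
  have "crel bs' (bs ! i) (kchange bs bs' c) = (\<Sum>S\<in>Pow {..<n}. g i (W S (c S)))"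
    by (simp add: kchange_def word g_def clinearD[OF crel_lin])
  also have "\<dots> = (\<Sum>S\<in>{S. S \<subseteq> {..<n} \<and> i \<notin> S}. ksgn i S *\<^sub>C W (insert i S) (c S))"
    by (rule sum.mono_neutral_cong_right) (auto simp: ins)
  also have "\<dots> = (\<Sum>S\<in>{S. S \<subseteq> {..<n} \<and> i \<in> S}. W S (ksgn i S *\<^sub>C c (S - {i})))"
    by (rule sum.reindex_bij_witness[of _ "\<lambda>S. S - {i}" "insert i"])
      (use i in \<open>auto simp: clinearD[OF Wlin] ksgn_remove ksgn_insert insert_absorb\<close>)
  also have "\<dots> = (\<Sum>S\<in>Pow {..<n}. W S (cre i c S))"
    by (rule sum.mono_neutral_cong_left) (auto simp: cre_def clinearD[OF Wlin])
  finally show ?thesis by (simp add: kchange_def word)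
qed

lemma kchange_crel: "l \<in> H \<Longrightarrow> kchange bs bs' (crel bs l c) = crel bs' l (kchange bs bs' (c :: nat set \<Rightarrow> 'x))"
proof -
  assume l: "l \<in> H"
  have "crel bs' (\<Sum>i<n. coord bs l i *\<^sub>C bs ! i) v = (\<Sum>i<n. coord bs l i *\<^sub>C crel bs' (bs ! i) v)" for v :: "nat set \<Rightarrow> 'x"
    by (rule other.crel_sum) (use bsH in auto)
  then show ?thesis
    using coord_expand[OF l] by (simp add: crel_def[of bs] clinearD[OF kchange_lin] kchange_cre)
qed

lemma kchange_vac: "kchange bs bs' (single {} x) = single {} (x :: 'x)"
proof -
  have "kchange bs bs' (single {} x) = (\<Sum>S\<in>Pow {..<n}. if S = {} then single {} x else 0)"
    unfolding kchange_def by (rule sum.cong) (auto simp: single_def clinearD[OF kword_lin] simp flip: kword_def)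
  then show ?thesis by (simp add: sum.delta)
qed

lemma kchange_klie: "supported c \<Longrightarrow> l \<in> H \<Longrightarrow> kchange bs bs' (klie bs \<theta> l c) = klie bs' \<theta> l (kchange bs bs' c)"
proof (induction c rule: chain_induct)
  case (add a b)
  then show ?case by (simp add: clinearD[OF kchange_lin] clinearD[OF klie_lin] clinearD[OF other.klie_lin])
next
  case (vac x)
  then show ?case by (simp add: klie_vac other.klie_vac kchange_vac)
next
  case (crel m c)
  then show ?case
    by (simp add: klie_crel other.klie_crel kchange_crel clinearD[OF kchange_lin] lie_closed)
qed

lemma kchange_kd: "supported c \<Longrightarrow> kchange bs bs' (kd bs \<theta> c) = kd bs' \<theta> (kchange bs bs' c)"
proof -
  assume "supported c"
  then have "supported c \<and> kchange bs bs' (kd bs \<theta> c) = kd bs' \<theta> (kchange bs bs' c)"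
  proof (induction c rule: chain_induct)
    case (add a b)
    then show ?case by (simp add: clinearD[OF kchange_lin] clinearD[OF kd_lin] clinearD[OF other.kd_lin] supported_add)
  next
    case (vac x)
    then show ?case by (simp add: kd_vac other.kd_vac kchange_vac supported_single clinearD[OF kchange_lin])
  next
    case (crel m c)
    then show ?case
      by (simp add: kd_crel other.kd_crel kchange_crel clinearD[OF kchange_lin] supported_crel kchange_klie)
  qed
  then show ?thesis by blast
qed

lemma kchange_chains:
  assumes "c \<in> koszul_chains bs p"
  shows "kchange bs bs' c \<in> koszul_chains bs' p"
  unfolding koszul_chains_def
proof (intro CollectI allI impI)
  fix R assume "kchange bs bs' c R \<noteq> 0"
  then obtain S where S: "S \<subseteq> {..<n}" "kword bs' (nths bs S) (c S) R \<noteq> 0"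
    unfolding kchange_def fun_ops by (meson PowD sum.not_neutral_contains_not_neutral)
  then have "c S \<noteq> 0" by (auto simp: clinearD[OF kword_lin] fun_ops)
  moreover have "length (nths bs S) = card S" using S(1) idx_props(4)[where n=n and S=S] by (simp add: nths_idx)
  ultimately show "R \<subseteq> {..<length bs'} \<and> int (card R) = p"
    using S assms by (auto simp: elem_tensor_kword[symmetric] elem_tensor_def koszul_chains_def split: if_splits)
qed

end

text \<open>The composite fixes the vacuum and commutes with every exterior multiplication, hence it
  is the identity by induction on chains; the inverse of the matrix of minors never has to be
  computed.\<close>

lemma kchange_kchange:
  fixes \<theta> :: "'l::complex_lie_algebra \<Rightarrow> ('x::complex_banach \<Rightarrow>\<^sub>L 'x)" and c :: "nat set \<Rightarrow> 'x"
  assumes "koszul_change bs bs' H \<theta>" and c: "koszul_setting.supported bs c"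
  shows "kchange bs' bs (kchange bs bs' c) = c"
proof -
  interpret koszul_change bs bs' H \<theta> by fact
  interpret opp: koszul_change bs' bs H \<theta> by unfold_locales
  show ?thesis using c
  proof (induction c rule: chain_induct)
    case (add a b)
    then show ?case by (simp add: clinearD[OF kchange_lin] clinearD[OF opp.kchange_lin])
  next
    case (vac x)
    then show ?case by (simp add: kchange_vac opp.kchange_vac)
  next
    case (crel l c)
    then show ?case by (simp add: kchange_crel opp.kchange_crel)
  qed
qed

section \<open>Complexes of finite direct sums of a Banach space\<close>

definition supp_on :: "'j set \<Rightarrow> ('j \<Rightarrow> 'x::zero) set"
  where "supp_on J = {c. \<forall>j. c j \<noteq> 0 \<longrightarrow> j \<in> J}"

definition chains :: "'j set \<Rightarrow> ('j \<Rightarrow> nat) \<Rightarrow> nat \<Rightarrow> ('j \<Rightarrow> 'x::zero) set"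
  where "chains J deg p = {c. \<forall>j. c j \<noteq> 0 \<longrightarrow> j \<in> J \<and> deg j = p}"

definition cnorm :: "'j set \<Rightarrow> ('j \<Rightarrow> 'x::complex_banach) \<Rightarrow> real"
  where "cnorm J c = (\<Sum>j\<in>J. norm (c j))"

lemma cseminorm_cnorm: "cseminorm (cnorm J)"
  unfolding cseminorm_def cnorm_def
  by (auto simp: fun_ops norm_scaleC sum_distrib_left norm_triangle_ineq simp flip: sum.distrib intro!: sum_mono)

lemmas cnormD = cseminormD[OF cseminorm_cnorm]

lemma chains_supp: "chains J deg p \<subseteq> supp_on J"
  by (auto simp: chains_def supp_on_def)

lemma subspace_supp_on: "complex_vector.subspace (supp_on J :: ('j \<Rightarrow> 'x::complex_vector) set)"
  by (auto simp: complex_vector.subspace_def supp_on_def fun_ops; metis add_0)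

lemma subspace_chains: "complex_vector.subspace (chains J deg p :: ('j \<Rightarrow> 'x::complex_vector) set)"
  by (auto simp: complex_vector.subspace_def chains_def fun_ops; metis add_0)

lemma norm_le_cnorm: "finite J \<Longrightarrow> c \<in> supp_on J \<Longrightarrow> norm (c j) \<le> cnorm J c"
  by (cases "c j = 0") (auto simp: cnorm_def supp_on_def sum_nonneg intro: member_le_sum)

lemma cnorm_eq_0: "finite J \<Longrightarrow> c \<in> supp_on J \<Longrightarrow> cnorm J c = 0 \<Longrightarrow> c = 0"
  using norm_le_cnorm[of J c] by (auto simp: fun_eq_iff fun_ops)

lemma tendsto_fun_iff: "(x \<longlongrightarrow> l) F \<longleftrightarrow> (\<forall>j. ((\<lambda>n. x n j) \<longlongrightarrow> l j) F)"
  for l :: "'j \<Rightarrow> 'x::topological_space"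
  using limitin_componentwise[of "\<lambda>_. euclidean" UNIV x l F]
  by (simp add: euclidean_product_topology)

lemma closed_limit_mem:
  assumes J: "finite J" and A: "closed A" "\<And>n. x n \<in> A" "A \<subseteq> supp_on J"
    and l: "l \<in> supp_on J" and lim: "(\<lambda>n. cnorm J (x n - l)) \<longlonglongrightarrow> 0"
  shows "l \<in> A"
proof -
  have "(\<lambda>n. x n j) \<longlonglongrightarrow> l j" for j
  proof (rule Lim_null[THEN iffD2], rule Lim_null_comparison[OF always_eventually lim], rule allI)
    fix n
    have "x n - l \<in> supp_on J" using A l csubspaceD(4)[OF subspace_supp_on] by blast
    then show "norm (x n j - l j) \<le> cnorm J (x n - l)"
      using norm_le_cnorm[OF J, of "x n - l" j] by (simp add: fun_ops)
  qed
  then have "x \<longlonglongrightarrow> l" by (simp add: tendsto_fun_iff)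
  then show ?thesis using A by (intro closed_sequentially[of A x l]) auto
qed

lemma closed_complete:
  assumes J: "finite J" and A: "closed A" "A \<subseteq> supp_on J"
  shows "seminorm_complete (cnorm J) A"
  unfolding seminorm_complete_def
proof (intro allI impI, elim conjE)
  fix x :: "nat \<Rightarrow> _" assume x: "\<forall>n. x n \<in> A" and C: "\<forall>e>0. \<exists>k. \<forall>m\<ge>k. \<forall>n\<ge>k. cnorm J (x m - x n) < e"
  have "Cauchy (\<lambda>n. x n j)" for j
    unfolding Cauchy_def
  proof (intro allI impI)
    fix e :: real assume "0 < e"
    then obtain k where k: "\<And>m n. m \<ge> k \<Longrightarrow> n \<ge> k \<Longrightarrow> cnorm J (x m - x n) < e" using C by blast
    have "dist (x m j) (x n j) < e" if "m \<ge> k" "n \<ge> k" for m n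
    proof -
      have "x m - x n \<in> supp_on J" using x A csubspaceD(4)[OF subspace_supp_on] by blast
      then show ?thesis using norm_le_cnorm[OF J, of "x m - x n" j] k[OF that] by (simp add: fun_ops dist_norm)
    qed
    then show "\<exists>k. \<forall>m\<ge>k. \<forall>n\<ge>k. dist (x m j) (x n j) < e" by blast
  qed
  then have "\<exists>l. (\<lambda>n. x n j) \<longlonglongrightarrow> l" for j by (simp add: Cauchy_convergent_iff convergent_def)
  then obtain l where l: "\<And>j. (\<lambda>n. x n j) \<longlonglongrightarrow> l j" by metis
  have "x \<longlonglongrightarrow> l" using l by (simp add: tendsto_fun_iff)
  then have "l \<in> A" using x A by (intro closed_sequentially[of A x l]) auto
  moreover have "(\<lambda>n. cnorm J (x n - l)) \<longlonglongrightarrow> (\<Sum>j\<in>J. norm (l j - l j))"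
    unfolding cnorm_def fun_ops by (intro tendsto_intros l)
  ultimately show "\<exists>l\<in>A. (\<lambda>n. cnorm J (x n - l)) \<longlonglongrightarrow> 0" by auto
qed

text \<open>The spectra use the product topology, the estimates use \<open>cnorm\<close>. Over a
  finite \<open>J\<close> the neighbourhoods of radius 1/(n+1) in the coordinates of
  \<open>J\<close> turn a point of the closure into a limit of a sequence in norm, and coordinates
  outside \<open>J\<close> remain zero in the closure.\<close>

lemma closed_if_limits:
  fixes A :: "('j \<Rightarrow> 'x::complex_banach) set"
  assumes J: "finite J" and A: "A \<subseteq> supp_on J"
    and lim: "\<And>x l. (\<And>n. x n \<in> A) \<Longrightarrow> l \<in> supp_on J \<Longrightarrow> (\<lambda>n. cnorm J (x n - l)) \<longlonglongrightarrow> 0 \<Longrightarrow> l \<in> A"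
  shows "closed A"
proof -
  have "l \<in> A" if l: "l \<in> closure A" for l
  proof -
    have "closed {c :: 'j \<Rightarrow> 'x. c j = 0}" for j
      by (intro closed_Collect_eq continuous_intros) auto
    then have "closed (\<Inter>j\<in>-J. {c :: 'j \<Rightarrow> 'x. c j = 0})" by blast
    moreover have "A \<subseteq> (\<Inter>j\<in>-J. {c. c j = 0})" using A by (auto simp: supp_on_def)
    ultimately have "l \<in> (\<Inter>j\<in>-J. {c. c j = 0})" using l closure_minimal by blast
    then have lJ: "l \<in> supp_on J" by (auto simp: supp_on_def)
    define N where "N n = (\<Inter>j\<in>J. {c. norm (c j - l j) < inverse (real (Suc n))})" for n
    have "open (N n)" for n
      unfolding N_def using J by (intro open_INT ballI open_Collect_less continuous_intros) auto
    moreover have "l \<in> N n" for n by (auto simp: N_def)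
    ultimately have "A \<inter> N n \<noteq> {}" for n using l by (metis closure_iff_nhds_not_empty inf_commute order_refl)
    then have "\<exists>y. y \<in> A \<and> y \<in> N n" for n by blast
    then obtain x where x: "\<And>n. x n \<in> A" "\<And>n. x n \<in> N n" by metis
    have "(\<lambda>n. cnorm J (x n - l)) \<longlonglongrightarrow> 0"
    proof (rule Lim_null_comparison)
      show "\<forall>\<^sub>F n in sequentially. norm (cnorm J (x n - l)) \<le> card J * inverse (real (Suc n))"
      proof (rule always_eventually, rule allI)
        fix n
        have "cnorm J (x n - l) \<le> card J * inverse (real (Suc n))"
          unfolding cnorm_def fun_ops using x(2)[of n] by (intro sum_bounded_above) (auto simp: N_def less_imp_le)
        then show "norm (cnorm J (x n - l)) \<le> card J * inverse (real (Suc n))" by (simp add: cnormD)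
      qed
      show "(\<lambda>n. card J * inverse (real (Suc n))) \<longlonglongrightarrow> 0"
        using tendsto_mult[OF tendsto_const LIMSEQ_inverse_real_of_nat, of "real (card J)"] by simp
    qed
    then show "l \<in> A" using lim x(1) lJ by blast
  qed
  then show ?thesis using closure_subset_eq by blast
qed

lemma closed_chains: "finite J \<Longrightarrow> closed (chains J deg p :: ('j \<Rightarrow> 'x::complex_banach) set)"
proof -
  have "chains J deg p = (\<Inter>j\<in>{j. \<not> (j \<in> J \<and> deg j = p)}. {c :: 'j \<Rightarrow> 'x. c j = 0})"
    by (auto simp: chains_def)
  moreover have "closed {c :: 'j \<Rightarrow> 'x. c j = 0}" for j
    by (intro closed_Collect_eq continuous_intros) auto
  ultimately show ?thesis by auto
qed

text \<open>A single operator \<open>d\<close> serves all degrees. Degrees are natural numbers, and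
  \<open>d_0\<close> takes the place of a zero space in degree -1.\<close>

locale banach_complex =
  fixes J :: "'j set" and deg :: "'j \<Rightarrow> nat" and d :: "('j \<Rightarrow> 'x::complex_banach) \<Rightarrow> 'j \<Rightarrow> 'x"
  assumes finJ: "finite J" and lin: "clinear d"
    and d_deg: "\<And>c p. c \<in> chains J deg (Suc p) \<Longrightarrow> d c \<in> chains J deg p"
    and d_0: "\<And>c. c \<in> chains J deg 0 \<Longrightarrow> d c = 0"
    and dd: "\<And>c. c \<in> supp_on J \<Longrightarrow> d (d c) = 0"
    and bounded: "\<exists>C. \<forall>c\<in>supp_on J. cnorm J (d c) \<le> C * cnorm J c"
begin

abbreviation "C \<equiv> chains J deg"

definition exact_at :: "nat \<Rightarrow> bool"
  where "exact_at p \<longleftrightarrow> (\<forall>c\<in>C p. d c = 0 \<longrightarrow> c \<in> d ` C (Suc p))"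

text \<open>The closed set is the outgoing range, which lies one degree lower. The incoming range is
  closed as well, since by exactness it is the kernel of \<open>d\<close> on
  \<open>C p\<close>.\<close>

definition strict_at :: "nat \<Rightarrow> bool"
  where "strict_at p \<longleftrightarrow> exact_at p \<and> closed (d ` C p)"

text \<open>A cycle z and a functional U with U z \<noteq> 0 and U d = 0, relaxed to errors of size
  e. The bounds 2, 1 and 1/2 on z, U and U z fix the scale independently of e; they are those of
  \<open>functional_of_not_bounded_below\<close>, and \<open>functional_of_not_surjective\<close>
  meets them too.\<close>

definition defect :: "nat \<Rightarrow> bool"
  where "defect p \<longleftrightarrow> (\<forall>e>0. \<exists>z\<in>C p. \<exists>U. cnorm J z \<le> 2 \<and> cnorm J (d z) \<le> e \<and>
    (\<forall>x y. U (x + y) = U x + U y) \<and> (\<forall>a x. U (a *\<^sub>C x) = a * U x) \<and> (\<forall>w. cmod (U w) \<le> cnorm J w) \<and>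
    (\<forall>c\<in>C (Suc p). cmod (U (d c)) \<le> e * cnorm J c) \<and> 1 / 2 \<le> cmod (U z))"

lemmas lD = clinearD[OF lin]
lemmas CD = csubspaceD[OF subspace_chains[where J=J and deg=deg]]

lemma C_supp: "c \<in> C p \<Longrightarrow> c \<in> supp_on J"
  using chains_supp by blast

lemma dC_supp: "c \<in> C p \<Longrightarrow> d c \<in> supp_on J"
  by (cases p) (auto simp: d_0 csubspaceD[OF subspace_supp_on] dest: d_deg C_supp)

lemma complete_C: "seminorm_complete (cnorm J) (C p)"
  using finJ by (intro closed_complete closed_chains chains_supp)

lemma subspace_image: "complex_vector.subspace (d ` C p)"
  unfolding complex_vector.subspace_def
proof (intro conjI ballI allI)
  show "0 \<in> d ` C p" using CD(1) by (intro image_eqI[of _ _ 0]) (auto simp: lD)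
  show "x + y \<in> d ` C p" if "x \<in> d ` C p" "y \<in> d ` C p" for x y
    using that CD(2) by (auto simp flip: lD(1) intro!: imageI)
  show "a *\<^sub>C x \<in> d ` C p" if "x \<in> d ` C p" for a x
    using that CD(3) by (auto simp flip: lD(2) intro!: imageI)
qed

lemma subspace_kernel: "complex_vector.subspace {c \<in> C p. d c = 0}"
  using CD[where p=p] lD by (auto simp: complex_vector.subspace_def)

lemma closed_kernel: "closed {c \<in> C p. d c = 0}"
proof (rule closed_if_limits[OF finJ])
  show "{c \<in> C p. d c = 0} \<subseteq> supp_on J" using C_supp by blast
  fix x l assume x: "\<And>n. x n \<in> {c \<in> C p. d c = 0}" and l: "l \<in> supp_on J" "(\<lambda>n. cnorm J (x n - l)) \<longlonglongrightarrow> 0"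
  have lC: "l \<in> C p"
    by (rule closed_limit_mem[OF finJ closed_chains[OF finJ] _ chains_supp l]) (use x in auto)
  obtain B where B: "\<And>c. c \<in> supp_on J \<Longrightarrow> cnorm J (d c) \<le> B * cnorm J c" using bounded by blast
  have "cnorm J (d l) \<le> B * cnorm J (x n - l)" for n
  proof -
    have "x n - l \<in> supp_on J" using x[of n] l C_supp csubspaceD(4)[OF subspace_supp_on] by blast
    then show ?thesis using B[of "x n - l"] x[of n] by (simp add: lD cnormD)
  qed
  moreover have "(\<lambda>n. B * cnorm J (x n - l)) \<longlonglongrightarrow> B * 0" by (intro tendsto_intros l)
  ultimately have "cnorm J (d l) \<le> 0" by (intro LIMSEQ_le_const[where a="cnorm J (d l)"]) auto
  then have "d l = 0" using cnormD(6)[of J "d l"] by (intro cnorm_eq_0[OF finJ dC_supp[OF lC]]) simp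
  then show "l \<in> {c \<in> C p. d c = 0}" using lC by blast
qed

text \<open>Here z is an exact cycle and only the functional is approximate, because the boundaries
  may be dense in the cycles.\<close>

lemma defect_if_not_exact: "\<not> exact_at p \<Longrightarrow> defect p"
  unfolding defect_def
proof (intro allI impI)
  fix e :: real assume "\<not> exact_at p" and e: "0 < e"
  then obtain z0 where z0: "z0 \<in> C p" "d z0 = 0" "z0 \<notin> d ` C (Suc p)" by (auto simp: exact_at_def)
  obtain B where B: "\<And>c. c \<in> supp_on J \<Longrightarrow> cnorm J (d c) \<le> B * cnorm J c" using bounded by blast
  have "\<exists>z\<in>{c \<in> C p. d c = 0}. \<exists>U. cnorm J z \<le> 1 \<and> (\<forall>x y. U (x + y) = U x + U y) \<and> (\<forall>a x. U (a *\<^sub>C x) = a * U x) \<and>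
    (\<forall>w. cmod (U w) \<le> cnorm J w) \<and> (\<forall>x\<in>C (Suc p). cmod (U (d x)) \<le> e * cnorm J x) \<and> 1 / 2 \<le> cmod (U z)"
    using cnorm_eq_0[OF finJ] C_supp d_deg dd B z0
    by (intro functional_of_not_surjective[where C=B, OF cseminorm_cnorm cseminorm_cnorm subspace_chains complete_C subspace_kernel _ lin _ _ _ _ e]) auto
  then obtain z U where "z \<in> C p" "d z = 0" "cnorm J z \<le> 1" and U: "(\<forall>x y. U (x + y) = U x + U y)" "(\<forall>a x. U (a *\<^sub>C x) = a * U x)"
    "(\<forall>w. cmod (U w) \<le> cnorm J w)" "(\<forall>x\<in>C (Suc p). cmod (U (d x)) \<le> e * cnorm J x)" "1 / 2 \<le> cmod (U z)"
    by blast
  then show "\<exists>z\<in>C p. \<exists>U. cnorm J z \<le> 2 \<and> cnorm J (d z) \<le> e \<and>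
    (\<forall>x y. U (x + y) = U x + U y) \<and> (\<forall>a x. U (a *\<^sub>C x) = a * U x) \<and> (\<forall>w. cmod (U w) \<le> cnorm J w) \<and>
    (\<forall>c\<in>C (Suc p). cmod (U (d c)) \<le> e * cnorm J c) \<and> 1 / 2 \<le> cmod (U z)"
    using e by (intro bexI[of _ z] exI[of _ U]) (auto simp: cnormD)
qed

text \<open>In the absence of a defect, the distance of x from the boundaries is at most a constant
  times the norm of \<open>d x\<close>. Since the boundaries are closed, cycles are at distance 0
  and thus boundaries. The same bound lets approximate preimages be replaced by small ones, so that
  successive approximation reaches every limit of the outgoing range.\<close>

lemma strict_if_no_defect:
  assumes cl: "closed (d ` C (Suc p))" and nd: "\<not> defect p"
  shows "strict_at p"
proof -
  let ?B = "d ` C (Suc p)"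
  obtain B where B: "\<And>c. c \<in> supp_on J \<Longrightarrow> cnorm J (d c) \<le> B * cnorm J c" using bounded by blast
  have BC: "?B \<subseteq> C p" using d_deg by blast
  have d0: "d b = 0" if "b \<in> ?B" for b using that dd C_supp by blast
  \<comment> \<open>Expresses that the distance of x from the boundaries is at most K times the norm
    of \<open>d x\<close>, without an infimum; its negation is the hypothesis of
    \<open>functional_of_not_bounded_below\<close>.\<close>
  have "\<exists>K\<ge>0. \<forall>x\<in>C p. \<forall>c. K * cnorm J (d x) < c \<longrightarrow> (\<exists>b\<in>?B. cnorm J (x - b) < c)"
  proof (rule ccontr)
    assume "\<not> ?thesis"
    then have nb: "\<exists>x\<in>C p. \<exists>c. K * cnorm J (d x) < c \<and> (\<forall>b\<in>?B. c \<le> cnorm J (x - b))" if "0 \<le> K" for K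
      using that by (meson not_le)
    have "defect p"
      unfolding defect_def
    proof (intro allI impI)
      fix e :: real assume e: "0 < e"
      have "\<exists>z\<in>C p. \<exists>U. cnorm J z \<le> 2 \<and> cnorm J (d z) \<le> e \<and> (\<forall>x y. U (x + y) = U x + U y) \<and> (\<forall>a x. U (a *\<^sub>C x) = a * U x) \<and>
        (\<forall>w. cmod (U w) \<le> cnorm J w) \<and> (\<forall>b\<in>?B. U b = 0) \<and> 1 / 2 \<le> cmod (U z)"
        by (rule functional_of_not_bounded_below[OF cseminorm_cnorm cseminorm_cnorm subspace_chains subspace_image BC lin _ _ e]; (rule d0 | rule nb))
      then obtain z U where zU: "z \<in> C p" "cnorm J z \<le> 2" "cnorm J (d z) \<le> e" "(\<forall>x y. U (x + y) = U x + U y)" "(\<forall>a x. U (a *\<^sub>C x) = a * U x)"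
        "(\<forall>w. cmod (U w) \<le> cnorm J w)" "\<forall>b\<in>?B. U b = 0" "1 / 2 \<le> cmod (U z)"
        by blast
      moreover have "cmod (U (d c)) \<le> e * cnorm J c" if "c \<in> C (Suc p)" for c
        using zU(7) that e by (simp add: cnormD)
      ultimately show "\<exists>z\<in>C p. \<exists>U. cnorm J z \<le> 2 \<and> cnorm J (d z) \<le> e \<and>
        (\<forall>x y. U (x + y) = U x + U y) \<and> (\<forall>a x. U (a *\<^sub>C x) = a * U x) \<and> (\<forall>w. cmod (U w) \<le> cnorm J w) \<and>
        (\<forall>c\<in>C (Suc p). cmod (U (d c)) \<le> e * cnorm J c) \<and> 1 / 2 \<le> cmod (U z)"
        by (intro bexI[of _ z] exI[of _ U]) auto
    qed
    then show False using nd by blast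
  qed
  then obtain K where K: "0 \<le> K"
    "\<And>x c. x \<in> C p \<Longrightarrow> K * cnorm J (d x) < c \<Longrightarrow> \<exists>b\<in>?B. cnorm J (x - b) < c" by blast
  have "exact_at p"
    unfolding exact_at_def
  proof (intro ballI impI)
    fix c assume c: "c \<in> C p" "d c = 0"
    have "\<exists>b\<in>?B. cnorm J (c - b) < inverse (real (Suc n))" for n
      using K(2)[OF c(1), of "inverse (real (Suc n))"] c(2) by (simp add: cnormD)
    then obtain b where b: "\<And>n. b n \<in> ?B" "\<And>n. cnorm J (c - b n) < inverse (real (Suc n))" by metis
    show "c \<in> ?B"
    proof (rule closed_limit_mem[OF finJ cl b(1)])
      show "?B \<subseteq> supp_on J" "c \<in> supp_on J" using BC C_supp c by auto
      show "(\<lambda>n. cnorm J (b n - c)) \<longlonglongrightarrow> 0"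
      proof (rule Lim_null_comparison[OF always_eventually LIMSEQ_inverse_real_of_nat], rule allI)
        fix n
        have "cnorm J (b n - c) = cnorm J (c - b n)" using cnormD(4)[of J "c - b n"] by simp
        then show "norm (cnorm J (b n - c)) \<le> inverse (real (Suc n))" using b(2)[of n] by (simp add: cnormD)
      qed
    qed
  qed
  moreover have "closed (d ` C p)"
  proof (rule closed_if_limits[OF finJ])
    show dC: "d ` C p \<subseteq> supp_on J" using dC_supp by blast
    fix y l assume y: "\<And>n. y n \<in> d ` C p" and l: "l \<in> supp_on J" "(\<lambda>n. cnorm J (y n - l)) \<longlonglongrightarrow> 0"
    \<comment> \<open>The closure in norm of the outgoing range.\<close>
    define Z where "Z = {z \<in> supp_on J. \<forall>e>0. \<exists>x\<in>C p. cnorm J (z - d x) < e}"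
    have "l \<in> Z"
      unfolding Z_def
    proof (intro CollectI conjI l(1) allI impI)
      fix e :: real assume "0 < e"
      then have "eventually (\<lambda>n. cnorm J (y n - l) < e) sequentially" by (rule order_tendstoD(2)[OF l(2)])
      then obtain n where "cnorm J (y n - l) < e" by (auto simp: eventually_sequentially)
      moreover obtain x where "x \<in> C p" "y n = d x" using y by blast
      moreover from this have "cnorm J (l - d x) < e" using cnormD(4)[of J "y n - l"] calculation by simp
      ultimately show "\<exists>x\<in>C p. cnorm J (l - d x) < e" by blast
    qed
    \<comment> \<open>An approximate preimage x0 may be large, but a boundary can be subtracted from
      it without changing \<open>d x0\<close>. As \<open>d x0\<close> has norm at most twice that of
      z, the remaining norm can be pushed below any bound above 2K times that of z; 2K + 1 is such a
      bound.\<close>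
    have step: "\<exists>x\<in>C p. cnorm J x \<le> (2 * K + 1) * cnorm J z \<and> cnorm J (z - d x) \<le> cnorm J z / 2" if z: "z \<in> Z" for z
    proof (cases "cnorm J z = 0")
      case True
      then show ?thesis using CD by (intro bexI[of _ 0]) (auto simp: lD cnormD)
    next
      case False
      then have pos: "0 < cnorm J z" using cnormD(6)[of J z] by linarith
      then obtain x0 where x0: "x0 \<in> C p" "cnorm J (z - d x0) < cnorm J z / 2"
        using z half_gt_zero unfolding Z_def by blast
      have "cnorm J (d x0) \<le> 2 * cnorm J z" using cnormD(5)[of J z "z - d x0"] x0(2) pos by simp
      then have "K * cnorm J (d x0) \<le> K * (2 * cnorm J z)" using K(1) by (rule mult_left_mono)
      then have "K * cnorm J (d x0) < (2 * K + 1) * cnorm J z" using pos by (simp add: algebra_simps)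
      then obtain b where b: "b \<in> ?B" "cnorm J (x0 - b) < (2 * K + 1) * cnorm J z" using K(2)[OF x0(1)] by blast
      have "d (x0 - b) = d x0" by (simp add: lD d0[OF b(1)])
      then show ?thesis using b x0 BC CD(4) by (intro bexI[of _ "x0 - b"]) auto
    qed
    have "\<exists>x\<in>C p. cnorm J x \<le> 2 * (2 * K + 1) * cnorm J l \<and> cnorm J (l - d x) = 0"
    proof (rule successive_approximation[OF cseminorm_cnorm cseminorm_cnorm subspace_chains complete_C lin _ _ _ step \<open>l \<in> Z\<close>])
      show "z - d x \<in> Z" if z: "z \<in> Z" and x: "x \<in> C p" for z x
        unfolding Z_def
      proof (intro CollectI conjI allI impI)
        show "z - d x \<in> supp_on J" using z dC_supp[OF x] csubspaceD(4)[OF subspace_supp_on] by (auto simp: Z_def)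
        fix e :: real assume "0 < e"
        then obtain x' where x': "x' \<in> C p" "cnorm J (z - d x') < e" using z by (auto simp: Z_def)
        then show "\<exists>x'\<in>C p. cnorm J (z - d x - d x') < e"
          using x CD(4) by (intro bexI[of _ "x' - x"]) (auto simp: lD)
      qed
    qed (use B C_supp K in auto)
    then obtain x where x: "x \<in> C p" "cnorm J (l - d x) = 0" by blast
    then have "l - d x = 0"
      using csubspaceD(4)[OF subspace_supp_on l(1) dC_supp[OF x(1)]] by (intro cnorm_eq_0[OF finJ])
    then show "l \<in> d ` C p" using x by auto
  qed
  ultimately show ?thesis by (simp add: strict_at_def)
qed

text \<open>The open mapping theorem is applied twice: to \<open>d\<close> from \<open>C p\<close>
  onto its closed range, and to \<open>d\<close> from \<open>C (Suc p)\<close> onto the kernel in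
  \<open>C p\<close>. The larger constant serves for both.\<close>

lemma strict_bounds:
  assumes "strict_at p"
  obtains K where "0 \<le> K"
    "\<And>y. y \<in> d ` C p \<Longrightarrow> \<exists>w\<in>C p. d w = y \<and> cnorm J w \<le> K * cnorm J y"
    "\<And>z. z \<in> C p \<Longrightarrow> d z = 0 \<Longrightarrow> \<exists>t\<in>C (Suc p). d t = z \<and> cnorm J t \<le> K * cnorm J z"
proof -
  obtain B where B: "\<And>c. c \<in> supp_on J \<Longrightarrow> cnorm J (d c) \<le> B * cnorm J c" using bounded by blast
  have ex: "exact_at p" and cl: "closed (d ` C p)" using assms by (auto simp: strict_at_def)
  have d0: "d x = 0" if "x \<in> C q" "cnorm J (d x) = 0" for x q
    using cnorm_eq_0[OF finJ dC_supp] that by blast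
  have B': "cnorm J (d x) \<le> B * cnorm J x" if "x \<in> C q" for x q using B C_supp that by blast
  have "\<exists>K\<ge>0. \<forall>z\<in>d ` C p. \<exists>x\<in>C p. d x = z \<and> cnorm J x \<le> K * cnorm J z"
    using dC_supp d0 B'
    by (intro open_mapping_seminorm[where C=B, OF cseminorm_cnorm cseminorm_cnorm subspace_chains complete_C subspace_image
          closed_complete[OF finJ cl] _ lin refl]) auto
  then obtain K1 where K1: "0 \<le> K1" "\<And>z. z \<in> d ` C p \<Longrightarrow> \<exists>x\<in>C p. d x = z \<and> cnorm J x \<le> K1 * cnorm J z" by blast
  have im: "d ` C (Suc p) = {c \<in> C p. d c = 0}" using ex d_deg dd[OF C_supp] by (auto simp: exact_at_def)
  have "\<exists>K\<ge>0. \<forall>z\<in>{c \<in> C p. d c = 0}. \<exists>x\<in>C (Suc p). d x = z \<and> cnorm J x \<le> K * cnorm J z"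
    using B' cnorm_eq_0[OF finJ C_supp]
    by (intro open_mapping_seminorm[where C=B, OF cseminorm_cnorm cseminorm_cnorm subspace_chains complete_C subspace_kernel
          closed_complete[OF finJ closed_kernel] _ lin im]) (auto intro: C_supp)
  then obtain K2 where K2: "0 \<le> K2" "\<And>z. z \<in> {c \<in> C p. d c = 0} \<Longrightarrow> \<exists>x\<in>C (Suc p). d x = z \<and> cnorm J x \<le> K2 * cnorm J z" by blast
  have le: "K1 * cnorm J z \<le> max K1 K2 * cnorm J z" "K2 * cnorm J z \<le> max K1 K2 * cnorm J z" for z :: "'j \<Rightarrow> 'x"
    by (intro mult_right_mono; simp add: cnormD)+
  show ?thesis
  proof (rule that[of "max K1 K2"])
    show "0 \<le> max K1 K2" using K1(1) by simp
    show "\<exists>w\<in>C p. d w = y \<and> cnorm J w \<le> max K1 K2 * cnorm J y" if "y \<in> d ` C p" for y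
      using K1(2)[OF that] le(1)[of y] order_trans by blast
    show "\<exists>t\<in>C (Suc p). d t = z \<and> cnorm J t \<le> max K1 K2 * cnorm J z" if "z \<in> C p" "d z = 0" for z
    proof -
      have "z \<in> {c \<in> C p. d c = 0}" using that by blast
      from K2(2)[OF this] show ?thesis using le(2)[of z] order_trans by blast
    qed
  qed
qed

end

section \<open>Bounded operators and their matrices\<close>

definition bop :: "'j set \<Rightarrow> (('j \<Rightarrow> 'x::complex_banach) \<Rightarrow> 'j \<Rightarrow> 'x) \<Rightarrow> bool"
  where "bop J F \<longleftrightarrow> clinear F \<and> (\<forall>c\<in>supp_on J. F c \<in> supp_on J) \<and>
    (\<exists>B. \<forall>c\<in>supp_on J. cnorm J (F c) \<le> B * cnorm J c)"

lemma bopD: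
  assumes "bop J F"
  shows "clinear F" "c \<in> supp_on J \<Longrightarrow> F c \<in> supp_on J"
    "\<exists>B\<ge>0. \<forall>c\<in>supp_on J. cnorm J (F c) \<le> B * cnorm J c"
proof -
  show "clinear F" "c \<in> supp_on J \<Longrightarrow> F c \<in> supp_on J" using assms by (auto simp: bop_def)
  obtain B where B: "\<And>c. c \<in> supp_on J \<Longrightarrow> cnorm J (F c) \<le> B * cnorm J c" using assms by (auto simp: bop_def)
  have "cnorm J (F c) \<le> max 0 B * cnorm J c" if "c \<in> supp_on J" for c
    using B[OF that] mult_right_mono[of B "max 0 B" "cnorm J c"] by (simp add: cnormD)
  then show "\<exists>B\<ge>0. \<forall>c\<in>supp_on J. cnorm J (F c) \<le> B * cnorm J c" by (intro exI[of _ "max 0 B"]) auto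
qed

lemma bop_compose: "bop J F \<Longrightarrow> bop J G \<Longrightarrow> bop J (\<lambda>c. F (G c))"
proof -
  assume F: "bop J F" and G: "bop J G"
  obtain B where B: "0 \<le> B" "\<And>c. c \<in> supp_on J \<Longrightarrow> cnorm J (F c) \<le> B * cnorm J c" using bopD(3)[OF F] by blast
  obtain B' where B': "0 \<le> B'" "\<And>c. c \<in> supp_on J \<Longrightarrow> cnorm J (G c) \<le> B' * cnorm J c" using bopD(3)[OF G] by blast
  have "cnorm J (F (G c)) \<le> (B * B') * cnorm J c" if "c \<in> supp_on J" for c
    using B(2)[OF bopD(2)[OF G that]] mult_left_mono[OF B'(2)[OF that] B(1)] by (simp add: mult.assoc)
  moreover have "clinear (\<lambda>c. F (G c))"
    by (rule clinearI) (simp_all add: clinearD[OF bopD(1)[OF F]] clinearD[OF bopD(1)[OF G]])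
  ultimately show ?thesis unfolding bop_def using bopD(2)[OF F] bopD(2)[OF G] by blast
qed

lemma bop_add: "bop J F \<Longrightarrow> bop J G \<Longrightarrow> bop J (\<lambda>c. F c + G c)"
proof -
  assume F: "bop J F" and G: "bop J G"
  obtain B where B: "0 \<le> B" "\<And>c. c \<in> supp_on J \<Longrightarrow> cnorm J (F c) \<le> B * cnorm J c" using bopD(3)[OF F] by blast
  obtain B' where B': "0 \<le> B'" "\<And>c. c \<in> supp_on J \<Longrightarrow> cnorm J (G c) \<le> B' * cnorm J c" using bopD(3)[OF G] by blast
  have "cnorm J (F c + G c) \<le> (B + B') * cnorm J c" if "c \<in> supp_on J" for c
    using B(2)[OF that] B'(2)[OF that] cnormD(1)[of J "F c" "G c"] by (simp add: algebra_simps)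
  moreover have "clinear (\<lambda>c. F c + G c)"
    by (rule clinearI) (simp_all add: clinearD[OF bopD(1)[OF F]] clinearD[OF bopD(1)[OF G]] scaleC_add_right)
  ultimately show ?thesis unfolding bop_def using bopD(2)[OF F] bopD(2)[OF G] csubspaceD(2)[OF subspace_supp_on] by blast
qed

lemma bop_uminus: "bop J F \<Longrightarrow> bop J (\<lambda>c. - F c)"
proof -
  assume F: "bop J F"
  have "clinear (\<lambda>c. - F c)" by (rule clinearI) (simp_all add: clinearD[OF bopD(1)[OF F]])
  then show ?thesis using bopD[OF F] csubspaceD(5)[OF subspace_supp_on] unfolding bop_def cnormD(4) by blast
qed

lemma bop_diff: "bop J F \<Longrightarrow> bop J G \<Longrightarrow> bop J (\<lambda>c. F c - G c)"
  using bop_add[OF _ bop_uminus, of J F G] by simp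

lemma bop_id: "bop J (\<lambda>c. c)"
  unfolding bop_def by (auto intro!: clinearI exI[of _ 1])

lemma bop_zero: "bop J (\<lambda>c. 0)"
  unfolding bop_def by (auto intro!: clinearI exI[of _ 0] simp: cnormD csubspaceD[OF subspace_supp_on])

definition restr :: "('j \<Rightarrow> bool) \<Rightarrow> ('j \<Rightarrow> 'x::zero) \<Rightarrow> 'j \<Rightarrow> 'x"
  where "restr P c = (\<lambda>j. if P j then c j else 0)"

lemma bop_restr: "bop J (restr P :: ('j \<Rightarrow> 'x::complex_banach) \<Rightarrow> _)"
proof -
  have "cnorm J (restr P c) \<le> 1 * cnorm J c" for c :: "'j \<Rightarrow> 'x"
    by (auto simp: cnorm_def restr_def intro!: sum_mono)
  moreover have "clinear (restr P :: ('j \<Rightarrow> 'x) \<Rightarrow> _)"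
    by (rule clinearI) (auto simp: restr_def fun_eq_iff fun_ops)
  ultimately show ?thesis unfolding bop_def by (fastforce simp: restr_def supp_on_def)
qed

lemma cblinfuns_intros [intro, simp]:
  "0 \<in> cblinfuns" "id_blinfun \<in> cblinfuns" "T \<in> cblinfuns \<Longrightarrow> S \<in> cblinfuns \<Longrightarrow> T + S \<in> cblinfuns"
  "T \<in> cblinfuns \<Longrightarrow> S \<in> cblinfuns \<Longrightarrow> T - S \<in> cblinfuns" "T \<in> cblinfuns \<Longrightarrow> a *\<^sub>C T \<in> cblinfuns"
  "U \<in> cblinfuns \<Longrightarrow> V \<in> cblinfuns \<Longrightarrow> U o\<^sub>L V \<in> cblinfuns"
  by (auto simp: cblinfuns_def blinfun.add_left blinfun.diff_left scaleC_add_right scaleC_diff_right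
      scaleC_blinfun.rep_eq scaleC_scaleC mult.commute)

lemma cblinfuns_sum [intro, simp]: "(\<And>i. i \<in> I \<Longrightarrow> f i \<in> cblinfuns) \<Longrightarrow> (\<Sum>i\<in>I. f i) \<in> cblinfuns"
  by (induction I rule: infinite_finite_induct) auto

text \<open>Operators on chains as matrices whose entries are operators on the coefficient space; in
  this form they can be tensored with the identity entry by entry.\<close>

definition mop :: "'j set \<Rightarrow> ('j \<Rightarrow> 'j \<Rightarrow> ('x::complex_banach \<Rightarrow>\<^sub>L 'x)) \<Rightarrow> ('j \<Rightarrow> 'x) \<Rightarrow> 'j \<Rightarrow> 'x"
  where "mop J A c = (\<lambda>R. if R \<in> J then \<Sum>S\<in>J. blinfun_apply (A R S) (c S) else 0)"

definition mm :: "'j set \<Rightarrow> ('j \<Rightarrow> 'j \<Rightarrow> ('x::complex_banach \<Rightarrow>\<^sub>L 'x)) \<Rightarrow> ('j \<Rightarrow> 'j \<Rightarrow> ('x \<Rightarrow>\<^sub>L 'x)) \<Rightarrow> 'j \<Rightarrow> 'j \<Rightarrow> ('x \<Rightarrow>\<^sub>L 'x)"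
  where "mm J A B = (\<lambda>R T. \<Sum>S\<in>J. A R S o\<^sub>L B S T)"

definition mat_of :: "'j set \<Rightarrow> (('j \<Rightarrow> 'x::complex_banach) \<Rightarrow> 'j \<Rightarrow> 'x) \<Rightarrow> 'j \<Rightarrow> 'j \<Rightarrow> ('x \<Rightarrow>\<^sub>L 'x)"
  where "mat_of J F = (\<lambda>R S. if R \<in> J \<and> S \<in> J then Blinfun (\<lambda>x. F (single S x) R) else 0)"

lemma single_supp: "S \<in> J \<Longrightarrow> single S x \<in> supp_on J"
  by (auto simp: supp_on_def single_def)

lemma cnorm_single: "finite J \<Longrightarrow> S \<in> J \<Longrightarrow> cnorm J (single S x) = norm x"
  by (simp add: cnorm_def single_def if_distrib sum.delta cong: if_cong)

lemma supp_on_expand: "finite J \<Longrightarrow> c \<in> supp_on J \<Longrightarrow> c = (\<Sum>S\<in>J. single S (c S))"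
  by (auto simp: fun_eq_iff fun_ops single_def supp_on_def if_distrib sum.delta)

lemma mat_of_apply:
  assumes J: "finite J" and F: "bop J F" and RS: "R \<in> J" "S \<in> J"
  shows "blinfun_apply (mat_of J F R S) x = F (single S x) R"
proof -
  obtain B where B: "0 \<le> B" "\<And>c. c \<in> supp_on J \<Longrightarrow> cnorm J (F c) \<le> B * cnorm J c" using bopD(3)[OF F] by blast
  note FD = clinearD[OF bopD(1)[OF F]]
  have "bounded_linear (\<lambda>x. F (single S x) R)"
  proof (rule bounded_linear_intro[where K=B])
    show "F (single S (x + y)) R = F (single S x) R + F (single S y) R" for x y
      by (simp add: clinearD[OF single_lin] FD fun_ops)
    show "F (single S (r *\<^sub>R x)) R = r *\<^sub>R F (single S x) R" for r x
      by (simp add: clinearD[OF single_lin] FD fun_ops scaleR_scaleC)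
    show "norm (F (single S x) R) \<le> norm x * B" for x
      using norm_le_cnorm[OF J bopD(2)[OF F single_supp[OF RS(2)]], of x R] B(2)[OF single_supp[OF RS(2)], of x]
      by (simp add: cnorm_single[OF J RS(2)] mult.commute)
  qed
  then show ?thesis using RS by (simp add: mat_of_def bounded_linear_Blinfun_apply)
qed

lemma mat_of_cblinfun:
  assumes J: "finite J" and F: "bop J F"
  shows "mat_of J F R S \<in> cblinfuns"
proof (cases "R \<in> J \<and> S \<in> J")
  case True
  then show ?thesis
    by (auto simp: cblinfuns_def mat_of_apply[OF J F] clinearD[OF single_lin] clinearD[OF bopD(1)[OF F]] fun_ops)
next
  case False
  then have "mat_of J F R S = 0" by (simp only: mat_of_def if_False)
  then show ?thesis by simp
qed

lemma mop_mat_of: "finite J \<Longrightarrow> bop J F \<Longrightarrow> c \<in> supp_on J \<Longrightarrow> mop J (mat_of J F) c = F c"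
proof -
  assume J: "finite J" and F: "bop J F" and c: "c \<in> supp_on J"
  have "F c = (\<Sum>S\<in>J. F (single S (c S)))"
    by (subst supp_on_expand[OF J c]) (simp add: clinearD[OF bopD(1)[OF F]])
  then have "F c R = mop J (mat_of J F) c R" if "R \<in> J" for R
    using that by (simp add: mop_def mat_of_apply[OF J F] fun_ops)
  moreover have "F c R = 0" if "R \<notin> J" for R using bopD(2)[OF F c] that by (auto simp: supp_on_def)
  ultimately show ?thesis by (auto simp: fun_eq_iff mop_def)
qed

lemma mop_mm: "mop J (mm J A B) c = mop J A (mop J B c)"
proof
  fix R
  have "(\<Sum>T\<in>J. \<Sum>S\<in>J. blinfun_apply (A R S) (blinfun_apply (B S T) (c T))) =
    (\<Sum>S\<in>J. \<Sum>T\<in>J. blinfun_apply (A R S) (blinfun_apply (B S T) (c T)))" by (rule sum.swap)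
  then show "mop J (mm J A B) c R = mop J A (mop J B c) R"
    by (simp add: mop_def mm_def blinfun.sum_left blinfun.sum_right)
qed

lemma mop_single: "finite J \<Longrightarrow> R \<in> J \<Longrightarrow> S \<in> J \<Longrightarrow> mop J A (single S x) R = blinfun_apply (A R S) x"
  by (simp add: mop_def single_def if_distrib[of "blinfun_apply _"] sum.delta blinfun.zero_right cong: if_cong)

lemma mop_bop:
  assumes J: "finite J" and A: "\<And>R S. A R S \<in> cblinfuns"
  shows "bop J (mop J A)"
proof -
  have "clinear (mop J A)"
    by (rule clinearI) (auto simp: mop_def fun_eq_iff fun_ops blinfun.add_right sum.distrib scaleC_sum_right cblinfunsD[OF A])
  moreover have "mop J A c \<in> supp_on J" for c by (auto simp: mop_def supp_on_def)
  moreover have "cnorm J (mop J A c) \<le> (\<Sum>R\<in>J. \<Sum>S\<in>J. norm (A R S)) * cnorm J c" if "c \<in> supp_on J" for c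
  proof -
    have "norm (mop J A c R) \<le> (\<Sum>S\<in>J. norm (A R S)) * cnorm J c" if "R \<in> J" for R
    proof -
      have "norm (mop J A c R) \<le> (\<Sum>S\<in>J. norm (blinfun_apply (A R S) (c S)))"
        using that by (simp add: mop_def norm_sum)
      also have "\<dots> \<le> (\<Sum>S\<in>J. norm (A R S) * cnorm J c)"
      proof (rule sum_mono)
        fix S
        show "norm (blinfun_apply (A R S) (c S)) \<le> norm (A R S) * cnorm J c"
          using norm_blinfun[of "A R S" "c S"] mult_left_mono[OF norm_le_cnorm[OF J \<open>c \<in> supp_on J\<close>, of S] norm_ge_zero[of "A R S"]]
          by linarith
      qed
      finally show ?thesis by (simp add: sum_distrib_right)
    qed
    then have "cnorm J (mop J A c) \<le> (\<Sum>R\<in>J. (\<Sum>S\<in>J. norm (A R S)) * cnorm J c)"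
      unfolding cnorm_def[of J "mop J A c"] by (intro sum_mono)
    then show ?thesis by (simp add: sum_distrib_right)
  qed
  ultimately show ?thesis unfolding bop_def by blast
qed

lemma mop_zero_entries:
  assumes "finite J" "\<And>c. c \<in> supp_on J \<Longrightarrow> mop J A c = 0" "R \<in> J" "S \<in> J"
  shows "A R S = 0"
proof (rule blinfun_eqI)
  fix x
  show "blinfun_apply (A R S) x = blinfun_apply 0 x"
    using mop_single[OF assms(1,3,4), of A x] assms(2)[OF single_supp[OF assms(4)], of x] by (simp add: fun_ops)
qed

section \<open>Splittings\<close>

context banach_complex
begin

definition hop :: "(('j \<Rightarrow> 'x) \<Rightarrow> 'j \<Rightarrow> 'x) \<Rightarrow> bool"
  where "hop h \<longleftrightarrow> bop J h \<and> (\<forall>q. \<forall>c\<in>C q. h c \<in> C (Suc q))"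

text \<open>As in \<open>koszul_split\<close>, the two operators are unrelated, since only one
  degree is concerned. Each is extended to all degrees so that operators can be composed
  freely.\<close>

definition split_at :: "nat \<Rightarrow> bool"
  where "split_at p \<longleftrightarrow> (\<exists>h h'. hop h \<and> hop h' \<and> (\<forall>c\<in>C p. d (h c) + h' (d c) = c))"

lemma bop_d: "bop J d"
proof -
  have "d c \<in> supp_on J" if "c \<in> supp_on J" for c
  proof -
    have "d c = (\<Sum>S\<in>J. d (single S (c S)))" by (subst supp_on_expand[OF finJ that]) (simp add: lD)
    moreover have "d (single S x) \<in> supp_on J" if "S \<in> J" for S x
      using that by (intro dC_supp[of _ "deg S"]) (auto simp: chains_def single_def split: if_splits)
    ultimately show ?thesis by (auto intro!: complex_vector.subspace_sum subspace_supp_on)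
  qed
  then show ?thesis using lin bounded by (simp add: bop_def)
qed

lemma restr_deg: "c \<in> C q \<Longrightarrow> restr (\<lambda>j. P (deg j)) c = (if P q then c else 0)"
  by (auto simp: restr_def chains_def fun_eq_iff fun_ops)

text \<open>Splittings of single degrees are glued into one homotopy by induction. In the new degree
  m the old value is replaced by k(c - h(d c)): the homotopy identity one degree lower makes c - h(d
  c) a cycle, and on cycles d k is the identity.\<close>

lemma exists_homotopy_below:
  assumes "\<And>q. q < m \<Longrightarrow> split_at q"
  shows "\<exists>h. hop h \<and> (\<forall>q<m. \<forall>c\<in>C q. d (h c) + h (d c) = c)"
  using assms
proof (induction m)
  case 0
  have "hop (\<lambda>c. 0)" by (auto simp: hop_def bop_zero CD)
  then show ?case by blast
next
  case (Suc m)
  then obtain h where h: "hop h" "\<And>q c. q < m \<Longrightarrow> c \<in> C q \<Longrightarrow> d (h c) + h (d c) = c" by (meson less_SucI)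
  obtain k k' where k: "hop k" "hop k'" "\<And>c. c \<in> C m \<Longrightarrow> d (k c) + k' (d c) = c"
    using Suc.prems[of m] by (auto simp: split_at_def)
  have hb: "bop J h" and kb: "bop J k" and kb': "bop J k'" using h k by (auto simp: hop_def)
  note hD = clinearD[OF bopD(1)[OF hb]] and kD = clinearD[OF bopD(1)[OF kb]] and kD' = clinearD[OF bopD(1)[OF kb']]
  let ?lt = "restr (\<lambda>j. deg j < m) :: ('j \<Rightarrow> 'x) \<Rightarrow> _" and ?eq = "restr (\<lambda>j. deg j = m) :: ('j \<Rightarrow> 'x) \<Rightarrow> _"
  define H where "H = (\<lambda>c. h (?lt c) + k (?eq c - h (d (?eq c))))"
  have lt: "?lt c = (if q < m then c else 0)" and eq: "?eq c = (if q = m then c else 0)" if "c \<in> C q" for c q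
    using restr_deg[OF that, of "\<lambda>q. q < m"] restr_deg[OF that, of "\<lambda>q. q = m"] by auto
  have dC: "d c \<in> C (q - 1) \<and> (q = 0 \<longrightarrow> d c = 0)" if "c \<in> C q" for c q
    using that d_deg d_0 CD(1) by (cases q) auto
  have Hlow: "H c = h c" if "c \<in> C q" "q < m" for c q
    using that by (simp add: H_def lt[OF that(1)] eq[OF that(1)] lD hD kD)
  have H0: "H 0 = 0" by (simp add: H_def clinearD(3)[OF bopD(1)[OF bop_restr]] lD hD kD)
  have "bop J H"
    unfolding H_def
    by (intro bop_add bop_diff bop_compose[OF hb] bop_compose[OF kb] bop_compose[OF bop_d] bop_restr)
  moreover have "H c \<in> C (Suc q)" if c: "c \<in> C q" for c q
  proof -
    have "h (d c) \<in> C q"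
    proof (cases q)
      case 0 then show ?thesis using dC[OF c] CD(1) by (simp add: hD)
    next
      case (Suc q') then show ?thesis using d_deg c h(1) by (auto simp: hop_def)
    qed
    then have "k (h (d c)) \<in> C (Suc q)" using k(1) by (auto simp: hop_def)
    then have "k c - k (h (d c)) \<in> C (Suc q)" using c k(1) by (intro CD(4)) (auto simp: hop_def)
    then show ?thesis using c h(1) CD(1)
      by (auto simp: H_def lt[OF c] eq[OF c] hop_def lD hD kD)
  qed
  moreover have "d (H c) + H (d c) = c" if q: "q < Suc m" and c: "c \<in> C q" for q c
  proof (cases "q < m")
    case True
    have "H (d c) = h (d c)" using Hlow[of "d c" "q - 1"] dC[OF c] True by simp
    then show ?thesis using h(2)[OF True c] Hlow[OF c True] by simp
  next
    case False
    with q have qm: "q = m" by simp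
    have Hd: "H (d c) = h (d c)"
    proof (cases m)
      case 0 then show ?thesis using dC[OF c] qm by (simp add: H0 hD)
    next
      case (Suc m') then show ?thesis using Hlow[of "d c" m'] dC[OF c] qm by simp
    qed
    have dhd: "d (h (d c)) = d c"
    proof (cases m)
      case 0 then show ?thesis using dC[OF c] qm by (simp add: hD lD)
    next
      case (Suc m')
      then have "d (h (d c)) + h (d (d c)) = d c" using dC[OF c] qm by (intro h(2)[of m']) auto
      then show ?thesis using dd[OF C_supp[OF c]] by (simp add: hD)
    qed
    have hdc: "c - h (d c) \<in> C m"
    proof (cases m)
      case 0 then show ?thesis using dC[OF c] qm c by (simp add: hD)
    next
      case (Suc m') then show ?thesis using dC[OF c] qm c h(1) by (intro CD(4)) (auto simp: hop_def)
    qed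
    have "d (k (c - h (d c))) = c - h (d c)"
      using k(3)[OF hdc] dhd by (simp add: lD kD')
    moreover have "H c = k (c - h (d c))" using qm by (simp add: H_def lt[OF c] eq[OF c] hD)
    ultimately show ?thesis using Hd by simp
  qed
  ultimately show ?case by (auto simp: hop_def intro!: exI[of _ H])
qed

text \<open>Descending induction from a degree beyond all of \<open>J\<close>, where there are no
  chains. The homotopy h found so far is already fixed in degree m, so the identity in degree m can
  only be achieved by its value in degree m - 1.\<close>

lemma exists_homotopy_above:
  assumes "\<And>q. m \<le> q \<Longrightarrow> split_at q"
  shows "\<exists>h. hop h \<and> (\<forall>q\<ge>m. \<forall>c\<in>C q. d (h c) + h (d c) = c)"
proof -
  define N where "N = Suc (Max (insert 0 (deg ` J)))"
  have big: "C q = {0}" if "N \<le> q" for q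
  proof -
    have "deg j < N" if "j \<in> J" for j using finJ that by (auto simp: N_def less_Suc_eq_le)
    then show ?thesis using that by (fastforce simp: chains_def fun_eq_iff fun_ops)
  qed
  define i where "i = N - m"
  have "\<exists>h. hop h \<and> (\<forall>q\<ge>m. \<forall>c\<in>C q. d (h c) + h (d c) = c)" if "N \<le> m + i" "\<And>q. m \<le> q \<Longrightarrow> split_at q" for i m
    using that
  proof (induction i arbitrary: m)
    case 0
    have "hop (\<lambda>c. 0)" by (auto simp: hop_def bop_zero CD)
    moreover have "c = 0" if "m \<le> q" "c \<in> C q" for q c using that 0 big[of q] by auto
    ultimately show ?case by (intro exI[of _ "\<lambda>c. 0"]) (auto simp: lD)
  next
    case (Suc i)
    have "\<exists>h. hop h \<and> (\<forall>q\<ge>Suc m. \<forall>c\<in>C q. d (h c) + h (d c) = c)"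
      by (rule Suc.IH) (use Suc.prems in auto)
    then obtain h where h: "hop h" "\<And>q c. Suc m \<le> q \<Longrightarrow> c \<in> C q \<Longrightarrow> d (h c) + h (d c) = c" by blast
    have "\<exists>k k'. hop k \<and> hop k' \<and> (\<forall>c\<in>C m. d (k c) + k' (d c) = c)"
      using Suc.prems(2)[OF order_refl] unfolding split_at_def .
    then obtain k k' where k: "hop k" "hop k'" and k3: "\<forall>c\<in>C m. d (k c) + k' (d c) = c"
      by (elim exE conjE)
    have hb: "bop J h" and kb: "bop J k" and kb': "bop J k'" using h k by (auto simp: hop_def)
    note hD = clinearD[OF bopD(1)[OF hb]] and kD' = clinearD[OF bopD(1)[OF kb']]
    let ?ge = "restr (\<lambda>j. m \<le> deg j) :: ('j \<Rightarrow> 'x) \<Rightarrow> _" and ?pr = "restr (\<lambda>j. Suc (deg j) = m) :: ('j \<Rightarrow> 'x) \<Rightarrow> _"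
    \<comment> \<open>Using k' alone in degree m - 1 would leave the error d h c - d k c. The
      correction - d h k' removes it, because the identity for h in degree m + 1 gives d h d k = d k
      on degree m.\<close>
    define H where "H = (\<lambda>c. h (?ge c) + (k' (?pr c) - d (h (k' (?pr c)))))"
    have ge: "?ge c = (if m \<le> q then c else 0)" and pr: "?pr c = (if Suc q = m then c else 0)" if "c \<in> C q" for c q
      using restr_deg[OF that, of "\<lambda>q. m \<le> q"] restr_deg[OF that, of "\<lambda>q. Suc q = m"] by auto
    have dC: "d c \<in> C (q - 1) \<and> (q = 0 \<longrightarrow> d c = 0)" if "c \<in> C q" for c q
      using that d_deg d_0 CD(1) by (cases q) auto
    have Hhigh: "H c = h c" if "c \<in> C q" "m \<le> q" for c q
      using that by (simp add: H_def ge[OF that(1)] pr[OF that(1)] lD hD kD')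
    have "bop J H"
      unfolding H_def
      by (intro bop_add bop_diff bop_compose[OF hb] bop_compose[OF kb'] bop_compose[OF bop_d] bop_restr)
    moreover have "H c \<in> C (Suc q)" if c: "c \<in> C q" for c q
    proof -
      have "k' c - d (h (k' c)) \<in> C (Suc q)" using c h(1) k(2) d_deg by (intro CD(4)) (auto simp: hop_def)
      then show ?thesis using c h(1) CD(1)
        by (auto simp: H_def ge[OF c] pr[OF c] hop_def lD hD kD')
    qed
    moreover have "d (H c) + H (d c) = c" if q: "m \<le> q" and c: "c \<in> C q" for q c
    proof (cases "m = q")
      case False
      have "H (d c) = h (d c)" using Hhigh[of "d c" "q - 1"] dC[OF c] False q by simp
      then show ?thesis using h(2)[of q c] Hhigh[OF c] c q False by simp
    next
      case True
      have Hd: "H (d c) = k' (d c) - d (h (k' (d c)))"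
      proof (cases m)
        case 0
        have "H 0 = 0" by (simp add: H_def clinearD(3)[OF bopD(1)[OF bop_restr]] lD hD kD')
        then show ?thesis using dC[OF c] 0 True by (simp add: hD kD' lD)
      next
        case (Suc m')
        then have dc: "d c \<in> C m'" using dC[OF c] True by simp
        have "?ge (d c) = 0" "?pr (d c) = d c" using ge[OF dc] pr[OF dc] Suc by auto
        then show ?thesis by (simp add: H_def hD)
      qed
      have kc: "k c \<in> C (Suc m)" using k(1) c True by (auto simp: hop_def)
      have "d (h (d (k c))) = d (k c - d (h (k c)))"
        using h(2)[OF order_refl kc] by (metis add_diff_cancel_left')
      also have "\<dots> = d (k c)"
        using dd[of "h (k c)"] bopD(2)[OF hb C_supp[OF kc]] by (simp add: lD)
      finally have dhdk: "d (h (d (k c))) = d (k c)" .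
      have "k' (d c) = c - d (k c)" using bspec[OF k3, of c] c True by (metis add_diff_cancel_left')
      then show ?thesis
        using Hhigh[OF c] True by (simp add: Hd lD hD dhdk)
    qed
    ultimately show ?case by (auto simp: hop_def intro!: exI[of _ H])
  qed
  from this[of m "N - m"] show ?thesis using assms by auto
qed

end

section \<open>Tensor products of complexes\<close>

locale matrix_complex =
  fixes J :: "'j set" and deg :: "'j \<Rightarrow> nat" and A :: "'j \<Rightarrow> 'j \<Rightarrow> ('x::complex_banach \<Rightarrow>\<^sub>L 'x)"
  assumes finJ: "finite J" and cblin: "\<And>R S. A R S \<in> cblinfuns"
    and entry_deg: "\<And>R S. A R S \<noteq> 0 \<Longrightarrow> R \<in> J \<and> S \<in> J \<and> deg S = Suc (deg R)"
    and AA: "\<And>c. mop J A (mop J A c) = 0"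
begin

sublocale banach_complex J deg "mop J A"
proof (rule banach_complex.intro)
  show "finite J" by (rule finJ)
  have mb: "bop J (mop J A)" by (rule mop_bop[OF finJ cblin])
  show "clinear (mop J A)" using mb by (rule bopD)
  show "\<exists>C. \<forall>c\<in>supp_on J. cnorm J (mop J A c) \<le> C * cnorm J c" using bopD(3)[OF mb] by blast
  show "mop J A (mop J A c) = 0" for c by (rule AA)
  have ne: "\<exists>S. A R S \<noteq> 0 \<and> c S \<noteq> 0" if "mop J A c R \<noteq> 0" for c R
  proof -
    have "(\<Sum>S\<in>J. blinfun_apply (A R S) (c S)) \<noteq> 0" using that by (auto simp: mop_def split: if_splits)
    then obtain S where "S \<in> J" "blinfun_apply (A R S) (c S) \<noteq> 0"
      by (rule sum.not_neutral_contains_not_neutral)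
    then show ?thesis by (metis blinfun.zero_left blinfun.zero_right)
  qed
  show "mop J A c \<in> chains J deg p" if "c \<in> chains J deg (Suc p)" for c p
    unfolding chains_def
  proof (intro CollectI allI impI)
    fix R assume "mop J A c R \<noteq> 0"
    then obtain S where "A R S \<noteq> 0" "c S \<noteq> 0" using ne by blast
    then show "R \<in> J \<and> deg R = p" using entry_deg[of R S] that by (auto simp: chains_def)
  qed
  show "mop J A c = 0" if c: "c \<in> chains J deg 0" for c
  proof (rule ccontr)
    assume "mop J A c \<noteq> 0"
    then obtain R where "mop J A c R \<noteq> 0" by (auto simp: fun_eq_iff fun_ops)
    then obtain S where "A R S \<noteq> 0" "c S \<noteq> 0" using ne by blast
    then show False using entry_deg[of R S] c by (auto simp: chains_def)
  qed
qed

end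

definition lift1 :: "(('x::complex_banach \<Rightarrow>\<^sub>L 'x) \<Rightarrow> ('y::complex_banach \<Rightarrow>\<^sub>L 'y) \<Rightarrow> ('t::complex_banach \<Rightarrow>\<^sub>L 't)) \<Rightarrow> 'j set \<Rightarrow> 'k set \<Rightarrow>
    ('j \<Rightarrow> 'j \<Rightarrow> ('x \<Rightarrow>\<^sub>L 'x)) \<Rightarrow> ('j \<times> 'k \<Rightarrow> 't) \<Rightarrow> 'j \<times> 'k \<Rightarrow> 't"
  where "lift1 op J1 J2 A t = (\<lambda>(R, R'). if R \<in> J1 \<and> R' \<in> J2
    then \<Sum>S\<in>J1. blinfun_apply (op (A R S) id_blinfun) (t (S, R')) else 0)"

definition lift2 :: "(('x::complex_banach \<Rightarrow>\<^sub>L 'x) \<Rightarrow> ('y::complex_banach \<Rightarrow>\<^sub>L 'y) \<Rightarrow> ('t::complex_banach \<Rightarrow>\<^sub>L 't)) \<Rightarrow> 'j set \<Rightarrow> 'k set \<Rightarrow>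
    ('k \<Rightarrow> 'k \<Rightarrow> ('y \<Rightarrow>\<^sub>L 'y)) \<Rightarrow> ('j \<times> 'k \<Rightarrow> 't) \<Rightarrow> 'j \<times> 'k \<Rightarrow> 't"
  where "lift2 op J1 J2 B t = (\<lambda>(R, R'). if R \<in> J1 \<and> R' \<in> J2
    then \<Sum>S\<in>J2. blinfun_apply (op id_blinfun (B R' S)) (t (R, S)) else 0)"

text \<open>The sign of the degree in the first factor. It anticommutes with the first differential
  and commutes with the second, which makes the total differential square to zero.\<close>

definition sg :: "('j \<Rightarrow> nat) \<Rightarrow> ('j \<times> 'k \<Rightarrow> 't::complex_vector) \<Rightarrow> 'j \<times> 'k \<Rightarrow> 't"
  where "sg deg t = (\<lambda>(R, R'). (-1) ^ deg R *\<^sub>C t (R, R'))"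

lemma blinfun_compose_id [simp]: "id_blinfun o\<^sub>L T = T" "T o\<^sub>L id_blinfun = T"
  by (auto intro!: blinfun_eqI)

lemma sg_lin: "clinear (sg deg)"
  by (rule clinearI) (auto simp: sg_def fun_eq_iff fun_ops scaleC_add_right scaleC_scaleC mult.commute)

lemma sg_sg: "sg deg (sg deg t) = t"
  by (auto simp: sg_def fun_eq_iff scaleC_scaleC simp flip: power_add mult_2)

context banach_tensor_product
begin

lemma op_zero [simp]: "S \<in> cblinfuns \<Longrightarrow> 0 \<otimes>\<^sub>o S = 0" "T \<in> cblinfuns \<Longrightarrow> T \<otimes>\<^sub>o 0 = 0"
  using optens_scaleC_left[of 0 S 0] optens_scaleC_right[of T 0 0] by simp_all

lemma op_diff: "T \<in> cblinfuns \<Longrightarrow> T' \<in> cblinfuns \<Longrightarrow> S \<in> cblinfuns \<Longrightarrow> (T - T') \<otimes>\<^sub>o S = T \<otimes>\<^sub>o S - T' \<otimes>\<^sub>o S"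
  "T \<in> cblinfuns \<Longrightarrow> S \<in> cblinfuns \<Longrightarrow> S' \<in> cblinfuns \<Longrightarrow> T \<otimes>\<^sub>o (S - S') = T \<otimes>\<^sub>o S - T \<otimes>\<^sub>o S'"
  using optens_add_left[of "T - T'" T' S] optens_add_right[of T "S - S'" S'] by (simp_all add: algebra_simps)

lemma op_sum: "(\<And>i. i \<in> I \<Longrightarrow> f i \<in> cblinfuns) \<Longrightarrow> S \<in> cblinfuns \<Longrightarrow> (\<Sum>i\<in>I. f i) \<otimes>\<^sub>o S = (\<Sum>i\<in>I. f i \<otimes>\<^sub>o S)"
  "(\<And>i. i \<in> I \<Longrightarrow> g i \<in> cblinfuns) \<Longrightarrow> T \<in> cblinfuns \<Longrightarrow> T \<otimes>\<^sub>o (\<Sum>i\<in>I. g i) = (\<Sum>i\<in>I. T \<otimes>\<^sub>o g i)"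
  by (induction I rule: infinite_finite_induct) (auto simp: optens_add_left optens_add_right)

lemma cblinfuns_scaleR: "T \<in> cblinfuns \<Longrightarrow> r *\<^sub>R T \<in> cblinfuns"
  by (auto simp: cblinfuns_def blinfun.scaleR_left scaleR_scaleC scaleC_scaleC mult.commute)

lemma scaleR_blinfun_eq: "r *\<^sub>R T = complex_of_real r *\<^sub>C (T :: 'a::real_normed_vector \<Rightarrow>\<^sub>L 'b::complex_normed_vector)"
  by (rule blinfun_eqI) (simp add: blinfun.scaleR_left scaleC_blinfun.rep_eq scaleR_scaleC)

text \<open>A bilinear map that is continuous at the origin is bounded: both arguments are rescaled
  to norm r, where the value has norm at most 1, and this yields the constant 1/r^2.\<close>

lemma optens_bound: "\<exists>K\<ge>0. \<forall>T\<in>cblinfuns. \<forall>S\<in>cblinfuns. norm (T \<otimes>\<^sub>o S) \<le> K * norm T * norm S"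
proof -
  have "\<exists>\<delta>>0. \<forall>z\<in>cblinfuns \<times> cblinfuns. dist z (0, 0) < \<delta> \<longrightarrow>
    dist ((\<lambda>(T, S). T \<otimes>\<^sub>o S) z) ((\<lambda>(T, S). T \<otimes>\<^sub>o S) (0, 0)) < 1"
    using optens_continuous[unfolded continuous_on_iff, rule_format, of "(0, 0)" 1] by auto
  then obtain \<delta> where \<delta>: "0 < \<delta>" "\<And>T S. T \<in> cblinfuns \<Longrightarrow> S \<in> cblinfuns \<Longrightarrow> dist (T, S) (0, 0) < \<delta> \<Longrightarrow> norm (T \<otimes>\<^sub>o S) < 1"
    by (fastforce simp: dist_norm)
  \<comment> \<open>Two arguments of norm at most r form a pair at distance at most 2r < \<delta>
    from the origin.\<close>
  define r where "r = \<delta> / 3"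
  have r: "0 < r" using \<delta> by (simp add: r_def)
  have small: "norm (T \<otimes>\<^sub>o S) \<le> 1" if "T \<in> cblinfuns" "S \<in> cblinfuns" "norm T \<le> r" "norm S \<le> r" for T S
  proof -
    have "dist (T, S) (0, 0) \<le> norm T + norm S" by (simp add: dist_norm norm_Pair sqrt_sum_squares_le_sum)
    also have "\<dots> < \<delta>" using that \<delta>(1) by (simp add: r_def)
    finally show ?thesis using \<delta>(2)[OF that(1,2)] by simp
  qed
  have "norm (T \<otimes>\<^sub>o S) \<le> (1 / r\<^sup>2) * norm T * norm S" if T: "T \<in> cblinfuns" and S: "S \<in> cblinfuns" for T S
  proof (cases "T = 0 \<or> S = 0")
    case True then show ?thesis using T S by auto
  next
    case False
    define a where "a = r / norm T"
    define b where "b = r / norm S"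
    have ab: "0 < a" "0 < b" using False r by (auto simp: a_def b_def)
    have "norm ((a *\<^sub>R T) \<otimes>\<^sub>o (b *\<^sub>R S)) \<le> 1"
      using False r T S by (intro small cblinfuns_scaleR) (auto simp: a_def b_def)
    moreover have "(a *\<^sub>R T) \<otimes>\<^sub>o (b *\<^sub>R S) = (a * b) *\<^sub>R (T \<otimes>\<^sub>o S)"
      using T S by (simp add: scaleR_blinfun_eq optens_scaleC_left optens_scaleC_right scaleC_scaleC)
    ultimately have "a * b * norm (T \<otimes>\<^sub>o S) \<le> 1" using ab by simp
    then have "norm (T \<otimes>\<^sub>o S) \<le> 1 / (a * b)" using ab by (simp add: le_divide_eq mult.commute)
    also have "\<dots> = (1 / r\<^sup>2) * norm T * norm S" using False r by (simp add: a_def b_def power2_eq_square)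
    finally show ?thesis .
  qed
  then show ?thesis by (intro exI[of _ "1 / r\<^sup>2"]) auto
qed

abbreviation "\<Lambda>1 \<equiv> lift1 (\<otimes>\<^sub>o)"
abbreviation "\<Lambda>2 \<equiv> lift2 (\<otimes>\<^sub>o)"

lemma lift1_lin: "(\<And>R S. A R S \<in> cblinfuns) \<Longrightarrow> clinear (\<Lambda>1 J1 J2 A)"
  by (rule clinearI) (auto simp: lift1_def fun_eq_iff fun_ops blinfun.add_right sum.distrib scaleC_sum_right cblinfunsD optens_closed)

lemma lift2_lin: "(\<And>R S. B R S \<in> cblinfuns) \<Longrightarrow> clinear (\<Lambda>2 J1 J2 B)"
  by (rule clinearI) (auto simp: lift2_def fun_eq_iff fun_ops blinfun.add_right sum.distrib scaleC_sum_right cblinfunsD optens_closed)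

lemma lift1_mm:
  assumes "\<And>R S. A R S \<in> cblinfuns" "\<And>R S. B R S \<in> cblinfuns"
  shows "\<Lambda>1 J1 J2 (mm J1 A B) t = \<Lambda>1 J1 J2 A (\<Lambda>1 J1 J2 B t)"
proof -
  have "(\<Sum>T\<in>J1. blinfun_apply (mm J1 A B R T \<otimes>\<^sub>o id_blinfun) (t (T, R'))) =
    (\<Sum>S\<in>J1. blinfun_apply (A R S \<otimes>\<^sub>o id_blinfun) (\<Sum>T\<in>J1. blinfun_apply (B S T \<otimes>\<^sub>o id_blinfun) (t (T, R'))))" for R R'
  proof -
    have "(\<Sum>T\<in>J1. blinfun_apply (mm J1 A B R T \<otimes>\<^sub>o id_blinfun) (t (T, R'))) =
      (\<Sum>T\<in>J1. \<Sum>S\<in>J1. blinfun_apply ((A R S \<otimes>\<^sub>o id_blinfun) o\<^sub>L (B S T \<otimes>\<^sub>o id_blinfun)) (t (T, R')))"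
      using assms by (simp add: mm_def op_sum T3 blinfun.sum_left del: blinfun_apply_blinfun_compose)
    also have "\<dots> = (\<Sum>S\<in>J1. \<Sum>T\<in>J1. blinfun_apply ((A R S \<otimes>\<^sub>o id_blinfun) o\<^sub>L (B S T \<otimes>\<^sub>o id_blinfun)) (t (T, R')))"
      by (rule sum.swap)
    finally show ?thesis by (simp add: blinfun.sum_right)
  qed
  then show ?thesis by (auto simp: lift1_def fun_eq_iff)
qed

lemma lift2_mm:
  assumes "\<And>R S. A R S \<in> cblinfuns" "\<And>R S. B R S \<in> cblinfuns"
  shows "\<Lambda>2 J1 J2 (mm J2 A B) t = \<Lambda>2 J1 J2 A (\<Lambda>2 J1 J2 B t)"
proof -
  have "(\<Sum>T\<in>J2. blinfun_apply (id_blinfun \<otimes>\<^sub>o mm J2 A B R' T) (t (R, T))) =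
    (\<Sum>S\<in>J2. blinfun_apply (id_blinfun \<otimes>\<^sub>o A R' S) (\<Sum>T\<in>J2. blinfun_apply (id_blinfun \<otimes>\<^sub>o B S T) (t (R, T))))" for R R'
  proof -
    have "(\<Sum>T\<in>J2. blinfun_apply (id_blinfun \<otimes>\<^sub>o mm J2 A B R' T) (t (R, T))) =
      (\<Sum>T\<in>J2. \<Sum>S\<in>J2. blinfun_apply ((id_blinfun \<otimes>\<^sub>o A R' S) o\<^sub>L (id_blinfun \<otimes>\<^sub>o B S T)) (t (R, T)))"
      using assms by (simp add: mm_def op_sum T3 blinfun.sum_left del: blinfun_apply_blinfun_compose)
    also have "\<dots> = (\<Sum>S\<in>J2. \<Sum>T\<in>J2. blinfun_apply ((id_blinfun \<otimes>\<^sub>o A R' S) o\<^sub>L (id_blinfun \<otimes>\<^sub>o B S T)) (t (R, T)))"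
      by (rule sum.swap)
    finally show ?thesis by (simp add: blinfun.sum_right)
  qed
  then show ?thesis by (auto simp: lift2_def fun_eq_iff)
qed

lemma lift_commute:
  assumes "\<And>R S. A R S \<in> cblinfuns" "\<And>R S. B R S \<in> cblinfuns"
  shows "\<Lambda>2 J1 J2 B (\<Lambda>1 J1 J2 A t) = \<Lambda>1 J1 J2 A (\<Lambda>2 J1 J2 B t)"
proof -
  have *: "blinfun_apply (T \<otimes>\<^sub>o id_blinfun) (blinfun_apply (id_blinfun \<otimes>\<^sub>o S) v) =
      blinfun_apply (id_blinfun \<otimes>\<^sub>o S) (blinfun_apply (T \<otimes>\<^sub>o id_blinfun) v)"
    if "T \<in> cblinfuns" "S \<in> cblinfuns" for T S v
    using that T3[of T id_blinfun id_blinfun S] T3[of id_blinfun T S id_blinfun]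
    by (simp flip: blinfun_apply_blinfun_compose)
  have "(\<Sum>S'\<in>J2. \<Sum>S\<in>J1. blinfun_apply (id_blinfun \<otimes>\<^sub>o B R' S') (blinfun_apply (A R S \<otimes>\<^sub>o id_blinfun) (t (S, S')))) =
    (\<Sum>S\<in>J1. \<Sum>S'\<in>J2. blinfun_apply (A R S \<otimes>\<^sub>o id_blinfun) (blinfun_apply (id_blinfun \<otimes>\<^sub>o B R' S') (t (S, S'))))" for R R'
    by (subst sum.swap) (simp add: * assms)
  then show ?thesis by (auto simp: lift1_def lift2_def fun_eq_iff blinfun.sum_right)
qed

lemma sg_lift2: "(\<And>R S. B R S \<in> cblinfuns) \<Longrightarrow> \<Lambda>2 J1 J2 B (sg deg t) = sg deg (\<Lambda>2 J1 J2 B t)"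
  by (auto simp: sg_def lift2_def fun_eq_iff cblinfunsD[OF optens_closed] scaleC_sum_right)

lemma sg_lift1:
  assumes "\<And>R S. A R S \<in> cblinfuns" "\<And>R S. A R S \<noteq> 0 \<Longrightarrow> deg S = Suc (deg R) \<or> deg R = Suc (deg S)"
  shows "\<Lambda>1 J1 J2 A (sg deg t) = - sg deg (\<Lambda>1 J1 J2 A t)"
proof -
  have "blinfun_apply (A R S \<otimes>\<^sub>o id_blinfun) ((-1) ^ deg S *\<^sub>C v) = - ((-1) ^ deg R *\<^sub>C blinfun_apply (A R S \<otimes>\<^sub>o id_blinfun) v)" for R S v
  proof (cases "A R S = 0")
    case False
    then have "(-1) ^ deg S = - ((-1) ^ deg R :: complex)" using assms(2)[of R S] by auto
    then show ?thesis using assms(1) by (simp add: cblinfunsD[OF optens_closed] blinfun.minus_right)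
  qed (simp add: blinfun.zero_left)
  then show ?thesis by (auto simp: sg_def lift1_def fun_eq_iff fun_ops scaleC_sum_right sum_negf)
qed

lemma bop_lift1:
  fixes A :: "'j \<Rightarrow> 'j \<Rightarrow> ('x \<Rightarrow>\<^sub>L 'x)" and J2 :: "'k set"
  assumes J: "finite J1" "finite J2" and A: "\<And>R S. A R S \<in> cblinfuns"
  shows "bop (J1 \<times> J2) (\<Lambda>1 J1 J2 A)"
proof -
  let ?M = "\<lambda>z w. if snd z = snd w then A (fst z) (fst w) \<otimes>\<^sub>o id_blinfun else 0"
  have "(\<Sum>w\<in>J1 \<times> J2. blinfun_apply (?M (R, R') w) (t w)) = (\<Sum>S\<in>J1. blinfun_apply (A R S \<otimes>\<^sub>o id_blinfun) (t (S, R')))"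
    if "R' \<in> J2" for R R' t
  proof -
    have "(\<Sum>w\<in>J1 \<times> J2. blinfun_apply (?M (R, R') w) (t w)) =
      (\<Sum>S\<in>J1. \<Sum>S'\<in>J2. if R' = S' then blinfun_apply (A R S \<otimes>\<^sub>o id_blinfun) (t (S, R')) else 0)"
      unfolding sum.cartesian_product' by (intro sum.cong) (auto simp: blinfun.zero_left)
    then show ?thesis using that J by (simp add: sum.delta)
  qed
  then have "\<Lambda>1 J1 J2 A = mop (J1 \<times> J2) ?M"
    by (auto simp: fun_eq_iff lift1_def mop_def)
  moreover have "?M z w \<in> cblinfuns" for z w :: "'j \<times> 'k" using A by (auto simp: optens_closed)
  ultimately show ?thesis using J mop_bop[of "J1 \<times> J2" ?M] by simp
qed

lemma bop_lift2:
  fixes B :: "'k \<Rightarrow> 'k \<Rightarrow> ('y \<Rightarrow>\<^sub>L 'y)" and J1 :: "'j set"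
  assumes J: "finite J1" "finite J2" and B: "\<And>R S. B R S \<in> cblinfuns"
  shows "bop (J1 \<times> J2) (\<Lambda>2 J1 J2 B)"
proof -
  let ?M = "\<lambda>z w. if fst z = fst w then id_blinfun \<otimes>\<^sub>o B (snd z) (snd w) else 0"
  have "(\<Sum>w\<in>J1 \<times> J2. blinfun_apply (?M (R, R') w) (t w)) = (\<Sum>S\<in>J2. blinfun_apply (id_blinfun \<otimes>\<^sub>o B R' S) (t (R, S)))"
    if "R \<in> J1" for R R' t
  proof -
    have "(\<Sum>w\<in>J1 \<times> J2. blinfun_apply (?M (R, R') w) (t w)) =
      (\<Sum>S\<in>J1. \<Sum>S'\<in>J2. if R = S then blinfun_apply (id_blinfun \<otimes>\<^sub>o B R' S') (t (R, S')) else 0)"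
      unfolding sum.cartesian_product' by (intro sum.cong) (auto simp: blinfun.zero_left)
    also have "\<dots> = (\<Sum>S\<in>J1. if R = S then \<Sum>S'\<in>J2. blinfun_apply (id_blinfun \<otimes>\<^sub>o B R' S') (t (R, S')) else 0)"
      by (intro sum.cong) auto
    finally show ?thesis using that J by (simp add: sum.delta)
  qed
  then have "\<Lambda>2 J1 J2 B = mop (J1 \<times> J2) ?M"
    by (auto simp: fun_eq_iff lift2_def mop_def)
  moreover have "?M z w \<in> cblinfuns" for z w :: "'j \<times> 'k" using B by (auto simp: optens_closed)
  ultimately show ?thesis using J mop_bop[of "J1 \<times> J2" ?M] by simp
qed

lemma bop_sg: "bop J (sg deg :: ('j \<times> 'k \<Rightarrow> 't) \<Rightarrow> _)"
proof -
  have "cnorm J (sg deg t) \<le> 1 * cnorm J t" for t :: "'j \<times> 'k \<Rightarrow> 't"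
    by (auto simp: cnorm_def sg_def norm_scaleC norm_power intro!: sum_mono)
  moreover have "sg deg t \<in> supp_on J" if "t \<in> supp_on J" for t :: "'j \<times> 'k \<Rightarrow> 't"
    using that by (auto simp: sg_def supp_on_def)
  ultimately show ?thesis unfolding bop_def using sg_lin by blast
qed

end

locale tensor_complex = banach_tensor_product tens optens +
    K1: matrix_complex J1 deg1 A1 + K2: matrix_complex J2 deg2 A2
  for tens :: "'x::complex_banach \<Rightarrow> 'y::complex_banach \<Rightarrow> 't::complex_banach" (infixl \<open>\<otimes>\<^sub>v\<close> 70)
    and optens :: "('x \<Rightarrow>\<^sub>L 'x) \<Rightarrow> ('y \<Rightarrow>\<^sub>L 'y) \<Rightarrow> ('t \<Rightarrow>\<^sub>L 't)"  (infixl \<open>\<otimes>\<^sub>o\<close> 70)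
    and J1 :: "'j set" and deg1 and A1 :: "'j \<Rightarrow> 'j \<Rightarrow> ('x \<Rightarrow>\<^sub>L 'x)"
    and J2 :: "'k set" and deg2 and A2 :: "'k \<Rightarrow> 'k \<Rightarrow> ('y \<Rightarrow>\<^sub>L 'y)"
begin

definition dT :: "('j \<times> 'k \<Rightarrow> 't) \<Rightarrow> 'j \<times> 'k \<Rightarrow> 't"
  where "dT t = \<Lambda>1 J1 J2 A1 t + sg deg1 (\<Lambda>2 J1 J2 A2 t)"

definition degT :: "'j \<times> 'k \<Rightarrow> nat"
  where "degT = (\<lambda>(R, R'). deg1 R + deg2 R')"

abbreviation "JT \<equiv> J1 \<times> J2"

lemma lift1_zero: "\<Lambda>1 J1 J2 A1 (\<Lambda>1 J1 J2 A1 t) = 0"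
proof -
  have "mm J1 A1 A1 R S = 0" if "R \<in> J1" "S \<in> J1" for R S
    by (rule mop_zero_entries[OF K1.finJ _ that]) (simp add: mop_mm K1.AA)
  then have "\<Lambda>1 J1 J2 (mm J1 A1 A1) t = 0" by (auto simp: lift1_def fun_eq_iff fun_ops blinfun.zero_left)
  then show ?thesis by (simp add: lift1_mm K1.cblin)
qed

lemma lift2_zero: "\<Lambda>2 J1 J2 A2 (\<Lambda>2 J1 J2 A2 t) = 0"
proof -
  have "mm J2 A2 A2 R S = 0" if "R \<in> J2" "S \<in> J2" for R S
    by (rule mop_zero_entries[OF K2.finJ _ that]) (simp add: mop_mm K2.AA)
  then have "\<Lambda>2 J1 J2 (mm J2 A2 A2) t = 0" by (auto simp: lift2_def fun_eq_iff fun_ops blinfun.zero_left)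
  then show ?thesis by (simp add: lift2_mm K2.cblin)
qed

lemma sg_A1: "\<Lambda>1 J1 J2 A1 (sg deg1 t) = - sg deg1 (\<Lambda>1 J1 J2 A1 t)"
  using K1.entry_deg by (intro sg_lift1 K1.cblin) auto

lemma sg_A2: "\<Lambda>2 J1 J2 A2 (sg deg t) = sg deg (\<Lambda>2 J1 J2 A2 t)"
  by (rule sg_lift2) (rule K2.cblin)

lemma dT_bop: "bop JT dT"
  unfolding dT_def[abs_def]
  by (intro bop_add bop_compose[OF bop_sg] bop_lift1 bop_lift2 K1.finJ K2.finJ K1.cblin K2.cblin)

lemma dT_nonzero:
  assumes "dT t (R, R') \<noteq> 0"
  shows "R \<in> J1 \<and> R' \<in> J2 \<and> ((\<exists>S. A1 R S \<noteq> 0 \<and> t (S, R') \<noteq> 0) \<or> (\<exists>S. A2 R' S \<noteq> 0 \<and> t (R, S) \<noteq> 0))"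
proof -
  have "\<Lambda>1 J1 J2 A1 t (R, R') \<noteq> 0 \<or> \<Lambda>2 J1 J2 A2 t (R, R') \<noteq> 0"
    using assms by (auto simp: dT_def fun_ops sg_def)
  then show ?thesis
  proof
    assume a: "\<Lambda>1 J1 J2 A1 t (R, R') \<noteq> 0"
    then obtain S where "blinfun_apply (A1 R S \<otimes>\<^sub>o id_blinfun) (t (S, R')) \<noteq> 0"
      by (auto simp: lift1_def split: if_splits elim: sum.not_neutral_contains_not_neutral)
    then have "A1 R S \<noteq> 0" "t (S, R') \<noteq> 0" by (auto simp: blinfun.zero_left blinfun.zero_right)
    then show ?thesis using a by (auto simp: lift1_def split: if_splits)
  next
    assume a: "\<Lambda>2 J1 J2 A2 t (R, R') \<noteq> 0"
    then obtain S where "blinfun_apply (id_blinfun \<otimes>\<^sub>o A2 R' S) (t (R, S)) \<noteq> 0"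
      by (auto simp: lift2_def split: if_splits elim: sum.not_neutral_contains_not_neutral)
    then have "A2 R' S \<noteq> 0" "t (R, S) \<noteq> 0" by (auto simp: blinfun.zero_left blinfun.zero_right)
    then show ?thesis using a by (auto simp: lift2_def split: if_splits)
  qed
qed

sublocale T: banach_complex JT degT dT
proof (rule banach_complex.intro)
  show "finite JT" using K1.finJ K2.finJ by simp
  show "clinear dT" using dT_bop by (rule bopD)
  show "\<exists>C. \<forall>c\<in>supp_on JT. cnorm JT (dT c) \<le> C * cnorm JT c" using bopD(3)[OF dT_bop] by blast
  show "dT (dT t) = 0" for t
    by (simp add: dT_def clinearD[OF lift1_lin[OF K1.cblin]] clinearD[OF lift2_lin[OF K2.cblin]] clinearD[OF sg_lin]
        lift1_zero lift2_zero sg_A1 sg_A2 sg_sg lift_commute[OF K1.cblin K2.cblin])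
  show "dT c \<in> chains JT degT p" if "c \<in> chains JT degT (Suc p)" for c p
    unfolding chains_def
  proof (intro CollectI allI impI, clarify)
    fix R R' assume "dT c (R, R') \<noteq> 0"
    from dT_nonzero[OF this] show "(R, R') \<in> JT \<and> degT (R, R') = p"
      using that K1.entry_deg[of R] K2.entry_deg[of R'] by (fastforce simp: chains_def degT_def)
  qed
  show "dT c = 0" if c: "c \<in> chains JT degT 0" for c
  proof (rule ccontr)
    assume "dT c \<noteq> 0"
    then obtain R R' where "dT c (R, R') \<noteq> 0" by (auto simp: fun_eq_iff fun_ops)
    from dT_nonzero[OF this] show False
      using c K1.entry_deg[of R] K2.entry_deg[of R'] by (fastforce simp: chains_def degT_def)
  qed
qed

end

section \<open>Defects in a tensor product of complexes\<close>

context banach_complex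
begin

text \<open>Supplies the unit vectors that span the ranges of the rank one operators used
  below.\<close>

lemma defect_nontrivial:
  assumes "defect p"
  shows "\<exists>x0 :: 'x. norm x0 = 1"
proof -
  obtain z U where zU: "z \<in> C p" "\<forall>a x. U (a *\<^sub>C x) = a * U (x :: 'j \<Rightarrow> 'x)" "1 / 2 \<le> cmod (U z)"
    using assms[unfolded defect_def, rule_format, of 1] by auto
  have "z \<noteq> 0"
  proof
    assume "z = 0"
    then have "U z = 0 * U z" using zU(2)[rule_format, of 0 z] by simp
    then show False using zU(3) by simp
  qed
  then obtain j where j: "z j \<noteq> 0" by (auto simp: fun_eq_iff fun_ops)
  then have "norm ((1 / norm (z j)) *\<^sub>R z j) = 1" by simp
  then show ?thesis by blast
qed

end

context matrix_complex
begin

text \<open>Only operators can be tensored by means of \<open>optens\<close>, so the functional U is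
  replaced by rank one operators \<open>P R\<close> with values in the line of \<open>x0\<close>,
  one for each component of a chain. The scalar \<open>a\<close> is U z, and the sums of
  \<open>P R\<close> composed with \<open>A R S\<close> are the components of U composed with the
  differential.\<close>

lemma defect_operators:
  assumes "defect p" and x0: "norm (x0 :: 'x) = 1" and e: "0 < e"
  obtains z P a where "z \<in> C p" "cnorm J z \<le> 2" "cnorm J (mop J A z) \<le> e"
    "\<And>R. P R \<in> cblinfuns" "\<And>R. norm (P R :: 'x \<Rightarrow>\<^sub>L 'x) \<le> 1"
    "\<And>S. S \<in> J \<Longrightarrow> norm (\<Sum>R\<in>J. P R o\<^sub>L A R S) \<le> e"
    "(\<Sum>R\<in>J. blinfun_apply (P R) (z R)) = a *\<^sub>C x0" "1 / 2 \<le> cmod a"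
proof -
  obtain z U where z: "z \<in> C p" "cnorm J z \<le> 2" "cnorm J (mop J A z) \<le> e"
    and U: "\<And>x y. U (x + y) = U x + U y" "\<And>a x. U (a *\<^sub>C x) = a * U x" "\<And>w. cmod (U w) \<le> cnorm J w"
    "\<And>c. c \<in> C (Suc p) \<Longrightarrow> cmod (U (mop J A c)) \<le> e * cnorm J c" "1 / 2 \<le> cmod (U z)"
    using assms(1)[unfolded defect_def, rule_format, OF e] by blast
  have Ulin: "clinear U" by (rule clinearI) (simp_all add: U scaleC_complex_def)
  \<comment> \<open>Components outside degree p are set to zero, because U composed with the
    differential is known to be small on \<open>C (Suc p)\<close> only.\<close>
  define P where "P R = (if R \<in> J \<and> deg R = p then Blinfun (\<lambda>x. U (single R x) *\<^sub>C x0) else 0)" for R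
  have bl: "bounded_linear (\<lambda>x. U (single R x) *\<^sub>C x0)" if "R \<in> J" for R
  proof (rule bounded_linear_intro[where K=1])
    show "U (single R (x + y)) *\<^sub>C x0 = U (single R x) *\<^sub>C x0 + U (single R y) *\<^sub>C x0" for x y
      by (simp add: clinearD[OF single_lin] U scaleC_add_left)
    show "U (single R (r *\<^sub>R x)) *\<^sub>C x0 = r *\<^sub>R (U (single R x) *\<^sub>C x0)" for r x
      by (simp add: clinearD[OF single_lin] U scaleR_scaleC scaleC_scaleC)
    show "norm (U (single R x) *\<^sub>C x0) \<le> norm x * 1" for x
      using U(3)[of "single R x"] x0 by (simp add: norm_scaleC cnorm_single[OF finJ that])
  qed
  have Papp: "blinfun_apply (P R) x = U (single R x) *\<^sub>C x0" if "R \<in> J" "deg R = p" for R x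
    using that bl[OF that(1)] by (simp add: P_def bounded_linear_Blinfun_apply)
  have P0: "P R = 0" if "\<not> (R \<in> J \<and> deg R = p)" for R unfolding P_def using that by (simp only: if_False)
  have Pc: "P R \<in> cblinfuns" for R
  proof (cases "R \<in> J \<and> deg R = p")
    case True then show ?thesis by (auto simp: cblinfuns_def Papp clinearD[OF single_lin] U scaleC_scaleC)
  qed (simp add: P0)
  have Pn: "norm (P R) \<le> 1" for R
  proof (cases "R \<in> J \<and> deg R = p")
    case True
    show ?thesis
    proof (rule norm_blinfun_bound)
      show "norm (blinfun_apply (P R) x) \<le> 1 * norm x" for x
        using True U(3)[of "single R x"] x0 by (simp add: Papp norm_scaleC cnorm_single[OF finJ])
    qed simp
  qed (simp add: P0)
  have PA: "norm (\<Sum>R\<in>J. P R o\<^sub>L A R S) \<le> e" if S: "S \<in> J" for S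
  proof (cases "deg S = Suc p")
    case False
    then have "P R o\<^sub>L A R S = 0" for R
    proof (cases "A R S = 0")
      case False
      then have "deg R \<noteq> p" using entry_deg[OF False] \<open>deg S \<noteq> Suc p\<close> by auto
      then show ?thesis by (auto simp: P0 intro!: blinfun_eqI)
    qed (auto intro!: blinfun_eqI simp: blinfun.zero_right)
    then show ?thesis using e by simp
  next
    case True
    show ?thesis
    proof (rule norm_blinfun_bound)
      fix x
      have "mop J A (single S x) \<in> supp_on J" by (auto simp: mop_def supp_on_def)
      from supp_on_expand[OF finJ this]
      have ex: "mop J A (single S x) = (\<Sum>R\<in>J. single R (blinfun_apply (A R S) x))"
        by (simp add: mop_single[OF finJ _ S])
      have "blinfun_apply (P R) (blinfun_apply (A R S) x) = U (single R (blinfun_apply (A R S) x)) *\<^sub>C x0" if "R \<in> J" for R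
      proof (cases "deg R = p")
        case False
        then have "A R S = 0" using entry_deg[of R S] True by auto
        then show ?thesis by (simp add: blinfun.zero_right clinearD[OF single_lin] clinearD[OF Ulin])
      qed (simp add: Papp that)
      then have "blinfun_apply (\<Sum>R\<in>J. P R o\<^sub>L A R S) x = U (mop J A (single S x)) *\<^sub>C x0"
        by (simp add: blinfun.sum_left ex clinearD[OF Ulin] scaleC_sum_left)
      moreover have "single S x \<in> C (Suc p)" using S True by (auto simp: chains_def single_def split: if_splits)
      ultimately show "norm (blinfun_apply (\<Sum>R\<in>J. P R o\<^sub>L A R S) x) \<le> e * norm x"
        using U(4)[of "single S x"] x0 by (simp add: norm_scaleC cnorm_single[OF finJ S])
    qed (use e in simp)
  qed
  have "blinfun_apply (P R) (z R) = U (single R (z R)) *\<^sub>C x0" if "R \<in> J" for R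
  proof (cases "deg R = p")
    case False
    then have "z R = 0" using z(1) by (auto simp: chains_def)
    then show ?thesis by (simp add: blinfun.zero_right clinearD[OF single_lin] clinearD[OF Ulin])
  qed (simp add: Papp that)
  then have "(\<Sum>R\<in>J. blinfun_apply (P R) (z R)) = U (\<Sum>R\<in>J. single R (z R)) *\<^sub>C x0"
    by (simp add: clinearD[OF Ulin] scaleC_sum_left)
  also have "(\<Sum>R\<in>J. single R (z R)) = z" using supp_on_expand[OF finJ C_supp[OF z(1)]] by simp
  finally show ?thesis using that[OF z Pc Pn PA _ U(5)] by blast
qed

end

context tensor_complex
begin

interpretation tens: bounded_bilinear "(\<otimes>\<^sub>v)" by (rule tens_bounded_bilinear)

text \<open>Exactness with closed range would write z \<otimes> y as w + d s, where w has the same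
  small differential as z \<otimes> y and hence small norm, and s is bounded. The operator
  \<open>W\<close>, built from the tensors of the two families of rank one operators, is bounded and
  almost annihilates boundaries, so its value on z \<otimes> y would be of order e; but that value
  has norm at least 1/4, the product of the two bounds 1/2.\<close>

theorem defect_tensor:
  assumes "K1.defect i" and "K2.defect j"
  shows "\<not> T.strict_at (i + j)"
proof
  assume "T.strict_at (i + j)"
  then obtain K where K: "0 \<le> K"
    "\<And>y. y \<in> dT ` T.C (i + j) \<Longrightarrow> \<exists>w\<in>T.C (i + j). dT w = y \<and> cnorm JT w \<le> K * cnorm JT y"
    "\<And>z. z \<in> T.C (i + j) \<Longrightarrow> dT z = 0 \<Longrightarrow> \<exists>t\<in>T.C (Suc (i + j)). dT t = z \<and> cnorm JT t \<le> K * cnorm JT z"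
    by (rule T.strict_bounds) blast
  obtain M where M: "0 \<le> M" "\<And>T S. T \<in> cblinfuns \<Longrightarrow> S \<in> cblinfuns \<Longrightarrow> norm (T \<otimes>\<^sub>o S) \<le> M * norm T * norm S"
    using optens_bound by blast
  obtain x0 :: 'x where x0: "norm x0 = 1" using K1.defect_nontrivial[OF assms(1)] by blast
  obtain y0 :: 'y where y0: "norm y0 = 1" using K2.defect_nontrivial[OF assms(2)] by blast
  \<comment> \<open>Collects the constants of the final estimate: w has norm at most 4Ke and
    \<open>W\<close> norm at most M; s has norm at most K(4 + 4K) and \<open>W\<close> composed with
    the differential norm at most 2Me. The choice of \<open>e\<close> then makes L e < 1/4 and e
    \<le> 1.\<close>
  define L where "L = 4 * M * K + 2 * M * (K * (4 + 4 * K))"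
  have L: "0 \<le> L" using M(1) K(1) by (simp add: L_def)
  define e where "e = 1 / (4 * L + 8)"
  have e: "0 < e" "e \<le> 1" using L by (auto simp: e_def divide_le_eq)
  obtain z P a where z: "z \<in> K1.C i" "cnorm J1 z \<le> 2" "cnorm J1 (mop J1 A1 z) \<le> e"
    and P: "\<And>R. P R \<in> cblinfuns" "\<And>R. norm (P R) \<le> 1" "\<And>S. S \<in> J1 \<Longrightarrow> norm (\<Sum>R\<in>J1. P R o\<^sub>L A1 R S) \<le> e"
    and a: "(\<Sum>R\<in>J1. blinfun_apply (P R) (z R)) = a *\<^sub>C x0" "1 / 2 \<le> cmod a"
    by (rule K1.defect_operators[OF assms(1) x0 e(1)]) blast
  obtain y Q b where y: "y \<in> K2.C j" "cnorm J2 y \<le> 2" "cnorm J2 (mop J2 A2 y) \<le> e"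
    and Q: "\<And>R. Q R \<in> cblinfuns" "\<And>R. norm (Q R) \<le> 1" "\<And>S. S \<in> J2 \<Longrightarrow> norm (\<Sum>R\<in>J2. Q R o\<^sub>L A2 R S) \<le> e"
    and b: "(\<Sum>R\<in>J2. blinfun_apply (Q R) (y R)) = b *\<^sub>C y0" "1 / 2 \<le> cmod b"
    by (rule K2.defect_operators[OF assms(2) y0 e(1)]) blast
  define W where "W t = (\<Sum>R\<in>J1. \<Sum>R'\<in>J2. blinfun_apply (P R \<otimes>\<^sub>o Q R') (t (R, R')))" for t :: "'j \<times> 'k \<Rightarrow> 't"
  have Wadd: "W (s + t) = W s + W t" for s t by (simp add: W_def fun_ops blinfun.add_right sum.distrib)
  have cn: "cnorm JT t = (\<Sum>R\<in>J1. \<Sum>R'\<in>J2. norm (t (R, R')))" for t :: "'j \<times> 'k \<Rightarrow> 't"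
    by (simp add: cnorm_def sum.cartesian_product')
  have bnd: "norm (\<Sum>R\<in>J1. \<Sum>R'\<in>J2. blinfun_apply (G R R') (t (R, R'))) \<le> c * cnorm JT t"
    if "\<And>R R'. R \<in> J1 \<Longrightarrow> R' \<in> J2 \<Longrightarrow> norm (G R R') \<le> c" for G c and t :: "'j \<times> 'k \<Rightarrow> 't"
  proof -
    have "norm (blinfun_apply (G R R') (t (R, R'))) \<le> c * norm (t (R, R'))" if "R \<in> J1" "R' \<in> J2" for R R'
      using norm_blinfun[of "G R R'" "t (R, R')"] mult_right_mono[OF \<open>\<And>R R'. R \<in> J1 \<Longrightarrow> R' \<in> J2 \<Longrightarrow> norm (G R R') \<le> c\<close>[OF that] norm_ge_zero[of "t (R, R')"]]
      by linarith
    then show ?thesis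
      unfolding cn sum_distrib_left by (intro sum_norm_le)
  qed
  have Wb: "norm (W t) \<le> M * cnorm JT t" for t
    unfolding W_def
  proof (rule bnd)
    fix R R'
    have "M * norm (P R) * norm (Q R') \<le> M * 1 * 1" using P(2) Q(2) M(1) by (intro mult_mono) auto
    then show "norm (P R \<otimes>\<^sub>o Q R') \<le> M" using M(2)[OF P(1) Q(1), of R R'] by simp
  qed
  have W1: "norm (W (\<Lambda>1 J1 J2 A1 t)) \<le> (M * e) * cnorm JT t" for t
  proof -
    have "W (\<Lambda>1 J1 J2 A1 t) = (\<Sum>R\<in>J1. \<Sum>R'\<in>J2. \<Sum>S\<in>J1. blinfun_apply ((P R \<otimes>\<^sub>o Q R') o\<^sub>L (A1 R S \<otimes>\<^sub>o id_blinfun)) (t (S, R')))"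
      by (simp add: W_def lift1_def blinfun.sum_right)
    also have "\<dots> = (\<Sum>R'\<in>J2. \<Sum>S\<in>J1. \<Sum>R\<in>J1. blinfun_apply ((P R o\<^sub>L A1 R S) \<otimes>\<^sub>o Q R') (t (S, R')))"
      by (subst sum.swap, rule sum.cong[OF refl], subst sum.swap) (simp add: T3 P Q K1.cblin del: blinfun_apply_blinfun_compose)
    also have "\<dots> = (\<Sum>S\<in>J1. \<Sum>R'\<in>J2. blinfun_apply ((\<Sum>R\<in>J1. P R o\<^sub>L A1 R S) \<otimes>\<^sub>o Q R') (t (S, R')))"
      by (subst sum.swap) (simp add: op_sum P Q K1.cblin blinfun.sum_left)
    also have "norm \<dots> \<le> (M * e) * cnorm JT t"
    proof (rule bnd)
      fix S R' assume S: "S \<in> J1"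
      have "M * norm (\<Sum>R\<in>J1. P R o\<^sub>L A1 R S) * norm (Q R') \<le> M * e * 1"
        using P(3)[OF S] Q(2) M(1) e by (intro mult_mono) auto
      then show "norm ((\<Sum>R\<in>J1. P R o\<^sub>L A1 R S) \<otimes>\<^sub>o Q R') \<le> M * e"
        using M(2)[of "\<Sum>R\<in>J1. P R o\<^sub>L A1 R S" "Q R'"] P(1) Q(1) K1.cblin by simp
    qed
    finally show ?thesis .
  qed
  have W2: "norm (W (sg deg1 (\<Lambda>2 J1 J2 A2 t))) \<le> (M * e) * cnorm JT t" for t
  proof -
    have "W (sg deg1 (\<Lambda>2 J1 J2 A2 t)) = (\<Sum>R\<in>J1. (-1) ^ deg1 R *\<^sub>C (\<Sum>R'\<in>J2. \<Sum>S\<in>J2. blinfun_apply ((P R \<otimes>\<^sub>o Q R') o\<^sub>L (id_blinfun \<otimes>\<^sub>o A2 R' S)) (t (R, S))))"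
      by (simp add: W_def lift2_def sg_def blinfun.sum_right cblinfunsD[OF optens_closed] P Q scaleC_sum_right)
    also have "\<dots> = (\<Sum>R\<in>J1. (-1) ^ deg1 R *\<^sub>C (\<Sum>S\<in>J2. blinfun_apply (P R \<otimes>\<^sub>o (\<Sum>R'\<in>J2. Q R' o\<^sub>L A2 R' S)) (t (R, S))))"
      by (rule sum.cong[OF refl], subst sum.swap) (simp add: T3 P Q K2.cblin op_sum blinfun.sum_left del: blinfun_apply_blinfun_compose)
    also have "\<dots> = (\<Sum>R\<in>J1. \<Sum>S\<in>J2. blinfun_apply ((-1) ^ deg1 R *\<^sub>C (P R \<otimes>\<^sub>o (\<Sum>R'\<in>J2. Q R' o\<^sub>L A2 R' S))) (t (R, S)))"
      by (simp add: scaleC_sum_right scaleC_blinfun.rep_eq)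
    also have "norm \<dots> \<le> (M * e) * cnorm JT t"
    proof (rule bnd)
      fix R S assume S: "S \<in> J2"
      have "norm ((-1) ^ n *\<^sub>C T) = norm T" for n and T :: "'t \<Rightarrow>\<^sub>L 't"
        by (cases "even n") auto
      moreover have "M * norm (P R) * norm (\<Sum>R'\<in>J2. Q R' o\<^sub>L A2 R' S) \<le> M * 1 * e"
        using Q(3)[OF S] P(2) M(1) e by (intro mult_mono) auto
      ultimately show "norm ((-1) ^ deg1 R *\<^sub>C (P R \<otimes>\<^sub>o (\<Sum>R'\<in>J2. Q R' o\<^sub>L A2 R' S))) \<le> M * e"
        using M(2)[of "P R" "\<Sum>R'\<in>J2. Q R' o\<^sub>L A2 R' S"] P(1) Q(1) K2.cblin by simp
    qed
    finally show ?thesis .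
  qed
  have WdT: "norm (W (dT t)) \<le> 2 * (M * e) * cnorm JT t" for t
    using W1[of t] W2[of t] norm_triangle_ineq[of "W (\<Lambda>1 J1 J2 A1 t)" "W (sg deg1 (\<Lambda>2 J1 J2 A2 t))"]
    by (simp add: dT_def Wadd)
  define tt where "tt u v = (\<lambda>(R, R'). u R \<otimes>\<^sub>v v R')" for u :: "'j \<Rightarrow> 'x" and v :: "'k \<Rightarrow> 'y"
  have cntt: "cnorm JT (tt u v) = cnorm J1 u * cnorm J2 v" for u v
    unfolding cn by (simp add: tt_def T1 cnorm_def sum_product)
  define t0 where "t0 = tt z y"
  have t0C: "t0 \<in> T.C (i + j)"
  proof -
    have "z R \<otimes>\<^sub>v y R' \<noteq> 0 \<Longrightarrow> z R \<noteq> 0 \<and> y R' \<noteq> 0" for R R' using tens.zero_left tens.zero_right by metis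
    then show ?thesis using z(1) y(1) by (fastforce simp: t0_def tt_def chains_def degT_def)
  qed
  have nt0: "cnorm JT t0 \<le> 4"
    using mult_mono[OF z(2) y(2)] by (simp add: t0_def cntt cnormD)
  have Wt0: "1 / 4 \<le> norm (W t0)"
  proof -
    have "W t0 = (\<Sum>R\<in>J1. blinfun_apply (P R) (z R)) \<otimes>\<^sub>v (\<Sum>R'\<in>J2. blinfun_apply (Q R') (y R'))"
      unfolding tens.sum_left unfolding tens.sum_right by (simp add: W_def t0_def tt_def T2 P Q)
    also have "norm \<dots> = cmod a * cmod b" by (simp add: a b T1 norm_scaleC x0 y0)
    finally show ?thesis using mult_mono[OF a(2) b(2)] by simp
  qed
  have "\<Lambda>1 J1 J2 A1 t0 = restr (\<lambda>w. w \<in> JT) (tt (mop J1 A1 z) y)"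
    by (auto simp: fun_eq_iff lift1_def restr_def tt_def t0_def mop_def T2 K1.cblin tens.sum_left)
  moreover have "\<Lambda>2 J1 J2 A2 t0 = restr (\<lambda>w. w \<in> JT) (tt z (mop J2 A2 y))"
    by (auto simp: fun_eq_iff lift2_def restr_def tt_def t0_def mop_def T2 K2.cblin tens.sum_right)
  moreover have "cnorm JT (restr (\<lambda>w. w \<in> JT) t) = cnorm JT t" "cnorm JT (sg deg1 t) = cnorm JT t" for t :: "'j \<times> 'k \<Rightarrow> 't"
    by (auto simp: cnorm_def restr_def sg_def norm_scaleC norm_power intro!: sum.cong)
  ultimately have "cnorm JT (dT t0) \<le> cnorm J1 (mop J1 A1 z) * cnorm J2 y + cnorm J1 z * cnorm J2 (mop J2 A2 y)"
    using cnormD(1)[of JT "\<Lambda>1 J1 J2 A1 t0" "sg deg1 (\<Lambda>2 J1 J2 A2 t0)"] by (simp add: dT_def cntt)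
  also have "\<dots> \<le> e * 2 + 2 * e"
    using z y e by (intro add_mono mult_mono) (auto simp: cnormD)
  finally have ndt0: "cnorm JT (dT t0) \<le> 4 * e" by simp
  obtain w where w: "w \<in> T.C (i + j)" "dT w = dT t0" "cnorm JT w \<le> K * cnorm JT (dT t0)"
    using K(2)[of "dT t0"] t0C by blast
  have nw: "cnorm JT w \<le> 4 * K * e" using w(3) mult_left_mono[OF ndt0 K(1)] by simp
  have "t0 - w \<in> T.C (i + j)" "dT (t0 - w) = 0" using t0C w T.CD(4) by (auto simp: T.lD)
  then obtain s where s: "s \<in> T.C (Suc (i + j))" "dT s = t0 - w" "cnorm JT s \<le> K * cnorm JT (t0 - w)"
    using K(3) by blast
  have "cnorm JT (t0 - w) \<le> 4 + 4 * K"
    using cnormD(5)[of JT t0 w] nt0 nw mult_left_mono[OF e(2), of "4 * K"] K(1) by simp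
  then have ns: "cnorm JT s \<le> K * (4 + 4 * K)" using s(3) mult_left_mono[OF _ K(1)] order_trans by blast
  have "t0 = w + dT s" using s(2) by simp
  then have "norm (W t0) \<le> norm (W w) + norm (W (dT s))" using norm_triangle_ineq[of "W w" "W (dT s)"] by (simp only: Wadd)
  also have "\<dots> \<le> M * (4 * K * e) + 2 * (M * e) * (K * (4 + 4 * K))"
    using Wb[of w] mult_left_mono[OF nw M(1)] WdT[of s] mult_left_mono[OF ns, of "2 * (M * e)"] M(1) e(1) by simp
  also have "\<dots> = L * e" by (simp add: L_def algebra_simps)
  also have "\<dots> < 1 / 4" using L by (simp add: e_def field_simps)
  finally show False using Wt0 by simp
qed

section \<open>Homotopies of a tensor product of complexes\<close>

lemma lift1_chains:
  assumes "\<And>R S. M R S \<noteq> 0 \<Longrightarrow> deg1 R + u = deg1 S + v" "t \<in> T.C q" "q' + u = q + v"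
  shows "\<Lambda>1 J1 J2 M t \<in> T.C q'"
  unfolding chains_def
proof (intro CollectI allI impI, clarify)
  fix R R' assume "\<Lambda>1 J1 J2 M t (R, R') \<noteq> 0"
  then have J: "R \<in> J1" "R' \<in> J2" and "(\<Sum>S\<in>J1. blinfun_apply (M R S \<otimes>\<^sub>o id_blinfun) (t (S, R'))) \<noteq> 0"
    by (auto simp: lift1_def split: if_splits)
  from this(3) obtain S where "blinfun_apply (M R S \<otimes>\<^sub>o id_blinfun) (t (S, R')) \<noteq> 0"
    by (rule sum.not_neutral_contains_not_neutral)
  then have "M R S \<noteq> 0" "t (S, R') \<noteq> 0" by (auto simp: blinfun.zero_left blinfun.zero_right)
  moreover from this have "deg1 S + deg2 R' = q" using assms(2) by (auto simp: chains_def degT_def)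
  ultimately show "(R, R') \<in> JT \<and> degT (R, R') = q'"
    using assms(1)[of R S] assms(3) J by (simp add: degT_def)
qed

lemma lift2_chains:
  assumes "\<And>R S. M R S \<noteq> 0 \<Longrightarrow> deg2 R + u = deg2 S + v" "t \<in> T.C q" "q' + u = q + v"
  shows "\<Lambda>2 J1 J2 M t \<in> T.C q'"
  unfolding chains_def
proof (intro CollectI allI impI, clarify)
  fix R R' assume "\<Lambda>2 J1 J2 M t (R, R') \<noteq> 0"
  then have J: "R \<in> J1" "R' \<in> J2" and "(\<Sum>S\<in>J2. blinfun_apply (id_blinfun \<otimes>\<^sub>o M R' S) (t (R, S))) \<noteq> 0"
    by (auto simp: lift2_def split: if_splits)
  from this(3) obtain S where "blinfun_apply (id_blinfun \<otimes>\<^sub>o M R' S) (t (R, S)) \<noteq> 0"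
    by (rule sum.not_neutral_contains_not_neutral)
  then have "M R' S \<noteq> 0" "t (R, S) \<noteq> 0" by (auto simp: blinfun.zero_left blinfun.zero_right)
  moreover from this have "deg1 R + deg2 S = q" using assms(2) by (auto simp: chains_def degT_def)
  ultimately show "(R, R') \<in> JT \<and> degT (R, R') = q'"
    using assms(1)[of R' S] assms(3) J by (simp add: degT_def)
qed

end

context matrix_complex
begin

lemma mat_of_hop:
  assumes "hop h"
  shows "mat_of J h R S \<in> cblinfuns" "mat_of J h R S \<noteq> 0 \<Longrightarrow> deg R = Suc (deg S)"
proof -
  have b: "bop J h" using assms by (simp add: hop_def)
  show "mat_of J h R S \<in> cblinfuns" by (rule mat_of_cblinfun[OF finJ b])
  assume nz: "mat_of J h R S \<noteq> 0"
  have "R \<in> J \<and> S \<in> J"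
  proof (rule ccontr)
    assume "\<not> ?thesis"
    then have "mat_of J h R S = 0" by (simp only: mat_of_def if_False)
    then show False using nz by simp
  qed
  then have RS: "R \<in> J" "S \<in> J" by auto
  have "\<exists>x. blinfun_apply (mat_of J h R S) x \<noteq> 0"
  proof (rule ccontr)
    assume "\<not> ?thesis"
    then have "mat_of J h R S = 0" by (intro blinfun_eqI) simp
    then show False using nz by simp
  qed
  then obtain x where "blinfun_apply (mat_of J h R S) x \<noteq> 0" by blast
  then have "h (single S x) R \<noteq> 0" by (simp add: mat_of_apply[OF finJ b RS])
  moreover have "single S x \<in> C (deg S)" using RS by (auto simp: chains_def single_def split: if_splits)
  then have "h (single S x) \<in> C (Suc (deg S))" using assms unfolding hop_def by blast
  ultimately show "deg R = Suc (deg S)" unfolding chains_def by blast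
qed

text \<open>The matrix of I - (d h + h d). Its columns vanish in those degrees in which h satisfies
  the homotopy identity.\<close>

definition error_matrix :: "(('j \<Rightarrow> 'x) \<Rightarrow> 'j \<Rightarrow> 'x) \<Rightarrow> 'j \<Rightarrow> 'j \<Rightarrow> ('x \<Rightarrow>\<^sub>L 'x)"
  where "error_matrix h R S = (if R = S then id_blinfun else 0) - mm J A (mat_of J h) R S - mm J (mat_of J h) A R S"

lemma error_matrix_zero:
  assumes h: "hop h" and good: "\<And>c. c \<in> C q \<Longrightarrow> mop J A (h c) + h (mop J A c) = c"
    and RS: "R \<in> J" "S \<in> J" "deg S = q"
  shows "error_matrix h R S = 0"
proof (rule blinfun_eqI)
  fix x :: 'x
  let ?s = "single S x"
  have sC: "?s \<in> C q" using RS by (auto simp: chains_def single_def split: if_splits)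
  have b: "bop J h" using h by (simp add: hop_def)
  have "blinfun_apply (mm J A (mat_of J h) R S) x = mop J A (h ?s) R"
    using mop_single[OF finJ RS(1,2), of "mm J A (mat_of J h)" x]
    by (simp add: mop_mm mop_mat_of[OF finJ b C_supp[OF sC]])
  moreover have "blinfun_apply (mm J (mat_of J h) A R S) x = h (mop J A ?s) R"
    using mop_single[OF finJ RS(1,2), of "mm J (mat_of J h) A" x]
    by (simp add: mop_mm mop_mat_of[OF finJ b dC_supp[OF sC]])
  moreover have "(mop J A (h ?s) + h (mop J A ?s)) R = ?s R" using good[OF sC] by simp
  ultimately show "blinfun_apply (error_matrix h R S) x = blinfun_apply 0 x"
    by (auto simp: error_matrix_def blinfun.diff_left blinfun.add_left single_def fun_ops algebra_simps split: if_splits)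
qed

end

context tensor_complex
begin

lemma lift1_error:
  assumes h: "K1.hop h" and t: "t \<in> supp_on JT"
  shows "\<Lambda>1 J1 J2 (K1.error_matrix h) t =
    t - \<Lambda>1 J1 J2 A1 (\<Lambda>1 J1 J2 (mat_of J1 h) t) - \<Lambda>1 J1 J2 (mat_of J1 h) (\<Lambda>1 J1 J2 A1 t)"
proof -
  note mc = K1.mat_of_hop(1)[OF h]
  have mmc: "mm J1 A1 (mat_of J1 h) R S \<in> cblinfuns" "mm J1 (mat_of J1 h) A1 R S \<in> cblinfuns" for R S
    by (auto simp: mm_def K1.cblin mc)
  have "\<Lambda>1 J1 J2 (K1.error_matrix h) t (R, R') = (t - \<Lambda>1 J1 J2 (mm J1 A1 (mat_of J1 h)) t - \<Lambda>1 J1 J2 (mm J1 (mat_of J1 h) A1) t) (R, R')" for R R'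
  proof (cases "R \<in> J1 \<and> R' \<in> J2")
    case False
    then have "t (R, R') = 0" using t by (auto simp: supp_on_def)
    then show ?thesis using False by (auto simp: lift1_def fun_ops)
  next
    case True
    have "blinfun_apply (K1.error_matrix h R S \<otimes>\<^sub>o id_blinfun) v = (if R = S then v else 0) -
      blinfun_apply (mm J1 A1 (mat_of J1 h) R S \<otimes>\<^sub>o id_blinfun) v - blinfun_apply (mm J1 (mat_of J1 h) A1 R S \<otimes>\<^sub>o id_blinfun) v" for S v
      using mmc by (simp add: K1.error_matrix_def op_diff T3_id blinfun.diff_left blinfun.zero_left)
    then show ?thesis using True K1.finJ by (simp add: lift1_def fun_ops sum_subtractf sum.delta)
  qed
  then have "\<Lambda>1 J1 J2 (K1.error_matrix h) t = t - \<Lambda>1 J1 J2 (mm J1 A1 (mat_of J1 h)) t - \<Lambda>1 J1 J2 (mm J1 (mat_of J1 h) A1) t"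
    by (auto simp: fun_eq_iff)
  then show ?thesis by (simp add: lift1_mm K1.cblin mc)
qed

lemma lift2_error:
  assumes h: "K2.hop h" and t: "t \<in> supp_on JT"
  shows "\<Lambda>2 J1 J2 (K2.error_matrix h) t =
    t - \<Lambda>2 J1 J2 A2 (\<Lambda>2 J1 J2 (mat_of J2 h) t) - \<Lambda>2 J1 J2 (mat_of J2 h) (\<Lambda>2 J1 J2 A2 t)"
proof -
  note mc = K2.mat_of_hop(1)[OF h]
  have mmc: "mm J2 A2 (mat_of J2 h) R S \<in> cblinfuns" "mm J2 (mat_of J2 h) A2 R S \<in> cblinfuns" for R S
    by (auto simp: mm_def K2.cblin mc)
  have "\<Lambda>2 J1 J2 (K2.error_matrix h) t (R, R') = (t - \<Lambda>2 J1 J2 (mm J2 A2 (mat_of J2 h)) t - \<Lambda>2 J1 J2 (mm J2 (mat_of J2 h) A2) t) (R, R')" for R R'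
  proof (cases "R \<in> J1 \<and> R' \<in> J2")
    case False
    then have "t (R, R') = 0" using t by (auto simp: supp_on_def)
    then show ?thesis using False by (auto simp: lift2_def fun_ops)
  next
    case True
    have "blinfun_apply (id_blinfun \<otimes>\<^sub>o K2.error_matrix h R' S) v = (if R' = S then v else 0) -
      blinfun_apply (id_blinfun \<otimes>\<^sub>o mm J2 A2 (mat_of J2 h) R' S) v - blinfun_apply (id_blinfun \<otimes>\<^sub>o mm J2 (mat_of J2 h) A2 R' S) v" for S v
      using mmc by (simp add: K2.error_matrix_def op_diff T3_id blinfun.diff_left blinfun.zero_left)
    then show ?thesis using True K2.finJ by (simp add: lift2_def fun_ops sum_subtractf sum.delta)
  qed
  then have "\<Lambda>2 J1 J2 (K2.error_matrix h) t = t - \<Lambda>2 J1 J2 (mm J2 A2 (mat_of J2 h)) t - \<Lambda>2 J1 J2 (mm J2 (mat_of J2 h) A2) t"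
    by (auto simp: fun_eq_iff)
  then show ?thesis by (simp add: lift2_mm K2.cblin mc)
qed

text \<open>Let E1 and E2 be the errors I - (d h + h d) and I - (d g + g d) of the two factors. The
  operator h \<otimes> I plus the signed E1 \<otimes> g is a homotopy with error E1 \<otimes> E2. On
  the summand of bidegree (i, j) one of the two errors vanishes, as i lies in \<open>Q1\<close> or j
  in \<open>Q2\<close>.\<close>

theorem split_tensor:
  assumes h: "K1.hop h" "\<And>q c. q \<in> Q1 \<Longrightarrow> c \<in> K1.C q \<Longrightarrow> mop J1 A1 (h c) + h (mop J1 A1 c) = c"
    and g: "K2.hop g" "\<And>q c. q \<in> Q2 \<Longrightarrow> c \<in> K2.C q \<Longrightarrow> mop J2 A2 (g c) + g (mop J2 A2 c) = c"
    and r: "\<And>i j. i + j = r \<Longrightarrow> i \<in> Q1 \<or> j \<in> Q2"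
  shows "T.split_at r"
proof -
  define a where "a = \<Lambda>1 J1 J2 A1"
  define b where "b = \<Lambda>2 J1 J2 A2"
  define hh where "hh = \<Lambda>1 J1 J2 (mat_of J1 h)"
  define gg where "gg = \<Lambda>2 J1 J2 (mat_of J2 g)"
  define s where "s = (sg deg1 :: ('j \<times> 'k \<Rightarrow> 't) \<Rightarrow> _)"
  note hc = K1.mat_of_hop(1)[OF h(1)] and gc = K2.mat_of_hop(1)[OF g(1)]
  have "clinear a" "clinear b" "clinear hh" "clinear gg" "clinear s"
    unfolding a_def b_def hh_def gg_def s_def by (intro lift1_lin lift2_lin sg_lin K1.cblin K2.cblin hc gc)+
  note lins = this[THEN clinearD(1)] this[THEN clinearD(3)] this[THEN clinearD(4)] this[THEN clinearD(5)]
  have comm: "b (a t) = a (b t)" "b (hh t) = hh (b t)" "gg (a t) = a (gg t)" "gg (hh t) = hh (gg t)" for t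
    unfolding a_def b_def hh_def gg_def by (rule lift_commute; rule K1.cblin K2.cblin hc gc)+
  have aa: "a (a t) = 0" for t unfolding a_def by (rule lift1_zero)
  have "hh (s t) = - s (hh t)" for t
    unfolding hh_def s_def using K1.mat_of_hop(2)[OF h(1)] by (intro sg_lift1[OF hc]) blast
  moreover have "gg (s t) = s (gg t)" for t unfolding gg_def s_def by (rule sg_lift2[OF gc])
  moreover have "a (s t) = - s (a t)" "b (s t) = s (b t)" "s (s t) = t" for t
    unfolding a_def b_def s_def by (rule sg_A1, rule sg_A2, rule sg_sg)
  ultimately have sgn: "a (s t) = - s (a t)" "hh (s t) = - s (hh t)" "b (s t) = s (b t)" "gg (s t) = s (gg t)" "s (s t) = t" for t
    by blast+
  define err where "err t = t - a (hh t) - hh (a t)" for t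
  define H where "H t = hh t + s (err (gg t))" for t
  \<comment> \<open>The first summand of \<open>H\<close> contributes I - E1, the second E1(I - E2).
    The cross terms cancel because the sign anticommutes with \<open>a\<close> and
    \<open>hh\<close>, and because \<open>a\<close> commutes with \<open>err\<close> as its square
    is zero.\<close>
  have homotopy: "dT (H t) + H (dT t) = t - err (t - b (gg t) - gg (b t))" for t
    unfolding dT_def a_def[symmetric] b_def[symmetric] s_def[symmetric]
    by (simp add: H_def err_def lins comm aa sgn algebra_simps)
  have ba: "bop JT a" and "bop JT b" and bh: "bop JT hh" and bg: "bop JT gg" and bs: "bop JT s"
    unfolding a_def b_def hh_def gg_def s_def
    by (intro bop_lift1 bop_lift2 bop_sg K1.finJ K2.finJ K1.cblin K2.cblin hc gc)+
  have "bop JT H"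
    unfolding H_def[abs_def] err_def
    by (intro bop_add bop_compose[OF bs] bop_diff bop_compose[OF ba] bop_compose[OF bh] bop_compose[OF bg] bh bg)
  moreover have "H t \<in> T.C (Suc q)" if t: "t \<in> T.C q" for t q
  proof -
    \<comment> \<open>The degree is shifted by v - u; \<open>lift1_chains\<close> keeps the two
      naturals apart to avoid truncated subtraction.\<close>
    have hC: "hh v \<in> T.C (Suc q)" if "v \<in> T.C q" for v q
      unfolding hh_def by (rule lift1_chains[where u=0 and v=1, OF _ that]) (use K1.mat_of_hop(2)[OF h(1)] in auto)
    have gC: "gg v \<in> T.C (Suc q)" if "v \<in> T.C q" for v q
      unfolding gg_def by (rule lift2_chains[where u=0 and v=1, OF _ that]) (use K2.mat_of_hop(2)[OF g(1)] in auto)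
    have aC: "a v \<in> T.C q" if "v \<in> T.C (Suc q)" for v q
      unfolding a_def by (rule lift1_chains[where u=1 and v=0, OF _ that]) (use K1.entry_deg in auto)
    have sC: "s v \<in> T.C q" if "v \<in> T.C q" for v q
      using that by (auto simp: s_def sg_def chains_def)
    have "err (gg t) \<in> T.C (Suc q)"
      unfolding err_def using gC[OF t] by (intro T.CD(4) aC hC)
    then show ?thesis unfolding H_def using t by (intro T.CD(2) hC sC)
  qed
  moreover have "dT (H t) + H (dT t) = t" if t: "t \<in> T.C r" for t
  proof -
    have tS: "t \<in> supp_on JT" by (rule T.C_supp[OF t])
    have e2: "t - b (gg t) - gg (b t) = \<Lambda>2 J1 J2 (K2.error_matrix g) t"
      unfolding lift2_error[OF g(1) tS] b_def gg_def ..
    have e2S: "\<Lambda>2 J1 J2 (K2.error_matrix g) t \<in> supp_on JT" by (auto simp: lift2_def supp_on_def)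
    have "err (\<Lambda>2 J1 J2 (K2.error_matrix g) t) = \<Lambda>1 J1 J2 (K1.error_matrix h) (\<Lambda>2 J1 J2 (K2.error_matrix g) t)"
      unfolding lift1_error[OF h(1) e2S] err_def a_def hh_def ..
    also have "\<dots> = 0"
    proof -
      have "blinfun_apply (K1.error_matrix h R S \<otimes>\<^sub>o id_blinfun) (blinfun_apply (id_blinfun \<otimes>\<^sub>o K2.error_matrix g R' S') (t (S, S'))) = 0"
        if "R \<in> J1" "R' \<in> J2" "S \<in> J1" "S' \<in> J2" for R R' S S'
      proof (cases "t (S, S') = 0")
        case False
        then have "deg1 S + deg2 S' = r" using t by (auto simp: chains_def degT_def)
        from r[OF this] have "K1.error_matrix h R S = 0 \<or> K2.error_matrix g R' S' = 0"
        proof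
          assume "deg1 S \<in> Q1"
          then have "K1.error_matrix h R S = 0" by (intro K1.error_matrix_zero[OF h(1) _ that(1,3) refl] h(2))
          then show ?thesis ..
        next
          assume "deg2 S' \<in> Q2"
          then have "K2.error_matrix g R' S' = 0" by (intro K2.error_matrix_zero[OF g(1) _ that(2,4) refl] g(2))
          then show ?thesis ..
        qed
        then show ?thesis by (auto simp: blinfun.zero_left blinfun.zero_right)
      qed (simp add: blinfun.zero_right)
      then show ?thesis by (auto simp: fun_eq_iff fun_ops lift1_def lift2_def blinfun.sum_right)
    qed
    finally show ?thesis using homotopy[of t] e2 by simp
  qed
  ultimately show ?thesis unfolding T.split_at_def T.hop_def by (intro exI[of _ H]) blast
qed

text \<open>Let p be the first degree in which the first complex does not split, or r + 1 if there
  is none up to r. Then the second one splits in all degrees below r + 1 - p, and i + j = r implies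
  i < p or j < r + 1 - p, so the partial homotopies suffice for degree r.\<close>

theorem not_split_below:
  assumes "\<not> T.split_at r"
  shows "\<exists>i j. i + j \<le> r \<and> \<not> K1.split_at i \<and> \<not> K2.split_at j"
proof (rule ccontr)
  assume "\<not> ?thesis"
  then have no: "K1.split_at i \<or> K2.split_at j" if "i + j \<le> r" for i j using that by blast
  define p where "p = (LEAST i. i = Suc r \<or> \<not> K1.split_at i)"
  have p: "p = Suc r \<or> \<not> K1.split_at p" unfolding p_def by (rule LeastI[of _ "Suc r"]) simp
  have below: "K1.split_at i" if "i < p" for i using not_less_Least[OF that[unfolded p_def]] by simp
  have above: "K2.split_at j" if "j < Suc r - p" for j using p no[of p j] that by auto
  obtain h where h: "K1.hop h" "\<forall>q<p. \<forall>c\<in>K1.C q. mop J1 A1 (h c) + h (mop J1 A1 c) = c"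
    using K1.exists_homotopy_below[OF below] by blast
  obtain g where g: "K2.hop g" "\<forall>q<Suc r - p. \<forall>c\<in>K2.C q. mop J2 A2 (g c) + g (mop J2 A2 c) = c"
    using K2.exists_homotopy_below[OF above] by blast
  have "T.split_at r"
    by (rule split_tensor[where ?Q1.0="{..<p}" and ?Q2.0="{..<Suc r - p}", OF h(1) _ g(1)]) (use h g in auto)
  then show False using assms by simp
qed

text \<open>Let p be the least degree from which the first complex splits upwards. If p > 0, it
  fails to split in degree p - 1, so the second one splits from degree r + 1 - p on, and i + j = r
  implies i \<ge> p or j \<ge> r + 1 - p. If p = 0 the first complex splits everywhere; if it fails
  in some degree from r on, the second one splits everywhere.\<close>

theorem not_split_above:
  assumes "\<not> T.split_at r"
  shows "\<exists>i j. r \<le> i + j \<and> \<not> K1.split_at i \<and> \<not> K2.split_at j"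
proof (rule ccontr)
  assume "\<not> ?thesis"
  then have no: "K1.split_at i \<or> K2.split_at j" if "r \<le> i + j" for i j using that by blast
  show False
  proof (cases "\<exists>i\<ge>r. \<not> K1.split_at i")
    case True
    then have K2: "K2.split_at j" for j using no[of _ j] by (meson trans_le_add1)
    obtain h where h: "K1.hop h" using K1.exists_homotopy_below[of 0] by blast
    obtain g where g: "K2.hop g" "\<forall>q\<ge>0. \<forall>c\<in>K2.C q. mop J2 A2 (g c) + g (mop J2 A2 c) = c"
      using K2.exists_homotopy_above[of 0, OF K2] by blast
    have "T.split_at r"
      by (rule split_tensor[where ?Q1.0="{}" and ?Q2.0=UNIV, OF h _ g(1)]) (use g in auto)
    then show False using assms by simp
  next
    case False
    define p where "p = (LEAST i. \<forall>i'\<ge>i. K1.split_at i')"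
    have "\<forall>i'\<ge>p. K1.split_at i'" unfolding p_def by (rule LeastI[of _ r]) (use False in blast)
    then have p: "\<And>i. p \<le> i \<Longrightarrow> K1.split_at i" by blast
    define n where "n = (if p = 0 then Suc r else Suc r - p)"
    have K2: "K2.split_at j" if j: "n \<le> j" "p \<noteq> 0" for j
    proof -
      have "\<not> (\<forall>i'\<ge>p - 1. K1.split_at i')" using not_less_Least[of "p - 1" "\<lambda>i. \<forall>i'\<ge>i. K1.split_at i'"] j(2) by (simp add: p_def)
      then obtain i' where "p - 1 \<le> i'" "\<not> K1.split_at i'" by blast
      then show ?thesis using no[of i' j] j by (auto simp: n_def)
    qed
    obtain h where h: "K1.hop h" "\<forall>q\<ge>p. \<forall>c\<in>K1.C q. mop J1 A1 (h c) + h (mop J1 A1 c) = c"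
      using K1.exists_homotopy_above[of p, OF p] by blast
    show False
    proof (cases "p = 0")
      case True
      obtain g where g: "K2.hop g" using K2.exists_homotopy_below[of 0] by blast
      have "T.split_at r"
        by (rule split_tensor[where ?Q1.0=UNIV and ?Q2.0="{}", OF h(1) _ g(1)]) (use h True in auto)
      then show False using assms by simp
    next
      case False
      obtain g where g: "K2.hop g" "\<forall>q\<ge>n. \<forall>c\<in>K2.C q. mop J2 A2 (g c) + g (mop J2 A2 c) = c"
        using K2.exists_homotopy_above[of n, OF K2[OF _ False]] by blast
      have "T.split_at r"
        by (rule split_tensor[where ?Q1.0="{p..}" and ?Q2.0="{n..}", OF h(1) _ g(1)]) (use h g False in \<open>auto simp: n_def\<close>)
      then show False using assms by simp
    qed
  qed
qed

end

section \<open>Hilbert spaces\<close>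

text \<open>The norm \<open>cnorm\<close> is a sum of norms and does not come from an inner product;
  it is equivalent to the one of the orthogonal sum \<open>IP\<close>. For the latter, a minimizing
  sequence in \<open>A\<close> is Cauchy by the parallelogram law, and its limit is the orthogonal
  projection.\<close>

lemma hilbert_projection:
  fixes A :: "('j \<Rightarrow> 'x::complex_banach) set"
  assumes hilb: "hilbert_space TYPE('x)" and J: "finite J"
    and A: "complex_vector.subspace A" "A \<subseteq> supp_on J" "closed A"
  shows "\<exists>P K. clinear P \<and> (\<forall>x. P x \<in> A) \<and> (\<forall>a\<in>A. P a = a) \<and> 0 \<le> K \<and> (\<forall>x. cnorm J (P x) \<le> K * cnorm J x)"
proof -
  note AD = csubspaceD[OF A(1)]
  obtain ip :: "'x \<Rightarrow> 'x \<Rightarrow> complex" where ip: "\<And>x y z. ip (x + y) z = ip x z + ip y z"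
    "\<And>a x y. ip (a *\<^sub>C x) y = a * ip x y" "\<And>x y. ip y x = cnj (ip x y)"
    "\<And>x. ip x x = complex_of_real ((norm x)\<^sup>2)"
    using hilb unfolding hilbert_space_def by blast
  define IP where "IP c c' = (\<Sum>j\<in>J. ip (c j) (c' j))" for c c'
  define Q where "Q c = (\<Sum>j\<in>J. (norm (c j))\<^sup>2)" for c :: "'j \<Rightarrow> 'x"
  have IPadd: "IP (x + y) z = IP x z + IP y z" for x y z by (simp add: IP_def fun_ops ip(1) sum.distrib)
  have IPsc: "IP (a *\<^sub>C x) y = a * IP x y" for a x y by (simp add: IP_def fun_ops ip(2) sum_distrib_left)
  have IPcnj: "IP y x = cnj (IP x y)" for x y unfolding IP_def cnj_sum by (intro sum.cong refl ip(3))
  have IPadd': "IP z (x + y) = IP z x + IP z y" for x y z using IPadd[of x y z] IPcnj by (metis complex_cnj_add)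
  have IPsc': "IP y (a *\<^sub>C x) = cnj a * IP y x" for a x y using IPsc[of a x y] IPcnj by (metis complex_cnj_mult)
  have IPQ: "IP c c = complex_of_real (Q c)" for c by (simp add: IP_def Q_def ip(4))
  have Q0: "0 \<le> Q c" for c by (simp add: Q_def sum_nonneg)
  have IPm: "IP (- x) y = - IP x y" "IP y (- x) = - IP y x" for x y
    using IPsc[of "-1" x y] IPsc'[of y "-1" x] by simp_all
  have Qadd: "Q (x + y) = Q x + Q y + 2 * Re (IP x y)" for x y
  proof -
    have "complex_of_real (Q (x + y)) = IP x x + IP y y + (IP x y + cnj (IP x y))"
      using IPcnj[of y x] by (simp add: IPQ[symmetric] IPadd IPadd')
    also have "\<dots> = complex_of_real (Q x + Q y + 2 * Re (IP x y))" by (simp add: IPQ complex_add_cnj)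
    finally show ?thesis by (simp only: of_real_eq_iff)
  qed
  have Qsc: "Q (a *\<^sub>C x) = (cmod a)\<^sup>2 * Q x" for a x
    by (simp add: Q_def fun_ops norm_scaleC power_mult_distrib sum_distrib_left)
  have Qle: "sqrt (Q c) \<le> cnorm J c" for c
    using L2_set_le_sum[of J "\<lambda>j. norm (c j)"] by (simp add: L2_set_def Q_def cnorm_def)
  have leQ: "cnorm J c \<le> real (card J) * sqrt (Q c)" for c
  proof -
    have "norm (c j) \<le> sqrt (Q c)" if "j \<in> J" for j
      using J that by (intro real_le_rsqrt) (auto simp: Q_def intro: member_le_sum)
    then show ?thesis unfolding cnorm_def using sum_bounded_above[of J "\<lambda>j. norm (c j)" "sqrt (Q c)"] by simp
  qed
  have proj: "\<exists>a\<in>A. \<forall>b\<in>A. IP (x - a) b = 0" if x: "x \<in> supp_on J" for x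
  proof -
    define \<delta> where "\<delta> = Inf ((\<lambda>a. Q (x - a)) ` A)"
    have bdd: "bdd_below ((\<lambda>a. Q (x - a)) ` A)" by (intro bdd_belowI[of _ 0]) (auto simp: Q0)
    have low: "\<delta> \<le> Q (x - a)" if "a \<in> A" for a unfolding \<delta>_def using that bdd by (intro cInf_lower) auto
    have "\<exists>a\<in>A. Q (x - a) < \<delta> + inverse (real (Suc n))" for n
    proof (rule ccontr)
      assume "\<not> ?thesis"
      then have "\<delta> + inverse (real (Suc n)) \<le> \<delta>"
        unfolding \<delta>_def using AD(1) by (intro cInf_greatest) (auto simp: not_less)
      moreover have "0 < inverse (real (Suc n))" by simp
      ultimately show False by linarith
    qed
    then obtain a where a: "\<And>n. a n \<in> A" "\<And>n. Q (x - a n) < \<delta> + inverse (real (Suc n))" by metis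
    \<comment> \<open>The midpoint of \<open>a m\<close> and \<open>a n\<close> lies in
      \<open>A\<close>, so its squared distance from x is at least \<delta>; the parallelogram law
      turns this into a bound for the difference.\<close>
    have par: "Q (a m - a n) < 2 * inverse (real (Suc m)) + 2 * inverse (real (Suc n))" for m n
    proof -
      let ?u = "x - a m" and ?v = "x - a n"
      have "Q (?u + ?v) + Q (?u - ?v) = 2 * Q ?u + 2 * Q ?v"
        using Qadd[of ?u ?v] Qadd[of ?u "- ?v"] Qsc[of "-1" ?v] IPm(2)[of ?u ?v] by simp
      moreover have "Q (?u + ?v) = 4 * Q (x - (1/2) *\<^sub>C (a m + a n))"
      proof -
        have "?u + ?v = 2 *\<^sub>C (x - (1/2) *\<^sub>C (a m + a n))"
          by (simp add: scaleC_diff_right scaleC_scaleC scaleC_2)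
        then show ?thesis by (simp add: Qsc)
      qed
      moreover have "\<delta> \<le> Q (x - (1/2) *\<^sub>C (a m + a n))" using a(1) AD by (intro low) auto
      moreover have "Q (?u - ?v) = Q (a m - a n)"
        using Qsc[of "-1" "a m - a n"] by simp
      ultimately show ?thesis using a(2)[of m] a(2)[of n] by linarith
    qed
    have "\<exists>l\<in>A. (\<lambda>n. cnorm J (a n - l)) \<longlonglongrightarrow> 0"
    proof (rule closed_complete[OF J A(3,2), unfolded seminorm_complete_def, rule_format], intro conjI allI impI a(1))
      fix e :: real assume e: "0 < e"
      \<comment> \<open>One more than the equivalence constant of the norms, to stay positive for
        empty \<open>J\<close>.\<close>
      define c where "c = real (card J) + 1"
      have c: "0 < c" by (simp add: c_def)
      have "0 < (e / c)\<^sup>2 / 4" using e c by simp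
      then obtain k where k: "inverse (real (Suc k)) < (e / c)\<^sup>2 / 4" using reals_Archimedean by blast
      show "\<exists>k. \<forall>m\<ge>k. \<forall>n\<ge>k. cnorm J (a m - a n) < e"
      proof (intro exI[of _ k] allI impI)
        fix m n assume "k \<le> m" "k \<le> n"
        then have "inverse (real (Suc m)) \<le> inverse (real (Suc k))" "inverse (real (Suc n)) \<le> inverse (real (Suc k))"
          by (auto intro: le_imp_inverse_le)
        then have "Q (a m - a n) < (e / c)\<^sup>2" using par[of m n] k by linarith
        then have "sqrt (Q (a m - a n)) < e / c" using e c by (intro real_less_lsqrt) auto
        then have "c * sqrt (Q (a m - a n)) < e" using c by (simp add: less_divide_eq mult.commute)
        moreover have "real (card J) * sqrt (Q (a m - a n)) \<le> c * sqrt (Q (a m - a n))"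
          using Q0 by (intro mult_right_mono) (auto simp: c_def)
        ultimately show "cnorm J (a m - a n) < e" using leQ[of "a m - a n"] by linarith
      qed
    qed
    then obtain l where l: "l \<in> A" "(\<lambda>n. cnorm J (a n - l)) \<longlonglongrightarrow> 0" by blast
    have "sqrt (Q (x - l)) \<le> sqrt \<delta>"
    proof -
      have tri: "sqrt (Q (u + v)) \<le> sqrt (Q u) + sqrt (Q v)" for u v :: "'j \<Rightarrow> 'x"
      proof -
        have "sqrt (Q (u + v)) \<le> L2_set (\<lambda>j. norm (u j) + norm (v j)) J"
          unfolding Q_def L2_set_def[symmetric] fun_ops by (intro L2_set_mono norm_triangle_ineq) auto
        also have "\<dots> \<le> sqrt (Q u) + sqrt (Q v)"
          using L2_set_triangle_ineq[of "\<lambda>j. norm (u j)" "\<lambda>j. norm (v j)" J] by (simp add: Q_def L2_set_def)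
        finally show ?thesis .
      qed
      have "sqrt (Q (x - l)) \<le> sqrt (\<delta> + inverse (real (Suc n))) + cnorm J (a n - l)" for n
        using tri[of "x - a n" "a n - l"] real_sqrt_le_mono[OF less_imp_le[OF a(2)[of n]]] Qle[of "a n - l"] by (simp del: real_sqrt_le_iff)
      moreover have "(\<lambda>n. sqrt (\<delta> + inverse (real (Suc n))) + cnorm J (a n - l)) \<longlonglongrightarrow> sqrt (\<delta> + 0) + 0"
        by (intro tendsto_intros LIMSEQ_inverse_real_of_nat l)
      ultimately show ?thesis by (intro LIMSEQ_le_const) auto
    qed
    then have Ql: "Q (x - l) \<le> \<delta>" by simp
    have "IP (x - l) b = 0" if b: "b \<in> A" for b
    proof -
      define w where "w = IP (x - l) b"
      \<comment> \<open>The minimality of l is tested on l + r w b with real r, where w is the inner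
        product that should vanish. Below, r = 1/(Q(b) + 1) makes the right hand side less than half
        of the left one unless w = 0.\<close>
      have ineq: "2 * r * (cmod w)\<^sup>2 \<le> r\<^sup>2 * (cmod w)\<^sup>2 * Q b" for r :: real
      proof -
        define t where "t = complex_of_real r * w"
        have "Q (x - l) \<le> Q (x - (l + t *\<^sub>C b))" using Ql low[of "l + t *\<^sub>C b"] l(1) b AD by (meson order_trans)
        also have "x - (l + t *\<^sub>C b) = (x - l) + (- t) *\<^sub>C b" by simp
        also have "Q \<dots> = Q (x - l) + (cmod t)\<^sup>2 * Q b + 2 * Re (cnj (- t) * w)"
          using Qadd[of "x - l" "(- t) *\<^sub>C b"] by (simp only: Qsc IPsc' w_def norm_minus_cancel)
        also have "cnj (- t) * w = - complex_of_real (r * (cmod w)\<^sup>2)"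
          using complex_norm_square[of w] by (simp add: t_def mult.commute mult.left_commute)
        finally show ?thesis by (simp add: t_def norm_mult power_mult_distrib)
      qed
      have "(cmod w)\<^sup>2 = 0"
      proof (rule ccontr)
        assume "(cmod w)\<^sup>2 \<noteq> 0"
        then have pos: "0 < (cmod w)\<^sup>2" by simp
        define r where "r = 1 / (Q b + 1)"
        have r: "0 < r" "r * Q b < 1" using Q0[of b] by (auto simp: r_def)
        have "r\<^sup>2 * (cmod w)\<^sup>2 * Q b = (r * (cmod w)\<^sup>2) * (r * Q b)" by (simp add: power2_eq_square)
        also have "\<dots> \<le> (r * (cmod w)\<^sup>2) * 1" using r pos by (intro mult_left_mono) auto
        finally have "r * (cmod w)\<^sup>2 \<le> 0" using ineq[of r] by simp
        moreover have "0 < r * (cmod w)\<^sup>2" using r pos by simp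
        ultimately show False by simp
      qed
      then show ?thesis by (simp add: w_def)
    qed
    then show ?thesis using l(1) by blast
  qed
  \<comment> \<open>Components outside \<open>J\<close> are cut off first, so that the projection is
    linear on the whole function type.\<close>
  define r where "r = (restr (\<lambda>j. j \<in> J) :: ('j \<Rightarrow> 'x) \<Rightarrow> _)"
  have rS: "r x \<in> supp_on J" for x by (auto simp: r_def restr_def supp_on_def)
  have rlin: "clinear r" unfolding r_def using bop_restr by (rule bopD)
  obtain P where P: "\<And>x. P x \<in> A" "\<And>x b. b \<in> A \<Longrightarrow> IP (r x - P x) b = 0"
    using proj[OF rS] by metis
  have uniq: "a = a'" if "a \<in> A" "a' \<in> A" "\<And>b. b \<in> A \<Longrightarrow> IP (x - a) b = 0" "\<And>b. b \<in> A \<Longrightarrow> IP (x - a') b = 0" for a a' x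
  proof -
    have m: "a - a' \<in> A" by (rule AD(4)[OF that(1,2)])
    have "IP ((x - a') + - (x - a)) (a - a') = 0" using that(3)[OF m] that(4)[OF m] by (simp only: IPadd IPm) simp
    then have "IP (a - a') (a - a') = 0" by simp
    then have "Q (a - a') = 0" by (simp add: IPQ)
    then have "cnorm J (a - a') = 0" using leQ[of "a - a'"] cnormD(6)[of J "a - a'"] by simp
    then have "a - a' = 0" using cnorm_eq_0[OF J] m A(2) by blast
    then show ?thesis by simp
  qed
  have "clinear P"
  proof (rule clinearI)
    fix x y
    show "P (x + y) = P x + P y"
    proof (rule uniq[of _ _ "r (x + y)"])
      fix b assume b: "b \<in> A"
      have "r (x + y) - (P x + P y) = (r x - P x) + (r y - P y)" by (simp add: clinearD[OF rlin])
      then show "IP (r (x + y) - (P x + P y)) b = 0" using P(2)[OF b] by (simp only: IPadd) simp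
    qed (use P AD in auto)
  next
    fix s x
    show "P (s *\<^sub>C x) = s *\<^sub>C P x"
    proof (rule uniq[of _ _ "r (s *\<^sub>C x)"])
      fix b assume b: "b \<in> A"
      have "r (s *\<^sub>C x) - s *\<^sub>C P x = s *\<^sub>C (r x - P x)" by (simp add: clinearD[OF rlin] scaleC_diff_right)
      then show "IP (r (s *\<^sub>C x) - s *\<^sub>C P x) b = 0" using P(2)[OF b] by (simp only: IPsc) simp
    qed (use P AD in auto)
  qed
  moreover have "P a = a" if a: "a \<in> A" for a
  proof (rule uniq[of _ _ a])
    have "r a = a" using a A(2) by (auto simp: r_def restr_def supp_on_def fun_eq_iff)
    then show "IP (a - P a) b = 0" if "b \<in> A" for b using P(2)[OF that, of a] by simp
    show "IP (a - a) b = 0" for b using IPsc[of 0 0 b] by simp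
  qed (use P a in auto)
  moreover have "cnorm J (P x) \<le> real (card J) * cnorm J x" for x
  proof -
    have "Q (r x) = Q (r x - P x) + Q (P x)"
      using Qadd[of "r x - P x" "P x"] P(2)[OF P(1), of x x] by simp
    then have "sqrt (Q (P x)) \<le> sqrt (Q (r x))" using Q0[of "r x - P x"] by simp
    also have "\<dots> \<le> cnorm J (r x)" by (rule Qle)
    also have "\<dots> = cnorm J x" by (simp add: cnorm_def r_def restr_def)
    finally have "real (card J) * sqrt (Q (P x)) \<le> real (card J) * cnorm J x" by (intro mult_left_mono) auto
    then show ?thesis using leQ[of "P x"] by linarith
  qed
  ultimately show ?thesis using P(1) by (intro exI[of _ P] exI[of _ "real (card J)"]) auto
qed

context banach_complex
begin

text \<open>A preimage under \<open>d\<close> minus its projection onto the kernel does not depend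
  on the preimage, so this choice is linear; it is bounded by the open mapping theorem. Projecting
  the argument onto the closed range and restricting it to the degree below p makes it an operator
  on all chains.\<close>

lemma hilbert_generalized_inverse:
  assumes hilb: "hilbert_space TYPE('x)" and cl: "closed (d ` C p)"
  shows "\<exists>S. hop S \<and> (\<forall>c\<in>C p. d (S (d c)) = d c)"
proof (cases p)
  case 0
  have "hop (\<lambda>c. 0)" by (auto simp: hop_def bop_zero CD)
  then show ?thesis using 0 d_0 by (intro exI[of _ "\<lambda>c. 0"]) (auto simp: lD)
next
  case (Suc p')
  let ?B = "d ` C p" and ?Z = "{c \<in> C p. d c = 0}"
  have Bs: "?B \<subseteq> supp_on J" using dC_supp by blast
  have Zs: "?Z \<subseteq> supp_on J" using C_supp by blast
  obtain P K where P: "clinear P" "\<And>x. P x \<in> ?B" "\<And>a. a \<in> ?B \<Longrightarrow> P a = a" "0 \<le> K" "\<And>x. cnorm J (P x) \<le> K * cnorm J x"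
    using hilbert_projection[OF hilb finJ subspace_image Bs cl] by blast
  obtain P' K' where P': "clinear P'" "\<And>x. P' x \<in> ?Z" "\<And>a. a \<in> ?Z \<Longrightarrow> P' a = a" "0 \<le> K'" "\<And>x. cnorm J (P' x) \<le> K' * cnorm J x"
    using hilbert_projection[OF hilb finJ subspace_kernel Zs closed_kernel] by blast
  note PD = clinearD[OF P(1)] and PD' = clinearD[OF P'(1)]
  obtain B where B: "\<And>c. c \<in> supp_on J \<Longrightarrow> cnorm J (d c) \<le> B * cnorm J c" using bounded by blast
  have "\<exists>K\<ge>0. \<forall>z\<in>?B. \<exists>x\<in>C p. d x = z \<and> cnorm J x \<le> K * cnorm J z"
  proof (rule open_mapping_seminorm[where C=B, OF cseminorm_cnorm cseminorm_cnorm subspace_chains complete_C subspace_image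
          closed_complete[OF finJ cl Bs] _ lin refl])
    show "z = 0" if "z \<in> ?B" "cnorm J z = 0" for z using cnorm_eq_0[OF finJ] that Bs by blast
    show "cnorm J (d x) \<le> B * cnorm J x" if "x \<in> C p" for x using B C_supp that by blast
  qed
  then obtain K0 where K0: "0 \<le> K0" "\<And>z. z \<in> ?B \<Longrightarrow> \<exists>x\<in>C p. d x = z \<and> cnorm J x \<le> K0 * cnorm J z" by blast
  then obtain w where w: "\<And>z. z \<in> ?B \<Longrightarrow> w z \<in> C p" "\<And>z. z \<in> ?B \<Longrightarrow> d (w z) = z" "\<And>z. z \<in> ?B \<Longrightarrow> cnorm J (w z) \<le> K0 * cnorm J z"
    by metis
  define s where "s z = w z - P' (w z)" for z
  \<comment> \<open>Two preimages differ by an element of the kernel, which \<open>P'\<close> fixes.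
    Linearity of \<open>S\<close> follows by inserting sums and multiples of chosen
    preimages.\<close>
  have s_any: "s z = v - P' v" if "z \<in> ?B" "v \<in> C p" "d v = z" for z v
  proof -
    have "w z - v \<in> C p" "d (w z - v) = 0" using w(1)[OF that(1)] w(2)[OF that(1)] that(2,3) CD(4) by (auto simp only: lD) simp
    then have "w z - v \<in> ?Z" by blast
    from P'(3)[OF this] show ?thesis by (simp add: s_def PD' algebra_simps)
  qed
  define R where "R = (restr (\<lambda>j. deg j = p') :: ('j \<Rightarrow> 'x) \<Rightarrow> _)"
  have Rlin: "clinear R" unfolding R_def using bop_restr by (rule bopD)
  define S where "S c = s (P (R c))" for c
  have SC: "S c \<in> C p" for c unfolding S_def s_def using w(1)[OF P(2)] P'(2) by (intro CD(4)) auto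
  have "clinear S"
  proof (rule clinearI)
    fix x y
    have "w (P (R x)) + w (P (R y)) \<in> C p" using w(1)[OF P(2)] CD(2) by blast
    then have "s (P (R (x + y))) = (w (P (R x)) + w (P (R y))) - P' (w (P (R x)) + w (P (R y)))"
      by (intro s_any P(2)) (simp_all add: lD w(2)[OF P(2)] PD clinearD[OF Rlin])
    then show "S (x + y) = S x + S y" by (simp add: S_def s_def PD')
  next
    fix a x
    have "a *\<^sub>C w (P (R x)) \<in> C p" using w(1)[OF P(2)] CD(3) by blast
    then have "s (P (R (a *\<^sub>C x))) = a *\<^sub>C w (P (R x)) - P' (a *\<^sub>C w (P (R x)))"
      by (intro s_any P(2)) (simp_all add: lD w(2)[OF P(2)] PD clinearD[OF Rlin])
    then show "S (a *\<^sub>C x) = a *\<^sub>C S x" by (simp add: S_def s_def PD' scaleC_diff_right)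
  qed
  moreover have "cnorm J (S c) \<le> ((1 + K') * (K0 * K)) * cnorm J c" for c
  proof -
    let ?v = "w (P (R c))"
    have "cnorm J (R c) \<le> cnorm J c" by (auto simp: R_def cnorm_def restr_def intro!: sum_mono)
    then have "K * cnorm J (R c) \<le> K * cnorm J c" using P(4) by (rule mult_left_mono)
    then have "cnorm J (P (R c)) \<le> K * cnorm J c" using P(5)[of "R c"] by linarith
    then have "K0 * cnorm J (P (R c)) \<le> K0 * (K * cnorm J c)" using K0(1) by (rule mult_left_mono)
    then have v: "cnorm J ?v \<le> K0 * (K * cnorm J c)" using w(3)[OF P(2), of "R c"] by linarith
    have "cnorm J (S c) \<le> (1 + K') * cnorm J ?v"
      using cnormD(5)[of J ?v "P' ?v"] P'(5)[of ?v] by (simp add: S_def s_def algebra_simps)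
    also have "\<dots> \<le> (1 + K') * (K0 * (K * cnorm J c))" using v P'(4) by (intro mult_left_mono) auto
    finally show ?thesis by (simp add: mult.assoc)
  qed
  ultimately have "bop J S" unfolding bop_def using C_supp[OF SC] by blast
  moreover have "S c \<in> C (Suc q)" if c: "c \<in> C q" for c q
  proof (cases "q = p'")
    case True then show ?thesis using SC[of c] Suc by simp
  next
    case False
    then have "R c = 0" using restr_deg[OF c, of "\<lambda>q. q = p'"] by (simp add: R_def)
    then have "S c = S 0" by (simp add: S_def clinearD[OF Rlin])
    then show ?thesis using clinearD(3)[OF \<open>clinear S\<close>] CD(1) by simp
  qed
  moreover have "d (S (d c)) = d c" if c: "c \<in> C p" for c
  proof -
    have "d c \<in> C p'" using c d_deg Suc by simp
    then have "R (d c) = d c" using restr_deg[of "d c" p' "\<lambda>q. q = p'"] by (simp add: R_def)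
    then have "P (R (d c)) = d c" using P(3)[of "d c"] c by simp
    moreover have "d (P' v) = 0" for v using P'(2)[of v] by simp
    ultimately show ?thesis using w(2)[of "d c"] c by (simp add: S_def s_def lD)
  qed
  ultimately show ?thesis unfolding hop_def by blast
qed

text \<open>With generalized inverses S and S' of the differentials on \<open>C p\<close> and
  \<open>C (Suc p)\<close>, the chain c - S(d c) is a cycle, hence a boundary, and d S' is the
  identity on boundaries. So S'(c - S(d c)) and S split the complex.\<close>

theorem hilbert_split:
  assumes hilb: "hilbert_space TYPE('x)" and st: "strict_at p"
  shows "split_at p"
proof -
  have ex: "exact_at p" and cl: "closed (d ` C p)" using st by (auto simp: strict_at_def)
  have im: "d ` C (Suc p) = {c \<in> C p. d c = 0}" using ex d_deg dd[OF C_supp] by (auto simp: exact_at_def)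
  obtain S where S: "hop S" "\<And>c. c \<in> C p \<Longrightarrow> d (S (d c)) = d c"
    using hilbert_generalized_inverse[OF hilb cl] by blast
  obtain S' where S': "hop S'" "\<And>c. c \<in> C (Suc p) \<Longrightarrow> d (S' (d c)) = d c"
    using hilbert_generalized_inverse[OF hilb, of "Suc p"] closed_kernel im by metis
  have Sb: "bop J S" "bop J S'" using S S' by (auto simp: hop_def)
  have S'z: "d (S' z) = z" if "z \<in> C p" "d z = 0" for z
  proof -
    have "z \<in> d ` C (Suc p)" using im that by simp
    then obtain c where c: "c \<in> C (Suc p)" "z = d c" by blast
    then show ?thesis using S'(2) by simp
  qed
  define h where "h = (\<lambda>c. S' (c - restr (\<lambda>j. deg j = p) (S (d (restr (\<lambda>j. deg j = p) c)))))"
  have SdC: "S (d c) \<in> C p" if "c \<in> C p" for c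
  proof (cases p)
    case 0 then show ?thesis using d_0 that CD(1) by (simp add: clinearD[OF bopD(1)[OF Sb(1)]])
  next
    case (Suc p') then show ?thesis using d_deg that S(1) by (auto simp: hop_def)
  qed
  have hc: "h c = S' (c - S (d c))" if "c \<in> C p" for c
    using restr_deg[OF that, of "\<lambda>q. q = p"] restr_deg[OF SdC[OF that], of "\<lambda>q. q = p"] by (simp add: h_def)
  have "bop J h"
    unfolding h_def by (intro bop_compose[OF Sb(2)] bop_diff bop_id bop_compose[OF bop_restr] bop_compose[OF Sb(1)] bop_compose[OF bop_d] bop_restr)
  moreover have "h c \<in> C (Suc q)" if c: "c \<in> C q" for c q
  proof (cases "q = p")
    case True
    then have "c - S (d c) \<in> C p" using SdC c by (intro CD(4)) auto
    then show ?thesis using True hc c S'(1) by (auto simp: hop_def)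
  next
    case False
    then have "restr (\<lambda>j. deg j = p) c = 0" using restr_deg[OF c, of "\<lambda>q. q = p"] by simp
    then have "h c = S' c" by (simp add: h_def lD clinearD[OF bopD(1)[OF Sb(1)]] clinearD(3)[OF bopD(1)[OF bop_restr]])
    then show ?thesis using S'(1) c by (auto simp: hop_def)
  qed
  ultimately have hh: "hop h" by (simp add: hop_def)
  have "d (h c) + S (d c) = c" if c: "c \<in> C p" for c
  proof -
    have "c - S (d c) \<in> C p" using c SdC CD(4) by blast
    moreover have "d (c - S (d c)) = 0" by (simp add: lD S(2)[OF c])
    ultimately show ?thesis using S'z hc[OF c] by simp
  qed
  then show ?thesis unfolding split_at_def using S(1) hh by (intro exI[of _ h] exI[of _ S] conjI ballI)
qed

text \<open>Applying d to the splitting identity shows that d h' fixes the outgoing range. A limit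
  of that range is thus fixed by the bounded operator d h' and lies in the range itself.\<close>

lemma image_split_closed:
  assumes "split_at p"
  shows "strict_at p"
proof -
  obtain h h' where h: "hop h" "hop h'" "\<And>c. c \<in> C p \<Longrightarrow> d (h c) + h' (d c) = c"
    using assms by (auto simp: split_at_def)
  have hb: "bop J h" "bop J h'" using h by (auto simp: hop_def)
  note hD' = clinearD[OF bopD(1)[OF hb(2)]]
  have ex: "exact_at p"
    unfolding exact_at_def
  proof (intro ballI impI)
    fix c assume c: "c \<in> C p" "d c = 0"
    then have "c = d (h c)" using h(3)[of c] by (simp add: hD')
    then show "c \<in> d ` C (Suc p)" using h(1) c by (auto simp: hop_def)
  qed
  have dhd: "d (h' (d c)) = d c" if "c \<in> C p" for c
  proof -
    have "d (d (h c)) = 0" using bopD(2)[OF hb(1) C_supp[OF that]] by (rule dd)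
    then show ?thesis using arg_cong[OF h(3)[OF that], of d] by (simp add: lD)
  qed
  have "closed (d ` C p)"
  proof (cases p)
    case 0
    have "d ` C p = {0}" using 0 d_0 CD(1) by (auto intro!: image_eqI[of _ _ 0] simp: lD)
    moreover have "{0} = (chains {} deg p :: ('j \<Rightarrow> 'x) set)" by (auto simp: chains_def fun_eq_iff fun_ops)
    ultimately show ?thesis using closed_chains[OF finite.emptyI, of deg p] by metis
  next
    case (Suc p')
    show ?thesis
    proof (rule closed_if_limits[OF finJ])
      show "d ` C p \<subseteq> supp_on J" using dC_supp by blast
      fix y l assume y: "\<And>n. y n \<in> d ` C p" and l: "l \<in> supp_on J" "(\<lambda>n. cnorm J (y n - l)) \<longlonglongrightarrow> 0"
      have yC: "y n \<in> C p'" for n using y[of n] d_deg Suc by auto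
      have lC: "l \<in> C p'" by (rule closed_limit_mem[OF finJ closed_chains[OF finJ] yC chains_supp l])
      have b: "bop J (\<lambda>c. d (h' c))" by (intro bop_compose[OF bop_d] hb)
      obtain B where B: "0 \<le> B" "\<And>c. c \<in> supp_on J \<Longrightarrow> cnorm J (d (h' c)) \<le> B * cnorm J c" using bopD(3)[OF b] by blast
      have fix_y: "d (h' (y n)) = y n" for n using y[of n] dhd by auto
      have "cnorm J (l - d (h' l)) \<le> (1 + B) * cnorm J (y n - l)" for n
      proof -
        have "l - d (h' l) = d (h' (y n - l)) - (y n - l)" using fix_y[of n] by (simp add: hD' lD)
        then have "cnorm J (l - d (h' l)) \<le> cnorm J (d (h' (y n - l))) + cnorm J (y n - l)"
          using cnormD(5)[of J "d (h' (y n - l))" "y n - l"] by (simp only:)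
        moreover have "y n - l \<in> supp_on J" using C_supp[OF yC] l csubspaceD(4)[OF subspace_supp_on] by blast
        ultimately show ?thesis
          using B(2)[of "y n - l"] by (simp add: distrib_right)
      qed
      moreover have "(\<lambda>n. (1 + B) * cnorm J (y n - l)) \<longlonglongrightarrow> (1 + B) * 0" by (intro tendsto_intros l)
      ultimately have "cnorm J (l - d (h' l)) \<le> 0" by (intro LIMSEQ_le_const[where a="cnorm J (l - d (h' l))"]) auto
      then have "cnorm J (l - d (h' l)) = 0" using cnormD(6)[of J "l - d (h' l)"] by linarith
      moreover have "h' l \<in> C p" using lC h(2) Suc by (auto simp: hop_def)
      moreover from this have "l - d (h' l) \<in> supp_on J" using dC_supp l(1) csubspaceD(4)[OF subspace_supp_on] by blast
      ultimately have "l - d (h' l) = 0" using cnorm_eq_0[OF finJ] by blast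
      then have "l = d (h' l)" by simp
      then show "l \<in> d ` C p" using \<open>h' l \<in> C p\<close> by blast
    qed
  qed
  then show ?thesis using ex by (simp add: strict_at_def)
qed

end

section \<open>Isomorphic complexes\<close>

locale complex_iso = A: banach_complex J deg d + B: banach_complex J' deg' d'
  for J :: "'j set" and deg and d :: "('j \<Rightarrow> 'x::complex_banach) \<Rightarrow> 'j \<Rightarrow> 'x"
    and J' :: "'k set" and deg' and d' :: "('k \<Rightarrow> 'x) \<Rightarrow> 'k \<Rightarrow> 'x" +
  fixes \<Phi> :: "('j \<Rightarrow> 'x) \<Rightarrow> 'k \<Rightarrow> 'x" and \<Psi> :: "('k \<Rightarrow> 'x) \<Rightarrow> 'j \<Rightarrow> 'x"
  assumes \<Phi>_lin: "clinear \<Phi>" and \<Psi>_lin: "clinear \<Psi>"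
    and \<Phi>_bounded: "\<exists>K\<ge>0. \<forall>c\<in>supp_on J. cnorm J' (\<Phi> c) \<le> K * cnorm J c"
    and \<Psi>_bounded: "\<exists>K\<ge>0. \<forall>c\<in>supp_on J'. cnorm J (\<Psi> c) \<le> K * cnorm J' c"
    and \<Phi>_supp: "\<And>c. c \<in> supp_on J \<Longrightarrow> \<Phi> c \<in> supp_on J'" and \<Psi>_supp: "\<And>c. c \<in> supp_on J' \<Longrightarrow> \<Psi> c \<in> supp_on J"
    and \<Phi>_chains: "\<And>c p. c \<in> A.C p \<Longrightarrow> \<Phi> c \<in> B.C p" and \<Psi>_chains: "\<And>c p. c \<in> B.C p \<Longrightarrow> \<Psi> c \<in> A.C p"
    and \<Psi>\<Phi>: "\<And>c. c \<in> supp_on J \<Longrightarrow> \<Psi> (\<Phi> c) = c" and \<Phi>\<Psi>: "\<And>c. c \<in> supp_on J' \<Longrightarrow> \<Phi> (\<Psi> c) = c"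
    and \<Phi>_d: "\<And>c. c \<in> supp_on J \<Longrightarrow> \<Phi> (d c) = d' (\<Phi> c)"
begin

lemmas \<Phi>D = clinearD[OF \<Phi>_lin] and \<Psi>D = clinearD[OF \<Psi>_lin]

lemma \<Psi>_d: "c \<in> supp_on J' \<Longrightarrow> \<Psi> (d' c) = d (\<Psi> c)"
  using \<Phi>_d[OF \<Psi>_supp, of c] \<Psi>\<Phi>[of "d (\<Psi> c)"] \<Phi>\<Psi>[of c] bopD(2)[OF A.bop_d \<Psi>_supp] by metis

lemma strict_transfer:
  assumes "A.strict_at p"
  shows "B.strict_at p"
proof -
  have ex: "A.exact_at p" and cl: "closed (d ` A.C p)" using assms by (auto simp: A.strict_at_def)
  have "B.exact_at p"
    unfolding B.exact_at_def
  proof (intro ballI impI)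
    fix c assume c: "c \<in> B.C p" "d' c = 0"
    have "d (\<Psi> c) = 0" using \<Psi>_d[OF B.C_supp[OF c(1)]] c(2) by (simp add: \<Psi>D)
    then obtain b where b: "b \<in> A.C (Suc p)" "\<Psi> c = d b" using ex \<Psi>_chains[OF c(1)] by (auto simp: A.exact_at_def)
    then have "c = d' (\<Phi> b)" using \<Phi>\<Psi>[OF B.C_supp[OF c(1)]] \<Phi>_d[OF A.C_supp[OF b(1)]] by simp
    then show "c \<in> d' ` B.C (Suc p)" using \<Phi>_chains[OF b(1)] by blast
  qed
  moreover have "closed (d' ` B.C p)"
  proof (rule closed_if_limits[OF B.finJ])
    show "d' ` B.C p \<subseteq> supp_on J'" using B.dC_supp by blast
    fix y l assume y: "\<And>n. y n \<in> d' ` B.C p" and l: "l \<in> supp_on J'" "(\<lambda>n. cnorm J' (y n - l)) \<longlonglongrightarrow> 0"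
    obtain K where K: "0 \<le> K" "\<And>c. c \<in> supp_on J' \<Longrightarrow> cnorm J (\<Psi> c) \<le> K * cnorm J' c" using \<Psi>_bounded by blast
    have "\<Psi> l \<in> d ` A.C p"
    proof (rule closed_limit_mem[OF A.finJ cl, where x="\<lambda>n. \<Psi> (y n)"])
      show "\<Psi> (y n) \<in> d ` A.C p" for n
      proof -
        obtain c where c: "c \<in> B.C p" "y n = d' c" using y by blast
        then show ?thesis using \<Psi>_d[OF B.C_supp[OF c(1)]] \<Psi>_chains[OF c(1)] by simp
      qed
      show "d ` A.C p \<subseteq> supp_on J" using A.dC_supp by blast
      show "\<Psi> l \<in> supp_on J" by (rule \<Psi>_supp[OF l(1)])
      show "(\<lambda>n. cnorm J (\<Psi> (y n) - \<Psi> l)) \<longlonglongrightarrow> 0"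
      proof (rule Lim_null_comparison[OF always_eventually])
        show "\<forall>n. norm (cnorm J (\<Psi> (y n) - \<Psi> l)) \<le> K * cnorm J' (y n - l)"
        proof
          fix n
          have "y n \<in> supp_on J'" using y[of n] B.dC_supp by auto
          then have "y n - l \<in> supp_on J'" using l(1) by (rule csubspaceD(4)[OF subspace_supp_on])
          then show "norm (cnorm J (\<Psi> (y n) - \<Psi> l)) \<le> K * cnorm J' (y n - l)"
            using K(2) by (simp add: cnormD flip: \<Psi>D(5))
        qed
        show "(\<lambda>n. K * cnorm J' (y n - l)) \<longlonglongrightarrow> 0" using tendsto_mult[OF tendsto_const l(2), of K] by simp
      qed
    qed
    then obtain c where c: "c \<in> A.C p" "\<Psi> l = d c" by blast
    then have "l = d' (\<Phi> c)" using \<Phi>\<Psi>[OF l(1)] \<Phi>_d[OF A.C_supp[OF c(1)]] by simp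
    then show "l \<in> d' ` B.C p" using \<Phi>_chains[OF c(1)] by blast
  qed
  ultimately show ?thesis by (simp add: B.strict_at_def)
qed

lemma split_transfer:
  assumes "A.split_at p"
  shows "B.split_at p"
proof -
  obtain h h' where h: "A.hop h" "A.hop h'" "\<And>c. c \<in> A.C p \<Longrightarrow> d (h c) + h' (d c) = c"
    using assms by (auto simp: A.split_at_def)
  obtain K where K: "0 \<le> K" "\<And>c. c \<in> supp_on J' \<Longrightarrow> cnorm J (\<Psi> c) \<le> K * cnorm J' c" using \<Psi>_bounded by blast
  obtain L where L: "0 \<le> L" "\<And>c. c \<in> supp_on J \<Longrightarrow> cnorm J' (\<Phi> c) \<le> L * cnorm J c" using \<Phi>_bounded by blast
  have tr: "B.hop (\<lambda>c. \<Phi> (k (\<Psi> c)))" if k: "A.hop k" for k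
  proof -
    have kb: "bop J k" using k by (simp add: A.hop_def)
    obtain M where M: "0 \<le> M" "\<And>c. c \<in> supp_on J \<Longrightarrow> cnorm J (k c) \<le> M * cnorm J c" using bopD(3)[OF kb] by blast
    have "cnorm J' (\<Phi> (k (\<Psi> c))) \<le> (L * (M * K)) * cnorm J' c" if c: "c \<in> supp_on J'" for c
    proof -
      have "cnorm J' (\<Phi> (k (\<Psi> c))) \<le> L * cnorm J (k (\<Psi> c))" using L(2)[OF bopD(2)[OF kb \<Psi>_supp[OF c]]] .
      also have "\<dots> \<le> L * (M * cnorm J (\<Psi> c))" using M(2)[OF \<Psi>_supp[OF c]] L(1) by (rule mult_left_mono)
      also have "\<dots> \<le> L * (M * (K * cnorm J' c))" using K(2)[OF c] L(1) M(1) by (intro mult_left_mono)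
      finally show ?thesis by (simp add: mult.assoc)
    qed
    moreover have "clinear (\<lambda>c. \<Phi> (k (\<Psi> c)))"
      by (rule clinearI) (simp_all add: \<Phi>D \<Psi>D clinearD[OF bopD(1)[OF kb]])
    moreover have "\<Phi> (k (\<Psi> c)) \<in> supp_on J'" if "c \<in> supp_on J'" for c
      using \<Phi>_supp[OF bopD(2)[OF kb \<Psi>_supp[OF that]]] .
    ultimately have "bop J' (\<lambda>c. \<Phi> (k (\<Psi> c)))" unfolding bop_def by blast
    moreover have "\<Phi> (k (\<Psi> c)) \<in> B.C (Suc q)" if "c \<in> B.C q" for c q
      using k \<Phi>_chains \<Psi>_chains[OF that] by (auto simp: A.hop_def)
    ultimately show ?thesis by (simp add: B.hop_def)
  qed
  have "d' (\<Phi> (h (\<Psi> c))) + \<Phi> (h' (\<Psi> (d' c))) = c" if c: "c \<in> B.C p" for c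
  proof -
    have hb: "bop J h" using h(1) by (simp add: A.hop_def)
    have S: "\<Psi> c \<in> A.C p" by (rule \<Psi>_chains[OF c])
    have "d' (\<Phi> (h (\<Psi> c))) = \<Phi> (d (h (\<Psi> c)))" using \<Phi>_d[OF bopD(2)[OF hb A.C_supp[OF S]]] by simp
    moreover have "\<Psi> (d' c) = d (\<Psi> c)" by (rule \<Psi>_d[OF B.C_supp[OF c]])
    ultimately have "d' (\<Phi> (h (\<Psi> c))) + \<Phi> (h' (\<Psi> (d' c))) = \<Phi> (d (h (\<Psi> c)) + h' (d (\<Psi> c)))"
      by (simp add: \<Phi>D)
    then show ?thesis using h(3)[OF S] \<Phi>\<Psi>[OF B.C_supp[OF c]] by simp
  qed
  then show ?thesis unfolding B.split_at_def using tr[OF h(1)] tr[OF h(2)] by (intro exI conjI ballI)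
qed

end

section \<open>The Koszul complex as a complex with matrix differential\<close>

lemma ann_chains:
  "c \<in> chains (Pow {..<n}) card (Suc q) \<Longrightarrow> ann i c \<in> chains (Pow {..<n}) card q"
  "c \<in> chains (Pow {..<n}) card 0 \<Longrightarrow> ann i c = 0"
proof -
  assume c: "c \<in> chains (Pow {..<n}) card (Suc q)"
  show "ann i c \<in> chains (Pow {..<n}) card q"
    unfolding chains_def
  proof (intro CollectI allI impI)
    fix S assume "ann i c S \<noteq> 0"
    then have i: "i \<notin> S" and "c (insert i S) \<noteq> 0" by (auto simp: ann_def split: if_splits)
    then have S: "insert i S \<subseteq> {..<n}" "card (insert i S) = Suc q" using c by (auto simp: chains_def)
    moreover have "finite S" using S(1) finite_subset[of S "{..<n}"] by auto
    ultimately show "S \<in> Pow {..<n} \<and> card S = q" using i by auto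
  qed
next
  assume c: "c \<in> chains (Pow {..<n}) card 0"
  have "c (insert i S) = 0" for S
  proof (rule ccontr)
    assume "c (insert i S) \<noteq> 0"
    then have "insert i S \<subseteq> {..<n}" "card (insert i S) = 0" using c by (auto simp: chains_def)
    then show False using finite_subset[of "insert i S" "{..<n}"] by (auto simp: card_eq_0_iff)
  qed
  then show "ann i c = 0" by (auto simp: ann_def fun_eq_iff fun_ops)
qed

lemma cre_chains:
  assumes "i < n" "c \<in> chains (Pow {..<n}) card q"
  shows "cre i c \<in> chains (Pow {..<n}) card (Suc q)"
  unfolding chains_def
proof (intro CollectI allI impI)
  fix S assume "cre i c S \<noteq> 0"
  then have i: "i \<in> S" and "c (S - {i}) \<noteq> 0" by (auto simp: cre_def split: if_splits)
  then have S: "S - {i} \<subseteq> {..<n}" "card (S - {i}) = q" using assms(2) by (auto simp: chains_def)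
  have "finite (S - {i})" using S(1) finite_subset by blast
  then have "finite S" by simp
  then show "S \<in> Pow {..<n} \<and> card S = Suc q" using i S assms(1) card_Suc_Diff1[of S i] by auto
qed

lemma crel_chains:
  fixes c :: "nat set \<Rightarrow> 'x::complex_vector"
  assumes "c \<in> chains (Pow {..<length bs}) card q"
  shows "crel bs l c \<in> chains (Pow {..<length bs}) card (Suc q)"
  unfolding crel_def
  by (intro complex_vector.subspace_sum[OF subspace_chains] csubspaceD(3)[OF subspace_chains] cre_chains assms) auto

lemma app_chains: "c \<in> chains J deg q \<Longrightarrow> app T c \<in> chains J deg q"
  by (auto simp: chains_def app_def) (metis blinfun.zero_right)+

lemma app_zero: "app T 0 = 0"
  by (auto simp: app_def fun_eq_iff fun_ops blinfun.zero_right)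

lemma kd_chains:
  "c \<in> chains (Pow {..<length bs}) card (Suc q) \<Longrightarrow> kd bs \<theta> c \<in> chains (Pow {..<length bs}) card q"
  "c \<in> chains (Pow {..<length bs}) card 0 \<Longrightarrow> kd bs \<theta> c = 0"
proof -
  assume c: "c \<in> chains (Pow {..<length bs}) card (Suc q)"
  have "crel bs l (ann j (ann i c)) \<in> chains (Pow {..<length bs}) card q" for i j l
  proof (cases q)
    case 0
    then have "ann j (ann i c) = 0" using c by (intro ann_chains(2)[where n="length bs"] ann_chains(1)) simp
    then show ?thesis by (simp add: clinearD[OF crel_lin] csubspaceD[OF subspace_chains])
  next
    case (Suc q')
    then show ?thesis using c by (auto intro!: crel_chains ann_chains)
  qed
  then show "kd bs \<theta> c \<in> chains (Pow {..<length bs}) card q"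
    unfolding kd_def using c
    by (intro csubspaceD(2,3)[OF subspace_chains] complex_vector.subspace_sum[OF subspace_chains] app_chains ann_chains) auto
next
  assume "c \<in> chains (Pow {..<length bs}) card 0"
  then have "ann i c = 0" for i by (rule ann_chains(2))
  then show "kd bs \<theta> c = 0" by (simp add: kd_def clinearD[OF crel_lin] clinearD[OF ann_lin] app_zero)
qed

text \<open>Creation and annihilation act on the exterior factor only, so their matrix entries are
  complex numbers that can be computed on complex-valued chains; this is how \<open>kmat\<close> is
  obtained.\<close>

lemma ann_scale: "ann i (\<lambda>S. g S *\<^sub>C x) = (\<lambda>S. ann i g S *\<^sub>C x)" for g :: "nat set \<Rightarrow> complex"
  by (auto simp: ann_def fun_eq_iff scaleC_scaleC scaleC_complex_def)

lemma cre_scale: "cre i (\<lambda>S. g S *\<^sub>C x) = (\<lambda>S. cre i g S *\<^sub>C x)" for g :: "nat set \<Rightarrow> complex"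
  by (auto simp: cre_def fun_eq_iff scaleC_scaleC scaleC_complex_def)

lemma crel_scale: "crel bs l (\<lambda>S. g S *\<^sub>C x) = (\<lambda>S. crel bs l g S *\<^sub>C x)" for g :: "nat set \<Rightarrow> complex"
  by (auto simp: crel_def fun_eq_iff fun_ops cre_scale scaleC_scaleC scaleC_complex_def scaleC_sum_left)

lemma single_scale: "single S x = (\<lambda>R. single S (1::complex) R *\<^sub>C x)"
  by (auto simp: single_def)

lemma kword_scale: "kword bs ls x R = kword bs ls (1::complex) R *\<^sub>C x"
proof -
  have "kword bs ls x = (\<lambda>R. kword bs ls (1::complex) R *\<^sub>C x)"
    by (induction ls) (auto simp: crel_scale intro: single_scale)
  then show ?thesis by metis
qed

definition kmat :: "'l::complex_lie_algebra list \<Rightarrow> ('l \<Rightarrow> ('x::complex_banach \<Rightarrow>\<^sub>L 'x)) \<Rightarrow> nat set \<Rightarrow> nat set \<Rightarrow> ('x \<Rightarrow>\<^sub>L 'x)"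
  where "kmat bs \<theta> R S = (if R \<in> Pow {..<length bs} \<and> S \<in> Pow {..<length bs}
    then (\<Sum>i<length bs. ann i (single S 1) R *\<^sub>C \<theta> (bs ! i)) +
      (1 / 2) *\<^sub>C (\<Sum>i<length bs. \<Sum>j<length bs. crel bs (lie (bs ! i) (bs ! j)) (ann j (ann i (single S 1))) R) *\<^sub>C id_blinfun
    else 0)"

lemma kmat_cblinfun: "(\<And>l. \<theta> l \<in> cblinfuns) \<Longrightarrow> kmat bs \<theta> R S \<in> cblinfuns"
  unfolding kmat_def by (cases "R \<in> Pow {..<length bs} \<and> S \<in> Pow {..<length bs}") (simp_all only: simp_thms if_True if_False cblinfuns_intros cblinfuns_sum)

lemma kd_single:
  assumes "\<And>l. \<theta> l \<in> cblinfuns" "R \<in> Pow {..<length bs}" "S \<in> Pow {..<length bs}"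
  shows "kd bs \<theta> (single S x) R = blinfun_apply (kmat bs \<theta> R S) x"
proof -
  have "kd bs \<theta> (\<lambda>R. single S (1::complex) R *\<^sub>C x) R = blinfun_apply (kmat bs \<theta> R S) x"
    using assms
    by (simp add: kd_def kmat_def fun_ops ann_scale crel_scale app_def cblinfunsD blinfun.add_left blinfun.sum_left
        scaleC_blinfun.rep_eq scaleC_sum_left)
  then show ?thesis by (subst single_scale)
qed

lemma kd_general_lin: "(\<And>l. \<theta> l \<in> cblinfuns) \<Longrightarrow> clinear (kd bs \<theta>)"
  by (rule clinearI)
    (simp_all add: kd_def clinearD[OF app_lin] clinearD[OF crel_lin] clinearD[OF ann_lin]
      sum.distrib scaleC_add_right scaleC_sum_right scaleC_scaleC)

lemma kd_kmat:
  assumes \<theta>: "\<And>l. \<theta> l \<in> cblinfuns" and c: "c \<in> supp_on (Pow {..<length bs})"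
  shows "kd bs \<theta> c = mop (Pow {..<length bs}) (kmat bs \<theta>) c"
proof
  fix R
  let ?J = "Pow {..<length bs}"
  have "kd bs \<theta> c = (\<Sum>S\<in>?J. kd bs \<theta> (single S (c S)))"
    by (subst supp_on_expand[OF _ c]) (simp_all add: clinearD[OF kd_general_lin[OF \<theta>]])
  moreover have "kd bs \<theta> (single S x) R = 0" if "S \<in> ?J" "R \<notin> ?J" for S x
  proof -
    have S: "single S x \<in> chains ?J card (card S)" using that by (auto simp: chains_def single_def split: if_splits)
    show ?thesis
    proof (cases "card S")
      case 0 then show ?thesis using kd_chains(2)[of "single S x" bs \<theta>] S by (simp add: fun_ops)
    next
      case (Suc q)
      then have "kd bs \<theta> (single S x) \<in> chains ?J card q" using S by (intro kd_chains(1)) simp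
      then show ?thesis using that(2) unfolding chains_def by blast
    qed
  qed
  ultimately show "kd bs \<theta> c R = mop ?J (kmat bs \<theta>) c R"
    by (auto simp: fun_ops mop_def kd_single[OF \<theta>] intro!: sum.neutral)
qed

context koszul_setting
begin

abbreviation "J \<equiv> Pow {..<n}"

lemma supported_iff: "supported c \<longleftrightarrow> c \<in> supp_on J"
  by (auto simp: supported_def supp_on_def)

sublocale K: matrix_complex J card "kmat bs \<theta>"
proof
  show "finite J" by simp
  show "kmat bs \<theta> R S \<in> cblinfuns" for R S by (rule kmat_cblinfun[OF rep_cblin])
  show "R \<in> J \<and> S \<in> J \<and> card S = Suc (card R)" if nz: "kmat bs \<theta> R S \<noteq> 0" for R S
  proof -
    have RS: "R \<in> J \<and> S \<in> J"
    proof (rule ccontr)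
      assume "\<not> ?thesis"
      then have "kmat bs \<theta> R S = 0" by (simp only: kmat_def if_False)
      then show False using nz by simp
    qed
    have "\<exists>x. blinfun_apply (kmat bs \<theta> R S) x \<noteq> 0"
    proof (rule ccontr)
      assume "\<not> ?thesis"
      then have "kmat bs \<theta> R S = 0" by (intro blinfun_eqI) simp
      then show False using nz by simp
    qed
    then obtain x where x: "kd bs \<theta> (single S x) R \<noteq> 0" using RS by (auto simp: kd_single[OF rep_cblin])
    have S: "single S x \<in> chains J card (card S)" using RS by (auto simp: chains_def single_def split: if_splits)
    show ?thesis
    proof (cases "card S")
      case 0 then show ?thesis using kd_chains(2)[of "single S x" bs \<theta>] S x by (simp add: fun_ops)
    next
      case (Suc q)
      then have "kd bs \<theta> (single S x) \<in> chains J card q" using S by (intro kd_chains(1)) simp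
      then have "card R = q" using x unfolding chains_def by blast
      then show ?thesis using RS Suc by simp
    qed
  qed
  show "mop J (kmat bs \<theta>) (mop J (kmat bs \<theta>) c) = 0" for c
  proof -
    let ?c = "restr (\<lambda>S. S \<in> J) c"
    have S: "?c \<in> supp_on J" by (auto simp: restr_def supp_on_def)
    have "mop J (kmat bs \<theta>) c = mop J (kmat bs \<theta>) ?c" by (auto simp: mop_def restr_def fun_eq_iff intro!: sum.cong)
    also have "\<dots> = kd bs \<theta> ?c" by (rule kd_kmat[OF rep_cblin S, symmetric])
    finally have 1: "mop J (kmat bs \<theta>) c = kd bs \<theta> ?c" .
    have "mop J (kmat bs \<theta>) c \<in> supp_on J" by (auto simp: mop_def supp_on_def)
    then have "mop J (kmat bs \<theta>) (mop J (kmat bs \<theta>) c) = kd bs \<theta> (mop J (kmat bs \<theta>) c)"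
      by (rule kd_kmat[OF rep_cblin, symmetric])
    then show ?thesis using kd_kd[of ?c] S supported_iff by (simp add: 1)
  qed
qed

lemma koszul_chains_eq: "koszul_chains bs (int p) = (K.C p :: (nat set \<Rightarrow> 'x) set)"
  by (auto simp: koszul_chains_def chains_def)

lemma C_suppJ: "c \<in> K.C p \<Longrightarrow> c \<in> supp_on J" for c :: "nat set \<Rightarrow> 'x"
  by (rule K.C_supp)

lemma koszul_chains_neg: "p < 0 \<Longrightarrow> koszul_chains bs p = {0 :: nat set \<Rightarrow> 'x}"
  by (auto simp: koszul_chains_def fun_eq_iff fun_ops)

lemma chain_norm_eq: "chain_norm bs = cnorm J"
  by (auto simp: chain_norm_def cnorm_def fun_eq_iff)

lemma koszul_d_eq: "c \<in> supp_on J \<Longrightarrow> koszul_d bs \<theta> c = mop J (kmat bs \<theta>) c"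
  using koszul_d_kd[OF supported_iff[THEN iffD2]] kd_kmat[OF rep_cblin] by simp

lemma koszul_boundaries_eq: "koszul_boundaries bs \<theta> (int p - 1) = mop J (kmat bs \<theta>) ` K.C p"
  using koszul_d_eq[OF C_suppJ] by (simp add: koszul_boundaries_def koszul_chains_eq)

text \<open>The class of the zero cycle is the set of boundaries, so the quotient consists of this
  class alone just when every cycle is a boundary.\<close>

lemma koszul_homology_zero_iff: "koszul_homology_zero bs \<theta> (int p) \<longleftrightarrow> K.exact_at p"
proof -
  let ?Z = "{c \<in> K.C p. mop J (kmat bs \<theta>) c = 0}" and ?B = "mop J (kmat bs \<theta>) ` K.C (Suc p)"
  have Z: "koszul_cycles bs \<theta> (int p) = ?Z"
    using koszul_d_eq[OF C_suppJ] by (auto simp: koszul_cycles_def koszul_chains_eq zero_fun_def)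
  have B: "koszul_boundaries bs \<theta> (int p) = ?B"
    using koszul_boundaries_eq[of "Suc p"] by simp
  have BZ: "?B \<subseteq> ?Z" using K.d_deg K.AA by blast
  have Bdiff: "0 \<in> ?B" using csubspaceD(1)[OF K.subspace_image] .
  define r where "r = {(a, b). a \<in> ?Z \<and> b \<in> ?Z \<and> (\<lambda>S. a S - b S) \<in> ?B}"
  have hz: "koszul_homology_zero bs \<theta> (int p) \<longleftrightarrow> ?Z // r = {?B}"
    by (simp add: koszul_homology_zero_def koszul_homology_def Z B r_def)
  have refl: "(a, a) \<in> r" if "a \<in> ?Z" for a using that Bdiff by (simp add: r_def flip: zero_fun_def)
  have "?Z // r = {?B} \<longleftrightarrow> ?Z \<subseteq> ?B"
  proof
    assume q: "?Z // r = {?B}"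
    show "?Z \<subseteq> ?B"
    proof
      fix a assume a: "a \<in> ?Z"
      then have "r `` {a} \<in> ?Z // r" by (rule quotientI)
      then have "r `` {a} = ?B" using q by blast
      then show "a \<in> ?B" using refl[OF a] by blast
    qed
  next
    assume "?Z \<subseteq> ?B"
    with BZ have eq: "?Z = ?B" by blast
    have sub: "complex_vector.subspace ?B" by (rule K.subspace_image)
    have "r `` {a} = ?B" if a: "a \<in> ?Z" for a
    proof -
      have "(\<lambda>S. a S - b S) \<in> ?B" if "b \<in> ?Z" for b
        using csubspaceD(4)[OF sub, of a b] a that eq by (simp add: fun_diff_def)
      then show ?thesis using a eq by (auto simp: r_def)
    qed
    moreover have "0 \<in> ?Z" using Bdiff eq by simp
    ultimately show "?Z // r = {?B}" unfolding quotient_def by blast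
  qed
  then show ?thesis using hz unfolding K.exact_at_def by blast
qed

text \<open>\<open>koszul_split\<close> uses maps on the chains of one degree, whereas a
  \<open>hop\<close> acts on all degrees. In one direction the operators are restricted; in the
  other, the argument is first cut down to the support and to the degree in question.\<close>

lemma koszul_split_iff: "koszul_split bs \<theta> (int p) \<longleftrightarrow> K.split_at p"
proof
  assume "K.split_at p"
  then obtain h h' where h: "K.hop h" "K.hop h'" "\<And>c. c \<in> K.C p \<Longrightarrow> mop J (kmat bs \<theta>) (h c) + h' (mop J (kmat bs \<theta>) c) = c"
    by (auto simp: K.split_at_def)
  have cb: "chain_bounded_linear bs (int q) (int q + 1) k" if "K.hop k" for k q
  proof -
    have kb: "bop J k" using that by (simp add: K.hop_def)
    obtain M where "\<And>c. c \<in> supp_on J \<Longrightarrow> cnorm J (k c) \<le> M * cnorm J c" using bopD(3)[OF kb] by blast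
    then show ?thesis
      using that clinearD(1,2)[OF bopD(1)[OF kb]] C_suppJ[of _ q] koszul_chains_eq[of q] koszul_chains_eq[of "Suc q"]
      unfolding chain_bounded_linear_def chain_norm_eq K.hop_def plus_fun_def scaleC_fun_def
      by (auto simp: add.commute intro!: exI[of _ M])
  qed
  \<comment> \<open>For p = 0 the source is the zero space in degree -1, so all clauses concern the
    zero chain.\<close>
  have cb': "chain_bounded_linear bs (int p - 1) (int p) h'"
  proof (cases p)
    case 0
    have "bop J h'" using h(2) by (simp add: K.hop_def)
    then have "h' 0 = 0" using clinearD(3)[OF bopD(1)] by blast
    moreover have "(\<lambda>S. (0 :: nat set \<Rightarrow> 'x) S + 0 S) = 0" "(\<lambda>S. t *\<^sub>C (0 :: nat set \<Rightarrow> 'x) S) = 0" for t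
      by (simp_all add: fun_eq_iff fun_ops)
    ultimately show ?thesis using 0 koszul_chains_neg[of "-1"] koszul_chains_eq[of 0] K.CD(1)
      by (auto simp: chain_bounded_linear_def chain_norm_eq cnormD simp flip: zero_fun_def)
  next
    case (Suc q) then show ?thesis using cb[OF h(2), of q] by (simp add: add.commute)
  qed
  show "koszul_split bs \<theta> (int p)"
    unfolding koszul_split_def
  proof (rule exI[of _ h], rule exI[of _ h'], intro conjI cb[OF h(1)] cb' ballI)
    fix c :: "nat set \<Rightarrow> 'x" assume c: "c \<in> koszul_chains bs (int p)"
    then have cC: "c \<in> K.C p" by (simp add: koszul_chains_eq)
    then have hC: "h c \<in> K.C (Suc p)" using h(1) by (auto simp: K.hop_def)
    show "(\<lambda>S. koszul_d bs \<theta> (h c) S + h' (koszul_d bs \<theta> c) S) = c"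
      using h(3)[OF cC] K.C_supp[OF cC] K.C_supp[OF hC] by (simp add: koszul_d_eq plus_fun_def)
  qed
next
  assume "koszul_split bs \<theta> (int p)"
  then obtain h h' where h: "chain_bounded_linear bs (int p) (int p + 1) h" "chain_bounded_linear bs (int p - 1) (int p) h'"
    "\<And>c. c \<in> koszul_chains bs (int p) \<Longrightarrow> (\<lambda>S. koszul_d bs \<theta> (h c) S + h' (koszul_d bs \<theta> c) S) = c"
    unfolding koszul_split_def by blast
  have ext: "K.hop (\<lambda>c. k (restr (\<lambda>S. card S = q) (restr (\<lambda>S. S \<in> J) c)))"
    if k: "chain_bounded_linear bs (int q) (int q + 1) k" for k q
  proof -
    let ?r = "\<lambda>c :: nat set \<Rightarrow> 'x. restr (\<lambda>S. card S = q) (restr (\<lambda>S. S \<in> J) c)"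
    have rC: "?r c \<in> K.C q" for c by (auto simp: restr_def chains_def)
    have rl: "?r (a + b) = ?r a + ?r b" "?r (s *\<^sub>C a) = s *\<^sub>C ?r a" for a b s
      by (auto simp: restr_def fun_eq_iff fun_ops)
    have kC: "k c \<in> K.C (Suc q)" if "c \<in> K.C q" for c
      using k that koszul_chains_eq[of q] koszul_chains_eq[of "Suc q"] by (auto simp: chain_bounded_linear_def add.commute)
    have kadd: "k (a + b) = k a + k b" "k (s *\<^sub>C a) = s *\<^sub>C k a" if "a \<in> K.C q" "b \<in> K.C q" for a b s
      using k that koszul_chains_eq[of q] by (auto simp: chain_bounded_linear_def plus_fun_def scaleC_fun_def)
    have "\<exists>M. \<forall>c\<in>K.C q. cnorm J (k c) \<le> M * cnorm J c"
      using k unfolding chain_bounded_linear_def chain_norm_eq koszul_chains_eq by blast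
    then obtain M where M: "\<And>c. c \<in> K.C q \<Longrightarrow> cnorm J (k c) \<le> M * cnorm J c" by blast
    have "cnorm J (k (?r c)) \<le> max 0 M * cnorm J c" for c
    proof -
      have "cnorm J (k (?r c)) \<le> max 0 M * cnorm J (?r c)"
        using M[OF rC, of c] mult_right_mono[of M "max 0 M" "cnorm J (?r c)"] by (simp add: cnormD)
      also have "cnorm J (?r c) \<le> cnorm J c" by (auto simp: cnorm_def restr_def intro!: sum_mono)
      finally show ?thesis by (simp add: mult_left_mono)
    qed
    moreover have "clinear (\<lambda>c. k (?r c))" by (rule clinearI) (simp_all only: rl kadd(1)[OF rC rC] kadd(2)[OF rC rC])
    ultimately have "bop J (\<lambda>c. k (?r c))" unfolding bop_def using K.C_supp[OF kC[OF rC]] by blast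
    moreover have "k (?r c) \<in> K.C (Suc q')" if c: "c \<in> K.C q'" for c q'
    proof (cases "q' = q")
      case True then show ?thesis using kC[OF rC] by simp
    next
      case False
      have "?r c = 0" using c False by (auto simp: restr_def chains_def fun_eq_iff fun_ops)
      moreover have "k 0 = 0" using kadd(2)[OF K.CD(1) K.CD(1), of 0] by simp
      ultimately show ?thesis by (simp add: K.CD(1))
    qed
    ultimately show ?thesis by (simp add: K.hop_def)
  qed
  have r_id: "restr (\<lambda>S. card S = q) (restr (\<lambda>S. S \<in> J) c) = c" if "c \<in> K.C q" for c :: "nat set \<Rightarrow> 'x" and q
    using that by (auto simp: restr_def chains_def fun_eq_iff fun_ops)
  have eq: "mop J (kmat bs \<theta>) (h c) + h' (mop J (kmat bs \<theta>) c) = c" if c: "c \<in> K.C p" for c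
  proof -
    have hC: "h c \<in> K.C (Suc p)"
      using h(1) c koszul_chains_eq[of p] koszul_chains_eq[of "Suc p"] by (auto simp: chain_bounded_linear_def add.commute)
    show ?thesis using h(3)[of c] c K.C_supp[OF c] K.C_supp[OF hC] by (simp add: koszul_chains_eq koszul_d_eq plus_fun_def)
  qed
  show "K.split_at p"
  proof (cases p)
    case 0
    have "K.hop (\<lambda>c. 0)" by (auto simp: K.hop_def bop_zero K.CD)
    moreover have "h' 0 = 0"
    proof -
      have "(0 :: nat set \<Rightarrow> 'x) \<in> koszul_chains bs (int p - 1)" using koszul_chains_neg[of "-1"] 0 by simp
      then have "\<forall>t. h' (\<lambda>S. t *\<^sub>C (0 :: nat set \<Rightarrow> 'x) S) = (\<lambda>S. t *\<^sub>C h' 0 S)"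
        using h(2) unfolding chain_bounded_linear_def by blast
      from spec[OF this, of 0] show ?thesis by (simp add: zero_fun_def)
    qed
    ultimately show ?thesis
      unfolding K.split_at_def using ext[OF h(1)] eq r_id[of _ p] K.d_0 0
      by - (rule exI[of _ "\<lambda>c. h (restr (\<lambda>S. card S = p) (restr (\<lambda>S. S \<in> J) c))"], rule exI[of _ "\<lambda>c. 0"], auto)
  next
    case (Suc q)
    have h2: "chain_bounded_linear bs (int q) (int q + 1) h'" using h(2) Suc by (simp add: add.commute)
    show ?thesis
      unfolding K.split_at_def using ext[OF h(1)] ext[OF h2] eq r_id[of _ p] r_id[of _ q] K.d_deg Suc
      by - (rule exI[of _ "\<lambda>c. h (restr (\<lambda>S. card S = p) (restr (\<lambda>S. S \<in> J) c))"],
          rule exI[of _ "\<lambda>c. h' (restr (\<lambda>S. card S = q) (restr (\<lambda>S. S \<in> J) c))"], auto)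
  qed
qed

end

lemma cnorm_sum: "cnorm J (\<Sum>i\<in>I. f i) \<le> (\<Sum>i\<in>I. cnorm J (f i))"
proof (induction I rule: infinite_finite_induct)
  case (insert i I)
  then show ?case using cnormD(1)[of J "f i" "sum f I"] by simp
qed (auto simp: cnormD)

lemma kchange_bounded:
  "\<exists>K\<ge>0. \<forall>c. cnorm (Pow {..<length bs'}) (kchange bs bs' c) \<le> K * cnorm (Pow {..<length bs}) (c :: nat set \<Rightarrow> 'x::complex_banach)"
proof (intro exI conjI allI)
  let ?J = "Pow {..<length bs}" and ?J' = "Pow {..<length bs'}"
  let ?a = "\<lambda>S. \<Sum>R\<in>?J'. cmod (kword bs' (nths bs S) 1 R)"
  show "0 \<le> (\<Sum>S\<in>?J. ?a S)" by (intro sum_nonneg) auto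
  fix c :: "nat set \<Rightarrow> 'x"
  have word: "cnorm ?J' (kword bs' (nths bs S) x) = ?a S * norm x" for S and x :: 'x
    unfolding cnorm_def by (subst kword_scale) (simp add: norm_scaleC sum_distrib_right)
  have "cnorm ?J' (kchange bs bs' c) \<le> (\<Sum>S\<in>?J. cnorm ?J' (kword bs' (nths bs S) (c S)))"
    unfolding kchange_def by (rule cnorm_sum)
  also have "\<dots> \<le> (\<Sum>S\<in>?J. ?a S * cnorm ?J c)"
    unfolding word by (intro sum_mono mult_left_mono) (auto simp: cnorm_def intro!: sum_nonneg member_le_sum)
  finally show "cnorm ?J' (kchange bs bs' c) \<le> (\<Sum>S\<in>?J. ?a S) * cnorm ?J c" by (simp add: sum_distrib_right)
qed

lemma kchange_chains':
  "c \<in> chains (Pow {..<length bs}) card p \<Longrightarrow> koszul_change bs bs' H \<theta> \<Longrightarrow>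
    kchange bs bs' c \<in> chains (Pow {..<length bs'}) card p" for c :: "nat set \<Rightarrow> 'x::complex_banach" and \<theta> :: "'l::complex_lie_algebra \<Rightarrow> ('x \<Rightarrow>\<^sub>L 'x)"
proof -
  assume c: "c \<in> chains (Pow {..<length bs}) card p" and "koszul_change bs bs' H \<theta>"
  then interpret koszul_change bs bs' H \<theta> by simp
  show ?thesis using kchange_chains[of c "int p"] c by (simp add: koszul_chains_eq other.koszul_chains_eq)
qed

context koszul_change
begin

lemma iso: "complex_iso J card (mop J (kmat bs \<theta>)) (Pow {..<length bs'}) card (mop (Pow {..<length bs'}) (kmat bs' \<theta>))
   (kchange bs bs') (kchange bs' bs)"
proof -
  interpret opp: koszul_change bs' bs H \<theta> by unfold_locales
  let ?J' = "Pow {..<length bs'}"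
  have kc: "koszul_change bs bs' H \<theta>" and kc': "koszul_change bs' bs H \<theta>" by unfold_locales
  have supp: "kchange bs1 bs2 c \<in> supp_on (Pow {..<length bs2})"
    if "koszul_change bs1 bs2 H \<theta>" "c \<in> supp_on (Pow {..<length bs1})" for bs1 bs2 and c :: "nat set \<Rightarrow> 'x"
  proof -
    interpret X: koszul_change bs1 bs2 H \<theta> by fact
    have "c = (\<Sum>S\<in>X.J. single S (c S))" by (rule supp_on_expand[OF _ that(2)]) simp
    then have "kchange bs1 bs2 c = (\<Sum>S\<in>X.J. kchange bs1 bs2 (single S (c S)))"
      using clinearD(6)[OF X.kchange_lin] by metis
    moreover have "kchange bs1 bs2 (single S (c S)) \<in> supp_on (Pow {..<length bs2})" if S: "S \<in> X.J" for S
    proof -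
      have "single S (c S) \<in> chains X.J card (card S)" using S by (auto simp: chains_def single_def split: if_splits)
      then show ?thesis using kchange_chains'[OF _ \<open>koszul_change bs1 bs2 H \<theta>\<close>] chains_supp by blast
    qed
    ultimately show ?thesis by (simp only: complex_vector.subspace_sum[OF subspace_supp_on])
  qed
  show ?thesis
  proof (rule complex_iso.intro[OF K.banach_complex_axioms other.K.banach_complex_axioms complex_iso_axioms.intro])
    show "clinear (kchange bs bs' :: (nat set \<Rightarrow> 'x) \<Rightarrow> _)" "clinear (kchange bs' bs :: (nat set \<Rightarrow> 'x) \<Rightarrow> _)"
      by (rule kchange_lin opp.kchange_lin)+
    show "\<exists>K\<ge>0. \<forall>c\<in>supp_on J. cnorm ?J' (kchange bs bs' c) \<le> K * cnorm J (c :: nat set \<Rightarrow> 'x)"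
      using kchange_bounded[of bs' bs] by blast
    show "\<exists>K\<ge>0. \<forall>c\<in>supp_on ?J'. cnorm J (kchange bs' bs c) \<le> K * cnorm ?J' (c :: nat set \<Rightarrow> 'x)"
      using kchange_bounded[of bs bs'] by blast
    show "kchange bs bs' c \<in> supp_on ?J'" if "c \<in> supp_on J" for c :: "nat set \<Rightarrow> 'x" by (rule supp[OF kc that])
    show "kchange bs' bs c \<in> supp_on J" if "c \<in> supp_on ?J'" for c :: "nat set \<Rightarrow> 'x" by (rule supp[OF kc' that])
    show "kchange bs bs' c \<in> chains ?J' card p" if "c \<in> K.C p" for c :: "nat set \<Rightarrow> 'x" and p by (rule kchange_chains'[OF that kc])
    show "kchange bs' bs c \<in> K.C p" if "c \<in> chains ?J' card p" for c :: "nat set \<Rightarrow> 'x" and p by (rule kchange_chains'[OF that kc'])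
    show "kchange bs' bs (kchange bs bs' c) = c" if "c \<in> supp_on J" for c :: "nat set \<Rightarrow> 'x"
      by (rule kchange_kchange[OF kc]) (use that supported_iff in blast)
    show "kchange bs bs' (kchange bs' bs c) = c" if "c \<in> supp_on ?J'" for c :: "nat set \<Rightarrow> 'x"
      by (rule kchange_kchange[OF kc']) (use that other.supported_iff in blast)
    show "kchange bs bs' (mop J (kmat bs \<theta>) c) = mop ?J' (kmat bs' \<theta>) (kchange bs bs' c)" if "c \<in> supp_on J" for c
      using kchange_kd[OF supported_iff[THEN iffD2, OF that]] kd_kmat[OF rep_cblin that] kd_kmat[OF rep_cblin supp[OF kc that]]
      by simp
  qed
qed

end

section \<open>The Koszul complex of a product\<close>

lemma subspace_Times: "complex_vector.subspace A \<Longrightarrow> complex_vector.subspace B \<Longrightarrow> complex_vector.subspace (A \<times> B)"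
  by (auto simp: complex_vector.subspace_def zero_prod_def scaleC_prod_def)

lemma sum_lessThan_add: "(\<Sum>i<a + b. f i) = (\<Sum>i<a. f i) + (\<Sum>i<b. f (a + i))" for f :: "nat \<Rightarrow> 'a::comm_monoid_add"
  by (induction b) (auto simp: add.assoc)

locale koszul_tensor = banach_tensor_product tens optens + S1: koszul_setting bs1 H1 \<theta>1 + S2: koszul_setting bs2 H2 \<theta>2
  for tens :: "'x::complex_banach \<Rightarrow> 'y::complex_banach \<Rightarrow> 't::complex_banach" (infixl \<open>\<otimes>\<^sub>v\<close> 70)
    and optens :: "('x \<Rightarrow>\<^sub>L 'x) \<Rightarrow> ('y \<Rightarrow>\<^sub>L 'y) \<Rightarrow> ('t \<Rightarrow>\<^sub>L 't)"  (infixl \<open>\<otimes>\<^sub>o\<close> 70)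
    and bs1 :: "'l1::complex_lie_algebra list" and H1 and \<theta>1 :: "'l1 \<Rightarrow> ('x \<Rightarrow>\<^sub>L 'x)"
    and bs2 :: "'l2::complex_lie_algebra list" and H2 and \<theta>2 :: "'l2 \<Rightarrow> ('y \<Rightarrow>\<^sub>L 'y)"
begin

definition bs12 :: "('l1 \<times> 'l2) list"
  where "bs12 = map (\<lambda>b. (b, 0)) bs1 @ map (\<lambda>b. (0, b)) bs2"

definition \<theta>T :: "'l1 \<times> 'l2 \<Rightarrow> ('t \<Rightarrow>\<^sub>L 't)"
  where "\<theta>T = tensor_representation (\<otimes>\<^sub>o) \<theta>1 \<theta>2"

lemma \<theta>T_eq: "\<theta>T l = \<theta>1 (fst l) \<otimes>\<^sub>o id_blinfun + id_blinfun \<otimes>\<^sub>o \<theta>2 (snd l)"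
  by (simp add: \<theta>T_def tensor_representation_def split: prod.splits)

lemma length_bs12 [simp]: "length bs12 = length bs1 + length bs2"
  by (simp add: bs12_def)

lemma nth_bs12: "i < length bs1 \<Longrightarrow> bs12 ! i = (bs1 ! i, 0)" "i < length bs2 \<Longrightarrow> bs12 ! (length bs1 + i) = (0, bs2 ! i)"
  by (simp_all add: bs12_def nth_append)

lemma pair_expand: "l1 \<in> H1 \<Longrightarrow> (l1, 0) = (\<Sum>i<length bs1. coord bs1 l1 i *\<^sub>C bs12 ! i)"
  "l2 \<in> H2 \<Longrightarrow> (0, l2) = (\<Sum>i<length bs2. coord bs2 l2 i *\<^sub>C bs12 ! (length bs1 + i))"
  using S1.coord_expand[of l1] S2.coord_expand[of l2]
  by (simp_all add: prod_eq_iff fst_sum snd_sum nth_bs12 scaleC_prod_def)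

lemma span_bs12: "cspan (set bs12) = H1 \<times> H2"
proof
  show "cspan (set bs12) \<subseteq> H1 \<times> H2"
  proof (rule complex_vector.span_minimal[OF _ subspace_Times[OF S1.H_sub S2.H_sub]])
    have "set bs1 \<subseteq> H1" "set bs2 \<subseteq> H2" using complex_vector.span_superset S1.span S2.span by blast+
    then show "set bs12 \<subseteq> H1 \<times> H2" using csubspaceD(1)[OF S1.H_sub] csubspaceD(1)[OF S2.H_sub] by (auto simp: bs12_def)
  qed
next
  show "H1 \<times> H2 \<subseteq> cspan (set bs12)"
  proof clarify
    fix l1 l2 assume l: "l1 \<in> H1" "l2 \<in> H2"
    have "(l1, 0) \<in> cspan (set bs12)" "(0, l2) \<in> cspan (set bs12)"
      unfolding pair_expand(1)[OF l(1)] pair_expand(2)[OF l(2)]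
      by (intro complex_vector.span_sum complex_vector.span_scale complex_vector.span_base nth_mem; simp)+
    then have "(l1, 0) + (0, l2) \<in> cspan (set bs12)" by (rule complex_vector.span_add)
    then show "(l1, l2) \<in> cspan (set bs12)" by simp
  qed
qed

lemma independent_bs12: "distinct bs12 \<and> complex_vector.independent (set bs12)"
proof
  have 0: "0 \<notin> set bs1" "0 \<notin> set bs2"
    using S1.indep S2.indep complex_vector.dependent_zero by blast+
  show "distinct bs12" using S1.dist S2.dist 0 by (auto simp: bs12_def distinct_map inj_on_def)
  show "complex_vector.independent (set bs12)"
  proof (rule complex_vector.independent_if_scalars_zero)
    fix f x assume s: "(\<Sum>x\<in>set bs12. f x *\<^sub>C x) = 0" and x: "x \<in> set bs12"
    have "(\<Sum>x\<in>set bs12. f x *\<^sub>C x) = (\<Sum>x\<in>(\<lambda>b. (b, 0)) ` set bs1. f x *\<^sub>C x) + (\<Sum>x\<in>(\<lambda>b. (0, b)) ` set bs2. f x *\<^sub>C x)"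
      using 0 by (subst sum.union_disjoint[symmetric]) (auto simp: bs12_def)
    also have "\<dots> = (\<Sum>b\<in>set bs1. f (b, 0) *\<^sub>C (b, 0)) + (\<Sum>b\<in>set bs2. f (0, b) *\<^sub>C (0, b))"
      by (subst (1 2) sum.reindex) (auto simp: inj_on_def)
    finally have "(\<Sum>b\<in>set bs1. f (b, 0) *\<^sub>C b) = 0" "(\<Sum>b\<in>set bs2. f (0, b) *\<^sub>C b) = 0"
      using s by (simp_all add: prod_eq_iff fst_sum snd_sum scaleC_prod_def)
    then show "f x = 0"
      using complex_vector.independentD[OF S1.indep, of "set bs1" "\<lambda>b. f (b, 0)"]
        complex_vector.independentD[OF S2.indep, of "set bs2" "\<lambda>b. f (0, b)"] x
      by (auto simp: bs12_def)
  qed simp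
qed

lemma op_right_commute: "T \<in> cblinfuns \<Longrightarrow> S \<in> cblinfuns \<Longrightarrow>
    (T \<otimes>\<^sub>o id_blinfun) o\<^sub>L (id_blinfun \<otimes>\<^sub>o S) = (id_blinfun \<otimes>\<^sub>o S) o\<^sub>L (T \<otimes>\<^sub>o id_blinfun)"
  by (simp add: T3)

sublocale P: koszul_setting bs12 "H1 \<times> H2" \<theta>T
proof (rule koszul_setting.intro)
  show "distinct bs12" "complex_vector.independent (set bs12)" using independent_bs12 by auto
  show "cspan (set bs12) = H1 \<times> H2" by (rule span_bs12)
  show "lie x y \<in> H1 \<times> H2" if "x \<in> H1 \<times> H2" "y \<in> H1 \<times> H2" for x y
    using that S1.lie_closed S2.lie_closed by (auto simp: lie_prod_def)
  show "\<theta>T l \<in> cblinfuns" for l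
    unfolding \<theta>T_eq by (intro cblinfuns_intros(3) optens_closed S1.rep_cblin S2.rep_cblin cblinfuns_intros(2))
  show "clinear \<theta>T"
  proof (rule clinearI)
    show "\<theta>T (x + y) = \<theta>T x + \<theta>T y" for x y
      by (simp add: \<theta>T_eq clinearD[OF S1.rep_lin] clinearD[OF S2.rep_lin] optens_add_left optens_add_right S1.rep_cblin S2.rep_cblin)
    show "\<theta>T (a *\<^sub>C x) = a *\<^sub>C \<theta>T x" for a x
      by (simp add: \<theta>T_eq scaleC_prod_def clinearD[OF S1.rep_lin] clinearD[OF S2.rep_lin] optens_scaleC_left optens_scaleC_right
          S1.rep_cblin S2.rep_cblin scaleC_add_right)
  qed
  show "\<theta>T (lie x y) = (\<theta>T x o\<^sub>L \<theta>T y) - (\<theta>T y o\<^sub>L \<theta>T x)" if xy: "x \<in> H1 \<times> H2" "y \<in> H1 \<times> H2" for x y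
  proof -
    note [simp] = S1.rep_cblin S2.rep_cblin
    let ?a = "\<lambda>x. \<theta>1 (fst x) \<otimes>\<^sub>o id_blinfun" and ?b = "\<lambda>x. id_blinfun \<otimes>\<^sub>o \<theta>2 (snd x)"
    have comm: "blinfun_apply (?a x) (blinfun_apply (?b y) v) = blinfun_apply (?b y) (blinfun_apply (?a x) v)" for x y v
      using arg_cong[OF op_right_commute[of "\<theta>1 (fst x)" "\<theta>2 (snd y)"], of "\<lambda>T. blinfun_apply T v"] by simp
    have "?a (lie x y) = (?a x o\<^sub>L ?a y) - (?a y o\<^sub>L ?a x)"
      using xy by (simp add: lie_prod_def S1.rep_lie op_diff T3 mem_Times_iff)
    moreover have "?b (lie x y) = (?b x o\<^sub>L ?b y) - (?b y o\<^sub>L ?b x)"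
      using xy by (simp add: lie_prod_def S2.rep_lie op_diff T3 mem_Times_iff)
    ultimately show ?thesis
      by (intro blinfun_eqI) (simp add: \<theta>T_eq blinfun.add_left blinfun.diff_left blinfun.add_right comm)
  qed
qed

section \<open>Slices of a chain along the two factors\<close>

abbreviation "n1 \<equiv> length bs1"
abbreviation "n2 \<equiv> length bs2"

definition join :: "nat set \<Rightarrow> nat set \<Rightarrow> nat set"
  where "join S S' = S \<union> (+) n1 ` S'"

text \<open>Fixing one of the two index sets leaves a chain over the other factor with coefficients
  in the tensor product. Operators of that factor act on its slices as in its own Koszul complex, up
  to the sign found in \<open>join_high\<close>.\<close>

definition slice1 :: "(nat set \<Rightarrow> 't) \<Rightarrow> nat set \<Rightarrow> nat set \<Rightarrow> 't"
  where "slice1 c S' = (\<lambda>S. if S \<subseteq> {..<n1} then c (join S S') else 0)"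

definition slice2 :: "(nat set \<Rightarrow> 't) \<Rightarrow> nat set \<Rightarrow> nat set \<Rightarrow> 't"
  where "slice2 c S = (\<lambda>S'. if S' \<subseteq> {..<n2} then c (join S S') else 0)"

lemma join_low: "i < n1 \<Longrightarrow> i \<in> join S S' \<longleftrightarrow> i \<in> S" "i < n1 \<Longrightarrow> insert i (join S S') = join (insert i S) S'"
  "i < n1 \<Longrightarrow> join S S' - {i} = join (S - {i}) S'" "i < n1 \<Longrightarrow> ksgn i (join S S') = ksgn i S"
proof -
  assume i: "i < n1"
  show "i \<in> join S S' \<longleftrightarrow> i \<in> S" "insert i (join S S') = join (insert i S) S'" "join S S' - {i} = join (S - {i}) S'"
    using i by (auto simp: join_def)
  have "{s \<in> join S S'. s < i} = {s \<in> S. s < i}" using i by (auto simp: join_def)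
  then show "ksgn i (join S S') = ksgn i S" by (simp only: ksgn_def)
qed

text \<open>All of S lies below n1 + i, whence the additional factor (-1)^card S. It is the origin
  of the sign \<open>sg\<close> in the tensor product differential.\<close>

lemma join_high:
  assumes "S \<subseteq> {..<n1}"
  shows "n1 + i \<in> join S S' \<longleftrightarrow> i \<in> S'" "insert (n1 + i) (join S S') = join S (insert i S')"
    "join S S' - {n1 + i} = join S (S' - {i})" "ksgn (n1 + i) (join S S') = (-1) ^ card S * ksgn i S'"
proof -
  show "n1 + i \<in> join S S' \<longleftrightarrow> i \<in> S'" "insert (n1 + i) (join S S') = join S (insert i S')"
    "join S S' - {n1 + i} = join S (S' - {i})" using assms by (auto simp: join_def)
  have eq: "{s \<in> join S S'. s < n1 + i} = S \<union> (+) n1 ` {s \<in> S'. s < i}" using assms by (auto simp: join_def)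
  have "finite S" using assms finite_subset by blast
  moreover have "finite {s \<in> S'. s < i}" by (rule finite_subset[of _ "{..<i}"]) auto
  moreover have "S \<inter> (+) n1 ` {s \<in> S'. s < i} = {}" using assms by auto
  ultimately have "card {s \<in> join S S'. s < n1 + i} = card S + card {s \<in> S'. s < i}"
    unfolding eq by (subst card_Un_disjoint) (auto simp: card_image)
  then show "ksgn (n1 + i) (join S S') = (-1) ^ card S * ksgn i S'" by (simp add: ksgn_def power_add)
qed

lemma slice1_ann: "i < n1 \<Longrightarrow> slice1 (ann i c) S' = ann i (slice1 c S')"
  by (auto simp: slice1_def ann_def fun_eq_iff join_low)

lemma slice1_cre: "i < n1 \<Longrightarrow> slice1 (cre i c) S' = cre i (slice1 c S')"
  by (auto simp: slice1_def cre_def fun_eq_iff join_low)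

lemma slice2_ann: "i < n2 \<Longrightarrow> S \<subseteq> {..<n1} \<Longrightarrow> slice2 (ann (n1 + i) c) S = (-1) ^ card S *\<^sub>C ann i (slice2 c S)"
  by (auto simp: slice2_def ann_def fun_eq_iff fun_ops join_high scaleC_scaleC)

lemma slice2_cre: "i < n2 \<Longrightarrow> S \<subseteq> {..<n1} \<Longrightarrow> slice2 (cre (n1 + i) c) S = (-1) ^ card S *\<^sub>C cre i (slice2 c S)"
  by (auto simp: slice2_def cre_def fun_eq_iff fun_ops join_high scaleC_scaleC)

lemma slice_lin: "clinear (\<lambda>c. slice1 c S')" "clinear (\<lambda>c. slice2 c S)"
  by (auto simp: slice1_def slice2_def fun_eq_iff fun_ops intro!: clinearI)

lemmas slice1D = clinearD[OF slice_lin(1)] and slice2D = clinearD[OF slice_lin(2)]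

lemma slice1_crel: "l \<in> H1 \<Longrightarrow> slice1 (crel bs12 (l, 0) c) S' = crel bs1 l (slice1 c S')"
proof -
  assume l: "l \<in> H1"
  have "crel bs12 (l, 0) c = (\<Sum>i<n1. coord bs1 l i *\<^sub>C crel bs12 (bs12 ! i) c)"
    unfolding pair_expand(1)[OF l] using P.bsH by (intro P.crel_sum) auto
  also have "\<dots> = (\<Sum>i<n1. coord bs1 l i *\<^sub>C cre i c)" by (simp add: P.crel_basis)
  finally show ?thesis by (simp add: slice1D slice1_cre crel_def)
qed

lemma slice2_crel: "l \<in> H2 \<Longrightarrow> S \<subseteq> {..<n1} \<Longrightarrow> slice2 (crel bs12 (0, l) c) S = (-1) ^ card S *\<^sub>C crel bs2 l (slice2 c S)"
proof -
  assume l: "l \<in> H2" and S: "S \<subseteq> {..<n1}"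
  have "crel bs12 (0, l) c = (\<Sum>i<n2. coord bs2 l i *\<^sub>C crel bs12 (bs12 ! (n1 + i)) c)"
    unfolding pair_expand(2)[OF l] using P.bsH by (intro P.crel_sum) auto
  also have "\<dots> = (\<Sum>i<n2. coord bs2 l i *\<^sub>C cre (n1 + i) c)" by (simp add: P.crel_basis)
  finally show ?thesis by (simp add: slice2D slice2_cre crel_def S scaleC_sum_right scaleC_scaleC mult.commute)
qed

lemma slice_app: "slice1 (app T c) S' = app T (slice1 c S')" "slice2 (app T c) S = app T (slice2 c S)"
  by (auto simp: slice1_def slice2_def app_def fun_eq_iff blinfun.zero_right)

abbreviation "\<theta>1' \<equiv> \<lambda>l. \<theta>1 l \<otimes>\<^sub>o id_blinfun"
abbreviation "\<theta>2' \<equiv> \<lambda>l. id_blinfun \<otimes>\<^sub>o \<theta>2 l"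

lemma \<theta>'_cblin: "\<theta>1' l \<in> cblinfuns" "\<theta>2' l' \<in> cblinfuns"
  by (intro optens_closed S1.rep_cblin S2.rep_cblin cblinfuns_intros(2))+

text \<open>Mixed brackets vanish in the direct sum, so the differential falls into two blocks.
  Every term of the second block contains an odd number of creation and annihilation operators, so
  exactly one sign survives.\<close>

lemma kd_join:
  assumes S: "S \<subseteq> {..<n1}" and S': "S' \<subseteq> {..<n2}"
  shows "kd bs12 \<theta>T c (join S S') = kd bs1 \<theta>1' (slice1 c S') S + (-1) ^ card S *\<^sub>C kd bs2 \<theta>2' (slice2 c S) S'"
proof -
  let ?a = "\<Sum>i<n1. app (\<theta>1' (bs1 ! i)) (ann i c)" and ?b = "\<Sum>i<n2. app (\<theta>2' (bs2 ! i)) (ann (n1 + i) c)"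
  let ?u = "\<Sum>i<n1. \<Sum>j<n1. crel bs12 (lie (bs1 ! i) (bs1 ! j), 0) (ann j (ann i c))"
  let ?v = "\<Sum>i<n2. \<Sum>j<n2. crel bs12 (0, lie (bs2 ! i) (bs2 ! j)) (ann (n1 + j) (ann (n1 + i) c))"
  have "kd bs12 \<theta>T c = (?a + ?b) + (1 / 2) *\<^sub>C (?u + ?v)"
    by (simp add: kd_def sum_lessThan_add nth_bs12 \<theta>T_eq clinearD[OF S1.rep_lin] clinearD[OF S2.rep_lin]
        lie_prod_def P.crel_zero flip: zero_prod_def)
  also have "\<dots> = (?a + (1 / 2) *\<^sub>C ?u) + (?b + (1 / 2) *\<^sub>C ?v)" by (simp add: scaleC_add_right)
  finally have "kd bs12 \<theta>T c (join S S') = (?a + (1 / 2) *\<^sub>C ?u) (join S S') + (?b + (1 / 2) *\<^sub>C ?v) (join S S')"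
    by (simp add: plus_fun_apply)
  moreover have "(?a + (1 / 2) *\<^sub>C ?u) (join S S') = slice1 (?a + (1 / 2) *\<^sub>C ?u) S' S" using S by (simp add: slice1_def)
  moreover have "slice1 (?a + (1 / 2) *\<^sub>C ?u) S' = kd bs1 \<theta>1' (slice1 c S')"
    using S1.lie_closed[OF S1.bsH S1.bsH] by (simp add: slice1D slice_app slice1_ann slice1_crel kd_def)
  moreover have "(?b + (1 / 2) *\<^sub>C ?v) (join S S') = slice2 (?b + (1 / 2) *\<^sub>C ?v) S S'" using S' by (simp add: slice2_def)
  moreover have "slice2 (?b + (1 / 2) *\<^sub>C ?v) S = (-1) ^ card S *\<^sub>C kd bs2 \<theta>2' (slice2 c S)"
  proof -
    \<comment> \<open>Two of the three signs in the bracket terms cancel.\<close>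
    have sq: "(-1) ^ card S * ((-1) ^ card S) = (1 :: complex)" by (simp flip: power_add)
    have "slice2 (crel bs12 (0, lie (bs2 ! i) (bs2 ! j)) (ann (n1 + j) (ann (n1 + i) c))) S =
      (-1) ^ card S *\<^sub>C crel bs2 (lie (bs2 ! i) (bs2 ! j)) (ann j (ann i (slice2 c S)))" if "i < n2" "j < n2" for i j
      using that S2.lie_closed[OF S2.bsH S2.bsH]
      by (simp add: slice2_crel[OF _ S] slice2_ann[OF _ S] clinearD[OF ann_lin] clinearD[OF crel_lin] scaleC_scaleC sq)
    then show ?thesis
      by (simp add: slice2D slice_app slice2_ann[OF _ S] kd_def clinearD[OF app_lin[OF \<theta>'_cblin(2)]] scaleC_add_right
          scaleC_sum_right scaleC_scaleC)
  qed
  ultimately show ?thesis by (simp add: scaleC_fun_apply)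
qed

sublocale TC: tensor_complex tens optens S1.J card "kmat bs1 \<theta>1" S2.J card "kmat bs2 \<theta>2" ..

definition unjoin :: "(nat set \<Rightarrow> 't) \<Rightarrow> nat set \<times> nat set \<Rightarrow> 't"
  where "unjoin c = (\<lambda>(S, S'). if S \<in> S1.J \<and> S' \<in> S2.J then c (join S S') else 0)"

definition rejoin :: "(nat set \<times> nat set \<Rightarrow> 't) \<Rightarrow> nat set \<Rightarrow> 't"
  where "rejoin t = (\<lambda>S. if S \<in> P.J then t (S \<inter> {..<n1}, {i. n1 + i \<in> S}) else 0)"

lemma kmat_tensor: "kmat bs1 \<theta>1' R S = kmat bs1 \<theta>1 R S \<otimes>\<^sub>o id_blinfun" "kmat bs2 \<theta>2' R S = id_blinfun \<otimes>\<^sub>o kmat bs2 \<theta>2 R S"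
  by (simp_all add: kmat_def op_sum optens_add_left optens_add_right optens_scaleC_left optens_scaleC_right T3_id S1.rep_cblin S2.rep_cblin)

lemma join_parts:
  "S \<subseteq> {..<n1} \<Longrightarrow> join S S' \<inter> {..<n1} = S" "S \<subseteq> {..<n1} \<Longrightarrow> {i. n1 + i \<in> join S S'} = S'"
  "join (R \<inter> {..<n1}) {i. n1 + i \<in> R} = R"
proof -
  show "S \<subseteq> {..<n1} \<Longrightarrow> join S S' \<inter> {..<n1} = S" "S \<subseteq> {..<n1} \<Longrightarrow> {i. n1 + i \<in> join S S'} = S'"
    by (auto simp: join_def)
  show "join (R \<inter> {..<n1}) {i. n1 + i \<in> R} = R"
  proof (rule Set.set_eqI)
    fix x
    have "x \<in> (+) n1 ` {i. n1 + i \<in> R} \<longleftrightarrow> n1 \<le> x \<and> x \<in> R" by (auto simp: le_iff_add)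
    then show "x \<in> join (R \<inter> {..<n1}) {i. n1 + i \<in> R} \<longleftrightarrow> x \<in> R" by (auto simp: join_def)
  qed
qed

lemma join_J: "S \<in> S1.J \<Longrightarrow> S' \<in> S2.J \<Longrightarrow> join S S' \<in> P.J" "S \<in> S1.J \<Longrightarrow> S' \<in> S2.J \<Longrightarrow> card (join S S') = card S + card S'"
  "R \<in> P.J \<Longrightarrow> R \<inter> {..<n1} \<in> S1.J \<and> {i. n1 + i \<in> R} \<in> S2.J"
proof -
  show "S \<in> S1.J \<Longrightarrow> S' \<in> S2.J \<Longrightarrow> join S S' \<in> P.J" "R \<in> P.J \<Longrightarrow> R \<inter> {..<n1} \<in> S1.J \<and> {i. n1 + i \<in> R} \<in> S2.J"
    by (auto simp: join_def)
  assume S: "S \<in> S1.J" "S' \<in> S2.J"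
  then have "finite S" "finite S'" using finite_subset[of _ "{..<n1}"] finite_subset[of _ "{..<n2}"] by auto
  moreover have "S \<inter> (+) n1 ` S' = {}" using S by auto
  ultimately show "card (join S S') = card S + card S'" unfolding join_def by (subst card_Un_disjoint) (auto simp: card_image)
qed

lemma unjoin_d:
  assumes c: "c \<in> supp_on P.J"
  shows "unjoin (mop P.J (kmat bs12 \<theta>T) c) = TC.dT (unjoin c)"
proof -
  have "unjoin (mop P.J (kmat bs12 \<theta>T) c) (S, S') = TC.dT (unjoin c) (S, S')" for S S'
  proof (cases "S \<in> S1.J \<and> S' \<in> S2.J")
    case False
    then show ?thesis by (auto simp: unjoin_def TC.dT_def lift1_def lift2_def sg_def fun_ops)
  next
    case True
    then have S: "S \<subseteq> {..<n1}" "S' \<subseteq> {..<n2}" by auto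
    have "slice1 c S' \<in> supp_on S1.J" "slice2 c S \<in> supp_on S2.J" by (auto simp: slice1_def slice2_def supp_on_def split: if_splits)
    note kd_kmat[OF \<theta>'_cblin(1) this(1)] kd_kmat[OF \<theta>'_cblin(2) this(2)]
    then have "unjoin (mop P.J (kmat bs12 \<theta>T) c) (S, S') =
       mop S1.J (kmat bs1 \<theta>1') (slice1 c S') S + (-1) ^ card S *\<^sub>C mop S2.J (kmat bs2 \<theta>2') (slice2 c S) S'"
      using True kd_join[OF S, of c] kd_kmat[OF P.rep_cblin c] by (simp add: unjoin_def)
    also have "\<dots> = TC.dT (unjoin c) (S, S')"
      using True by (simp add: TC.dT_def fun_ops sg_def lift1_def lift2_def mop_def kmat_tensor slice1_def slice2_def unjoin_def cong: sum.cong)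
    finally show ?thesis .
  qed
  then show ?thesis by (auto simp: fun_eq_iff)
qed

lemma unjoin_iso: "complex_iso P.J card (mop P.J (kmat bs12 \<theta>T)) TC.JT TC.degT TC.dT unjoin rejoin"
proof (rule complex_iso.intro[OF P.K.banach_complex_axioms TC.T.banach_complex_axioms complex_iso_axioms.intro])
  show "clinear unjoin" "clinear rejoin" by (auto simp: unjoin_def rejoin_def fun_eq_iff fun_ops intro!: clinearI)
  have n: "cnorm TC.JT (unjoin c) = cnorm P.J c" for c
    unfolding cnorm_def
  proof (rule sum.reindex_bij_witness[of _ "\<lambda>S. (S \<inter> {..<n1}, {i. n1 + i \<in> S})" "\<lambda>w. join (fst w) (snd w)"])
    fix w assume w: "w \<in> TC.JT"
    then have S: "fst w \<in> S1.J" "snd w \<in> S2.J" "fst w \<subseteq> {..<n1}" by auto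
    show "(join (fst w) (snd w) \<inter> {..<n1}, {i. n1 + i \<in> join (fst w) (snd w)}) = w"
      by (simp only: join_parts(1)[OF S(3)] join_parts(2)[OF S(3)] prod.collapse)
    show "join (fst w) (snd w) \<in> P.J" by (rule join_J(1)[OF S(1,2)])
    show "norm (c (join (fst w) (snd w))) = norm (unjoin c w)" using S(1,2) by (simp add: unjoin_def split_beta del: Pow_iff)
  next
    fix R assume R: "R \<in> P.J"
    show "join (fst (R \<inter> {..<n1}, {i. n1 + i \<in> R})) (snd (R \<inter> {..<n1}, {i. n1 + i \<in> R})) = R"
      by (simp only: fst_conv snd_conv join_parts(3))
    show "(R \<inter> {..<n1}, {i. n1 + i \<in> R}) \<in> TC.JT" using join_J(3)[OF R] by (simp only: mem_Times_iff fst_conv snd_conv)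
  qed
  show "\<exists>K\<ge>0. \<forall>c\<in>supp_on P.J. cnorm TC.JT (unjoin c) \<le> K * cnorm P.J c" using n by (intro exI[of _ 1]) auto
  show rxri: "unjoin (rejoin t) = t" if "t \<in> supp_on TC.JT" for t
    using that join_J(1) by (auto simp: unjoin_def rejoin_def fun_eq_iff supp_on_def join_parts)
  show "rejoin (unjoin c) = c" if "c \<in> supp_on P.J" for c
    using that join_J(3) by (auto simp: unjoin_def rejoin_def fun_eq_iff supp_on_def join_parts)
  have "cnorm P.J (rejoin t) = cnorm TC.JT t" if "t \<in> supp_on TC.JT" for t
    using n[of "rejoin t"] rxri[OF that] by simp
  then show "\<exists>K\<ge>0. \<forall>t\<in>supp_on TC.JT. cnorm P.J (rejoin t) \<le> K * cnorm TC.JT t" by (intro exI[of _ 1]) auto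
  show "unjoin c \<in> supp_on TC.JT" for c by (auto simp: unjoin_def supp_on_def split: if_splits)
  show "rejoin t \<in> supp_on P.J" for t by (auto simp: rejoin_def supp_on_def split: if_splits)
  show "unjoin c \<in> TC.T.C p" if "c \<in> P.K.C p" for c p
    using that join_J(2) by (auto simp: unjoin_def chains_def TC.degT_def split: if_splits)
  show "rejoin t \<in> P.K.C p" if "t \<in> TC.T.C p" for t p
    unfolding chains_def
  proof (intro CollectI allI impI)
    fix R assume "rejoin t R \<noteq> 0"
    then have R: "R \<in> P.J" "t (R \<inter> {..<n1}, {i. n1 + i \<in> R}) \<noteq> 0" by (auto simp: rejoin_def split: if_splits)
    then have "card (R \<inter> {..<n1}) + card {i. n1 + i \<in> R} = p" using that by (auto simp: chains_def TC.degT_def)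
    then show "R \<in> P.J \<and> card R = p" using join_J(2)[of "R \<inter> {..<n1}" "{i. n1 + i \<in> R}"] join_J(3)[OF R(1)] join_parts(3)[of R] R(1) by simp
  qed
  show "unjoin (mop P.J (kmat bs12 \<theta>T) c) = TC.dT (unjoin c)" if "c \<in> supp_on P.J" for c by (rule unjoin_d[OF that])
qed

end

lemma complex_iso_sym:
  assumes "complex_iso J deg d J' deg' d' \<Phi> \<Psi>"
  shows "complex_iso J' deg' d' J deg d \<Psi> \<Phi>"
proof -
  interpret complex_iso J deg d J' deg' d' \<Phi> \<Psi> by fact
  show ?thesis
    by (rule complex_iso.intro[OF B.banach_complex_axioms A.banach_complex_axioms complex_iso_axioms.intro])
      (fact \<Phi>_lin \<Psi>_lin \<Phi>_bounded \<Psi>_bounded \<Phi>_supp \<Psi>_supp \<Phi>_chains \<Psi>_chains \<Psi>\<Phi> \<Phi>\<Psi> \<Psi>_d)+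
qed

section \<open>Joint spectra in terms of strict and split degrees\<close>

lemma chains_trivial:
  assumes "\<And>j. j \<in> J \<Longrightarrow> deg j \<noteq> p"
  shows "chains J deg p = {0 :: 'j \<Rightarrow> 'x::complex_vector}"
proof -
  have "c \<in> chains J deg p \<longleftrightarrow> (\<forall>j. c j = 0)" for c :: "'j \<Rightarrow> 'x"
    using assms unfolding chains_def by blast
  then show ?thesis by (auto simp: fun_eq_iff zero_fun_apply)
qed

context banach_complex
begin

lemma deg_bound: "\<exists>m. \<forall>p\<ge>m. C p = {0 :: 'j \<Rightarrow> 'x}"
proof (intro exI allI impI)
  fix p assume p: "Suc (\<Sum>j\<in>J. deg j) \<le> p"
  have "deg j \<noteq> p" if "j \<in> J" for j
    using member_le_sum[of j J deg] finJ that p by auto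
  then show "C p = {0 :: 'j \<Rightarrow> 'x}" by (rule chains_trivial)
qed

lemma split_above:
  assumes "C p = {0 :: 'j \<Rightarrow> 'x}"
  shows "split_at p"
  unfolding split_at_def
proof (intro exI conjI ballI)
  show "hop (\<lambda>c. 0)" "hop (\<lambda>c. 0)" unfolding hop_def by (auto simp: bop_zero CD(1))
  show "d 0 + 0 = c" if "c \<in> C p" for c using that assms by (simp add: lD)
qed

text \<open>Exactness one degree lower identifies the outgoing range with a kernel, which is
  closed.\<close>

lemma strict_below:
  assumes ex: "\<And>q. q \<le> p \<Longrightarrow> exact_at q"
  shows "strict_at p"
proof -
  have "closed (d ` C p)"
  proof (cases p)
    case 0
    have "d ` C 0 = {0}" using d_0 CD(1) by (auto simp: image_iff intro!: bexI[of _ 0])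
    moreover obtain m where "C m = {0 :: 'j \<Rightarrow> 'x}" using deg_bound by blast
    then have "closed {0 :: 'j \<Rightarrow> 'x}" using closed_chains[OF finJ, of deg m] by metis
    ultimately show ?thesis using 0 by simp
  next
    case (Suc q)
    have "d ` C (Suc q) = {c \<in> C q. d c = 0}"
      using ex[of q] d_deg dd[OF C_supp] Suc by (auto simp: exact_at_def)
    then show ?thesis using closed_kernel Suc by simp
  qed
  then show ?thesis using ex by (auto simp: strict_at_def)
qed

text \<open>Above degree p the outgoing range is a kernel by exactness one degree lower; in degree p
  itself its closedness is the hypothesis \<open>cl\<close>.\<close>

lemma strict_above:
  assumes cl: "closed (d ` C p)" and ex: "\<And>q. p \<le> q \<Longrightarrow> exact_at q" and pq: "p \<le> q"
  shows "strict_at q"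
proof -
  have "closed (d ` C q)"
  proof (cases "q = p")
    case False
    then obtain r where r: "q = Suc r" "p \<le> r" using pq by (cases q) auto
    have "d ` C (Suc r) = {c \<in> C r. d c = 0}"
      using ex[OF r(2)] d_deg dd[OF C_supp] by (auto simp: exact_at_def)
    then show ?thesis using closed_kernel r by simp
  qed (use cl in simp)
  then show ?thesis using ex[OF pq] by (auto simp: strict_at_def)
qed

lemma defect_below:
  assumes "\<not> strict_at p"
  shows "\<exists>q\<le>p. \<not> exact_at q \<and> defect q"
  using assms strict_below defect_if_not_exact by blast

text \<open>Descending induction from a degree without chains: strictness in degree r + 1 provides
  the closed range that \<open>strict_if_no_defect\<close> requires in degree r.\<close>

lemma defect_above:
  assumes "\<not> strict_at p"
  shows "\<exists>q\<ge>p. defect q"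
proof (rule ccontr)
  assume nd: "\<not> ?thesis"
  obtain m where m: "\<And>p. p \<ge> m \<Longrightarrow> C p = {0 :: 'j \<Rightarrow> 'x}" using deg_bound by auto
  have "strict_at q" if "p \<le> q" for q
  proof (cases "q \<le> max m p")
    case True
    then show ?thesis using that
    proof (induction rule: inc_induct)
      case base
      then show ?case using image_split_closed[OF split_above[OF m]] by simp
    next
      case (step r)
      then show ?case using strict_if_no_defect[of r] nd by (auto simp: strict_at_def)
    qed
  next
    case False
    then show ?thesis using image_split_closed[OF split_above[OF m]] by simp
  qed
  then show False using assms by auto
qed

end

definition koszul_strict where
  "koszul_strict bs \<theta> p \<longleftrightarrow> koszul_homology_zero bs \<theta> (int p) \<and> closed (koszul_boundaries bs \<theta> (int p - 1))"

lemma int_interval_iff: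
  "(\<exists>p\<in>{0..int m}. P p) \<longleftrightarrow> (\<exists>p\<le>m. P (int p))"
  "m \<le> d \<Longrightarrow> (\<exists>p\<in>{int d - int m..int d}. P p) \<longleftrightarrow> (\<exists>p\<le>d. d - m \<le> p \<and> P (int p))"
proof -
  have i: "(\<exists>p\<in>{int a..int b}. P p) \<longleftrightarrow> (\<exists>p\<in>{a..b}. P (int p))" for a b
    unfolding image_int_atLeastAtMost[symmetric] by simp
  show "(\<exists>p\<in>{0..int m}. P p) \<longleftrightarrow> (\<exists>p\<le>m. P (int p))"
    using i[of 0 m] by auto
  assume "m \<le> d"
  then have e: "int d - int m = int (d - m)" by simp
  show "(\<exists>p\<in>{int d - int m..int d}. P p) \<longleftrightarrow> (\<exists>p\<le>d. d - m \<le> p \<and> P (int p))"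
    unfolding e i by auto
qed

context koszul_setting
begin

lemma koszul_strict_iff: "koszul_strict bs \<theta> p \<longleftrightarrow> K.strict_at p"
  by (simp add: koszul_strict_def K.strict_at_def koszul_homology_zero_iff koszul_boundaries_eq)

lemma C_large: "n < p \<Longrightarrow> (K.C p :: (nat set \<Rightarrow> 'x) set) = {0}"
proof -
  assume p: "n < p"
  have "card S \<noteq> p" if "S \<in> J" for S
    using card_mono[of "{..<n}" S] that p by auto
  then show ?thesis by (rule chains_trivial)
qed

lemma split_large: "n < p \<Longrightarrow> koszul_split bs \<theta> (int p)"
  unfolding koszul_split_iff by (rule K.split_above[OF C_large])

lemma split_strict: "koszul_split bs \<theta> (int p) \<Longrightarrow> koszul_strict bs \<theta> p"
  unfolding koszul_split_iff koszul_strict_iff by (rule K.image_split_closed)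

lemma strict_large: "n < p \<Longrightarrow> koszul_strict bs \<theta> p"
  by (rule split_strict[OF split_large])

lemma strict_hilbert_split:
  "hilbert_space TYPE('x) \<Longrightarrow> koszul_strict bs \<theta> p \<longleftrightarrow> koszul_split bs \<theta> (int p)"
  using split_strict K.hilbert_split by (auto simp: koszul_split_iff koszul_strict_iff)

text \<open>If a degree is not strict, exactness fails there or below it, by
  \<open>strict_below\<close>; a degree that is not exact is not strict.\<close>

lemma sigma_delta_strict:
  "(\<exists>p\<in>{0..int m}. \<not> koszul_homology_zero bs \<theta> p) \<longleftrightarrow> (\<exists>p\<le>m. \<not> koszul_strict bs \<theta> p)"
  unfolding int_interval_iff koszul_homology_zero_iff koszul_strict_iff
  using K.strict_below by (meson K.strict_at_def order_trans)

lemma sigma_pi_strict: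
  assumes m: "m \<le> n"
  shows "(\<exists>p\<in>{int n - int m..int n}. \<not> koszul_homology_zero bs \<theta> p) \<or>
      \<not> closed (koszul_boundaries bs \<theta> (int n - int m - 1)) \<longleftrightarrow> (\<exists>p. n - m \<le> p \<and> \<not> koszul_strict bs \<theta> p)"
    (is "?L \<longleftrightarrow> ?R")
proof -
  have e: "int n - int m - 1 = int (n - m) - 1" using m by simp
  have L: "?L \<longleftrightarrow> (\<exists>p\<le>n. n - m \<le> p \<and> \<not> K.exact_at p) \<or> \<not> closed (mop J (kmat bs \<theta>) ` K.C (n - m))"
    unfolding int_interval_iff(2)[OF m] e koszul_homology_zero_iff koszul_boundaries_eq ..
  have big: "K.exact_at p" if "n < p" for p
    using strict_large[OF that] by (simp add: koszul_strict_iff K.strict_at_def)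
  show ?thesis
  proof
    assume ?L
    then show ?R unfolding L koszul_strict_iff K.strict_at_def by blast
  next
    assume ?R
    then obtain p where p: "n - m \<le> p" "\<not> K.strict_at p" by (auto simp: koszul_strict_iff)
    show ?L
    proof (rule ccontr)
      assume "\<not> ?L"
      then have cl: "closed (mop J (kmat bs \<theta>) ` K.C (n - m))"
        and ex: "\<And>q. q \<le> n \<Longrightarrow> n - m \<le> q \<Longrightarrow> K.exact_at q" unfolding L by blast+
      have "K.exact_at q" if "n - m \<le> q" for q using ex[OF _ that] big by (cases "q \<le> n") auto
      from K.strict_above[OF cl this p(1)] p(2) show False by blast
    qed
  qed
qed

lemma sp_pi_split:
  "m \<le> n \<Longrightarrow> (\<exists>p\<in>{int n - int m..int n}. \<not> koszul_split bs \<theta> p) \<longleftrightarrow> (\<exists>p. n - m \<le> p \<and> \<not> koszul_split bs \<theta> (int p))"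
  unfolding int_interval_iff(2) using split_large by (meson not_le)

lemma cdim_eq: "cdim H = n"
proof -
  have "cdim H = card (set bs)"
    using complex_vector.dim_span_eq_card_independent[OF indep] by (simp add: span)
  then show ?thesis using dist by (simp add: distinct_card)
qed

end

context koszul_change
begin

lemma koszul_strict_change: "koszul_strict bs \<theta> p \<longleftrightarrow> koszul_strict bs' \<theta> p"
  unfolding koszul_strict_iff other.koszul_strict_iff
  using complex_iso.strict_transfer[OF iso] complex_iso.strict_transfer[OF complex_iso_sym[OF iso]] by blast

lemma koszul_split_change: "koszul_split bs \<theta> (int p) \<longleftrightarrow> koszul_split bs' \<theta> (int p)"
  unfolding koszul_split_iff other.koszul_split_iff
  using complex_iso.split_transfer[OF iso] complex_iso.split_transfer[OF complex_iso_sym[OF iso]] by blast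

end

context koszul_tensor
begin

lemma strict_tensor: "koszul_strict bs12 \<theta>T p \<longleftrightarrow> TC.T.strict_at p"
  unfolding P.koszul_strict_iff
  using complex_iso.strict_transfer[OF unjoin_iso] complex_iso.strict_transfer[OF complex_iso_sym[OF unjoin_iso]] by blast

lemma split_tensor: "koszul_split bs12 \<theta>T (int p) \<longleftrightarrow> TC.T.split_at p"
  unfolding P.koszul_split_iff
  using complex_iso.split_transfer[OF unjoin_iso] complex_iso.split_transfer[OF complex_iso_sym[OF unjoin_iso]] by blast

lemma strict_product_below:
  assumes "\<not> koszul_strict bs1 \<theta>1 i" "\<not> koszul_strict bs2 \<theta>2 j"
  shows "\<exists>p\<le>i + j. \<not> koszul_strict bs12 \<theta>T p"
proof -
  obtain i' j' where "i' \<le> i" "S1.K.defect i'" "j' \<le> j" "S2.K.defect j'"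
    using assms S1.K.defect_below[of i] S2.K.defect_below[of j] unfolding S1.koszul_strict_iff S2.koszul_strict_iff by blast
  then show ?thesis using TC.defect_tensor[of i' j'] strict_tensor by (meson add_mono)
qed

lemma strict_product_above:
  assumes "\<not> koszul_strict bs1 \<theta>1 i" "\<not> koszul_strict bs2 \<theta>2 j"
  shows "\<exists>p\<ge>i + j. \<not> koszul_strict bs12 \<theta>T p"
proof -
  obtain i' j' where "i' \<ge> i" "S1.K.defect i'" "j' \<ge> j" "S2.K.defect j'"
    using assms S1.K.defect_above[of i] S2.K.defect_above[of j] unfolding S1.koszul_strict_iff S2.koszul_strict_iff by blast
  then show ?thesis using TC.defect_tensor[of i' j'] strict_tensor by (meson add_mono)
qed

lemma split_product_below:
  "\<not> koszul_split bs12 \<theta>T (int p) \<Longrightarrow>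
    \<exists>i j. i + j \<le> p \<and> \<not> koszul_split bs1 \<theta>1 (int i) \<and> \<not> koszul_split bs2 \<theta>2 (int j)"
  unfolding split_tensor S1.koszul_split_iff S2.koszul_split_iff by (rule TC.not_split_below)

lemma split_product_above:
  "\<not> koszul_split bs12 \<theta>T (int p) \<Longrightarrow>
    \<exists>i j. p \<le> i + j \<and> \<not> koszul_split bs1 \<theta>1 (int i) \<and> \<not> koszul_split bs2 \<theta>2 (int j)"
  unfolding split_tensor S1.koszul_split_iff S2.koszul_split_iff by (rule TC.not_split_above)

end

section \<open>The joint spectra of a subalgebra\<close>

lemma ordered_basis:
  assumes fd: "finite_dimensional (UNIV :: 'l::complex_vector set)" and H: "complex_vector.subspace (H :: 'l set)"
  shows "distinct (ordered_basis H)" "complex_vector.independent (set (ordered_basis H))"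
    "cspan (set (ordered_basis H)) = H"
proof -
  obtain B where B: "finite B" "cspan B = (UNIV :: 'l set)" using fd by (auto simp: finite_dimensional_def)
  obtain A where A: "A \<subseteq> H" "complex_vector.independent A" "H \<subseteq> cspan A"
    using complex_vector.maximal_independent_subset[of H] by blast
  have "finite A" using complex_vector.independent_span_bound[OF B(1) A(2)] B(2) by auto
  then obtain bs where bs: "set bs = A" "distinct bs" using finite_distinct_list by blast
  have "cspan A = H" using A(1,3) complex_vector.span_minimal[OF A(1) H] by blast
  then have "\<exists>bs. distinct bs \<and> complex_vector.independent (set bs) \<and> cspan (set bs) = H"
    using bs A(2) by blast
  from someI_ex[OF this]
  show "distinct (ordered_basis H)" "complex_vector.independent (set (ordered_basis H))"
    "cspan (set (ordered_basis H)) = H"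
    unfolding ordered_basis_def by blast+
qed

lemma dual_on_UNIV: "f \<in> dual_on UNIV \<longleftrightarrow> (\<forall>x y. f (x + y) = f x + f y) \<and> (\<forall>a x. f (a *\<^sub>C x) = a * f x)"
  by (simp add: dual_on_def)

lemma restrict_character_iff:
  assumes f: "f \<in> dual_on UNIV" and H: "lie_subalgebra H"
  shows "restrict f H \<in> lie_characters H \<longleftrightarrow> (\<forall>x\<in>H. \<forall>y\<in>H. f (lie x y) = 0)"
proof -
  have sub: "complex_vector.subspace H" using H by (simp add: lie_subalgebra_def)
  have comm: "lie_commutator H H \<subseteq> H"
    unfolding lie_commutator_def using H by (intro complex_vector.span_minimal) (auto simp: lie_subalgebra_def)
  have "restrict f H \<in> dual_on H"
    using f csubspaceD[OF sub] by (auto simp: dual_on_def)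
  then have "restrict f H \<in> lie_characters H \<longleftrightarrow> (\<forall>l\<in>lie_commutator H H. f l = 0)"
    using comm by (auto simp: lie_characters_def subset_iff)
  also have "\<dots> \<longleftrightarrow> (\<forall>x\<in>H. \<forall>y\<in>H. f (lie x y) = 0)"
  proof
    assume a: "\<forall>l\<in>lie_commutator H H. f l = 0"
    show "\<forall>x\<in>H. \<forall>y\<in>H. f (lie x y) = 0"
      using a unfolding lie_commutator_def by (blast intro: complex_vector.span_base)
  next
    assume a: "\<forall>x\<in>H. \<forall>y\<in>H. f (lie x y) = 0"
    have "f (0 + 0) = f 0 + f 0" using f unfolding dual_on_UNIV by blast
    then have f0: "f 0 = 0" by simp
    have "complex_vector.subspace {l. f l = 0}"
      using f f0 by (auto simp: complex_vector.subspace_def dual_on_UNIV)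
    then have "lie_commutator H H \<subseteq> {l. f l = 0}"
      unfolding lie_commutator_def using a by (intro complex_vector.span_minimal) auto
    then show "\<forall>l\<in>lie_commutator H H. f l = 0" by blast
  qed
  finally show ?thesis .
qed

lemma koszul_d_cong:
  assumes "\<And>l. l \<in> set bs \<Longrightarrow> \<theta> l = \<theta>' l"
  shows "koszul_d bs \<theta> = koszul_d bs \<theta>'"
proof (intro ext)
  fix c :: "nat set \<Rightarrow> 'b" and R
  have "koszul_elem bs \<theta> x (nths bs S) R = koszul_elem bs \<theta>' x (nths bs S) R" for x S
  proof -
    have "\<theta> (nths bs S ! i) = \<theta>' (nths bs S ! i)" if "i < length (nths bs S)" for i
      using subsetD[OF set_nths_subset nth_mem[OF that]] by (rule assms)
    then show ?thesis unfolding koszul_elem_def by (simp cong: sum.cong_simp)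
  qed
  then show "koszul_d bs \<theta> c R = koszul_d bs \<theta>' c R" unfolding koszul_d_def by simp
qed

lemma koszul_cong:
  assumes "\<And>l. l \<in> set bs \<Longrightarrow> \<theta> l = \<theta>' l"
  shows "koszul_homology_zero bs \<theta> p \<longleftrightarrow> koszul_homology_zero bs \<theta>' p"
    "koszul_boundaries bs \<theta> p = koszul_boundaries bs \<theta>' p"
    "koszul_split bs \<theta> p \<longleftrightarrow> koszul_split bs \<theta>' p"
proof -
  have "koszul_d bs \<theta> = koszul_d bs \<theta>'" using assms by (rule koszul_d_cong)
  then show "koszul_homology_zero bs \<theta> p \<longleftrightarrow> koszul_homology_zero bs \<theta>' p"
    "koszul_boundaries bs \<theta> p = koszul_boundaries bs \<theta>' p"
    "koszul_split bs \<theta> p \<longleftrightarrow> koszul_split bs \<theta>' p"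
    unfolding koszul_homology_zero_def koszul_homology_def koszul_cycles_def koszul_boundaries_def koszul_split_def
    by simp_all
qed

locale cartan_setting =
  fixes \<rho> :: "'l::complex_lie_algebra \<Rightarrow> ('x::complex_banach \<Rightarrow>\<^sub>L 'x)" and f :: "'l \<Rightarrow> complex" and H :: "'l set"
  assumes fd: "finite_dimensional (UNIV :: 'l set)" and rep: "lie_representation \<rho>" and sub: "lie_subalgebra H"
    and dual: "f \<in> dual_on UNIV" and char: "restrict f H \<in> lie_characters H"
begin

abbreviation "basis \<equiv> ordered_basis H"

lemma subspace_H: "complex_vector.subspace H"
  using sub by (simp add: lie_subalgebra_def)

sublocale koszul_setting basis H "shifted \<rho> f"
proof (rule koszul_setting.intro)
  show "distinct basis" "complex_vector.independent (set basis)" "cspan (set basis) = H"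
    by (rule ordered_basis[OF fd subspace_H])+
  show "lie x y \<in> H" if "x \<in> H" "y \<in> H" for x y using sub that by (auto simp: lie_subalgebra_def)
  have \<rho>: "clinear \<rho>" "\<rho> l \<in> cblinfuns" "\<rho> (lie x y) = (\<rho> x o\<^sub>L \<rho> y) - (\<rho> y o\<^sub>L \<rho> x)" for l x y
    using rep by (auto simp: lie_representation_def)
  show "clinear (shifted \<rho> f)"
    using dual by (intro clinearI)
      (simp_all add: shifted_def dual_on_UNIV clinearD[OF \<rho>(1)] scaleC_add_left scaleC_scaleC
        complex_vector.scale_right_diff_distrib)
  show "shifted \<rho> f l \<in> cblinfuns" for l
    unfolding shifted_def cblinfuns_def
    by (simp add: blinfun.diff_left scaleC_blinfun.rep_eq cblinfunsD[OF \<rho>(2)] complex_vector.scale_right_diff_distrib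
        scaleC_scaleC mult.commute)
  show "shifted \<rho> f (lie x y) = (shifted \<rho> f x o\<^sub>L shifted \<rho> f y) - (shifted \<rho> f y o\<^sub>L shifted \<rho> f x)"
    if "x \<in> H" "y \<in> H" for x y
  proof -
    have "f (lie x y) = 0" using restrict_character_iff[OF dual sub] char that by blast
    then show ?thesis
      by (intro blinfun_eqI) (simp add: shifted_def \<rho>(3) blinfun.diff_left blinfun.diff_right scaleC_blinfun.rep_eq
          cblinfunsD[OF \<rho>(2)] scaleC_scaleC mult.commute)
  qed
qed

text \<open>The spectra contain \<open>restrict f H\<close>, which is \<open>undefined\<close>
  outside \<open>H\<close> and need not be linear on the whole type; on the basis it may be
  exchanged for \<open>f\<close>, to which \<open>koszul_setting\<close> applies.\<close>

lemma restrict_shifted: "l \<in> set basis \<Longrightarrow> shifted \<rho> (restrict f H) l = shifted \<rho> f l"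
  using span complex_vector.span_superset[of "set basis"] by (auto simp: shifted_def)

lemma koszul_restrict:
  "koszul_homology_zero basis (shifted \<rho> (restrict f H)) p \<longleftrightarrow> koszul_homology_zero basis (shifted \<rho> f) p"
  "koszul_boundaries basis (shifted \<rho> (restrict f H)) p = koszul_boundaries basis (shifted \<rho> f) p"
  "koszul_split basis (shifted \<rho> (restrict f H)) p \<longleftrightarrow> koszul_split basis (shifted \<rho> f) p"
  by (rule koszul_cong; erule restrict_shifted)+

lemma mem_sigma_delta: "restrict f H \<in> sigma_delta k H \<rho> \<longleftrightarrow>
    (\<exists>p\<le>min k (cdim H). \<not> koszul_strict basis (shifted \<rho> f) p)"
  unfolding sigma_delta_def mem_Collect_eq koszul_restrict(1) sigma_delta_strict using char by simp

lemma mem_sp_delta: "restrict f H \<in> sp_delta k H \<rho> \<longleftrightarrow>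
    (\<exists>p\<le>min k (cdim H). \<not> koszul_split basis (shifted \<rho> f) (int p))"
  unfolding sp_delta_def mem_Collect_eq koszul_restrict(3) int_interval_iff using char by simp

lemma mem_sigma_pi: "restrict f H \<in> sigma_pi k H \<rho> \<longleftrightarrow>
    (\<exists>p. cdim H - min k (cdim H) \<le> p \<and> \<not> koszul_strict basis (shifted \<rho> f) p)"
  unfolding sigma_pi_def mem_Collect_eq koszul_restrict(1,2)
  using char sigma_pi_strict[of "min k (cdim H)"] by (simp add: cdim_eq)

lemma mem_sp_pi: "restrict f H \<in> sp_pi k H \<rho> \<longleftrightarrow>
    (\<exists>p. cdim H - min k (cdim H) \<le> p \<and> \<not> koszul_split basis (shifted \<rho> f) (int p))"
  unfolding sp_pi_def mem_Collect_eq koszul_restrict(3)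
  using char sp_pi_split[of "min k (cdim H)"] by (simp add: cdim_eq)

lemma sigma_subset_sp:
  "restrict f H \<in> sigma_delta k H \<rho> \<Longrightarrow> restrict f H \<in> sp_delta k H \<rho>"
  "restrict f H \<in> sigma_pi k H \<rho> \<Longrightarrow> restrict f H \<in> sp_pi k H \<rho>"
  unfolding mem_sigma_delta mem_sp_delta mem_sigma_pi mem_sp_pi using split_strict by blast+

lemma sp_eq_sigma_hilbert:
  assumes "hilbert_space TYPE('x)"
  shows "restrict f H \<in> sp_delta k H \<rho> \<longleftrightarrow> restrict f H \<in> sigma_delta k H \<rho>"
    "restrict f H \<in> sp_pi k H \<rho> \<longleftrightarrow> restrict f H \<in> sigma_pi k H \<rho>"
  unfolding mem_sigma_delta mem_sp_delta mem_sigma_pi mem_sp_pi strict_hilbert_split[OF assms] by blast+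

end

lemma sp_imp_character:
  "g \<in> sigma_delta k H \<rho> \<Longrightarrow> g \<in> lie_characters H" "g \<in> sigma_pi k H \<rho> \<Longrightarrow> g \<in> lie_characters H"
  "g \<in> sp_delta k H \<rho> \<Longrightarrow> g \<in> lie_characters H" "g \<in> sp_pi k H \<rho> \<Longrightarrow> g \<in> lie_characters H"
  by (auto simp: sigma_delta_def sigma_pi_def sp_delta_def sp_pi_def)

section \<open>Cartan subalgebras of a product\<close>

lemma clinear_fst_snd: "clinear fst" "clinear snd"
  by (auto intro!: clinearI simp: scaleC_prod_def)

lemma lie_prod_sel [simp]: "fst (lie x y) = lie (fst x) (fst y)" "snd (lie x y) = lie (snd x) (snd y)"
  by (simp_all add: lie_prod_def)

lemma scaleC_prod_sel [simp]: "fst (a *\<^sub>C x) = a *\<^sub>C fst x" "snd (a *\<^sub>C x) = a *\<^sub>C snd x"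
  by (simp_all add: scaleC_prod_def)

lemma subspace_commutator: "complex_vector.subspace (lie_commutator A B)"
  unfolding lie_commutator_def by (rule complex_vector.subspace_span)

lemma subspace_lower_central:
  "complex_vector.subspace H \<Longrightarrow> complex_vector.subspace ((lie_commutator H ^^ q) H)"
  by (cases q) (auto intro: subspace_commutator)

lemma lie_in_commutator: "x \<in> A \<Longrightarrow> y \<in> B \<Longrightarrow> lie x y \<in> lie_commutator A B"
  unfolding lie_commutator_def by (blast intro: complex_vector.span_base)

lemma lie_commutator_Times:
  assumes "0 \<in> A1" "0 \<in> A2" "0 \<in> B1" "0 \<in> B2"
  shows "lie_commutator (A1 \<times> A2) (B1 \<times> B2) = lie_commutator A1 B1 \<times> lie_commutator A2 B2" (is "?L = ?R")
proof
  have "{lie x y |x y. x \<in> A1 \<times> A2 \<and> y \<in> B1 \<times> B2} \<subseteq> ?R"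
    by (auto simp: lie_prod_def intro: lie_in_commutator)
  then show "?L \<subseteq> ?R"
    unfolding lie_commutator_def[of "A1 \<times> A2"]
    by (rule complex_vector.span_minimal) (intro subspace_Times subspace_commutator)
  have sub: "complex_vector.subspace ?L" by (rule subspace_commutator)
  note subD = csubspaceD[OF sub]
  have "lie_commutator A1 B1 \<subseteq> {u. (u, 0) \<in> ?L}"
    unfolding lie_commutator_def[of A1]
  proof (rule complex_vector.span_minimal)
    have "lie (x, 0) (y, 0) \<in> ?L" if "x \<in> A1" "y \<in> B1" for x y
      using that assms by (intro lie_in_commutator) auto
    then show "{lie x y |x y. x \<in> A1 \<and> y \<in> B1} \<subseteq> {u. (u, 0) \<in> ?L}" by (auto simp: lie_prod_def)
    show "complex_vector.subspace {u. (u, 0) \<in> ?L}"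
    proof (rule complex_vector.subspaceI; unfold mem_Collect_eq)
      show "(0, 0) \<in> ?L" using subD(1) by (simp add: zero_prod_def)
      show "(x + y, 0) \<in> ?L" if "(x, 0) \<in> ?L" "(y, 0) \<in> ?L" for x y using subD(2)[OF that] by simp
      show "(c *\<^sub>C x, 0) \<in> ?L" if "(x, 0) \<in> ?L" for c x using subD(3)[OF that, of c] by (simp add: scaleC_prod_def)
    qed
  qed
  moreover have "lie_commutator A2 B2 \<subseteq> {u. (0, u) \<in> ?L}"
    unfolding lie_commutator_def[of A2]
  proof (rule complex_vector.span_minimal)
    have "lie (0, x) (0, y) \<in> ?L" if "x \<in> A2" "y \<in> B2" for x y
      using that assms by (intro lie_in_commutator) auto
    then show "{lie x y |x y. x \<in> A2 \<and> y \<in> B2} \<subseteq> {u. (0, u) \<in> ?L}" by (auto simp: lie_prod_def)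
    show "complex_vector.subspace {u. (0, u) \<in> ?L}"
    proof (rule complex_vector.subspaceI; unfold mem_Collect_eq)
      show "(0, 0) \<in> ?L" using subD(1) by (simp add: zero_prod_def)
      show "(0, x + y) \<in> ?L" if "(0, x) \<in> ?L" "(0, y) \<in> ?L" for x y using subD(2)[OF that] by simp
      show "(0, c *\<^sub>C x) \<in> ?L" if "(0, x) \<in> ?L" for c x using subD(3)[OF that, of c] by (simp add: scaleC_prod_def)
    qed
  qed
  ultimately have "(u, 0) + (0, v) \<in> ?L" if "u \<in> lie_commutator A1 B1" "v \<in> lie_commutator A2 B2" for u v
    using that by (intro subD(2)) auto
  then show "?R \<subseteq> ?L" by auto
qed

lemma lower_central_Times:
  assumes "complex_vector.subspace H1" "complex_vector.subspace H2"
  shows "(lie_commutator (H1 \<times> H2) ^^ q) (H1 \<times> H2) = (lie_commutator H1 ^^ q) H1 \<times> (lie_commutator H2 ^^ q) H2"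
proof (induction q)
  case (Suc q)
  show ?case
    using csubspaceD(1)[OF assms(1)] csubspaceD(1)[OF assms(2)]
      csubspaceD(1)[OF subspace_lower_central[OF assms(1), of q]] csubspaceD(1)[OF subspace_lower_central[OF assms(2), of q]]
    by (simp add: Suc lie_commutator_Times)
qed simp

lemma lie_commutator_image:
  assumes \<phi>: "clinear \<phi>" "\<And>x y. \<phi> (lie x y) = lie (\<phi> x) (\<phi> y)"
  shows "\<phi> ` lie_commutator A B = lie_commutator (\<phi> ` A) (\<phi> ` B)"
proof -
  interpret \<phi>: Vector_Spaces.linear scaleC scaleC \<phi> by fact
  have "\<phi> ` {lie x y |x y. x \<in> A \<and> y \<in> B} = {lie x y |x y. x \<in> \<phi> ` A \<and> y \<in> \<phi> ` B}"
    using \<phi>(2) by (force simp: image_iff)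
  then show ?thesis unfolding lie_commutator_def using \<phi>.span_image by metis
qed

lemma lower_central_image:
  assumes \<phi>: "clinear \<phi>" "\<And>x y. \<phi> (lie x y) = lie (\<phi> x) (\<phi> y)"
  shows "\<phi> ` (lie_commutator H ^^ q) H = (lie_commutator (\<phi> ` H) ^^ q) (\<phi> ` H)"
  by (induction q) (simp_all add: lie_commutator_image[OF \<phi>])

lemma lower_central_zero_mono:
  assumes "(lie_commutator H ^^ q) H = {0}" "q \<le> r"
  shows "(lie_commutator H ^^ r) H = {0}"
  using assms(2)
proof (induction rule: dec_induct)
  case (step r)
  have "{lie x y |x y. x \<in> H \<and> y \<in> {0}} \<subseteq> {0}" by auto
  then have "lie_commutator H {0} \<subseteq> {0}" unfolding lie_commutator_def
    by (rule complex_vector.span_minimal) (simp add: complex_vector.subspace_single_0)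
  then have "lie_commutator H {0} = {0}" using csubspaceD(1)[OF subspace_commutator, of H "{0}"] by blast
  then show ?case using step by simp
qed (use assms in simp)

lemma lie_nilpotent_Times:
  assumes "lie_nilpotent H1" "lie_nilpotent H2" "complex_vector.subspace H1" "complex_vector.subspace H2"
  shows "lie_nilpotent (H1 \<times> H2)"
proof -
  obtain q r where "(lie_commutator H1 ^^ q) H1 = {0}" "(lie_commutator H2 ^^ r) H2 = {0}"
    using assms by (auto simp: lie_nilpotent_def)
  then have "(lie_commutator H1 ^^ max q r) H1 = {0}" "(lie_commutator H2 ^^ max q r) H2 = {0}"
    using lower_central_zero_mono by (meson max.cobounded1 max.cobounded2)+
  then have "(lie_commutator (H1 \<times> H2) ^^ max q r) (H1 \<times> H2) = {0}"
    by (simp add: lower_central_Times[OF assms(3,4)] zero_prod_def)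
  then show ?thesis unfolding lie_nilpotent_def by blast
qed

lemma lie_nilpotent_image:
  assumes \<phi>: "clinear \<phi>" "\<And>x y. \<phi> (lie x y) = lie (\<phi> x) (\<phi> y)" and "lie_nilpotent H"
  shows "lie_nilpotent (\<phi> ` H)"
proof -
  obtain q where "(lie_commutator H ^^ q) H = {0}" using assms by (auto simp: lie_nilpotent_def)
  then have "(lie_commutator (\<phi> ` H) ^^ q) (\<phi> ` H) = {0}"
    using lower_central_image[OF \<phi>, of q H] clinearD(3)[OF \<phi>(1)] by simp
  then show ?thesis unfolding lie_nilpotent_def by blast
qed

lemma lie_subalgebra_Times: "lie_subalgebra H1 \<Longrightarrow> lie_subalgebra H2 \<Longrightarrow> lie_subalgebra (H1 \<times> H2)"
  by (auto simp: lie_subalgebra_def subspace_Times lie_prod_def)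

lemma lie_subalgebra_image:
  assumes \<phi>: "clinear \<phi>" "\<And>x y. \<phi> (lie x y) = lie (\<phi> x) (\<phi> y)" and "lie_subalgebra H"
  shows "lie_subalgebra (\<phi> ` H)"
proof -
  interpret \<phi>: Vector_Spaces.linear scaleC scaleC \<phi> by fact
  show ?thesis using assms(3) \<phi>.subspace_image[of H] by (auto simp: lie_subalgebra_def simp flip: \<phi>(2))
qed

text \<open>Iterated brackets with h run through the descending central series of \<open>K\<close>,
  which ends at zero; its length is an exponent common to all h, as \<open>root_space\<close>
  demands.\<close>

lemma nilpotent_subset_root_space:
  assumes "lie_nilpotent K" "complex_vector.subspace K" "H \<subseteq> K"
  shows "K \<subseteq> root_space H (\<lambda>_. 0)"
proof
  fix l assume l: "l \<in> K"
  obtain q where q: "(lie_commutator K ^^ q) K = {0}" using assms by (auto simp: lie_nilpotent_def)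
  have "((\<lambda>v. lie h v - 0 *\<^sub>C v) ^^ r) l \<in> (lie_commutator K ^^ r) K" if "h \<in> H" for h r
    using that assms(3) l by (induction r) (auto intro: lie_in_commutator)
  from this[of _ q] have "\<forall>h\<in>H. ((\<lambda>v. lie h v - 0 *\<^sub>C v) ^^ q) l = 0" unfolding q by blast
  then show "l \<in> root_space H (\<lambda>_. 0)" unfolding root_space_def by blast
qed

lemma ad_power_zero: "((\<lambda>v. lie h v - a *\<^sub>C v) ^^ q) 0 = 0"
  by (induction q) simp_all

lemma ad_power_mono: "((\<lambda>v. lie h v - a *\<^sub>C v) ^^ q) l = 0 \<Longrightarrow> q \<le> r \<Longrightarrow> ((\<lambda>v. lie h v - a *\<^sub>C v) ^^ r) l = 0"
proof -
  assume a: "((\<lambda>v. lie h v - a *\<^sub>C v) ^^ q) l = 0" and "q \<le> r"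
  then obtain m where "r = m + q" using le_Suc_ex add.commute by metis
  then show ?thesis by (simp only: funpow_add comp_apply a ad_power_zero)
qed

lemma ad_power_pair:
  "((\<lambda>v. lie h v - a *\<^sub>C v) ^^ q) l =
    (((\<lambda>v. lie (fst h) v - a *\<^sub>C v) ^^ q) (fst l), ((\<lambda>v. lie (snd h) v - a *\<^sub>C v) ^^ q) (snd l))"
  by (induction q) (simp_all add: prod_eq_iff)

lemma root_space_zero_Times:
  assumes "0 \<in> H1" "0 \<in> H2"
  shows "root_space (H1 \<times> H2) (\<lambda>_. 0) = root_space H1 (\<lambda>_. 0) \<times> root_space H2 (\<lambda>_. 0)"
proof (rule Set.set_eqI, safe)
  fix l1 l2 assume "(l1, l2) \<in> root_space (H1 \<times> H2) (\<lambda>_. 0)"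
  then obtain q where q: "\<And>h. h \<in> H1 \<times> H2 \<Longrightarrow> ((\<lambda>v. lie h v - 0 *\<^sub>C v) ^^ q) (l1, l2) = 0"
    unfolding root_space_def by blast
  have "((\<lambda>v. lie h v - 0 *\<^sub>C v) ^^ q) l1 = 0" if "h \<in> H1" for h
    using q[of "(h, 0)"] that assms unfolding ad_power_pair by (simp add: zero_prod_def)
  then show "l1 \<in> root_space H1 (\<lambda>_. 0)" unfolding root_space_def by blast
  have "((\<lambda>v. lie h v - 0 *\<^sub>C v) ^^ q) l2 = 0" if "h \<in> H2" for h
    using q[of "(0, h)"] that assms unfolding ad_power_pair by (simp add: zero_prod_def)
  then show "l2 \<in> root_space H2 (\<lambda>_. 0)" unfolding root_space_def by blast
next
  fix l1 l2 assume "l1 \<in> root_space H1 (\<lambda>_. 0)" "l2 \<in> root_space H2 (\<lambda>_. 0)"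
  then obtain q r where q: "\<And>h. h \<in> H1 \<Longrightarrow> ((\<lambda>v. lie h v - 0 *\<^sub>C v) ^^ q) l1 = 0"
    and r: "\<And>h. h \<in> H2 \<Longrightarrow> ((\<lambda>v. lie h v - 0 *\<^sub>C v) ^^ r) l2 = 0"
    unfolding root_space_def by blast
  have "\<forall>h\<in>H1 \<times> H2. ((\<lambda>v. lie h v - 0 *\<^sub>C v) ^^ max q r) (l1, l2) = 0"
    unfolding ad_power_pair using ad_power_mono[OF q] ad_power_mono[OF r]
    by (auto simp: zero_prod_def simp del: complex_vector.scale_zero_left)
  then show "(l1, l2) \<in> root_space (H1 \<times> H2) (\<lambda>_. 0)" unfolding root_space_def by blast
qed

lemma cartan_Times:
  assumes "cartan_subalgebra H1" "cartan_subalgebra H2"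
  shows "cartan_subalgebra (H1 \<times> H2)"
proof -
  have sub: "complex_vector.subspace H1" "complex_vector.subspace H2"
    using assms by (auto simp: cartan_subalgebra_def lie_subalgebra_def)
  show ?thesis
    using assms lie_nilpotent_Times[OF _ _ sub] root_space_zero_Times[OF csubspaceD(1)[OF sub(1)] csubspaceD(1)[OF sub(2)]]
    unfolding cartan_subalgebra_def by (metis lie_subalgebra_Times)
qed

text \<open>The projections of \<open>H\<close> are nilpotent, so their product is contained in the nilspace of \<open>H\<close>.\<close>

lemma cartan_product_form:
  assumes "cartan_subalgebra H"
  shows "\<exists>H1 H2. cartan_subalgebra H1 \<and> cartan_subalgebra H2 \<and> H = H1 \<times> H2"
proof -
  define H1 H2 where "H1 = fst ` H" and "H2 = snd ` H"
  have H: "lie_subalgebra H" "lie_nilpotent H" "root_space H (\<lambda>_. 0) = H"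
    using assms by (auto simp: cartan_subalgebra_def)
  have s: "lie_subalgebra H1" "lie_subalgebra H2"
    unfolding H1_def H2_def using clinear_fst_snd H(1) by (auto intro!: lie_subalgebra_image)
  have n: "lie_nilpotent H1" "lie_nilpotent H2"
    unfolding H1_def H2_def using clinear_fst_snd H(2) by (auto intro!: lie_nilpotent_image)
  have c: "complex_vector.subspace H1" "complex_vector.subspace H2" using s by (auto simp: lie_subalgebra_def)
  have le: "H \<subseteq> H1 \<times> H2" by (auto simp: H1_def H2_def intro: rev_image_eqI)
  then have eq: "H = H1 \<times> H2"
    using nilpotent_subset_root_space[OF lie_nilpotent_Times[OF n c] subspace_Times[OF c] le] H(3) by blast
  have "H1 \<times> H2 = root_space H1 (\<lambda>_. 0) \<times> root_space H2 (\<lambda>_. 0)"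
    using H(3) root_space_zero_Times[OF csubspaceD(1)[OF c(1)] csubspaceD(1)[OF c(2)]] unfolding eq by simp
  moreover have "H1 \<noteq> {}" "H2 \<noteq> {}" using csubspaceD(1)[OF c(1)] csubspaceD(1)[OF c(2)] by blast+
  ultimately have "H1 = root_space H1 (\<lambda>_. 0)" "H2 = root_space H2 (\<lambda>_. 0)" by (auto simp: times_eq_iff)
  then show ?thesis using s n eq unfolding cartan_subalgebra_def by blast
qed

section \<open>Functionals that vanish on the complement of a Cartan subalgebra\<close>

lemma dual_zero: "f \<in> dual_on UNIV \<Longrightarrow> f 0 = 0"
  unfolding dual_on_UNIV by (metis add_cancel_right_right)

lemma vanish_cartan_complement:
  assumes f: "f \<in> dual_on UNIV"
  shows "(\<forall>l\<in>cartan_complement H. f l = 0) \<longleftrightarrow>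
    (\<forall>\<alpha>\<in>dual_on H. (\<exists>h\<in>H. \<alpha> h \<noteq> 0) \<longrightarrow> (\<forall>l\<in>root_space H \<alpha>. f l = 0))"
proof -
  have "complex_vector.subspace {l. f l = 0}"
    using f dual_zero[OF f] by (auto simp: complex_vector.subspace_def dual_on_UNIV)
  then have "cspan A \<subseteq> {l. f l = 0} \<longleftrightarrow> A \<subseteq> {l. f l = 0}" for A
    using complex_vector.span_minimal complex_vector.span_superset by blast
  from this[of "\<Union>\<alpha>\<in>{\<alpha> \<in> dual_on H. \<exists>h\<in>H. \<alpha> h \<noteq> 0}. root_space H \<alpha>", folded cartan_complement_def]
  have "(\<forall>l\<in>cartan_complement H. f l = 0) \<longleftrightarrow>
      (\<Union>\<alpha>\<in>{\<alpha> \<in> dual_on H. \<exists>h\<in>H. \<alpha> h \<noteq> 0}. root_space H \<alpha>) \<subseteq> {l. f l = 0}"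
    unfolding Ball_Collect .
  also have "\<dots> \<longleftrightarrow> (\<forall>\<alpha>\<in>dual_on H. (\<exists>h\<in>H. \<alpha> h \<noteq> 0) \<longrightarrow> (\<forall>l\<in>root_space H \<alpha>. f l = 0))"
    by auto
  finally show ?thesis .
qed

text \<open>Handles one component of a weight of a product. If the weight is nonzero on this factor,
  l lies in one of its root spaces. Otherwise the other component takes a nonzero value c, and the
  element 0 of this factor gives (- c)^q l = 0, hence l = 0.\<close>

lemma vanish_on_component:
  assumes f: "f \<in> dual_on UNIV" and v: "\<forall>l\<in>cartan_complement H. f l = 0"
    and a: "a \<in> dual_on H" and l: "\<And>h. h \<in> H \<Longrightarrow> ((\<lambda>v. lie h v - a h *\<^sub>C v) ^^ q) l = 0"
    and c: "((\<lambda>v. lie 0 v - c *\<^sub>C v) ^^ q) l = 0" and nz: "(\<exists>h\<in>H. a h \<noteq> 0) \<or> c \<noteq> 0"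
  shows "f l = 0"
proof (cases "\<exists>h\<in>H. a h \<noteq> 0")
  case True
  moreover have "l \<in> root_space H a" unfolding root_space_def using l by blast
  ultimately show ?thesis using v a unfolding vanish_cartan_complement[OF f] by blast
next
  case False
  have "((\<lambda>v. lie 0 v - c *\<^sub>C v) ^^ r) l = (- c) ^ r *\<^sub>C l" for r
    by (induction r) (simp_all add: scaleC_one scaleC_scaleC flip: complex_vector.scale_minus_left)
  then have "l = 0" using c nz False by simp
  then show ?thesis using dual_zero[OF f] by simp
qed

text \<open>A weight of one factor, extended by 0, is a weight of the product with the root vectors
  of that factor. Conversely, both components of a root vector of the product are treated by
  \<open>vanish_on_component\<close>.\<close>

lemma vanish_cartan_complement_Times:
  fixes f1 :: "'a::complex_lie_algebra \<Rightarrow> complex" and f2 :: "'b::complex_lie_algebra \<Rightarrow> complex"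
  assumes f1: "f1 \<in> dual_on UNIV" and f2: "f2 \<in> dual_on UNIV" and f: "(\<lambda>(l1, l2). f1 l1 + f2 l2) \<in> dual_on UNIV"
    and H: "complex_vector.subspace H1" "complex_vector.subspace H2"
  shows "(\<forall>l\<in>cartan_complement (H1 \<times> H2). (\<lambda>(l1, l2). f1 l1 + f2 l2) l = 0) \<longleftrightarrow>
    (\<forall>l\<in>cartan_complement H1. f1 l = 0) \<and> (\<forall>l\<in>cartan_complement H2. f2 l = 0)" (is "?L \<longleftrightarrow> ?R")
proof
  note HD = csubspaceD[OF H(1)] csubspaceD[OF H(2)]
  assume L: "?L"
  note L = this[unfolded vanish_cartan_complement[OF f], rule_format]
  show ?R
    unfolding vanish_cartan_complement[OF f1] vanish_cartan_complement[OF f2]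
  proof safe
    fix \<alpha> l h assume \<alpha>: "\<alpha> \<in> dual_on H1" and l: "l \<in> root_space H1 \<alpha>" and h: "h \<in> H1" "\<alpha> h \<noteq> 0"
    let ?a = "restrict (\<lambda>x. \<alpha> (fst x)) (H1 \<times> H2)"
    have "?a \<in> dual_on (H1 \<times> H2)" using \<alpha> HD by (auto simp: dual_on_def scaleC_prod_def)
    moreover have "\<exists>h\<in>H1 \<times> H2. ?a h \<noteq> 0" using h HD by (intro bexI[of _ "(h, 0)"]) auto
    moreover have "(l, 0) \<in> root_space (H1 \<times> H2) ?a"
      using l unfolding root_space_def ad_power_pair by (auto simp: ad_power_zero zero_prod_def)
    ultimately show "f1 l = 0" using L[of ?a "(l, 0)"] dual_zero[OF f2] by simp
  next
    fix \<alpha> l h assume \<alpha>: "\<alpha> \<in> dual_on H2" and l: "l \<in> root_space H2 \<alpha>" and h: "h \<in> H2" "\<alpha> h \<noteq> 0"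
    let ?a = "restrict (\<lambda>x. \<alpha> (snd x)) (H1 \<times> H2)"
    have "?a \<in> dual_on (H1 \<times> H2)" using \<alpha> HD by (auto simp: dual_on_def scaleC_prod_def)
    moreover have "\<exists>h\<in>H1 \<times> H2. ?a h \<noteq> 0" using h HD by (intro bexI[of _ "(0, h)"]) auto
    moreover have "(0, l) \<in> root_space (H1 \<times> H2) ?a"
      using l unfolding root_space_def ad_power_pair by (auto simp: ad_power_zero zero_prod_def)
    ultimately show "f2 l = 0" using L[of ?a "(0, l)"] dual_zero[OF f1] by simp
  qed
next
  note HD = csubspaceD[OF H(1)] csubspaceD[OF H(2)]
  assume R: "?R"
  show "?L"
    unfolding vanish_cartan_complement[OF f]
  proof clarify
    fix \<alpha> l1 l2 h1 h2
    assume \<alpha>: "\<alpha> \<in> dual_on (H1 \<times> H2)" and l: "(l1, l2) \<in> root_space (H1 \<times> H2) \<alpha>"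
      and h: "h1 \<in> H1" "h2 \<in> H2" and nz: "\<alpha> (h1, h2) \<noteq> 0"
    have add: "\<alpha> (x + y) = \<alpha> x + \<alpha> y" if "x \<in> H1 \<times> H2" "y \<in> H1 \<times> H2" for x y
      using \<alpha> that unfolding dual_on_def by blast
    have sc: "\<alpha> (a *\<^sub>C x) = a * \<alpha> x" if "x \<in> H1 \<times> H2" for a x
      using \<alpha> that unfolding dual_on_def by blast
    let ?a1 = "restrict (\<lambda>h. \<alpha> (h, 0)) H1" and ?a2 = "restrict (\<lambda>h. \<alpha> (0, h)) H2"
    have d1: "?a1 \<in> dual_on H1"
    proof -
      have "\<alpha> (x + y, 0) = \<alpha> (x, 0) + \<alpha> (y, 0)" if "x \<in> H1" "y \<in> H1" for x y
        using add[of "(x, 0)" "(y, 0)"] that HD by simp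
      moreover have "\<alpha> (a *\<^sub>C x, 0) = a * \<alpha> (x, 0)" if "x \<in> H1" for a x
        using sc[of "(x, 0)" a] that HD by (simp add: scaleC_prod_def)
      ultimately show ?thesis using HD by (auto simp: dual_on_def)
    qed
    have d2: "?a2 \<in> dual_on H2"
    proof -
      have "\<alpha> (0, x + y) = \<alpha> (0, x) + \<alpha> (0, y)" if "x \<in> H2" "y \<in> H2" for x y
        using add[of "(0, x)" "(0, y)"] that HD by simp
      moreover have "\<alpha> (0, a *\<^sub>C x) = a * \<alpha> (0, x)" if "x \<in> H2" for a x
        using sc[of "(0, x)" a] that HD by (simp add: scaleC_prod_def)
      ultimately show ?thesis using HD by (auto simp: dual_on_def)
    qed
    have nz': "\<alpha> (h1, 0) \<noteq> 0 \<or> \<alpha> (0, h2) \<noteq> 0"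
      using add[of "(h1, 0)" "(0, h2)"] h HD nz by auto
    obtain q where q: "\<And>h. h \<in> H1 \<times> H2 \<Longrightarrow> ((\<lambda>v. lie h v - \<alpha> h *\<^sub>C v) ^^ q) (l1, l2) = 0"
      using l unfolding root_space_def by blast
    have q1: "((\<lambda>v. lie h v - \<alpha> (h, h') *\<^sub>C v) ^^ q) l1 = 0" and q2: "((\<lambda>v. lie h' v - \<alpha> (h, h') *\<^sub>C v) ^^ q) l2 = 0"
      if "h \<in> H1" "h' \<in> H2" for h h'
      using q[of "(h, h')"] that unfolding ad_power_pair by (simp_all add: zero_prod_def)
    have "f1 l1 = 0"
    proof (rule vanish_on_component[OF f1 _ d1])
      show "\<forall>l\<in>cartan_complement H1. f1 l = 0" using R by blast
      show "((\<lambda>v. lie h v - ?a1 h *\<^sub>C v) ^^ q) l1 = 0" if "h \<in> H1" for h using q1[OF that HD(6)] that by simp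
      show "((\<lambda>v. lie 0 v - \<alpha> (0, h2) *\<^sub>C v) ^^ q) l1 = 0" by (rule q1[OF HD(1) h(2)])
      show "(\<exists>h\<in>H1. ?a1 h \<noteq> 0) \<or> \<alpha> (0, h2) \<noteq> 0" using nz' h(1) by auto
    qed
    moreover have "f2 l2 = 0"
    proof (rule vanish_on_component[OF f2 _ d2])
      show "\<forall>l\<in>cartan_complement H2. f2 l = 0" using R by blast
      show "((\<lambda>v. lie h v - ?a2 h *\<^sub>C v) ^^ q) l2 = 0" if "h \<in> H2" for h using q2[OF HD(1) that] that by simp
      show "((\<lambda>v. lie 0 v - \<alpha> (h1, 0) *\<^sub>C v) ^^ q) l2 = 0" by (rule q2[OF h(1) HD(6)])
      show "(\<exists>h\<in>H2. ?a2 h \<noteq> 0) \<or> \<alpha> (h1, 0) \<noteq> 0" using nz' h(2) by auto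
    qed
    ultimately show "f1 l1 + f2 l2 = 0" by simp
  qed
qed

lemma dual_pair:
  assumes "f1 \<in> dual_on UNIV" "f2 \<in> dual_on UNIV"
  shows "(\<lambda>(l1, l2). f1 l1 + f2 l2) \<in> dual_on UNIV"
  using assms unfolding dual_on_UNIV by (auto simp: scaleC_prod_def algebra_simps)

lemma dual_split:
  assumes "f \<in> dual_on (UNIV :: ('a::complex_vector \<times> 'b::complex_vector) set)"
  shows "\<exists>f1\<in>dual_on UNIV. \<exists>f2\<in>dual_on UNIV. f = (\<lambda>(l1, l2). f1 l1 + f2 l2)"
proof (intro bexI)
  have f: "f (x + y) = f x + f y" "f (a *\<^sub>C x) = a * f x" for x y a
    using assms unfolding dual_on_UNIV by blast+
  show "f = (\<lambda>(l1, l2). f (l1, 0) + f (0, l2))" by (auto simp: fun_eq_iff simp flip: f(1))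
  have "f (x + y, 0) = f (x, 0) + f (y, 0)" "f (a *\<^sub>C x, 0) = a * f (x, 0)" for x y a
    by (simp_all add: scaleC_prod_def flip: f)
  then show "(\<lambda>l. f (l, 0)) \<in> dual_on UNIV" by (simp add: dual_on_UNIV)
  have "f (0, x + y) = f (0, x) + f (0, y)" "f (0, a *\<^sub>C x) = a * f (0, x)" for x y a
    by (simp_all add: scaleC_prod_def flip: f)
  then show "(\<lambda>l. f (0, l)) \<in> dual_on UNIV" by (simp add: dual_on_UNIV)
qed

lemma character_Times:
  assumes f: "f1 \<in> dual_on UNIV" "f2 \<in> dual_on UNIV" and H: "lie_subalgebra H1" "lie_subalgebra H2"
  shows "restrict (\<lambda>(l1, l2). f1 l1 + f2 l2) (H1 \<times> H2) \<in> lie_characters (H1 \<times> H2) \<longleftrightarrow>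
    restrict f1 H1 \<in> lie_characters H1 \<and> restrict f2 H2 \<in> lie_characters H2"
proof -
  have "0 \<in> H1" "0 \<in> H2" using H csubspaceD(1) by (auto simp: lie_subalgebra_def)
  then have "(\<forall>x\<in>H1. \<forall>y\<in>H2. \<forall>x'\<in>H1. \<forall>y'\<in>H2. f1 (lie x x') + f2 (lie y y') = 0) \<longleftrightarrow>
      (\<forall>x\<in>H1. \<forall>y\<in>H1. f1 (lie x y) = 0) \<and> (\<forall>x\<in>H2. \<forall>y\<in>H2. f2 (lie x y) = 0)"
    using dual_zero[OF f(1)] dual_zero[OF f(2)] by (metis add.left_neutral add.right_neutral lie_zero(1))
  then show ?thesis
    unfolding restrict_character_iff[OF dual_pair[OF f] lie_subalgebra_Times[OF H]]
      restrict_character_iff[OF f(1) H(1)] restrict_character_iff[OF f(2) H(2)]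
    by (simp add: lie_prod_def)
qed

section \<open>The spectra of the tensor product representation\<close>

text \<open>The choice p = max a (k - n) is the least admissible one: it keeps q = k - p within n.
  The degrees found for the two factors must be enlarged in this way, because the union ranges over
  p + q = k exactly.\<close>

lemma split_index:
  fixes a b k :: nat
  assumes "a + b \<le> k" "k \<le> m + n" "a \<le> m" "b \<le> n"
  shows "\<exists>p q. a \<le> p \<and> p \<le> m \<and> b \<le> q \<and> q \<le> n \<and> p + q = k"
proof -
  have "a \<le> max a (k - n)" "max a (k - n) \<le> m" "b \<le> k - max a (k - n)" "k - max a (k - n) \<le> n"
    "max a (k - n) + (k - max a (k - n)) = k" using assms by auto
  then show ?thesis by blast
qed

context banach_tensor_product
begin

lemma tensor_lie_representation:
  fixes \<rho>1 :: "'l1::complex_lie_algebra \<Rightarrow> ('x \<Rightarrow>\<^sub>L 'x)" and \<rho>2 :: "'l2::complex_lie_algebra \<Rightarrow> ('y \<Rightarrow>\<^sub>L 'y)"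
  assumes fd: "finite_dimensional (UNIV :: 'l1 set)" "finite_dimensional (UNIV :: 'l2 set)"
    and rep: "lie_representation \<rho>1" "lie_representation \<rho>2"
  shows "lie_representation (tensor_representation (\<otimes>\<^sub>o) \<rho>1 \<rho>2)"
    and "finite_dimensional (UNIV :: ('l1 \<times> 'l2) set)"
    and "cdim (UNIV :: ('l1 \<times> 'l2) set) = cdim (UNIV :: 'l1 set) + cdim (UNIV :: 'l2 set)"
proof -
  have k: "koszul_setting (ordered_basis UNIV) UNIV \<rho>"
    if "finite_dimensional (UNIV :: 'l set)" "lie_representation \<rho>"
    for \<rho> :: "'l::complex_lie_algebra \<Rightarrow> ('z::complex_banach \<Rightarrow>\<^sub>L 'z)"
    using that ordered_basis[OF that(1) complex_vector.subspace_UNIV]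
    by (intro koszul_setting.intro) (auto simp: lie_representation_def)
  interpret koszul_tensor tens optens "ordered_basis (UNIV :: 'l1 set)" UNIV \<rho>1 "ordered_basis (UNIV :: 'l2 set)" UNIV \<rho>2
    by (rule koszul_tensor.intro[OF banach_tensor_product_axioms k[OF fd(1) rep(1)] k[OF fd(2) rep(2)]])
  show "lie_representation (tensor_representation (\<otimes>\<^sub>o) \<rho>1 \<rho>2)"
    using P.rep_lin P.rep_cblin P.rep_lie unfolding lie_representation_def \<theta>T_def by auto
  show "finite_dimensional (UNIV :: ('l1 \<times> 'l2) set)"
    using P.span unfolding finite_dimensional_def by (intro exI[of _ "set bs12"]) auto
  show "cdim (UNIV :: ('l1 \<times> 'l2) set) = cdim (UNIV :: 'l1 set) + cdim (UNIV :: 'l2 set)"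
    using P.cdim_eq S1.cdim_eq S2.cdim_eq by simp
qed

end

context cartan_setting
begin

lemma cdim_le: "cdim H \<le> cdim (UNIV :: 'l set)"
proof -
  note B = ordered_basis[OF fd complex_vector.subspace_UNIV]
  have "card (set basis) \<le> card (set (ordered_basis (UNIV :: 'l set)))"
    using complex_vector.independent_span_bound[of "set (ordered_basis (UNIV :: 'l set))" "set basis"] indep B(3) by auto
  also have "\<dots> = cdim (UNIV :: 'l set)"
    using complex_vector.dim_span_eq_card_independent[OF B(2)] B(3) by simp
  finally show ?thesis using dist by (simp add: cdim_eq distinct_card)
qed

end

locale cartan_tensor = banach_tensor_product tens optens + A1: cartan_setting \<rho>1 f1 H1 + A2: cartan_setting \<rho>2 f2 H2
  for tens :: "'x::complex_banach \<Rightarrow> 'y::complex_banach \<Rightarrow> 't::complex_banach" (infixl \<open>\<otimes>\<^sub>v\<close> 70)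
    and optens :: "('x \<Rightarrow>\<^sub>L 'x) \<Rightarrow> ('y \<Rightarrow>\<^sub>L 'y) \<Rightarrow> ('t \<Rightarrow>\<^sub>L 't)"  (infixl \<open>\<otimes>\<^sub>o\<close> 70)
    and \<rho>1 :: "'l1::complex_lie_algebra \<Rightarrow> ('x \<Rightarrow>\<^sub>L 'x)" and f1 H1
    and \<rho>2 :: "'l2::complex_lie_algebra \<Rightarrow> ('y \<Rightarrow>\<^sub>L 'y)" and f2 H2
begin

abbreviation "pair_dual \<equiv> (\<lambda>(l1, l2). f1 l1 + f2 l2)"
abbreviation "\<rho>T \<equiv> tensor_representation (\<otimes>\<^sub>o) \<rho>1 \<rho>2"

sublocale koszul_tensor tens optens A1.basis H1 "shifted \<rho>1 f1" A2.basis H2 "shifted \<rho>2 f2" ..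

text \<open>Since I \<otimes> I = I by (T3), the scalar shifts by f1 and f2 in the two factors add
  up to the shift by their pair.\<close>

lemma \<theta>T_shifted: "\<theta>T = shifted \<rho>T pair_dual"
proof -
  have c: "\<rho>1 l \<in> cblinfuns" "\<rho>2 l' \<in> cblinfuns" for l l'
    using A1.rep A2.rep by (auto simp: lie_representation_def)
  show ?thesis
    unfolding \<theta>T_def
    by (auto simp: fun_eq_iff shifted_def tensor_representation_def op_diff c optens_scaleC_left optens_scaleC_right
        T3_id scaleC_add_left)
qed

sublocale A: cartan_setting \<rho>T pair_dual "H1 \<times> H2"
proof (rule cartan_setting.intro)
  show "lie_representation \<rho>T" "finite_dimensional (UNIV :: ('l1 \<times> 'l2) set)"
    using tensor_lie_representation[OF A1.fd A2.fd A1.rep A2.rep] by auto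
  show "lie_subalgebra (H1 \<times> H2)" by (rule lie_subalgebra_Times[OF A1.sub A2.sub])
  show "pair_dual \<in> dual_on UNIV" by (rule dual_pair[OF A1.dual A2.dual])
  show "restrict pair_dual (H1 \<times> H2) \<in> lie_characters (H1 \<times> H2)"
    using character_Times[OF A1.dual A2.dual A1.sub A2.sub] A1.char A2.char by blast
qed

text \<open>The spectra of the product refer to an arbitrary basis of H1 \<times> H2, the tensor
  product complex to the concatenated one.\<close>

sublocale change: koszul_change bs12 A.basis "H1 \<times> H2" "shifted \<rho>T pair_dual"
  by (rule koszul_change.intro[OF P.koszul_setting_axioms[unfolded \<theta>T_shifted] A.koszul_setting_axioms])

lemma cdim_Times: "cdim (H1 \<times> H2) = cdim H1 + cdim H2"
  using P.cdim_eq A1.cdim_eq A2.cdim_eq by simp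

lemma sigma_delta_product:
  assumes "restrict f1 H1 \<in> sigma_delta p H1 \<rho>1" "restrict f2 H2 \<in> sigma_delta q H2 \<rho>2"
  shows "restrict pair_dual (H1 \<times> H2) \<in> sigma_delta (p + q) (H1 \<times> H2) \<rho>T"
proof -
  obtain i j where ij: "i \<le> min p (cdim H1)" "j \<le> min q (cdim H2)"
    and ns: "\<not> koszul_strict A1.basis (shifted \<rho>1 f1) i" "\<not> koszul_strict A2.basis (shifted \<rho>2 f2) j"
    using assms unfolding A1.mem_sigma_delta A2.mem_sigma_delta by blast
  obtain m where m: "m \<le> i + j" "\<not> koszul_strict bs12 \<theta>T m" using strict_product_below[OF ns] by blast
  have "m \<le> min (p + q) (cdim (H1 \<times> H2))" using m(1) ij by (auto simp: cdim_Times)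
  then show ?thesis
    using m(2) unfolding A.mem_sigma_delta \<theta>T_shifted change.koszul_strict_change by blast
qed

lemma sigma_pi_product:
  assumes "restrict f1 H1 \<in> sigma_pi p H1 \<rho>1" "restrict f2 H2 \<in> sigma_pi q H2 \<rho>2"
  shows "restrict pair_dual (H1 \<times> H2) \<in> sigma_pi (p + q) (H1 \<times> H2) \<rho>T"
proof -
  obtain i j where ij: "cdim H1 - min p (cdim H1) \<le> i" "cdim H2 - min q (cdim H2) \<le> j"
    and ns: "\<not> koszul_strict A1.basis (shifted \<rho>1 f1) i" "\<not> koszul_strict A2.basis (shifted \<rho>2 f2) j"
    using assms unfolding A1.mem_sigma_pi A2.mem_sigma_pi by blast
  obtain m where m: "i + j \<le> m" "\<not> koszul_strict bs12 \<theta>T m" using strict_product_above[OF ns] by blast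
  have "cdim (H1 \<times> H2) - min (p + q) (cdim (H1 \<times> H2)) \<le> m" using m(1) ij by (auto simp: cdim_Times)
  then show ?thesis
    using m(2) unfolding A.mem_sigma_pi \<theta>T_shifted change.koszul_strict_change by blast
qed

lemma sp_delta_product:
  assumes f: "restrict pair_dual (H1 \<times> H2) \<in> sp_delta k (H1 \<times> H2) \<rho>T"
    and k: "k \<le> cdim (UNIV :: 'l1 set) + cdim (UNIV :: 'l2 set)"
  shows "\<exists>p q. p \<le> cdim (UNIV :: 'l1 set) \<and> q \<le> cdim (UNIV :: 'l2 set) \<and> p + q = k \<and>
    restrict f1 H1 \<in> sp_delta p H1 \<rho>1 \<and> restrict f2 H2 \<in> sp_delta q H2 \<rho>2"
proof -
  obtain m where m: "m \<le> min k (cdim (H1 \<times> H2))" "\<not> koszul_split bs12 \<theta>T (int m)"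
    using f unfolding A.mem_sp_delta \<theta>T_shifted change.koszul_split_change by blast
  obtain i j where ij: "i + j \<le> m" "\<not> koszul_split A1.basis (shifted \<rho>1 f1) (int i)"
      "\<not> koszul_split A2.basis (shifted \<rho>2 f2) (int j)"
    using split_product_below[OF m(2)] by blast
  have d: "i \<le> cdim H1" "j \<le> cdim H2"
    using A1.split_large A2.split_large ij(2,3) unfolding A1.cdim_eq A2.cdim_eq by (meson not_le)+
  obtain p q where pq: "i \<le> p" "p \<le> cdim (UNIV :: 'l1 set)" "j \<le> q" "q \<le> cdim (UNIV :: 'l2 set)" "p + q = k"
    using split_index[of i j k "cdim (UNIV :: 'l1 set)" "cdim (UNIV :: 'l2 set)"] ij(1) m(1) k d A1.cdim_le A2.cdim_le
    by auto
  have "i \<le> min p (cdim H1)" "j \<le> min q (cdim H2)" using pq d by auto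
  then have "restrict f1 H1 \<in> sp_delta p H1 \<rho>1" "restrict f2 H2 \<in> sp_delta q H2 \<rho>2"
    unfolding A1.mem_sp_delta A2.mem_sp_delta using ij by blast+
  then show ?thesis using pq by blast
qed

lemma sp_pi_product:
  assumes f: "restrict pair_dual (H1 \<times> H2) \<in> sp_pi k (H1 \<times> H2) \<rho>T"
    and k: "k \<le> cdim (UNIV :: 'l1 set) + cdim (UNIV :: 'l2 set)"
  shows "\<exists>p q. p \<le> cdim (UNIV :: 'l1 set) \<and> q \<le> cdim (UNIV :: 'l2 set) \<and> p + q = k \<and>
    restrict f1 H1 \<in> sp_pi p H1 \<rho>1 \<and> restrict f2 H2 \<in> sp_pi q H2 \<rho>2"
proof -
  obtain m where m: "cdim (H1 \<times> H2) - min k (cdim (H1 \<times> H2)) \<le> m" "\<not> koszul_split bs12 \<theta>T (int m)"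
    using f unfolding A.mem_sp_pi \<theta>T_shifted change.koszul_split_change by blast
  obtain i j where ij: "m \<le> i + j" "\<not> koszul_split A1.basis (shifted \<rho>1 f1) (int i)"
      "\<not> koszul_split A2.basis (shifted \<rho>2 f2) (int j)"
    using split_product_above[OF m(2)] by blast
  have d: "i \<le> cdim H1" "j \<le> cdim H2"
    using A1.split_large A2.split_large ij(2,3) unfolding A1.cdim_eq A2.cdim_eq by (meson not_le)+
  \<comment> \<open>Measured from the top degree, the condition is additive again, and
    \<open>split_index\<close> applies as for the spectra of type delta.\<close>
  have "(cdim H1 - i) + (cdim H2 - j) \<le> k" using m(1) ij(1) d by (auto simp: cdim_Times)
  then obtain p q where pq: "cdim H1 - i \<le> p" "p \<le> cdim (UNIV :: 'l1 set)" "cdim H2 - j \<le> q"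
      "q \<le> cdim (UNIV :: 'l2 set)" "p + q = k"
    using split_index[of "cdim H1 - i" "cdim H2 - j" k "cdim (UNIV :: 'l1 set)" "cdim (UNIV :: 'l2 set)"]
      k A1.cdim_le A2.cdim_le by (meson diff_le_self le_trans)
  have "cdim H1 - min p (cdim H1) \<le> i" "cdim H2 - min q (cdim H2) \<le> j" using pq by auto
  then have "restrict f1 H1 \<in> sp_pi p H1 \<rho>1" "restrict f2 H2 \<in> sp_pi q H2 \<rho>2"
    unfolding A1.mem_sp_pi A2.mem_sp_pi using ij by blast+
  then show ?thesis using pq by blast
qed

end

section \<open>Passage to the Cartan spectra\<close>

text \<open>\<open>cartan_spectrum\<close> admits any Cartan subalgebra of the product. It is a
  product itself, and then the vanishing condition decouples, so the same pair H1, H2 serves for f1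
  and f2.\<close>

lemma mem_cartan_spectrum_Times:
  fixes f1 :: "'l1::complex_lie_algebra \<Rightarrow> complex" and f2 :: "'l2::complex_lie_algebra \<Rightarrow> complex"
  assumes f1: "f1 \<in> dual_on UNIV" and f2: "f2 \<in> dual_on UNIV"
  shows "(\<lambda>(l1, l2). f1 l1 + f2 l2) \<in> cartan_spectrum \<sigma> \<longleftrightarrow>
    (\<exists>H1 H2. cartan_subalgebra H1 \<and> cartan_subalgebra H2 \<and>
       restrict (\<lambda>(l1, l2). f1 l1 + f2 l2) (H1 \<times> H2) \<in> \<sigma> (H1 \<times> H2) \<and>
       (\<forall>l\<in>cartan_complement H1. f1 l = 0) \<and> (\<forall>l\<in>cartan_complement H2. f2 l = 0))" (is "?L \<longleftrightarrow> ?R")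
proof -
  have v: "(\<forall>l\<in>cartan_complement (H1 \<times> H2). (\<lambda>(l1, l2). f1 l1 + f2 l2) l = 0) \<longleftrightarrow>
      (\<forall>l\<in>cartan_complement H1. f1 l = 0) \<and> (\<forall>l\<in>cartan_complement H2. f2 l = 0)"
    if "cartan_subalgebra H1" "cartan_subalgebra H2" for H1 H2
    using vanish_cartan_complement_Times[OF f1 f2 dual_pair[OF f1 f2]] that
    by (simp add: cartan_subalgebra_def lie_subalgebra_def)
  show ?thesis
  proof
    assume ?L
    then obtain H where H: "cartan_subalgebra H" "restrict (\<lambda>(l1, l2). f1 l1 + f2 l2) H \<in> \<sigma> H"
        "\<forall>l\<in>cartan_complement H. (\<lambda>(l1, l2). f1 l1 + f2 l2) l = 0"
      unfolding cartan_spectrum_def by blast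
    obtain H1 H2 where c: "cartan_subalgebra H1" "cartan_subalgebra H2" and e: "H = H1 \<times> H2"
      using cartan_product_form[OF H(1)] by blast
    show ?R using c H(2) H(3)[unfolded e v[OF c]] unfolding e by blast
  next
    assume ?R
    then obtain H1 H2 where H: "cartan_subalgebra H1" "cartan_subalgebra H2"
        "restrict (\<lambda>(l1, l2). f1 l1 + f2 l2) (H1 \<times> H2) \<in> \<sigma> (H1 \<times> H2)"
        "(\<forall>l\<in>cartan_complement H1. f1 l = 0) \<and> (\<forall>l\<in>cartan_complement H2. f2 l = 0)"
      by blast
    show ?L
      unfolding cartan_spectrum_def mem_Collect_eq
      using dual_pair[OF f1 f2] cartan_Times[OF H(1,2)] H(3) H(4)[folded v[OF H(1,2)]] by blast
  qed
qed

lemma cartan_spectrum_mono: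
  assumes "\<And>f H. f \<in> dual_on UNIV \<Longrightarrow> cartan_subalgebra H \<Longrightarrow> restrict f H \<in> \<sigma> H \<Longrightarrow> restrict f H \<in> \<tau> H"
  shows "cartan_spectrum \<sigma> \<subseteq> cartan_spectrum \<tau>"
  using assms unfolding cartan_spectrum_def by blast

lemma mem_product_union:
  "f \<in> product_union F G k \<longleftrightarrow> (\<exists>p q f1 f2. p \<le> cdim (UNIV :: 'l1::complex_vector set) \<and>
     q \<le> cdim (UNIV :: 'l2::complex_vector set) \<and> p + q = k \<and> f1 \<in> F p \<and> f2 \<in> G q \<and> f = (\<lambda>(l1 :: 'l1, l2 :: 'l2). f1 l1 + f2 l2))"
  unfolding product_union_def dual_times_def image_def by force

lemma product_union_cartan_subset:
  assumes "\<And>f1 f2 H1 H2 p q. f1 \<in> dual_on UNIV \<Longrightarrow> f2 \<in> dual_on UNIV \<Longrightarrow> cartan_subalgebra H1 \<Longrightarrow> cartan_subalgebra H2 \<Longrightarrow>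
      restrict f1 H1 \<in> \<sigma>1 p H1 \<Longrightarrow> restrict f2 H2 \<in> \<sigma>2 q H2 \<Longrightarrow>
      restrict (\<lambda>(l1, l2). f1 l1 + f2 l2) (H1 \<times> H2) \<in> \<sigma> (p + q) (H1 \<times> H2)"
  shows "product_union (\<lambda>k. cartan_spectrum (\<sigma>1 k)) (\<lambda>k. cartan_spectrum (\<sigma>2 k)) k \<subseteq> cartan_spectrum (\<sigma> k)"
proof
  fix f assume "f \<in> product_union (\<lambda>k. cartan_spectrum (\<sigma>1 k)) (\<lambda>k. cartan_spectrum (\<sigma>2 k)) k"
  then obtain p q f1 f2 where pq: "p + q = k" and f: "f1 \<in> cartan_spectrum (\<sigma>1 p)" "f2 \<in> cartan_spectrum (\<sigma>2 q)"
      "f = (\<lambda>(l1, l2). f1 l1 + f2 l2)"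
    unfolding mem_product_union by blast
  have d: "f1 \<in> dual_on UNIV" "f2 \<in> dual_on UNIV" using f by (auto simp: cartan_spectrum_def)
  show "f \<in> cartan_spectrum (\<sigma> k)"
    unfolding f(3) mem_cartan_spectrum_Times[OF d]
    using f(1,2) assms[OF d] pq unfolding cartan_spectrum_def by blast
qed

lemma cartan_subset_product_union:
  assumes "\<And>f1 f2 H1 H2. f1 \<in> dual_on UNIV \<Longrightarrow> f2 \<in> dual_on UNIV \<Longrightarrow> cartan_subalgebra H1 \<Longrightarrow> cartan_subalgebra H2 \<Longrightarrow>
      restrict (\<lambda>(l1, l2). f1 l1 + f2 l2) (H1 \<times> H2) \<in> \<sigma> k (H1 \<times> H2) \<Longrightarrow>
      \<exists>p q. p \<le> cdim (UNIV :: 'l1 set) \<and> q \<le> cdim (UNIV :: 'l2 set) \<and> p + q = k \<and>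
        restrict f1 H1 \<in> \<sigma>1 p H1 \<and> restrict f2 H2 \<in> \<sigma>2 q H2"
  shows "cartan_spectrum (\<sigma> k :: ('l1::complex_lie_algebra \<times> 'l2::complex_lie_algebra) set \<Rightarrow> _)
    \<subseteq> product_union (\<lambda>k. cartan_spectrum (\<sigma>1 k)) (\<lambda>k. cartan_spectrum (\<sigma>2 k)) k"
proof
  fix f assume f: "f \<in> cartan_spectrum (\<sigma> k :: ('l1 \<times> 'l2) set \<Rightarrow> _)"
  then have "f \<in> dual_on UNIV" by (simp add: cartan_spectrum_def)
  then obtain f1 f2 where d: "f1 \<in> dual_on UNIV" "f2 \<in> dual_on UNIV" and e: "f = (\<lambda>(l1, l2). f1 l1 + f2 l2)"
    using dual_split by blast
  obtain H1 H2 where H: "cartan_subalgebra H1" "cartan_subalgebra H2"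
      "restrict (\<lambda>(l1, l2). f1 l1 + f2 l2) (H1 \<times> H2) \<in> \<sigma> k (H1 \<times> H2)"
      "\<forall>l\<in>cartan_complement H1. f1 l = 0" "\<forall>l\<in>cartan_complement H2. f2 l = 0"
    using f unfolding e mem_cartan_spectrum_Times[OF d] by blast
  obtain p q where pq: "p \<le> cdim (UNIV :: 'l1 set)" "q \<le> cdim (UNIV :: 'l2 set)" "p + q = k"
      "restrict f1 H1 \<in> \<sigma>1 p H1" "restrict f2 H2 \<in> \<sigma>2 q H2"
    using assms[OF d H(1-3)] by blast
  have "f1 \<in> cartan_spectrum (\<sigma>1 p)" "f2 \<in> cartan_spectrum (\<sigma>2 q)"
    using d H pq unfolding cartan_spectrum_def by blast+
  then show "f \<in> product_union (\<lambda>k. cartan_spectrum (\<sigma>1 k)) (\<lambda>k. cartan_spectrum (\<sigma>2 k)) k"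
    unfolding mem_product_union using pq(1-3) e by blast
qed

lemma cartan_settingI:
  fixes \<rho> :: "'l::complex_lie_algebra \<Rightarrow> ('x::complex_banach \<Rightarrow>\<^sub>L 'x)"
  assumes "finite_dimensional (UNIV :: 'l set)" "lie_representation \<rho>" "f \<in> dual_on UNIV" "cartan_subalgebra H"
    "restrict f H \<in> lie_characters H"
  shows "cartan_setting \<rho> f H"
  using assms by (intro cartan_setting.intro) (auto simp: cartan_subalgebra_def)

lemma Sigma_subset_Sp:
  fixes \<rho> :: "'l::complex_lie_algebra \<Rightarrow> ('x::complex_banach \<Rightarrow>\<^sub>L 'x)"
  assumes "finite_dimensional (UNIV :: 'l set)" "lie_representation \<rho>"
  shows "Sigma_delta \<rho> k \<subseteq> Sp_delta \<rho> k" "Sigma_pi \<rho> k \<subseteq> Sp_pi \<rho> k"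
  unfolding Sigma_delta_def Sp_delta_def Sigma_pi_def Sp_pi_def
  by (rule cartan_spectrum_mono, blast intro: cartan_setting.sigma_subset_sp cartan_settingI[OF assms] sp_imp_character)+

lemma Sp_eq_Sigma_hilbert:
  fixes \<rho> :: "'l::complex_lie_algebra \<Rightarrow> ('x::complex_banach \<Rightarrow>\<^sub>L 'x)"
  assumes "finite_dimensional (UNIV :: 'l set)" "lie_representation \<rho>" "hilbert_space TYPE('x)"
  shows "Sp_delta \<rho> = Sigma_delta \<rho>" "Sp_pi \<rho> = Sigma_pi \<rho>"
proof -
  have s: "cartan_setting \<rho> f H" if "f \<in> dual_on UNIV" "cartan_subalgebra H" "restrict f H \<in> lie_characters H" for f H
    by (rule cartan_settingI[OF assms(1,2) that])
  have "Sp_delta \<rho> k \<subseteq> Sigma_delta \<rho> k" "Sp_pi \<rho> k \<subseteq> Sigma_pi \<rho> k" for k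
    unfolding Sigma_delta_def Sp_delta_def Sigma_pi_def Sp_pi_def
    by (rule cartan_spectrum_mono,
        metis cartan_setting.sp_eq_sigma_hilbert[OF s assms(3)] sp_imp_character)+
  then show "Sp_delta \<rho> = Sigma_delta \<rho>" "Sp_pi \<rho> = Sigma_pi \<rho>"
    using Sigma_subset_Sp[OF assms(1,2)] by (intro ext subset_antisym; blast)+
qed

theorem theorem3p3:
  fixes \<rho>1 :: "'l1::complex_lie_algebra \<Rightarrow> ('x1::complex_banach \<Rightarrow>\<^sub>L 'x1)"
    and \<rho>2 :: "'l2::complex_lie_algebra \<Rightarrow> ('x2::complex_banach \<Rightarrow>\<^sub>L 'x2)"
    and tens :: "'x1 \<Rightarrow> 'x2 \<Rightarrow> 't::complex_banach"
    and optens :: "('x1 \<Rightarrow>\<^sub>L 'x1) \<Rightarrow> ('x2 \<Rightarrow>\<^sub>L 'x2) \<Rightarrow> ('t \<Rightarrow>\<^sub>L 't)"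
    and \<rho> :: "'l1 \<times> 'l2 \<Rightarrow> ('t \<Rightarrow>\<^sub>L 't)"
    and k :: nat
  assumes "finite_dimensional (UNIV :: 'l1 set)" and "lie_solvable (UNIV :: 'l1 set)"
    and "finite_dimensional (UNIV :: 'l2 set)" and "lie_solvable (UNIV :: 'l2 set)"
    and "lie_representation \<rho>1" and "lie_representation \<rho>2"
    and "banach_tensor_product tens optens"
    and "\<rho> = tensor_representation optens \<rho>1 \<rho>2"
    and "k \<le> cdim (UNIV :: ('l1 \<times> 'l2) set)"
  shows "(product_union (Sigma_delta \<rho>1) (Sigma_delta \<rho>2) k \<subseteq> Sigma_delta \<rho> k \<and>
          Sigma_delta \<rho> k \<subseteq> Sp_delta \<rho> k \<and>
          Sp_delta \<rho> k \<subseteq> product_union (Sp_delta \<rho>1) (Sp_delta \<rho>2) k) \<and>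
         (product_union (Sigma_pi \<rho>1) (Sigma_pi \<rho>2) k \<subseteq> Sigma_pi \<rho> k \<and>
          Sigma_pi \<rho> k \<subseteq> Sp_pi \<rho> k \<and>
          Sp_pi \<rho> k \<subseteq> product_union (Sp_pi \<rho>1) (Sp_pi \<rho>2) k) \<and>
         (hilbert_space TYPE('x1) \<and> hilbert_space TYPE('x2) \<longrightarrow>
            (product_union (Sigma_delta \<rho>1) (Sigma_delta \<rho>2) k = Sigma_delta \<rho> k \<and>
             Sigma_delta \<rho> k = Sp_delta \<rho> k \<and>
             Sp_delta \<rho> k = product_union (Sp_delta \<rho>1) (Sp_delta \<rho>2) k) \<and>
            (product_union (Sigma_pi \<rho>1) (Sigma_pi \<rho>2) k = Sigma_pi \<rho> k \<and>
             Sigma_pi \<rho> k = Sp_pi \<rho> k \<and>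
             Sp_pi \<rho> k = product_union (Sp_pi \<rho>1) (Sp_pi \<rho>2) k))"
proof -
  interpret banach_tensor_product tens optens by fact
  note fd = assms(1,3) and rep = assms(5,6)
  note T = tensor_lie_representation[OF fd rep]
  have ct: "cartan_tensor tens optens \<rho>1 f1 H1 \<rho>2 f2 H2"
    if "f1 \<in> dual_on UNIV" "f2 \<in> dual_on UNIV" "cartan_subalgebra H1" "cartan_subalgebra H2"
      "restrict f1 H1 \<in> lie_characters H1" "restrict f2 H2 \<in> lie_characters H2" for f1 f2 H1 H2
    using that by (intro cartan_tensor.intro banach_tensor_product_axioms cartan_settingI fd rep)
  have ct': "cartan_tensor tens optens \<rho>1 f1 H1 \<rho>2 f2 H2"
    if "f1 \<in> dual_on UNIV" "f2 \<in> dual_on UNIV" "cartan_subalgebra H1" "cartan_subalgebra H2"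
      "restrict (\<lambda>(l1, l2). f1 l1 + f2 l2) (H1 \<times> H2) \<in> lie_characters (H1 \<times> H2)" for f1 f2 H1 H2
    using that character_Times[OF that(1,2), of H1 H2] by (intro ct) (auto simp: cartan_subalgebra_def)
  have k: "k \<le> cdim (UNIV :: 'l1 set) + cdim (UNIV :: 'l2 set)" using assms(9) T(3) by simp
  have 1: "product_union (Sigma_delta \<rho>1) (Sigma_delta \<rho>2) k \<subseteq> Sigma_delta \<rho> k"
    "product_union (Sigma_pi \<rho>1) (Sigma_pi \<rho>2) k \<subseteq> Sigma_pi \<rho> k"
    unfolding Sigma_delta_def Sigma_pi_def assms(8)
    by (rule product_union_cartan_subset,
        rule cartan_tensor.sigma_delta_product[OF ct] cartan_tensor.sigma_pi_product[OF ct];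
        blast intro: sp_imp_character)+
  have 2: "Sp_delta \<rho> k \<subseteq> product_union (Sp_delta \<rho>1) (Sp_delta \<rho>2) k"
    "Sp_pi \<rho> k \<subseteq> product_union (Sp_pi \<rho>1) (Sp_pi \<rho>2) k"
    unfolding Sp_delta_def Sp_pi_def assms(8)
    by (rule cartan_subset_product_union,
        rule cartan_tensor.sp_delta_product[OF ct' _ k] cartan_tensor.sp_pi_product[OF ct' _ k];
        blast intro: sp_imp_character)+
  have 3: "Sigma_delta \<rho> k \<subseteq> Sp_delta \<rho> k" "Sigma_pi \<rho> k \<subseteq> Sp_pi \<rho> k"
    unfolding assms(8) by (rule Sigma_subset_Sp[OF T(2,1)])+
  show ?thesis
  proof (intro conjI impI; (elim conjE)?)
    assume h: "hilbert_space TYPE('x1)" "hilbert_space TYPE('x2)"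
    \<comment> \<open>The two ends of each chain of inclusions coincide by the Hilbert space
      property of the factors, so everything in between is squeezed; the norm of the tensor product
      space does not enter.\<close>
    note e = Sp_eq_Sigma_hilbert[OF fd(1) rep(1) h(1)] Sp_eq_Sigma_hilbert[OF fd(2) rep(2) h(2)]
    show "product_union (Sigma_delta \<rho>1) (Sigma_delta \<rho>2) k = Sigma_delta \<rho> k" "Sigma_delta \<rho> k = Sp_delta \<rho> k"
      "Sp_delta \<rho> k = product_union (Sp_delta \<rho>1) (Sp_delta \<rho>2) k"
      "product_union (Sigma_pi \<rho>1) (Sigma_pi \<rho>2) k = Sigma_pi \<rho> k" "Sigma_pi \<rho> k = Sp_pi \<rho> k"
      "Sp_pi \<rho> k = product_union (Sp_pi \<rho>1) (Sp_pi \<rho>2) k"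
      using 1 2 3 unfolding e by blast+
  qed (fact 1 2 3)+
qed

end
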